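(* Let $Q$ be a hypersurface ring of embedding dimension $2$, i.e. $Q=R/\langle f\rangle$ with $R$ a $2$-dimensional regular local ring with maximal ideal $\mathfrak{m}$ and $0\neq f\in\mathfrak{m}^2$, and let $d$ be the multiplicity of $Q$. Then $\mathrm{B}_{\mathbb{Q}}(Q)$ is a $3$-dimensional cone in $\mathbb{W}=\prod_{i=0}^\infty\mathbb{Q}$, and its closure is defined by (spanned by) the following $4$ extremal rays: (i) the ray spanned by $\epsilon_0$; (ii) the ray spanned by $\epsilon_0+\epsilon_1$; and (iii) the rays spanned by $\tfrac{d-1}{d}\epsilon_0+\sum_{i=1}^\infty\epsilon_i$ and $\tfrac1d\epsilon_0+\sum_{i=1}^\infty\epsilon_i$.
   Context: The multiplicity of $Q$ is its Hilbert--Samuel multiplicity. $\epsilon_i\in\mathbb{W}$ is the $i$th coordinate vector, and elements of $\mathbb{W}$ are written as possibly infinite sums $\sum a_i\epsilon_i$. For a finitely generated $Q$-module $M$, $b^Q(M)=(b_0,b_1,b_2,\dots)\in\mathbb{W}$ is its sequence of Betti numbers (ranks of the free modules in the minimal $Q$-free resolution of $M$). $\mathrm{B}_{\mathbb{Q}}(Q)\subseteq\mathbb{W}$ is the convex cone spanned by all $b^Q(M)$, with $M$ a finitely generated $Q$-module; its closure is taken in $\mathbb{W}$ (coordinatewise convergence).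
   Formalization: Not all four rays are extremal: for d>2, (d-1)/d ε_0+Σε_i is (1/d ε_0+Σε_i)+((d-2)/d)ε_0, and for d=2 the two vectors in (iii) coincide; so the closure is stated to be spanned by the four rays, with extremality claimed only for ε_0, ε_0+ε_1 and 1/d ε_0+Σε_i. *)

theory Defs
  imports
    "HOL-Analysis.Analysis"
    "HOL-Algebra.Algebra"
    "HOL-Library.Function_Algebras"
    "HOL-Library.Extended_Nat"
begin

section \<open>Local rings\<close>

definition noetherian_local_ring :: "('a, 'b) ring_scheme \<Rightarrow> bool" where
  "noetherian_local_ring R \<longleftrightarrow>
     cring R \<and> noetherian_ring R \<and> (\<exists>!I. maximalideal I R)"

definition max_ideal :: "('a, 'b) ring_scheme \<Rightarrow> 'a set" where
  "max_ideal R = (THE I. maximalideal I R)"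

primrec ideal_power :: "('a, 'b) ring_scheme \<Rightarrow> 'a set \<Rightarrow> nat \<Rightarrow> 'a set" where
  "ideal_power R I 0 = carrier R"
| "ideal_power R I (Suc n) = ideal_prod R I (ideal_power R I n)"

definition krull_dim :: "('a, 'b) ring_scheme \<Rightarrow> enat" where
  "krull_dim R =
     Sup {enat n | n. \<exists>P. (\<forall>i\<le>n. primeideal (P i) R) \<and> (\<forall>i<n. P i \<subset> P (Suc i))}"

definition min_num_gens :: "('a, 'b) ring_scheme \<Rightarrow> 'a set \<Rightarrow> nat" where
  "min_num_gens R I =
     (LEAST n. \<exists>A \<subseteq> carrier R. finite A \<and> card A = n \<and> I = genideal R A)"

definition regular_local_ring :: "('a, 'b) ring_scheme \<Rightarrow> bool" where
  "regular_local_ring R \<longleftrightarrow>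
     noetherian_local_ring R \<and> enat (min_num_gens R (max_ideal R)) = krull_dim R"

text \<open>Length of a ring as a module over itself. For a quotient ring this is also its length
  over the original ring, since the ideals of the quotient are exactly its submodules.\<close>

definition ring_length :: "('a, 'b) ring_scheme \<Rightarrow> enat" where
  "ring_length R =
     Sup {enat n | n. \<exists>J. (\<forall>i\<le>n. ideal (J i) R) \<and> (\<forall>i<n. J i \<subset> J (Suc i))}"

text \<open>Hilbert--Samuel multiplicity with respect to the maximal ideal:
  the limit of \<open>\<delta>! * length(R/m^n) / n^\<delta>\<close>, where \<open>\<delta>\<close> is the Krull dimension.
  For a Noetherian local ring the dimension and the lengths are finite, so \<open>the_enat\<close> is
  harmless, and the limit exists and is a positive integer.\<close>

definition hs_multiplicity :: "('a, 'b) ring_scheme \<Rightarrow> nat" where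
  "hs_multiplicity R = (let \<delta> = the_enat (krull_dim R) in
     THE e. (\<lambda>n. fact \<delta> * real (the_enat (ring_length (R Quot (ideal_power R (max_ideal R) n))))
                   / real n ^ \<delta>) \<longlonglongrightarrow> real e)"


section \<open>Modules and Betti numbers\<close>

definition fin_gen_module :: "('a, 'b) ring_scheme \<Rightarrow> ('a, 'm, 'c) module_scheme \<Rightarrow> bool" where
  "fin_gen_module R M \<longleftrightarrow> module R M \<and>
     (\<exists>A \<subseteq> carrier M. finite A \<and> (\<forall>N. submodule N R M \<and> A \<subseteq> N \<longrightarrow> N = carrier M))"

definition module_homs ::
  "('a, 'b) ring_scheme \<Rightarrow> ('a, 'm, 'c) module_scheme \<Rightarrow> ('a, 'n, 'e) module_scheme \<Rightarrow> ('m \<Rightarrow> 'n) set"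
where
  "module_homs R M N = {\<phi> \<in> carrier M \<rightarrow> carrier N.
     (\<forall>x\<in>carrier M. \<forall>y\<in>carrier M. \<phi> (x \<oplus>\<^bsub>M\<^esub> y) = \<phi> x \<oplus>\<^bsub>N\<^esub> \<phi> y) \<and>
     (\<forall>a\<in>carrier R. \<forall>x\<in>carrier M. \<phi> (a \<odot>\<^bsub>M\<^esub> x) = a \<odot>\<^bsub>N\<^esub> \<phi> x)}"

text \<open>The free module \<open>R^n\<close>. The fields \<open>mult\<close> and \<open>one\<close>, which \<open>module\<close> inherits from
  \<open>ring\<close>, play no role.\<close>

definition free_module :: "('a, 'b) ring_scheme \<Rightarrow> nat \<Rightarrow> ('a, nat \<Rightarrow> 'a) module" where
  "free_module R n =
     \<lparr>carrier = {..<n} \<rightarrow>\<^sub>E carrier R, mult = undefined, one = undefined,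
      ring.zero = (\<lambda>i\<in>{..<n}. \<zero>\<^bsub>R\<^esub>),
      add = (\<lambda>x y. \<lambda>i\<in>{..<n}. x i \<oplus>\<^bsub>R\<^esub> y i),
      smult = (\<lambda>a x. \<lambda>i\<in>{..<n}. a \<otimes>\<^bsub>R\<^esub> x i)\<rparr>"

text \<open>A minimal free resolution of \<open>M\<close> over a local ring,
  \<open>\<dots> \<rightarrow> R^(b 1) \<rightarrow> R^(b 0) \<rightarrow> M \<rightarrow> 0\<close>, with \<open>\<delta> i : R^(b (i+1)) \<rightarrow> R^(b i)\<close> and augmentation
  \<open>\<epsilon>\<close>. The last clause is minimality: \<open>im (\<delta> i) \<subseteq> m R^(b i)\<close>.\<close>

definition minimal_free_resolution ::
  "('a, 'b) ring_scheme \<Rightarrow> ('a, 'm, 'c) module_scheme \<Rightarrow> (nat \<Rightarrow> nat) \<Rightarrow>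
   ((nat \<Rightarrow> 'a) \<Rightarrow> 'm) \<Rightarrow> (nat \<Rightarrow> (nat \<Rightarrow> 'a) \<Rightarrow> (nat \<Rightarrow> 'a)) \<Rightarrow> bool"
where
  "minimal_free_resolution R M b \<epsilon> \<delta> \<longleftrightarrow>
     (let F = (\<lambda>i. free_module R (b i)) in
       \<epsilon> \<in> module_homs R (F 0) M \<and>
       (\<forall>i. \<delta> i \<in> module_homs R (F (Suc i)) (F i)) \<and>
       \<epsilon> ` carrier (F 0) = carrier M \<and>
       {x \<in> carrier (F 0). \<epsilon> x = \<zero>\<^bsub>M\<^esub>} = \<delta> 0 ` carrier (F 1) \<and>
       (\<forall>i. {x \<in> carrier (F (Suc i)). \<delta> i x = \<zero>\<^bsub>F i\<^esub>}
              = \<delta> (Suc i) ` carrier (F (Suc (Suc i)))) \<and>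
       (\<forall>i. \<forall>x \<in> carrier (F (Suc i)). \<forall>j < b i. \<delta> i x j \<in> max_ideal R))"

text \<open>\<open>b\<close> is the sequence of Betti numbers of \<open>M\<close>. Over a Noetherian local ring every finitely
  generated module has exactly one such \<open>b\<close>.\<close>

definition is_betti_sequence ::
  "('a, 'b) ring_scheme \<Rightarrow> ('a, 'm, 'c) module_scheme \<Rightarrow> (nat \<Rightarrow> nat) \<Rightarrow> bool"
where
  "is_betti_sequence R M b \<longleftrightarrow> (\<exists>\<epsilon> \<delta>. minimal_free_resolution R M b \<epsilon> \<delta>)"


section \<open>Cones in the space of rational sequences\<close>

definition scaleW :: "rat \<Rightarrow> (nat \<Rightarrow> rat) \<Rightarrow> nat \<Rightarrow> rat" where
  "scaleW c x = (\<lambda>i. c * x i)"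

interpretation W: vector_space scaleW
  by standard (auto simp: scaleW_def fun_eq_iff algebra_simps)

text \<open>The product topology for the usual topology on the rationals; \<open>rat\<close> is not an instance of
  \<open>topological_space\<close>, so that topology is pulled back from the reals.\<close>

definition W_topology :: "(nat \<Rightarrow> rat) topology" where
  "W_topology =
     product_topology (\<lambda>_. pullback_topology UNIV (of_rat :: rat \<Rightarrow> real) euclidean) UNIV"

definition rat_cone_hull :: "(nat \<Rightarrow> rat) set \<Rightarrow> (nat \<Rightarrow> rat) set" where
  "rat_cone_hull S =
     {\<Sum>x\<in>F. scaleW (c x) x | F c. finite F \<and> F \<subseteq> S \<and> (\<forall>x\<in>F. 0 \<le> c x)}"

text \<open>The ray spanned by \<open>v\<close> is an extremal ray of the convex cone \<open>C\<close>.\<close>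

definition extremal_ray :: "(nat \<Rightarrow> rat) set \<Rightarrow> (nat \<Rightarrow> rat) \<Rightarrow> bool" where
  "extremal_ray C v \<longleftrightarrow> v \<in> C \<and> v \<noteq> 0 \<and>
     (\<forall>x\<in>C. \<forall>y\<in>C. x + y \<in> rat_cone_hull {v} \<longrightarrow>
        x \<in> rat_cone_hull {v} \<and> y \<in> rat_cone_hull {v})"

definition eps :: "nat \<Rightarrow> nat \<Rightarrow> rat" where
  "eps k = (\<lambda>i. if i = k then 1 else 0)"

text \<open>The infinite sum of \<open>eps i\<close> over \<open>i \<ge> 1\<close>.\<close>

definition eps_tail :: "nat \<Rightarrow> rat" where
  "eps_tail = (\<lambda>i. if 1 \<le> i then 1 else 0)"

text \<open>The cone spanned by the Betti sequences of all finitely generated modules. The type of the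
  module elements has to be fixed; by \<open>betti_sequence_any_type\<close> below, modules over any other
  type give no further sequences.\<close>

definition betti_cone :: "('a, 'b) ring_scheme \<Rightarrow> (nat \<Rightarrow> rat) set" where
  "betti_cone R = rat_cone_hull
     {\<lambda>i. of_nat (b i) | b. \<exists>M :: ('a, (nat \<Rightarrow> 'a) set) module.
        fin_gen_module R M \<and> is_betti_sequence R M b}"

lemma betti_sequence_any_type:
  fixes R :: "('a, 'b) ring_scheme" and M :: "('a, 'm, 'c) module_scheme"
  assumes fg: "fin_gen_module R M" and b: "is_betti_sequence R M b"
  shows "\<exists>M' :: ('a, (nat \<Rightarrow> 'a) set) module. fin_gen_module R M' \<and> is_betti_sequence R M' b"
proof -
  have mod: "module R M"
    using fg by (simp add: fin_gen_module_def)
  interpret module R M by (rule mod)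
  obtain \<epsilon> \<delta> where res: "minimal_free_resolution R M b \<epsilon> \<delta>"
    using b by (auto simp: is_betti_sequence_def)
  define F0 where "F0 = carrier (free_module R (b 0))"
  have surj: "\<epsilon> ` F0 = carrier M"
    using res by (simp add: minimal_free_resolution_def F0_def Let_def)
  define \<phi> where "\<phi> m = {v \<in> F0. \<epsilon> v = m}" for m
  have inj: "inj_on \<phi> (carrier M)"
  proof (rule inj_onI)
    fix x y assume "x \<in> carrier M" "y \<in> carrier M" "\<phi> x = \<phi> y"
    moreover obtain v where "v \<in> F0" "\<epsilon> v = x"
      using \<open>x \<in> carrier M\<close> surj by (metis imageE)
    ultimately have "v \<in> \<phi> y" by (auto simp: \<phi>_def)
    thus "x = y" using \<open>\<epsilon> v = x\<close> by (simp add: \<phi>_def)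
  qed
  define \<psi> where "\<psi> = inv_into (carrier M) \<phi>"
  have \<psi>[simp]: "\<psi> (\<phi> x) = x" if "x \<in> carrier M" for x
    using that inj by (simp add: \<psi>_def)
  have \<phi>_eq: "\<phi> x = \<phi> y \<longleftrightarrow> x = y" if "x \<in> carrier M" "y \<in> carrier M" for x y
    using that inj by (auto dest: inj_onD)
  define M' :: "('a, (nat \<Rightarrow> 'a) set) module" where
    "M' = \<lparr>carrier = \<phi> ` carrier M, mult = undefined, one = undefined, ring.zero = \<phi> \<zero>\<^bsub>M\<^esub>,
           add = (\<lambda>u w. \<phi> (\<psi> u \<oplus>\<^bsub>M\<^esub> \<psi> w)), smult = (\<lambda>a u. \<phi> (a \<odot>\<^bsub>M\<^esub> \<psi> u))\<rparr>"
  have M'_simps[simp]: "carrier M' = \<phi> ` carrier M" "\<zero>\<^bsub>M'\<^esub> = \<phi> \<zero>\<^bsub>M\<^esub>"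
    "u \<oplus>\<^bsub>M'\<^esub> w = \<phi> (\<psi> u \<oplus>\<^bsub>M\<^esub> \<psi> w)" "a \<odot>\<^bsub>M'\<^esub> u = \<phi> (a \<odot>\<^bsub>M\<^esub> \<psi> u)" for u w a
    by (simp_all add: M'_def)
  have ab: "abelian_group M'"
  proof (rule abelian_groupI)
    fix u assume "u \<in> carrier M'"
    then obtain x where x: "x \<in> carrier M" "u = \<phi> x" by auto
    show "\<exists>w\<in>carrier M'. w \<oplus>\<^bsub>M'\<^esub> u = \<zero>\<^bsub>M'\<^esub>"
      using x by (intro bexI[of _ "\<phi> (\<ominus>\<^bsub>M\<^esub> x)"]) (auto simp: M.l_neg)
  qed (auto simp: M.a_ac)
  have mod': "module R M'"
    using ab by (intro moduleI R.is_cring)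
      (auto simp: smult_l_distr smult_r_distr smult_assoc1)
  have fg': "fin_gen_module R M'"
  proof -
    obtain A where A: "A \<subseteq> carrier M" "finite A"
      and gen: "\<And>N. submodule N R M \<Longrightarrow> A \<subseteq> N \<Longrightarrow> N = carrier M"
      using fg by (auto simp: fin_gen_module_def)
    have "N' = carrier M'" if N': "submodule N' R M'" "\<phi> ` A \<subseteq> N'" for N'
    proof -
      note E = module.submoduleE[OF mod' N'(1)]
      define N where "N = {x \<in> carrier M. \<phi> x \<in> N'}"
      obtain u where "u \<in> N'" using E(2) by blast
      then obtain x where x: "x \<in> carrier M" "\<phi> x \<in> N'" using E(1) by auto
      have zero: "\<phi> \<zero>\<^bsub>M\<^esub> \<in> N'"
        using E(4)[OF R.zero_closed x(2)] x(1) by simp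
      have smult: "\<phi> (a \<odot>\<^bsub>M\<^esub> y) \<in> N'" if "a \<in> carrier R" "y \<in> carrier M" "\<phi> y \<in> N'" for a y
        using E(4)[OF that(1,3)] that by simp
      have "submodule N R M"
      proof (rule submoduleI)
        show "N \<subseteq> carrier M" by (auto simp: N_def)
        show "\<zero>\<^bsub>M\<^esub> \<in> N" using zero by (simp add: N_def)
        fix y assume y: "y \<in> N"
        have "\<ominus>\<^bsub>M\<^esub> y = (\<ominus>\<^bsub>R\<^esub> \<one>\<^bsub>R\<^esub>) \<odot>\<^bsub>M\<^esub> y"
          using y by (simp add: N_def smult_l_minus)
        thus "\<ominus>\<^bsub>M\<^esub> y \<in> N" using y smult[of "\<ominus>\<^bsub>R\<^esub> \<one>\<^bsub>R\<^esub>" y] by (simp add: N_def)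
      next
        fix y z assume "y \<in> N" "z \<in> N"
        thus "y \<oplus>\<^bsub>M\<^esub> z \<in> N" using E(5)[of "\<phi> y" "\<phi> z"] by (simp add: N_def)
      next
        fix a y assume "a \<in> carrier R" "y \<in> N"
        thus "a \<odot>\<^bsub>M\<^esub> y \<in> N" using smult[of a y] by (simp add: N_def)
      qed
      moreover have "A \<subseteq> N" using A N'(2) by (auto simp: N_def)
      ultimately have "N = carrier M" by (rule gen)
      thus ?thesis using E(1) by (auto simp: N_def)
    qed
    thus ?thesis
      unfolding fin_gen_module_def using mod' A
      by (intro conjI exI[of _ "\<phi> ` A"]) auto
  qed
  have \<epsilon>: "\<epsilon> x \<in> carrier M" if "x \<in> F0" for x
    using surj that by blast
  have "minimal_free_resolution R M' b (\<phi> \<circ> \<epsilon>) \<delta>"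
  proof -
    have "\<epsilon> \<in> module_homs R (free_module R (b 0)) M"
      using res by (simp add: minimal_free_resolution_def Let_def)
    hence "\<phi> \<circ> \<epsilon> \<in> module_homs R (free_module R (b 0)) M'"
      using \<epsilon> by (auto simp: module_homs_def F0_def)
    moreover have "(\<phi> \<circ> \<epsilon>) ` F0 = carrier M'"
      using surj by (simp only: image_comp[symmetric] M'_simps)
    moreover have "{x \<in> F0. (\<phi> \<circ> \<epsilon>) x = \<zero>\<^bsub>M'\<^esub>} = {x \<in> F0. \<epsilon> x = \<zero>\<^bsub>M\<^esub>}"
      using \<epsilon> by (auto simp: \<phi>_eq)
    ultimately show ?thesis
      using res unfolding minimal_free_resolution_def Let_def F0_def by simp
  qed
  thus ?thesis
    using fg' by (auto simp: is_betti_sequence_def)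
qed

text \<open>For \<open>d > 2\<close> the vector with leading coefficient \<open>(d - 1) / d\<close> is the sum of the one with
  leading coefficient \<open>1 / d\<close> and of \<open>(d - 2) / d\<close> times \<open>eps 0\<close>, so it spans an extremal ray of
  no cone containing these; for \<open>d = 2\<close> the two vectors coincide.\<close>

lemma not_extremal_ray:
  assumes d: "2 < d"
    and "scaleW (1 / of_nat d) (eps 0) + eps_tail \<in> C"
    and "scaleW ((of_nat d - 2) / of_nat d) (eps 0) \<in> C"
  shows "\<not> extremal_ray C (scaleW ((of_nat d - 1) / of_nat d) (eps 0) + eps_tail)"
    (is "\<not> extremal_ray C ?u")
proof
  let ?x = "scaleW (1 / of_nat d) (eps 0) + eps_tail"
  let ?y = "scaleW ((of_nat d - 2) / of_nat d) (eps 0)"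
  have ray: "rat_cone_hull {v} = {scaleW c v | c. 0 \<le> c}" for v
  proof (intro equalityI subsetI)
    fix z assume "z \<in> rat_cone_hull {v}"
    then obtain F c where z: "z = (\<Sum>x\<in>F. scaleW (c x) x)" "F \<subseteq> {v}" "\<forall>x\<in>F. 0 \<le> c x"
      by (auto simp: rat_cone_hull_def)
    from z(2) consider "F = {}" | "F = {v}" by blast
    thus "z \<in> {scaleW c v | c. 0 \<le> c}"
    proof cases
      case 1
      hence "z = scaleW 0 v" using z by simp
      thus ?thesis by blast
    next
      case 2
      thus ?thesis using z by auto
    qed
  next
    fix z assume "z \<in> {scaleW c v | c. 0 \<le> c}"
    then obtain c where "z = scaleW c v" "0 \<le> c" by blast
    thus "z \<in> rat_cone_hull {v}"
      unfolding rat_cone_hull_def by (auto intro!: exI[of _ "{v}"] exI[of _ "\<lambda>_. c"])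
  qed
  have sum: "?x + ?y = scaleW 1 ?u"
    using d by (auto simp: fun_eq_iff scaleW_def eps_def of_nat_diff field_simps)
  assume "extremal_ray C ?u"
  moreover have "?x + ?y \<in> rat_cone_hull {?u}"
    unfolding ray sum using zero_le_one by blast
  ultimately have "?y \<in> rat_cone_hull {?u}"
    using assms unfolding extremal_ray_def by blast
  then obtain c where c: "?y = scaleW c ?u"
    unfolding ray by blast
  from fun_cong[OF c, of 1] have "c = 0"
    by (simp add: scaleW_def eps_def eps_tail_def)
  with fun_cong[OF c, of 0] show False
    using d by (simp add: scaleW_def eps_def eps_tail_def)
qed

end

theory Submission
  imports Defs
begin

text \<open>Let \<open>m = (x, y)\<close> be the maximal ideal of \<open>R\<close> and \<open>d\<close> the order of \<open>f\<close>. Some \<open>z \<in> m^k\<close> has an initial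
  form of degree \<open>k\<close> coprime to that of \<open>f\<close>, so that \<open>R/(f, z)\<close> has length \<open>k d\<close>. Lift a minimal resolution
  over \<open>Q\<close> to \<open>R\<close>, let \<open>K i \<subseteq> m R^(b i)\<close> be the preimage of the \<open>(i+1)\<close>-st syzygy module, and let \<open>a i\<close> be the
  length of \<open>R^(b i) / (K i + z R^(b i))\<close>. Additivity of length gives \<open>a 1 \<le> k d b 0\<close> and
  \<open>a (i + 1) + a i = k d b i\<close> for \<open>i \<ge> 1\<close>, while \<open>K i \<subseteq> m R^(b i)\<close> gives \<open>a i \<ge> k b i\<close>. Counting generators of
  \<open>K i\<close> gives \<open>b 1 \<ge> b 2 = b 3 = \<dots>\<close>, and the case \<open>a 3 \<ge> k b 2\<close> becomes
  \<open>d b 1 + b 2 \<le> d b 0 + d b 2\<close>. These inequalities cut out the closed simplicial cone spanned by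
  \<open>(1, 0, 0, \<dots>)\<close>, \<open>(1, 1, 0, \<dots>)\<close> and \<open>(1, d, d, \<dots>)\<close>, which are the Betti sequences of \<open>Q\<close>, \<open>Q/(z)\<close>
  and \<open>Q/m^d\<close>.\<close>

section \<open>Lengths of intervals of submodules\<close>

text \<open>Over an infinite residue field some linear form is coprime to the initial form of
  \<open>f\<close>, and \<open>k = 1\<close> would do. Over a small finite field every linear form
  may divide it, so \<open>z\<close> has degree \<open>k\<close>; all lengths are scaled by
  \<open>k\<close>, which cancels at the end. Counting generators calls for a linear parameter
  instead: one of the two generators of m is changed so that together with \<open>f\<close> it
  generates an ideal containing a power of m. The colength of that ideal may exceed
  \<open>d\<close>, but only its finiteness matters there.

  The module itself may have \<open>z\<close>-torsion, hence the mere inequality for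
  \<open>a 1\<close>. From the first syzygy on everything embeds in free modules over
  \<open>Q\<close>, on which \<open>z\<close> is regular, and lengths become additive.

  Regularity of \<open>R\<close> is exploited through the fact that its associated graded ring is a
  domain. This is derived from a chain of three primes: if an initial form vanished, a power of m
  would lie in a principal ideal. The counting takes place in intervals of submodules of free
  modules, so it never passes to quotient modules.\<close>

lemma (in module) submodule_zero: "submodule H R M \<Longrightarrow> \<zero>\<^bsub>M\<^esub> \<in> H"
  by (metis submoduleE(1,2,4) R.zero_closed smult_l_null subset_iff ex_in_conv)

lemma (in module) submodule_carr: "submodule H R M \<Longrightarrow> v \<in> H \<Longrightarrow> v \<in> carrier M"
  using submoduleE(1) by blast

lemma (in module) submodule_minus:
  "submodule H R M \<Longrightarrow> a \<in> H \<Longrightarrow> b \<in> H \<Longrightarrow> a \<ominus>\<^bsub>M\<^esub> b \<in> H"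
  by (simp add: a_minus_def submoduleE(3,5))

lemma (in module) submodule_add_cancel:
  assumes "submodule H R M" "a \<in> H" "b \<in> carrier M" "a \<oplus>\<^bsub>M\<^esub> b \<in> H"
  shows "b \<in> H"
proof -
  have "a \<in> carrier M" using assms submodule_carr by blast
  hence "(a \<oplus>\<^bsub>M\<^esub> b) \<ominus>\<^bsub>M\<^esub> a = b"
    using assms(3) by (simp add: a_minus_def M.a_comm[of a b] M.a_assoc M.r_neg)
  thus ?thesis using submodule_minus[OF assms(1,4,2)] by simp
qed

text \<open>Closure under negation is scaling by \<open>-1\<close>.\<close>

lemma (in module) submoduleI':
  assumes "H \<subseteq> carrier M" "\<zero>\<^bsub>M\<^esub> \<in> H"
    and "\<And>a b. a \<in> H \<Longrightarrow> b \<in> H \<Longrightarrow> a \<oplus>\<^bsub>M\<^esub> b \<in> H"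
    and "\<And>a x. a \<in> carrier R \<Longrightarrow> x \<in> H \<Longrightarrow> a \<odot>\<^bsub>M\<^esub> x \<in> H"
  shows "submodule H R M"
proof (rule submoduleI)
  fix a assume "a \<in> H"
  hence "\<ominus>\<^bsub>M\<^esub> a = (\<ominus>\<^bsub>R\<^esub> \<one>\<^bsub>R\<^esub>) \<odot>\<^bsub>M\<^esub> a" using assms(1) by (auto simp: smult_l_minus)
  thus "\<ominus>\<^bsub>M\<^esub> a \<in> H" using assms(4) \<open>a \<in> H\<close> by simp
qed (use assms in auto)

lemma (in module) submodule_Int:
  "submodule A R M \<Longrightarrow> submodule B R M \<Longrightarrow> submodule (A \<inter> B) R M"
  by (rule submoduleI') (auto simp: submodule_zero submoduleE dest: submodule_carr)

lemma set_add_iff: "v \<in> A <+>\<^bsub>M\<^esub> B \<longleftrightarrow> (\<exists>a\<in>A. \<exists>b\<in>B. v = a \<oplus>\<^bsub>M\<^esub> b)"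
  by (auto simp: set_add_def')

lemma (in module) submodule_set_add:
  assumes A: "submodule A R M" and B: "submodule B R M"
  shows "submodule (A <+>\<^bsub>M\<^esub> B) R M"
proof (rule submoduleI')
  show "A <+>\<^bsub>M\<^esub> B \<subseteq> carrier M"
    using submodule_carr[OF A] submodule_carr[OF B] by (auto simp: set_add_iff)
  show "\<zero>\<^bsub>M\<^esub> \<in> A <+>\<^bsub>M\<^esub> B"
    using submodule_zero[OF A] submodule_zero[OF B] by (force simp: set_add_iff)
next
  fix a b assume "a \<in> A <+>\<^bsub>M\<^esub> B" "b \<in> A <+>\<^bsub>M\<^esub> B"
  then obtain a1 b1 a2 b2 where h: "a1 \<in> A" "b1 \<in> B" "a = a1 \<oplus>\<^bsub>M\<^esub> b1" "a2 \<in> A" "b2 \<in> B" "b = a2 \<oplus>\<^bsub>M\<^esub> b2"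
    by (auto simp: set_add_iff)
  hence c: "a1 \<in> carrier M" "a2 \<in> carrier M" "b1 \<in> carrier M" "b2 \<in> carrier M"
    using A B submodule_carr by auto
  have "a \<oplus>\<^bsub>M\<^esub> b = (a1 \<oplus>\<^bsub>M\<^esub> a2) \<oplus>\<^bsub>M\<^esub> (b1 \<oplus>\<^bsub>M\<^esub> b2)" using h c by (simp add: M.a_ac)
  thus "a \<oplus>\<^bsub>M\<^esub> b \<in> A <+>\<^bsub>M\<^esub> B" unfolding set_add_iff using h A B submoduleE(5) by blast
next
  fix r v assume r: "r \<in> carrier R" and "v \<in> A <+>\<^bsub>M\<^esub> B"
  then obtain a b where h: "a \<in> A" "b \<in> B" "v = a \<oplus>\<^bsub>M\<^esub> b" by (auto simp: set_add_iff)
  hence "r \<odot>\<^bsub>M\<^esub> v = (r \<odot>\<^bsub>M\<^esub> a) \<oplus>\<^bsub>M\<^esub> (r \<odot>\<^bsub>M\<^esub> b)"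
    using submodule_carr[OF A] submodule_carr[OF B] r by (simp add: smult_r_distr)
  thus "r \<odot>\<^bsub>M\<^esub> v \<in> A <+>\<^bsub>M\<^esub> B" unfolding set_add_iff using h r A B submoduleE(4) by blast
qed

lemma (in module) subset_set_add1:
  "submodule A R M \<Longrightarrow> submodule B R M \<Longrightarrow> A \<subseteq> A <+>\<^bsub>M\<^esub> B"
  by (metis M.r_zero set_add_iff submodule_carr submodule_zero subsetI)

lemma (in module) subset_set_add2:
  "submodule A R M \<Longrightarrow> submodule B R M \<Longrightarrow> B \<subseteq> A <+>\<^bsub>M\<^esub> B"
  by (metis M.l_zero set_add_iff submodule_carr submodule_zero subsetI)

lemma (in module) set_add_subset:
  "submodule C R M \<Longrightarrow> A \<subseteq> C \<Longrightarrow> B \<subseteq> C \<Longrightarrow> A <+>\<^bsub>M\<^esub> B \<subseteq> C"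
  using submoduleE(5)[of C] by (auto simp: set_add_iff subset_iff)

lemma set_add_mono: "A \<subseteq> A' \<Longrightarrow> B \<subseteq> B' \<Longrightarrow> A <+>\<^bsub>M\<^esub> B \<subseteq> A' <+>\<^bsub>M\<^esub> B'"
  unfolding set_add_def' by blast

section \<open>Chains of submodules and additivity of length\<close>

definition submodule_chain ::
  "('a, 'b) ring_scheme \<Rightarrow> ('a, 'm, 'c) module_scheme \<Rightarrow> 'm set \<Rightarrow> 'm set \<Rightarrow> nat \<Rightarrow> bool" where
  "submodule_chain R M A B n \<longleftrightarrow>
     (\<exists>J. (\<forall>i\<le>n. submodule (J i) R M \<and> A \<subseteq> J i \<and> J i \<subseteq> B) \<and> (\<forall>i<n. J i \<subset> J (Suc i)))"

text \<open>The length of B/A, read off the submodules between \<open>A\<close> and \<open>B\<close>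
  so that no quotient module has to be built.\<close>

definition mlen ::
  "('a, 'b) ring_scheme \<Rightarrow> ('a, 'm, 'c) module_scheme \<Rightarrow> 'm set \<Rightarrow> 'm set \<Rightarrow> enat" where
  "mlen R M A B = Sup (enat ` {n. submodule_chain R M A B n})"

text \<open>Positivity of \<open>n\<close> excludes the empty set, whose supremum is 0.\<close>

lemma enat_le_Sup_iff:
  assumes "n > 0"
  shows "enat n \<le> Sup (enat ` S) \<longleftrightarrow> (\<exists>m\<in>S. n \<le> m)"
proof
  obtain k where k: "n = Suc k" using assms gr0_conv_Suc by blast
  assume "enat n \<le> Sup (enat ` S)"
  hence "enat k < Sup (enat ` S)" using k by (metis enat_ord_simps(2) lessI less_le_trans)
  then obtain m where "m \<in> S" "k < m" by (auto simp: less_Sup_iff)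
  thus "\<exists>m\<in>S. n \<le> m" using k by (auto simp: Suc_le_eq)
next
  assume "\<exists>m\<in>S. n \<le> m"
  then obtain m where "m \<in> S" "enat n \<le> enat m" by auto
  thus "enat n \<le> Sup (enat ` S)" by (meson Sup_upper image_eqI order_trans)
qed

lemma submodule_chain_0: "submodule A R M \<Longrightarrow> A \<subseteq> B \<Longrightarrow> submodule_chain R M A B 0"
  unfolding submodule_chain_def by auto

lemma submodule_chain_le: "submodule_chain R M A B n \<Longrightarrow> m \<le> n \<Longrightarrow> submodule_chain R M A B m"
  unfolding submodule_chain_def by (elim exE, rule_tac x=J in exI) auto

lemma submodule_chain_mono:
  "submodule_chain R M A B n \<Longrightarrow> A' \<subseteq> A \<Longrightarrow> B \<subseteq> B' \<Longrightarrow> submodule_chain R M A' B' n"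
  unfolding submodule_chain_def by (elim exE, rule_tac x=J in exI) blast

text \<open>Truncating a chain gives chains of every smaller length, so the lengths form an initial
  segment. Equalities of lengths thereby become statements about single chains.\<close>

lemma enat_le_mlen:
  assumes "submodule A R M" "A \<subseteq> B"
  shows "enat n \<le> mlen R M A B \<longleftrightarrow> submodule_chain R M A B n"
proof (cases "n = 0")
  case True
  thus ?thesis using submodule_chain_0[OF assms] by (simp add: zero_enat_def[symmetric])
next
  case False
  hence "enat n \<le> mlen R M A B \<longleftrightarrow> (\<exists>m. submodule_chain R M A B m \<and> n \<le> m)"
    unfolding mlen_def by (subst enat_le_Sup_iff) simp_all
  also have "\<dots> \<longleftrightarrow> submodule_chain R M A B n"
    using submodule_chain_le[of R M A B _ n] by (metis order_refl)
  finally show ?thesis .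
qed

lemma submodule_chain_append:
  assumes "submodule_chain R M A U p" "U \<subseteq> B" "submodule_chain R M U B q"
  shows "submodule_chain R M A B (p + q)"
proof -
  obtain J where J: "\<forall>i\<le>p. submodule (J i) R M \<and> A \<subseteq> J i \<and> J i \<subseteq> U" "\<forall>i<p. J i \<subset> J (Suc i)"
    using assms(1) unfolding submodule_chain_def by blast
  obtain H where H: "\<forall>i\<le>q. submodule (H i) R M \<and> U \<subseteq> H i \<and> H i \<subseteq> B" "\<forall>i<q. H i \<subset> H (Suc i)"
    using assms(3) unfolding submodule_chain_def by blast
  \<comment> \<open>\<open>U\<close> need not occur in either chain: the last term of
    \<open>J\<close> lies below it and \<open>H 0\<close> above it. Dropping \<open>H 0\<close>
    keeps the junction strict.\<close>
  define L where "L i = (if i \<le> p then J i else H (i - p))" for i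
  have AX: "A \<subseteq> U" using J(1) by blast
  have "submodule (L i) R M \<and> A \<subseteq> L i \<and> L i \<subseteq> B" if "i \<le> p + q" for i
  proof (cases "i \<le> p")
    case True thus ?thesis using J(1) assms(2) by (auto simp: L_def)
  next
    case False
    hence "i - p \<le> q" using that by simp
    thus ?thesis using H(1) AX False by (auto simp: L_def)
  qed
  moreover have "L i \<subset> L (Suc i)" if "i < p + q" for i
  proof -
    consider "i < p" | "i = p" | "i > p" by linarith
    thus ?thesis
    proof cases
      case 1 thus ?thesis using J(2) by (simp add: L_def)
    next
      case 2
      hence "q > 0" using that by simp
      have "J p \<subseteq> U" "U \<subseteq> H 0" "H 0 \<subset> H (Suc 0)" using J(1) H \<open>q > 0\<close> by simp_all
      thus ?thesis using 2 by (auto simp: L_def)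
    next
      case 3
      hence "i - p < q" using that by simp
      hence "H (i - p) \<subset> H (Suc (i - p))" using H(2) by blast
      thus ?thesis using 3 by (simp add: L_def Suc_diff_le)
    qed
  qed
  ultimately show ?thesis unfolding submodule_chain_def by (intro exI[of _ L]) simp
qed

lemma submodule_chain_step:
  assumes "submodule_chain R M A U p" "U \<subset> Y" "submodule U R M" "submodule Y R M"
  shows "submodule_chain R M A Y (Suc p)"
proof -
  have "submodule_chain R M U Y 1" unfolding submodule_chain_def
    using assms by (intro exI[of _ "\<lambda>i. if i = 0 then U else Y"]) auto
  from submodule_chain_append[OF assms(1) _ this] assms(2) show ?thesis by auto
qed

text \<open>By the modular law a strict step of a chain remains strict after intersecting with
  \<open>B\<close> or after adding \<open>B\<close>, so the two derived chains together have at
  least as many strict steps.\<close>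

lemma (in module) submodule_chain_split:
  assumes A: "submodule A R M" and B: "submodule B R M" and C: "submodule C R M"
    and AB: "A \<subseteq> B" and BC: "B \<subseteq> C" and ch: "submodule_chain R M A C n"
  shows "\<exists>p q. n = p + q \<and> submodule_chain R M A B p \<and> submodule_chain R M B C q"
proof -
  obtain J where J: "\<forall>i\<le>n. submodule (J i) R M \<and> A \<subseteq> J i \<and> J i \<subseteq> C" "\<forall>i<n. J i \<subset> J (Suc i)"
    using ch unfolding submodule_chain_def by blast
  have "\<exists>p q. i \<le> p + q \<and> submodule_chain R M A (J i \<inter> B) p \<and> submodule_chain R M B (J i <+>\<^bsub>M\<^esub> B) q"
    if "i \<le> n" for i
    using that
  proof (induction i)
    case 0
    thus ?case
      using submodule_chain_0[OF A, of "J 0 \<inter> B"] submodule_chain_0[OF B subset_set_add2[of "J 0" B]] J(1) B AB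
      by blast
  next
    case (Suc i)
    then obtain p q where pq: "i \<le> p + q" "submodule_chain R M A (J i \<inter> B) p"
      "submodule_chain R M B (J i <+>\<^bsub>M\<^esub> B) q" by auto
    let ?U = "J i" and ?Y = "J (Suc i)"
    have U: "submodule ?U R M" and Y: "submodule ?Y R M" and XY: "?U \<subset> ?Y" using J Suc.prems by auto
    have sI: "submodule (?U \<inter> B) R M" "submodule (?Y \<inter> B) R M"
      and sS: "submodule (?U <+>\<^bsub>M\<^esub> B) R M" "submodule (?Y <+>\<^bsub>M\<^esub> B) R M"
      using U Y B submodule_Int submodule_set_add by auto
    have m1: "?U \<inter> B \<subseteq> ?Y \<inter> B" and m2: "?U <+>\<^bsub>M\<^esub> B \<subseteq> ?Y <+>\<^bsub>M\<^esub> B"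
      using XY set_add_mono[of ?U ?Y B B] by auto
    show ?case
    proof (cases "?U \<inter> B = ?Y \<inter> B \<and> ?U <+>\<^bsub>M\<^esub> B = ?Y <+>\<^bsub>M\<^esub> B")
      case True
      have "?Y \<subseteq> ?U"
      proof
        fix v assume v: "v \<in> ?Y"
        hence "v \<in> ?U <+>\<^bsub>M\<^esub> B" using True subset_set_add1[OF Y B] by auto
        then obtain a b where ab: "a \<in> ?U" "b \<in> B" "v = a \<oplus>\<^bsub>M\<^esub> b" by (auto simp: set_add_iff)
        hence "b \<in> ?Y" using submodule_add_cancel[OF Y, of a b] v XY B submodule_carr by blast
        hence "b \<in> ?U" using True ab by blast
        thus "v \<in> ?U" using ab U submoduleE(5) by blast
      qed
      thus ?thesis using XY by blast
    next
      case False
      then consider "?U \<inter> B \<subset> ?Y \<inter> B" | "?U <+>\<^bsub>M\<^esub> B \<subset> ?Y <+>\<^bsub>M\<^esub> B"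
        using m1 m2 by blast
      thus ?thesis
      proof cases
        case 1
        from submodule_chain_step[OF pq(2) this sI] submodule_chain_mono[OF pq(3) order_refl m2] pq(1)
        show ?thesis by (intro exI[of _ "Suc p"] exI[of _ q]) auto
      next
        case 2
        from submodule_chain_step[OF pq(3) this sS] submodule_chain_mono[OF pq(2) order_refl m1] pq(1)
        show ?thesis by (intro exI[of _ p] exI[of _ "Suc q"]) auto
      qed
    qed
  qed
  from this[OF order_refl] obtain p q where pq: "n \<le> p + q" "submodule_chain R M A (J n \<inter> B) p"
    "submodule_chain R M B (J n <+>\<^bsub>M\<^esub> B) q" by auto
  have "J n <+>\<^bsub>M\<^esub> B \<subseteq> C" using J(1) BC C by (intro set_add_subset) auto
  hence p: "submodule_chain R M A B p" and q: "submodule_chain R M B C q"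
    using pq by (auto intro: submodule_chain_mono)
  \<comment> \<open>The induction only yields that \<open>p + q\<close> is at least
    \<open>n\<close>; the surplus is cut off.\<close>
  have "n = min p n + (n - min p n)" "n - min p n \<le> q" using pq(1) by auto
  thus ?thesis using submodule_chain_le[OF p, of "min p n"] submodule_chain_le[OF q] by (metis min.cobounded1)
qed

lemma enat_le_add_iff: "enat n \<le> U + Y \<longleftrightarrow> (\<exists>p q. n = p + q \<and> enat p \<le> U \<and> enat q \<le> Y)"
proof
  assume n: "enat n \<le> U + Y"
  show "\<exists>p q. n = p + q \<and> enat p \<le> U \<and> enat q \<le> Y"
  proof (cases U)
    case (enat a)
    show ?thesis
    proof (cases "n \<le> a")
      case True
      thus ?thesis using enat by (intro exI[of _ n] exI[of _ 0]) (auto simp: zero_enat_def[symmetric])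
    next
      case False
      hence "enat (n - a) \<le> Y" using n enat by (cases Y) auto
      thus ?thesis using enat False by (intro exI[of _ a] exI[of _ "n - a"]) auto
    qed
  next
    case infinity
    thus ?thesis by (intro exI[of _ n] exI[of _ 0]) (auto simp: zero_enat_def[symmetric])
  qed
next
  assume "\<exists>p q. n = p + q \<and> enat p \<le> U \<and> enat q \<le> Y"
  thus "enat n \<le> U + Y" by (metis add_mono plus_enat_simps(1))
qed

text \<open>Equality is tested on finite lower bounds because \<open>enat_le_mlen\<close> turns
  exactly these into chains.\<close>

lemma enat_eqI:
  assumes le: "\<And>n. enat n \<le> U \<longleftrightarrow> enat n \<le> Y"
  shows "U = Y"
proof (cases U; cases Y)
  fix a assume h: "U = enat a" "Y = \<infinity>"
  thus "U = Y" using le[of "Suc a"] by simp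
next
  fix a assume h: "U = \<infinity>" "Y = enat a"
  thus "U = Y" using le[of "Suc a"] by simp
next
  fix a b assume h: "U = enat a" "Y = enat b"
  thus "U = Y" using le[of a] le[of b] by simp
qed auto

lemma (in module) mlen_add:
  assumes "submodule A R M" "submodule B R M" "submodule C R M" "A \<subseteq> B" "B \<subseteq> C"
  shows "mlen R M A C = mlen R M A B + mlen R M B C"
proof (rule enat_eqI)
  fix n
  note eqs = enat_le_mlen[OF assms(1) order_trans[OF assms(4,5)]] enat_le_mlen[OF assms(1,4)]
    enat_le_mlen[OF assms(2,5)]
  show "enat n \<le> mlen R M A C \<longleftrightarrow> enat n \<le> mlen R M A B + mlen R M B C"
    unfolding enat_le_add_iff eqs
    using submodule_chain_split[OF assms] submodule_chain_append[OF _ assms(5)] by blast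
qed

lemma mlen_mono:
  assumes "A' \<subseteq> A" "B \<subseteq> B'"
  shows "mlen R M A B \<le> mlen R M A' B'"
proof -
  have "{n. submodule_chain R M A B n} \<subseteq> {n. submodule_chain R M A' B' n}"
    by (rule Collect_mono, rule impI, erule submodule_chain_mono[OF _ assms])
  hence "enat ` {n. submodule_chain R M A B n} \<subseteq> enat ` {n. submodule_chain R M A' B' n}"
    by (rule image_mono)
  thus ?thesis unfolding mlen_def by (rule Sup_subset_mono)
qed

lemma (in module) mlen_zero_iff:
  assumes "submodule A R M" "submodule B R M" "A \<subseteq> B"
  shows "mlen R M A B = 0 \<longleftrightarrow> A = B"
proof
  assume "mlen R M A B = 0"
  hence "\<not> submodule_chain R M A B 1" using enat_le_mlen[OF assms(1,3), of 1] by (simp add: zero_enat_def)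
  thus "A = B" using submodule_chain_step[OF submodule_chain_0[OF assms(1) order_refl] _ assms(1,2)] assms(3)
    by (metis One_nat_def psubsetI)
next
  assume "A = B"
  hence "\<not> submodule_chain R M A B (Suc 0)" unfolding submodule_chain_def by auto
  hence "\<not> enat (Suc 0) \<le> mlen R M A B" using enat_le_mlen[OF assms(1,3)] by blast
  thus "mlen R M A B = 0" by (cases "mlen R M A B") (auto simp: zero_enat_def)
qed

lemma (in module) mlen_self: "submodule A R M \<Longrightarrow> mlen R M A A = 0"
  by (simp add: mlen_zero_iff)

section \<open>Linear maps and lengths of images\<close>

locale module_map = M: module R M + N: module R N
  for R (structure) and M :: "('a, 'm, 'c) module_scheme" and N :: "('a, 'n, 'e) module_scheme" +
  fixes \<phi>
  assumes hom: "\<phi> \<in> module_homs R M N"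
begin

lemma closed [simp]: "v \<in> carrier M \<Longrightarrow> \<phi> v \<in> carrier N"
  and map_add: "v \<in> carrier M \<Longrightarrow> w \<in> carrier M \<Longrightarrow> \<phi> (v \<oplus>\<^bsub>M\<^esub> w) = \<phi> v \<oplus>\<^bsub>N\<^esub> \<phi> w"
  and map_smult: "a \<in> carrier R \<Longrightarrow> v \<in> carrier M \<Longrightarrow> \<phi> (a \<odot>\<^bsub>M\<^esub> v) = a \<odot>\<^bsub>N\<^esub> \<phi> v"
  using hom by (auto simp: module_homs_def)

lemma map_zero [simp]: "\<phi> \<zero>\<^bsub>M\<^esub> = \<zero>\<^bsub>N\<^esub>"
  using map_smult[of \<zero> "\<zero>\<^bsub>M\<^esub>"] by simp

lemma map_uminus: "v \<in> carrier M \<Longrightarrow> \<phi> (\<ominus>\<^bsub>M\<^esub> v) = \<ominus>\<^bsub>N\<^esub> \<phi> v"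
  using map_smult[of "\<ominus> \<one>" v] by (simp add: M.smult_l_minus N.smult_l_minus)

lemma map_minus: "v \<in> carrier M \<Longrightarrow> w \<in> carrier M \<Longrightarrow> \<phi> (v \<ominus>\<^bsub>M\<^esub> w) = \<phi> v \<ominus>\<^bsub>N\<^esub> \<phi> w"
  by (simp add: a_minus_def map_add map_uminus)

lemma submodule_image:
  assumes A: "submodule A R M"
  shows "submodule (\<phi> ` A) R N"
proof (rule N.submoduleI')
  note c = M.submodule_carr[OF A]
  show "\<phi> ` A \<subseteq> carrier N" using c by auto
  show "\<zero>\<^bsub>N\<^esub> \<in> \<phi> ` A" using M.submodule_zero[OF A] map_zero by (metis imageI)
  fix a b assume "a \<in> \<phi> ` A" "b \<in> \<phi> ` A"
  then obtain v w where "v \<in> A" "w \<in> A" "a = \<phi> v" "b = \<phi> w" by blast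
  thus "a \<oplus>\<^bsub>N\<^esub> b \<in> \<phi> ` A" using M.submoduleE(5)[OF A] map_add c by (metis imageI)
next
  note c = M.submodule_carr[OF A]
  fix a b assume a: "a \<in> carrier R" "b \<in> \<phi> ` A"
  then obtain v where "v \<in> A" "b = \<phi> v" by blast
  thus "a \<odot>\<^bsub>N\<^esub> b \<in> \<phi> ` A" using M.submoduleE(4)[OF A] map_smult c a by (metis imageI)
qed

lemma submodule_vimage:
  assumes B: "submodule B R M" and H: "submodule H R N"
  shows "submodule {v \<in> B. \<phi> v \<in> H} R M"
proof (rule M.submoduleI')
  note c = M.submodule_carr[OF B]
  show "{v \<in> B. \<phi> v \<in> H} \<subseteq> carrier M" using c by auto
  show "\<zero>\<^bsub>M\<^esub> \<in> {v \<in> B. \<phi> v \<in> H}" using M.submodule_zero[OF B] N.submodule_zero[OF H] by simp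
  fix v w assume "v \<in> {v \<in> B. \<phi> v \<in> H}" "w \<in> {v \<in> B. \<phi> v \<in> H}"
  thus "v \<oplus>\<^bsub>M\<^esub> w \<in> {v \<in> B. \<phi> v \<in> H}"
    using M.submoduleE(5)[OF B] N.submoduleE(5)[OF H] c by (simp add: map_add)
next
  note c = M.submodule_carr[OF B]
  fix a v assume "a \<in> carrier R" "v \<in> {v \<in> B. \<phi> v \<in> H}"
  thus "a \<odot>\<^bsub>M\<^esub> v \<in> {v \<in> B. \<phi> v \<in> H}"
    using M.submoduleE(4)[OF B] N.submoduleE(4)[OF H] c by (simp add: map_smult)
qed

text \<open>By \<open>ker\<close> the kernel of the map from \<open>B\<close> to N/E lies in
  \<open>A\<close>, so \<open>\<phi>\<close> induces an isomorphism from B/A onto the quotient of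
  the two sums. Chains are carried over by \<open>J\<close> to \<open>E + \<phi>(J)\<close> and back
  by preimages in \<open>B\<close>. Most comparisons of lengths below are instances.\<close>

lemma mlen_image:
  assumes E: "submodule E R N" and A: "submodule A R M" and B: "submodule B R M" and AB: "A \<subseteq> B"
    and ker: "\<And>v. v \<in> B \<Longrightarrow> \<phi> v \<in> E \<Longrightarrow> v \<in> A"
  shows "mlen R N (E <+>\<^bsub>N\<^esub> \<phi> ` A) (E <+>\<^bsub>N\<^esub> \<phi> ` B) = mlen R M A B"
proof (rule enat_eqI)
  fix n
  let ?S = "\<lambda>J. E <+>\<^bsub>N\<^esub> \<phi> ` J"
  have sub: "submodule (?S J) R N" if "submodule J R M" for J
    using that E N.submodule_set_add submodule_image by auto
  have mono: "?S J \<subseteq> ?S J'" if "J \<subseteq> J'" for J J'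
    using that set_add_mono by (meson image_mono order_refl)
  \<comment> \<open>Inclusions are reflected, which keeps strict steps strict: elements with the
    same image modulo \<open>E\<close> differ by an element of \<open>A\<close>.\<close>
  have refl: "J' \<subseteq> J" if J: "submodule J R M" "A \<subseteq> J" "J' \<subseteq> B" "J \<subseteq> J'" "?S J' \<subseteq> ?S J" for J J'
  proof
    fix v assume v: "v \<in> J'"
    have vB: "v \<in> B" "v \<in> carrier M" using v that B M.submodule_carr by auto
    have "\<phi> v = \<zero>\<^bsub>N\<^esub> \<oplus>\<^bsub>N\<^esub> \<phi> v" using vB by simp
    hence "\<phi> v \<in> ?S J'" using v N.submodule_zero[OF E] unfolding set_add_iff by blast
    hence "\<phi> v \<in> ?S J" using that by blast
    then obtain e j where e: "e \<in> E" "j \<in> J" "\<phi> v = e \<oplus>\<^bsub>N\<^esub> \<phi> j" by (auto simp: set_add_iff)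
    have j: "j \<in> carrier M" "j \<in> B" using e J M.submodule_carr by auto
    have eN: "e \<in> carrier N" using e E N.submodule_carr by auto
    have "\<phi> (v \<ominus>\<^bsub>M\<^esub> j) = e" using e(3) j vB eN
      by (simp only: map_minus) (simp add: a_minus_def N.a_assoc N.r_neg)
    moreover have "v \<ominus>\<^bsub>M\<^esub> j \<in> B" using M.submodule_minus[OF B] vB j by blast
    ultimately have "v \<ominus>\<^bsub>M\<^esub> j \<in> J" using ker e J by auto
    moreover have "v = (v \<ominus>\<^bsub>M\<^esub> j) \<oplus>\<^bsub>M\<^esub> j" using vB j by (simp add: a_minus_def M.a_assoc M.l_neg)
    ultimately show "v \<in> J" using e M.submoduleE(5)[OF J(1)] by metis
  qed
  have "submodule_chain R N (?S A) (?S B) n \<longleftrightarrow> submodule_chain R M A B n"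
  proof
    assume "submodule_chain R M A B n"
    then obtain J where J: "\<forall>i\<le>n. submodule (J i) R M \<and> A \<subseteq> J i \<and> J i \<subseteq> B" "\<forall>i<n. J i \<subset> J (Suc i)"
      unfolding submodule_chain_def by blast
    have "?S (J i) \<subset> ?S (J (Suc i))" if "i < n" for i
    proof -
      have Ji: "submodule (J i) R M" "A \<subseteq> J i" "J (Suc i) \<subseteq> B" "J i \<subset> J (Suc i)"
        using J that by simp_all
      hence "\<not> ?S (J (Suc i)) \<subseteq> ?S (J i)" using refl[OF Ji(1-3)] by blast
      thus ?thesis using mono[of "J i" "J (Suc i)"] Ji(4) by blast
    qed
    moreover have "submodule (?S (J i)) R N \<and> ?S A \<subseteq> ?S (J i) \<and> ?S (J i) \<subseteq> ?S B" if "i \<le> n" for i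
      using J(1) that sub mono by blast
    ultimately show "submodule_chain R N (?S A) (?S B) n"
      unfolding submodule_chain_def by (intro exI[of _ "\<lambda>i. ?S (J i)"]) simp
  next
    assume "submodule_chain R N (?S A) (?S B) n"
    then obtain H where H: "\<forall>i\<le>n. submodule (H i) R N \<and> ?S A \<subseteq> H i \<and> H i \<subseteq> ?S B" "\<forall>i<n. H i \<subset> H (Suc i)"
      unfolding submodule_chain_def by blast
    let ?V = "\<lambda>i. {v \<in> B. \<phi> v \<in> H i}"
    have EA: "E \<subseteq> ?S A" "\<phi> ` A \<subseteq> ?S A"
      using N.subset_set_add1[OF E submodule_image[OF A]] N.subset_set_add2[OF E submodule_image[OF A]] by auto
    \<comment> \<open>A new element of \<open>H (Suc i)\<close> can be corrected by an element of
      \<open>E\<close>, which lies in every \<open>H i\<close>, to the image of an element of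
      \<open>B\<close>.\<close>
    have "?V i \<subset> ?V (Suc i)" if i: "i < n" for i
    proof -
      obtain h where h: "h \<in> H (Suc i)" "h \<notin> H i" using H(2) i by blast
      have Hi: "submodule (H i) R N" "submodule (H (Suc i)) R N" "E \<subseteq> H i" "E \<subseteq> H (Suc i)" "H (Suc i) \<subseteq> ?S B"
        using H(1)[rule_format, of i] H(1)[rule_format, of "Suc i"] i EA by auto
      obtain e b where e: "e \<in> E" "b \<in> B" "h = e \<oplus>\<^bsub>N\<^esub> \<phi> b" 
        using h(1) Hi(5) unfolding set_add_iff[of h, symmetric] subset_iff by (auto simp: set_add_iff)
      have bc: "\<phi> b \<in> carrier N" using e B M.submodule_carr by simp
      have "\<phi> b \<in> H (Suc i)" using N.submodule_add_cancel[OF Hi(2) _ bc] e h Hi by auto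
      moreover have "\<phi> b \<notin> H i" using N.submoduleE(5)[OF Hi(1)] e h Hi by auto
      ultimately show ?thesis using e H(2) i by blast
    qed
    moreover have "submodule (?V i) R M \<and> A \<subseteq> ?V i \<and> ?V i \<subseteq> B" if "i \<le> n" for i
      using H(1)[rule_format, OF that] submodule_vimage[OF B] EA AB by blast
    ultimately show "submodule_chain R M A B n"
      unfolding submodule_chain_def by (intro exI[of _ ?V]) simp
  qed
  thus "enat n \<le> mlen R N (?S A) (?S B) \<longleftrightarrow> enat n \<le> mlen R M A B"
    using enat_le_mlen[OF sub[OF A] mono[OF AB]] enat_le_mlen[OF A AB] by simp
qed

end

context module
begin

lemma id_map: "module_map R M M (\<lambda>v. v)"
proof -
  have "(\<lambda>v. v) \<in> module_homs R M M" by (auto simp: module_homs_def)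
  thus ?thesis by (intro module_map.intro module_axioms module_map_axioms.intro)
qed

lemma smult_map:
  assumes z: "z \<in> carrier R"
  shows "module_map R M M (\<lambda>v. z \<odot>\<^bsub>M\<^esub> v)"
proof -
  have "z \<odot>\<^bsub>M\<^esub> (a \<odot>\<^bsub>M\<^esub> v) = a \<odot>\<^bsub>M\<^esub> (z \<odot>\<^bsub>M\<^esub> v)" if "a \<in> carrier R" "v \<in> carrier M" for a v
    using z that smult_assoc1 R.m_comm by metis
  hence "(\<lambda>v. z \<odot>\<^bsub>M\<^esub> v) \<in> module_homs R M M"
    using z by (auto simp: module_homs_def smult_r_distr)
  thus ?thesis by (intro module_map.intro module_axioms module_map_axioms.intro)
qed

text \<open>The case of the identity map in \<open>mlen_image\<close>.\<close>

lemma mlen_second_iso: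
  assumes "submodule E R M" "submodule A R M" "submodule B R M" "A \<subseteq> B" "B \<inter> E \<subseteq> A"
  shows "mlen R M (E <+>\<^bsub>M\<^esub> A) (E <+>\<^bsub>M\<^esub> B) = mlen R M A B"
proof -
  have "mlen R M (E <+>\<^bsub>M\<^esub> (\<lambda>v. v) ` A) (E <+>\<^bsub>M\<^esub> (\<lambda>v. v) ` B) = mlen R M A B"
    by (rule module_map.mlen_image[OF id_map assms(1-4)]) (use assms(5) in blast)
  thus ?thesis by simp
qed

lemma submodule_smult: "z \<in> carrier R \<Longrightarrow> submodule A R M \<Longrightarrow> submodule ((\<lambda>v. z \<odot>\<^bsub>M\<^esub> v) ` A) R M"
  by (rule module_map.submodule_image[OF smult_map])

lemma smult_subset: "z \<in> carrier R \<Longrightarrow> submodule A R M \<Longrightarrow> (\<lambda>v. z \<odot>\<^bsub>M\<^esub> v) ` A \<subseteq> A"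
  by (auto simp: submoduleE(4))

end

section \<open>The ring as a module over itself and free modules\<close>

text \<open>A copy of \<open>R\<close> on its own elements. The elements of
  \<open>free_module R 1\<close> are functions, so there ideals would not literally be
  submodules.\<close>

definition self_module :: "('a, 'b) ring_scheme \<Rightarrow> ('a, 'a) module" where
  "self_module R = \<lparr>carrier = carrier R, mult = mult R, one = one R, ring.zero = ring.zero R,
     add = add R, smult = mult R\<rparr>"

lemma self_module_simps [simp]:
  "carrier (self_module R) = carrier R" "a \<oplus>\<^bsub>self_module R\<^esub> b = a \<oplus>\<^bsub>R\<^esub> b"
  "a \<odot>\<^bsub>self_module R\<^esub> b = a \<otimes>\<^bsub>R\<^esub> b" "\<zero>\<^bsub>self_module R\<^esub> = \<zero>\<^bsub>R\<^esub>"
  by (simp_all add: self_module_def)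

lemma set_add_self_module [simp]: "A <+>\<^bsub>self_module R\<^esub> B = A <+>\<^bsub>R\<^esub> B"
  by (simp add: set_add_def')

lemma (in cring) module_self: "module R (self_module R)"
proof (rule moduleI)
  show "abelian_group (self_module R)"
  proof (rule abelian_groupI)
    fix u assume "u \<in> carrier (self_module R)"
    thus "\<exists>w\<in>carrier (self_module R). w \<oplus>\<^bsub>self_module R\<^esub> u = \<zero>\<^bsub>self_module R\<^esub>"
      by (intro bexI[of _ "\<ominus> u"]) (auto simp: l_neg)
  qed (auto simp: a_ac)
qed (auto simp: l_distr r_distr m_assoc is_cring)

lemma (in cring) submodule_self_iff: "submodule I R (self_module R) \<longleftrightarrow> ideal I R"
proof
  interpret S: module R "self_module R" by (rule module_self)
  assume I: "submodule I R (self_module R)"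
  show "ideal I R"
  proof (rule idealI[OF ring_axioms])
    have c: "I \<subseteq> carrier R" using S.submoduleE(1)[OF I] by simp
    show "subgroup I (add_monoid R)"
    proof (rule add.subgroupI)
      show "I \<subseteq> carrier R" "I \<noteq> {}" using c S.submoduleE(2)[OF I] by auto
      fix a b assume a: "a \<in> I"
      have "\<ominus> a = (\<ominus> \<one>) \<otimes> a" using a c by (auto simp: l_minus)
      thus "\<ominus> a \<in> I" using S.submoduleE(4)[OF I, of "\<ominus> \<one>" a] a by simp
      assume "b \<in> I"
      thus "a \<oplus> b \<in> I" using S.submoduleE(5)[OF I a] by simp
    qed
    fix a b assume ab: "a \<in> I" "b \<in> carrier R"
    show "b \<otimes> a \<in> I" using S.submoduleE(4)[OF I] ab by simp
    moreover have "a \<in> carrier R" using S.submodule_carr[OF I] ab by simp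
    ultimately show "a \<otimes> b \<in> I" using m_comm ab by simp
  qed
next
  interpret S: module R "self_module R" by (rule module_self)
  assume I: "ideal I R"
  show "submodule I R (self_module R)"
    by (rule S.submoduleI')
      (use ideal.Icarr[OF I] additive_subgroup.zero_closed[OF ideal.axioms(1)[OF I]]
        additive_subgroup.a_closed[OF ideal.axioms(1)[OF I]] ideal.I_l_closed[OF I] in auto)
qed

lemma free_module_simps [simp]:
  "carrier (free_module R n) = {..<n} \<rightarrow>\<^sub>E carrier R"
  "\<zero>\<^bsub>free_module R n\<^esub> = (\<lambda>i\<in>{..<n}. \<zero>\<^bsub>R\<^esub>)"
  "v \<oplus>\<^bsub>free_module R n\<^esub> w = (\<lambda>i\<in>{..<n}. v i \<oplus>\<^bsub>R\<^esub> w i)"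
  "a \<odot>\<^bsub>free_module R n\<^esub> v = (\<lambda>i\<in>{..<n}. a \<otimes>\<^bsub>R\<^esub> v i)"
  by (simp_all add: free_module_def)

lemma (in cring) module_free: "module R (free_module R n)"
proof (rule moduleI)
  show "abelian_group (free_module R n)"
  proof (rule abelian_groupI)
    fix u assume u: "u \<in> carrier (free_module R n)"
    show "\<exists>w\<in>carrier (free_module R n). w \<oplus>\<^bsub>free_module R n\<^esub> u = \<zero>\<^bsub>free_module R n\<^esub>"
      using u by (intro bexI[of _ "\<lambda>i\<in>{..<n}. \<ominus> u i"]) (auto simp: l_neg PiE_iff fun_eq_iff)
  qed (auto simp: a_ac PiE_iff fun_eq_iff extensional_def restrict_def)
qed (auto simp: l_distr r_distr m_assoc is_cring PiE_iff fun_eq_iff extensional_def restrict_def)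

abbreviation comp_set :: "'a set \<Rightarrow> nat \<Rightarrow> (nat \<Rightarrow> 'a) set" where
  "comp_set I n \<equiv> {..<n} \<rightarrow>\<^sub>E I"

lemma (in cring) submodule_comp_set:
  assumes I: "ideal I R"
  shows "submodule (comp_set I n) R (free_module R n)"
proof -
  interpret F: module R "free_module R n" by (rule module_free)
  show ?thesis
    by (rule F.submoduleI')
      (use ideal.Icarr[OF I] additive_subgroup.zero_closed[OF ideal.axioms(1)[OF I]]
        additive_subgroup.a_closed[OF ideal.axioms(1)[OF I]] ideal.I_l_closed[OF I]
        in \<open>auto simp: PiE_iff\<close>)
qed

lemma (in cring) proj_map:
  assumes "j < n"
  shows "module_map R (free_module R n) (self_module R) (\<lambda>v. v j)"
proof -
  have "(\<lambda>v. v j) \<in> module_homs R (free_module R n) (self_module R)"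
    using assms by (auto simp: module_homs_def PiE_iff)
  thus ?thesis
    by (intro module_map.intro module_self module_free module_map_axioms.intro)
qed

text \<open>R^n/I^n is filtered by freeing one coordinate at a time, and the projection to that
  coordinate identifies each step with R/I.\<close>

lemma (in cring) mlen_comp_set:
  assumes I: "ideal I R" and k: "mlen R (self_module R) I (carrier R) = enat k"
  shows "mlen R (free_module R n) (comp_set I n) (comp_set (carrier R) n) = enat (n * k)"
proof -
  interpret F: module R "free_module R n" by (rule module_free)
  define A where "A j = {v \<in> carrier (free_module R n). \<forall>i<n. j \<le> i \<longrightarrow> v i \<in> I}" for j
  have z: "\<zero> \<in> I" and ad: "\<And>a b. a \<in> I \<Longrightarrow> b \<in> I \<Longrightarrow> a \<oplus> b \<in> I"
    and sm: "\<And>a b. a \<in> carrier R \<Longrightarrow> b \<in> I \<Longrightarrow> a \<otimes> b \<in> I" and cr: "\<And>a. a \<in> I \<Longrightarrow> a \<in> carrier R"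
    using ideal.Icarr[OF I] additive_subgroup.zero_closed[OF ideal.axioms(1)[OF I]]
      additive_subgroup.a_closed[OF ideal.axioms(1)[OF I]] ideal.I_l_closed[OF I] by auto
  have A: "submodule (A j) R (free_module R n)" for j
    by (rule F.submoduleI') (use z ad sm in \<open>auto simp: A_def PiE_iff extensional_def\<close>)
  have step: "mlen R (free_module R n) (A j) (A (Suc j)) = enat k" if j: "j < n" for j
  proof -
    interpret P: module_map R "free_module R n" "self_module R" "\<lambda>v. v j" by (rule proj_map[OF j])
    have sI: "submodule I R (self_module R)" using I by (simp add: submodule_self_iff)
    have sub: "A j \<subseteq> A (Suc j)" by (auto simp: A_def)
    have ker: "v \<in> A j" if v: "v \<in> A (Suc j)" "v j \<in> I" for v
    proof -
      have "v i \<in> I" if "i < n" "j \<le> i" for i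
        using v that by (cases "i = j") (auto simp: A_def)
      thus ?thesis using v by (auto simp: A_def)
    qed
    have "(\<lambda>v. v j) ` A j \<subseteq> I" using j by (auto simp: A_def)
    hence e1: "I <+>\<^bsub>self_module R\<^esub> (\<lambda>v. v j) ` A j = I"
      using P.N.set_add_subset[OF sI order_refl] P.N.subset_set_add1[OF sI P.submodule_image[OF A]] by blast
    have "carrier R \<subseteq> (\<lambda>v. v j) ` A (Suc j)"
    proof
      fix a assume a: "a \<in> carrier R"
      let ?v = "\<lambda>i\<in>{..<n}. if i = j then a else \<zero>"
      have "?v \<in> A (Suc j)" using a z by (auto simp: A_def PiE_iff)
      moreover have "?v j = a" using j by simp
      ultimately show "a \<in> (\<lambda>v. v j) ` A (Suc j)" by (metis (no_types, lifting) imageI)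
    qed
    hence e2: "I <+>\<^bsub>self_module R\<^esub> (\<lambda>v. v j) ` A (Suc j) = carrier R"
      using P.N.submoduleE(1)[OF P.N.submodule_set_add[OF sI P.submodule_image[OF A[of "Suc j"]]]]
        P.N.subset_set_add2[OF sI P.submodule_image[OF A[of "Suc j"]]]
      unfolding self_module_simps by blast
    show ?thesis
      using P.mlen_image[OF sI A A sub ker] k unfolding e1 e2 by simp
  qed
  have "mlen R (free_module R n) (A 0) (A j) = enat (j * k)" if "j \<le> n" for j
    using that
  proof (induction j)
    case 0
    thus ?case using F.mlen_self[OF A] by (simp add: zero_enat_def)
  next
    case (Suc j)
    have "A 0 \<subseteq> A j" "A j \<subseteq> A (Suc j)" by (auto simp: A_def)
    hence "mlen R (free_module R n) (A 0) (A (Suc j)) = enat (j * k) + enat k"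
      using F.mlen_add[OF A A A, of 0 j "Suc j"] Suc step[of j] by simp
    thus ?case by (simp add: add.commute)
  qed
  from this[of n] have "mlen R (free_module R n) (A 0) (A n) = enat (n * k)" by simp
  moreover have "A 0 = comp_set I n" using cr by (auto simp: A_def PiE_iff extensional_def)
  moreover have "A n = comp_set (carrier R) n" by (auto simp: A_def)
  ultimately show ?thesis by simp
qed

section \<open>Linear combinations\<close>

primrec lincomb :: "('a, 'm, 'c) module_scheme \<Rightarrow> (nat \<Rightarrow> 'm) \<Rightarrow> (nat \<Rightarrow> 'a) \<Rightarrow> nat \<Rightarrow> 'm" where
  "lincomb M u v 0 = \<zero>\<^bsub>M\<^esub>"
| "lincomb M u v (Suc n) = lincomb M u v n \<oplus>\<^bsub>M\<^esub> v n \<odot>\<^bsub>M\<^esub> u n"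

definition lin_span :: "('a, 'b) ring_scheme \<Rightarrow> ('a, 'm, 'c) module_scheme \<Rightarrow> (nat \<Rightarrow> 'm) \<Rightarrow> nat \<Rightarrow> 'm set" where
  "lin_span R M u n = (\<lambda>v. lincomb M u v n) ` carrier (free_module R n)"

lemma lincomb_cong:
  "(\<And>i. i < n \<Longrightarrow> u i = u' i) \<Longrightarrow> (\<And>i. i < n \<Longrightarrow> v i = v' i) \<Longrightarrow> lincomb M u v n = lincomb M u' v' n"
  by (induction n) auto

context module
begin

lemma lincomb_in_submodule:
  "submodule K R M \<Longrightarrow> (\<And>i. i < n \<Longrightarrow> v i \<odot>\<^bsub>M\<^esub> u i \<in> K) \<Longrightarrow> lincomb M u v n \<in> K"
  by (induction n) (auto simp: submodule_zero submoduleE(4,5))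

lemma lincomb_closed:
  "(\<And>i. i < n \<Longrightarrow> u i \<in> carrier M) \<Longrightarrow> (\<And>i. i < n \<Longrightarrow> v i \<in> carrier R) \<Longrightarrow> lincomb M u v n \<in> carrier M"
  by (induction n) auto

lemma lincomb_add:
  "(\<And>i. i < n \<Longrightarrow> u i \<in> carrier M) \<Longrightarrow> (\<And>i. i < n \<Longrightarrow> v i \<in> carrier R) \<Longrightarrow> (\<And>i. i < n \<Longrightarrow> w i \<in> carrier R)
    \<Longrightarrow> lincomb M u (\<lambda>i. v i \<oplus>\<^bsub>R\<^esub> w i) n = lincomb M u v n \<oplus>\<^bsub>M\<^esub> lincomb M u w n"
  by (induction n) (simp_all add: smult_l_distr lincomb_closed M.a_ac)

lemma lincomb_smult:
  "(\<And>i. i < n \<Longrightarrow> u i \<in> carrier M) \<Longrightarrow> (\<And>i. i < n \<Longrightarrow> v i \<in> carrier R) \<Longrightarrow> a \<in> carrier R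
    \<Longrightarrow> lincomb M u (\<lambda>i. a \<otimes>\<^bsub>R\<^esub> v i) n = a \<odot>\<^bsub>M\<^esub> lincomb M u v n"
  by (induction n) (simp_all add: smult_r_distr lincomb_closed smult_assoc1)

lemma lincomb_map:
  assumes u: "\<And>i. i < n \<Longrightarrow> u i \<in> carrier M"
  shows "module_map R (free_module R n) M (\<lambda>v. lincomb M u v n)"
proof -
  have "(\<lambda>v. lincomb M u v n) \<in> module_homs R (free_module R n) M"
    unfolding module_homs_def
  proof (intro CollectI conjI ballI)
    show "(\<lambda>v. lincomb M u v n) \<in> carrier (free_module R n) \<rightarrow> carrier M"
      using u by (auto intro!: lincomb_closed)
    fix v w assume v: "v \<in> carrier (free_module R n)" and w: "w \<in> carrier (free_module R n)"
    have "lincomb M u (v \<oplus>\<^bsub>free_module R n\<^esub> w) n = lincomb M u (\<lambda>i. v i \<oplus>\<^bsub>R\<^esub> w i) n"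
      by (rule lincomb_cong) auto
    thus "lincomb M u (v \<oplus>\<^bsub>free_module R n\<^esub> w) n = lincomb M u v n \<oplus>\<^bsub>M\<^esub> lincomb M u w n"
      using lincomb_add[of n u v w] u v w by (auto simp: PiE_iff)
  next
    fix a v assume a: "a \<in> carrier R" and v: "v \<in> carrier (free_module R n)"
    have "lincomb M u (a \<odot>\<^bsub>free_module R n\<^esub> v) n = lincomb M u (\<lambda>i. a \<otimes>\<^bsub>R\<^esub> v i) n"
      by (rule lincomb_cong) auto
    thus "lincomb M u (a \<odot>\<^bsub>free_module R n\<^esub> v) n = a \<odot>\<^bsub>M\<^esub> lincomb M u v n"
      using lincomb_smult[of n u v a] u v a by (auto simp: PiE_iff)
  qed
  thus ?thesis
    by (intro module_map.intro module_axioms module_map_axioms.intro R.module_free)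
qed

definition cyclic :: "'c \<Rightarrow> 'c set" where
  "cyclic v = (\<lambda>a. a \<odot>\<^bsub>M\<^esub> v) ` carrier R"

lemma cyclic_map: 
  assumes v: "v \<in> carrier M"
  shows "module_map R (self_module R) M (\<lambda>a. a \<odot>\<^bsub>M\<^esub> v)"
proof -
  have "(\<lambda>a. a \<odot>\<^bsub>M\<^esub> v) \<in> module_homs R (self_module R) M"
    using v by (auto simp: module_homs_def smult_l_distr smult_assoc1)
  thus ?thesis
    by (intro module_map.intro module_axioms module_map_axioms.intro R.module_self)
qed

lemma submodule_cyclic:
  assumes v: "v \<in> carrier M"
  shows "submodule (cyclic v) R M"
proof -
  interpret S: module R "self_module R" by (rule R.module_self)
  show ?thesis
    using module_map.submodule_image[OF cyclic_map[OF v] S.carrier_is_submodule]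
    by (simp add: cyclic_def)
qed

lemma cyclic_self: "v \<in> carrier M \<Longrightarrow> v \<in> cyclic v"
  unfolding cyclic_def by (rule image_eqI[of _ _ "\<one>"]) auto

lemma cyclic_subset: "submodule K R M \<Longrightarrow> v \<in> K \<Longrightarrow> cyclic v \<subseteq> K"
  by (auto simp: cyclic_def submoduleE(4))

lemma submodule_lin_span:
  assumes u: "\<And>i. i < n \<Longrightarrow> u i \<in> carrier M"
  shows "submodule (lin_span R M u n) R M"
proof -
  interpret F: module R "free_module R n" by (rule R.module_free)
  show ?thesis unfolding lin_span_def
    by (rule module_map.submodule_image[OF lincomb_map[OF u] F.carrier_is_submodule])
qed

lemma lin_span_0: "lin_span R M u 0 = {\<zero>\<^bsub>M\<^esub>}"
  by (simp add: lin_span_def)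

lemma lin_span_Suc: "lin_span R M u (Suc n) = lin_span R M u n <+>\<^bsub>M\<^esub> cyclic (u n)"
proof (intro equalityI subsetI)
  fix w assume "w \<in> lin_span R M u (Suc n)"
  then obtain v where v: "v \<in> comp_set (carrier R) (Suc n)" "w = lincomb M u v (Suc n)"
    by (auto simp: lin_span_def)
  have "lincomb M u v n = lincomb M u (restrict v {..<n}) n" by (rule lincomb_cong) auto
  moreover have "restrict v {..<n} \<in> comp_set (carrier R) n" using v by (auto simp: PiE_iff)
  ultimately have "lincomb M u v n \<in> lin_span R M u n" by (auto simp: lin_span_def)
  moreover have "v n \<odot>\<^bsub>M\<^esub> u n \<in> cyclic (u n)" using v by (auto simp: cyclic_def PiE_iff)
  ultimately show "w \<in> lin_span R M u n <+>\<^bsub>M\<^esub> cyclic (u n)"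
    using v(2) by (auto simp: set_add_iff)
next
  fix w assume "w \<in> lin_span R M u n <+>\<^bsub>M\<^esub> cyclic (u n)"
  then obtain v a where va: "v \<in> comp_set (carrier R) n" "a \<in> carrier R"
    "w = lincomb M u v n \<oplus>\<^bsub>M\<^esub> a \<odot>\<^bsub>M\<^esub> u n"
    by (auto simp: lin_span_def cyclic_def set_add_iff)
  have "v(n := a) \<in> comp_set (carrier R) (Suc n)"
    using va by (auto simp: PiE_iff extensional_def)
  moreover have "lincomb M u (v(n := a)) n = lincomb M u v n" by (rule lincomb_cong) auto
  hence "w = lincomb M u (v(n := a)) (Suc n)" using va by simp
  ultimately show "w \<in> lin_span R M u (Suc n)"
    unfolding lin_span_def free_module_simps by (rule_tac image_eqI)
qed

lemma set_add_assoc: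
  assumes "A \<subseteq> carrier M" "B \<subseteq> carrier M" "C \<subseteq> carrier M"
  shows "(A <+>\<^bsub>M\<^esub> B) <+>\<^bsub>M\<^esub> C = A <+>\<^bsub>M\<^esub> (B <+>\<^bsub>M\<^esub> C)"
proof -
  have as: "a \<oplus>\<^bsub>M\<^esub> b \<oplus>\<^bsub>M\<^esub> c = a \<oplus>\<^bsub>M\<^esub> (b \<oplus>\<^bsub>M\<^esub> c)" if "a \<in> A" "b \<in> B" "c \<in> C" for a b c
    using assms that by (intro M.a_assoc) auto
  show ?thesis
  proof (intro equalityI subsetI)
    fix w assume "w \<in> (A <+>\<^bsub>M\<^esub> B) <+>\<^bsub>M\<^esub> C"
    then obtain a b c where "a \<in> A" "b \<in> B" "c \<in> C" "w = a \<oplus>\<^bsub>M\<^esub> b \<oplus>\<^bsub>M\<^esub> c"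
      unfolding set_add_def' by blast
    thus "w \<in> A <+>\<^bsub>M\<^esub> (B <+>\<^bsub>M\<^esub> C)" unfolding set_add_def' using as by blast
  next
    fix w assume "w \<in> A <+>\<^bsub>M\<^esub> (B <+>\<^bsub>M\<^esub> C)"
    then obtain a b c where "a \<in> A" "b \<in> B" "c \<in> C" "w = a \<oplus>\<^bsub>M\<^esub> (b \<oplus>\<^bsub>M\<^esub> c)"
      unfolding set_add_def' by blast
    hence "a \<oplus>\<^bsub>M\<^esub> b \<in> A <+>\<^bsub>M\<^esub> B" "c \<in> C" "w = (a \<oplus>\<^bsub>M\<^esub> b) \<oplus>\<^bsub>M\<^esub> c"
      using as[of a b c] by (auto simp: set_add_iff)
    thus "w \<in> (A <+>\<^bsub>M\<^esub> B) <+>\<^bsub>M\<^esub> C" unfolding set_add_iff[of w] by blast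
  qed
qed

lemma set_add_comm:
  assumes "A \<subseteq> carrier M" "B \<subseteq> carrier M"
  shows "A <+>\<^bsub>M\<^esub> B = B <+>\<^bsub>M\<^esub> A"
proof -
  have "a \<oplus>\<^bsub>M\<^esub> b = b \<oplus>\<^bsub>M\<^esub> a" if "a \<in> A" "b \<in> B" for a b
    using assms that by (intro M.a_comm) auto
  thus ?thesis unfolding set_eq_iff set_add_iff by metis
qed

end

lemma (in cring) module_map_free_eq_lincomb:
  assumes "module_map R (free_module R n) M \<phi>" and v: "v \<in> carrier (free_module R n)"
  shows "\<phi> v = lincomb M (\<lambda>j. \<phi> (\<lambda>i\<in>{..<n}. if i = j then \<one> else \<zero>)) v n"
proof -
  interpret module_map R "free_module R n" M \<phi> by fact
  let ?e = "\<lambda>j. \<lambda>i\<in>{..<n}. if i = j then \<one> else \<zero>"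
  \<comment> \<open>Truncation to the first \<open>j\<close> coordinates makes the expansion in unit
    vectors an induction on \<open>j\<close>.\<close>
  let ?t = "\<lambda>j. \<lambda>i\<in>{..<n}. if i < j then v i else \<zero>"
  have "\<phi> (?t j) = lincomb M (\<lambda>j. \<phi> (?e j)) v j" if "j \<le> n" for j
    using that
  proof (induction j)
    case 0
    have "?t 0 = \<zero>\<^bsub>free_module R n\<^esub>" by simp
    thus ?case by (simp only: map_zero lincomb.simps)
  next
    case (Suc j)
    have c: "?t j \<in> carrier (free_module R n)" "?e j \<in> carrier (free_module R n)" "v j \<in> carrier R"
      using v Suc.prems by (auto simp: PiE_iff)
    have "?t (Suc j) = ?t j \<oplus>\<^bsub>free_module R n\<^esub> (v j \<odot>\<^bsub>free_module R n\<^esub> ?e j)"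
      using v Suc.prems by (auto simp: fun_eq_iff PiE_iff less_Suc_eq)
    hence "\<phi> (?t (Suc j)) = \<phi> (?t j) \<oplus>\<^bsub>M\<^esub> v j \<odot>\<^bsub>M\<^esub> \<phi> (?e j)"
      using c by (simp only: map_add map_smult M.smult_closed)
    also have "\<phi> (?t j) = lincomb M (\<lambda>j. \<phi> (?e j)) v j" using Suc by (simp only: Suc_leD)
    finally show ?case by (simp only: lincomb.simps)
  qed
  from this[of n] have "\<phi> (?t n) = lincomb M (\<lambda>j. \<phi> (?e j)) v n" by simp
  moreover have "?t n = v" using v by (auto simp: fun_eq_iff PiE_iff extensional_def)
  ultimately show ?thesis by simp
qed

section \<open>Noetherian local rings whose maximal ideal has two generators\<close>

definition acc_module :: "('a, 'b) ring_scheme \<Rightarrow> ('a, 'm, 'c) module_scheme \<Rightarrow> bool" where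
  "acc_module R M \<longleftrightarrow>
     (\<forall>J. (\<forall>i::nat. submodule (J i) R M) \<and> (\<forall>i. J i \<subseteq> J (Suc i)) \<longrightarrow> (\<exists>n. \<forall>i\<ge>n. J i = J n))"

lemma acc_moduleD:
  fixes J :: "nat \<Rightarrow> 'm set"
  assumes "acc_module R M" "\<And>i. submodule (J i) R M" "\<And>i. J i \<subseteq> J (Suc i)"
  shows "\<exists>n. \<forall>i\<ge>n. J i = J n"
  using assms unfolding acc_module_def by simp

text \<open>Without a maximal member, iterating a choice of larger members would give a strictly
  ascending chain. This replaces Zorn's lemma below.\<close>

lemma acc_module_maximal:
  assumes acc: "acc_module R M" and S: "K \<in> S" "\<And>K. K \<in> S \<Longrightarrow> submodule K R M"
  shows "\<exists>K\<in>S. \<forall>L\<in>S. K \<subseteq> L \<longrightarrow> L = K"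
proof (rule ccontr)
  assume "\<not> ?thesis"
  hence "\<forall>K\<in>S. \<exists>L. L \<in> S \<and> K \<subset> L" by blast
  then obtain g where g: "\<And>K. K \<in> S \<Longrightarrow> g K \<in> S" "\<And>K. K \<in> S \<Longrightarrow> K \<subset> g K" by metis
  define J where "J n = (g ^^ n) K" for n
  have JS: "J n \<in> S" for n by (induction n) (simp_all add: J_def S(1) g(1))
  have Jlt: "J n \<subset> J (Suc n)" for n using g(2)[OF JS[of n]] by (simp add: J_def)
  obtain n where n: "\<forall>i\<ge>n. J i = J n"
    using acc_moduleD[of R M J, OF acc S(2)[OF JS] psubset_imp_subset[OF Jlt]] by blast
  from n[rule_format, of "Suc n"] Jlt[of n] show False by simp
qed

lemma (in cring) acc_module_self:
  assumes "noetherian_ring R"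
  shows "acc_module R (self_module R)"
  unfolding acc_module_def
proof (intro allI impI, elim conjE)
  interpret N: noetherian_ring R by fact
  fix J :: "nat \<Rightarrow> 'a set"
  assume J: "\<forall>i. submodule (J i) R (self_module R)" "\<forall>i. J i \<subseteq> J (Suc i)"
  have mono: "J i \<subseteq> J j" if "i \<le> j" for i j
    by (rule lift_Suc_mono_le[of J, OF _ that]) (use J(2) in blast)
  have "subset.chain {I. ideal I R} (range J)"
    unfolding subset_chain_def
  proof (intro conjI ballI)
    show "range J \<subseteq> {I. ideal I R}" using J(1) submodule_self_iff by auto
    fix A B assume "A \<in> range J" "B \<in> range J"
    then obtain i j where "A = J i" "B = J j" by blast
    thus "A \<subseteq> B \<or> B \<subseteq> A" using mono[of i j] mono[of j i] linear[of i j] by blast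
  qed
  hence "\<Union>(range J) \<in> range J" by (intro N.ideal_chain_is_trivial) auto
  then obtain n where n: "\<Union>(range J) = J n" by blast
  have "J i = J n" if "i \<ge> n" for i
    using mono[OF that] n by blast
  thus "\<exists>n. \<forall>i\<ge>n. J i = J n" by blast
qed

text \<open>A leading-term argument: the elements of \<open>J i\<close> whose coordinates after
  \<open>c\<close> vanish have \<open>c\<close>-th coordinates forming an ideal. Once these ideals
  are stationary for all \<open>c\<close>, an element of \<open>J i\<close> is reduced into
  \<open>J p\<close> coordinate by coordinate.\<close>

lemma (in cring) acc_module_free:
  assumes noeth: "noetherian_ring R"
  shows "acc_module R (free_module R n)"
  unfolding acc_module_def
proof (intro allI impI, elim conjE)
  interpret F: module R "free_module R n" by (rule module_free)
  fix J :: "nat \<Rightarrow> (nat \<Rightarrow> 'a) set"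
  assume sub: "\<forall>i. submodule (J i) R (free_module R n)" and inc: "\<forall>i. J i \<subseteq> J (Suc i)"
  have mono: "J i \<subseteq> J j" if "i \<le> j" for i j
    by (rule lift_Suc_mono_le[of J, OF _ that]) (use inc in blast)
  have J: "submodule (J i) R (free_module R n)" for i using sub by blast
  define A where "A c = {v \<in> carrier (free_module R n). \<forall>i<n. c \<le> i \<longrightarrow> v i = \<zero>}" for c
  have A: "submodule (A c) R (free_module R n)" for c
    by (rule F.submoduleI') (auto simp: A_def PiE_iff extensional_def)
  define I where "I c i = (\<lambda>v. v c) ` (J i \<inter> A (Suc c))" for c i
  have "\<exists>m. \<forall>i\<ge>m. I c i = I c m" if c: "c < n" for c
  proof -
    interpret P: module_map R "free_module R n" "self_module R" "\<lambda>v. v c" by (rule proj_map[OF c])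
    have "submodule (I c i) R (self_module R)" for i
      unfolding I_def by (rule P.submodule_image[OF F.submodule_Int[OF J A]])
    moreover have "I c i \<subseteq> I c (Suc i)" for i
      unfolding I_def using inc by blast
    ultimately show ?thesis using acc_module_self[OF noeth] unfolding acc_module_def by blast
  qed
  then obtain m where m: "\<And>c i. c < n \<Longrightarrow> i \<ge> m c \<Longrightarrow> I c i = I c (m c)" by metis
  \<comment> \<open>The set \<open>{0}\<close> keeps the maximum defined when
    \<open>n = 0\<close>.\<close>
  define p where "p = Max (m ` {..<n} \<union> {0})"
  have mp: "m c \<le> p" if "c < n" for c using that by (auto simp: p_def intro!: Max_ge)
  have "J i \<inter> A c \<subseteq> J p" if i: "i \<ge> p" and "c \<le> n" for i c
    using that(2)
  proof (induction c)
    case 0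
    have "A 0 \<subseteq> {\<zero>\<^bsub>free_module R n\<^esub>}"
      by (auto simp: A_def PiE_iff fun_eq_iff extensional_def)
    thus ?case using F.submodule_zero[OF J] by blast
  next
    case (Suc c)
    hence c: "c < n" by simp
    show ?case
    proof
      fix v assume v: "v \<in> J i \<inter> A (Suc c)"
      hence "v c \<in> I c i" by (auto simp: I_def)
      also have "I c i = I c p" using m[OF c, of i] m[OF c, of p] mp[OF c] i by simp
      finally obtain w where w: "w \<in> J p" "w \<in> A (Suc c)" "w c = v c" by (auto simp: I_def)
      have vc: "v \<in> carrier (free_module R n)" "w \<in> carrier (free_module R n)"
        using v w by (auto simp: A_def)
      let ?d = "v \<ominus>\<^bsub>free_module R n\<^esub> w"
      have "v = ?d \<oplus>\<^bsub>free_module R n\<^esub> w" using vc by (simp add: a_minus_def F.a_assoc F.M.l_neg del: free_module_simps)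
      have d: "?d \<in> J i" "?d \<in> A (Suc c)"
        using F.submodule_minus[OF J] F.submodule_minus[OF A] v w mono[OF i] by blast+
      have vd: "v j = ?d j \<oplus> w j" if "j < n" for j
        using arg_cong[OF \<open>v = ?d \<oplus>\<^bsub>free_module R n\<^esub> w\<close>, of "\<lambda>f. f j"] that by simp
      have dc: "?d \<in> carrier (free_module R n)" using d by (auto simp: A_def)
      have "?d c = \<zero>"
        using vd[OF c] w(3) c vc dc by (auto simp: PiE_iff intro: add.r_cancel_one'[THEN iffD1])
      hence "?d j = \<zero>" if "j < n" "c \<le> j" for j
        using that d(2) by (cases "j = c") (auto simp: A_def)
      hence "?d \<in> A c" using dc by (auto simp: A_def)
      hence "?d \<in> J p" using Suc d by auto
      thus "v \<in> J p" using F.submoduleE(5)[OF J _ w(1)] \<open>v = ?d \<oplus>\<^bsub>free_module R n\<^esub> w\<close> by metis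
    qed
  qed
  from this[of _ n] have "J i \<inter> A n \<subseteq> J p" if "i \<ge> p" for i using that by blast
  moreover have "J i \<subseteq> A n" for i using F.submoduleE(1)[OF J[of i]] by (auto simp: A_def)
  ultimately have "J i = J p" if "i \<ge> p" for i using that mono[OF that] by blast
  thus "\<exists>n. \<forall>i\<ge>n. J i = J n" by blast
qed

definition two_gen :: "('a, 'b) ring_scheme \<Rightarrow> 'a \<Rightarrow> 'a \<Rightarrow> 'a set" where
  "two_gen R x y = {x \<otimes>\<^bsub>R\<^esub> a \<oplus>\<^bsub>R\<^esub> y \<otimes>\<^bsub>R\<^esub> b | a b. a \<in> carrier R \<and> b \<in> carrier R}"

lemma (in cring) ideal_two_gen:
  assumes x: "x \<in> carrier R" and y: "y \<in> carrier R"
  shows "ideal (two_gen R x y) R"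
proof -
  interpret S: module R "self_module R" by (rule module_self)
  have "submodule ((\<lambda>v. x \<otimes> v) ` carrier R <+> (\<lambda>v. y \<otimes> v) ` carrier R) R (self_module R)"
    using S.submodule_set_add[OF S.submodule_smult[OF x S.carrier_is_submodule] S.submodule_smult[OF y S.carrier_is_submodule]]
    by simp
  moreover have "(\<lambda>v. x \<otimes> v) ` carrier R <+> (\<lambda>v. y \<otimes> v) ` carrier R = two_gen R x y"
    unfolding two_gen_def set_add_def' by blast
  ultimately show ?thesis by (simp add: submodule_self_iff)
qed

text \<open>Locality is expressed by invertibility of everything outside \<open>(x, y)\<close>; with
  \<open>one_notin\<close> this makes \<open>(x, y)\<close> the only maximal ideal.\<close>

locale two_gen_local = R?: cring R for R (structure) and x y +
  assumes noetherian: "noetherian_ring R"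
    and x_carr [simp, intro]: "x \<in> carrier R" and y_carr [simp, intro]: "y \<in> carrier R"
    and one_notin: "\<one> \<notin> two_gen R x y"
    and unit: "a \<in> carrier R \<Longrightarrow> a \<notin> two_gen R x y \<Longrightarrow> a \<in> Units R"
begin

abbreviation "\<mm> \<equiv> two_gen R x y"

lemma ideal_mm: "ideal \<mm> R"
  by (rule ideal_two_gen[OF x_carr y_carr])

lemma mm_carr: "a \<in> \<mm> \<Longrightarrow> a \<in> carrier R"
  using ideal.Icarr[OF ideal_mm] by blast

lemma mm_zero: "\<zero> \<in> \<mm>"
  and mm_add: "a \<in> \<mm> \<Longrightarrow> b \<in> \<mm> \<Longrightarrow> a \<oplus> b \<in> \<mm>"
  and mm_mult: "a \<in> carrier R \<Longrightarrow> b \<in> \<mm> \<Longrightarrow> a \<otimes> b \<in> \<mm>"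
  using additive_subgroup.zero_closed[OF ideal.axioms(1)[OF ideal_mm]]
    additive_subgroup.a_closed[OF ideal.axioms(1)[OF ideal_mm]] ideal.I_l_closed[OF ideal_mm] by auto

lemma mm_mult': "a \<in> \<mm> \<Longrightarrow> b \<in> carrier R \<Longrightarrow> a \<otimes> b \<in> \<mm>"
  using ideal.I_r_closed[OF ideal_mm] by blast

lemma x_mm [simp]: "x \<in> \<mm>" and y_mm [simp]: "y \<in> \<mm>"
proof -
  have "x = x \<otimes> \<one> \<oplus> y \<otimes> \<zero>" "y = x \<otimes> \<zero> \<oplus> y \<otimes> \<one>" by simp_all
  thus "x \<in> \<mm>" "y \<in> \<mm>" unfolding two_gen_def by blast+
qed

lemma one_minus_unit:
  assumes a: "a \<in> \<mm>"
  shows "\<one> \<ominus> a \<in> Units R"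
proof (rule unit)
  have ac: "a \<in> carrier R" using a mm_carr by blast
  thus "\<one> \<ominus> a \<in> carrier R" by simp
  show "\<one> \<ominus> a \<notin> \<mm>"
  proof
    assume "\<one> \<ominus> a \<in> \<mm>"
    hence "(\<one> \<ominus> a) \<oplus> a \<in> \<mm>" using a mm_add by blast
    moreover have "(\<one> \<ominus> a) \<oplus> a = \<one>" using ac by (simp add: a_minus_def a_assoc l_neg)
    ultimately show False using one_notin by simp
  qed
qed

lemma proper_ideal_le_mm:
  assumes I: "ideal I R" "\<one> \<notin> I"
  shows "I \<subseteq> \<mm>"
proof
  fix a assume a: "a \<in> I"
  show "a \<in> \<mm>"
  proof (rule ccontr)
    assume "a \<notin> \<mm>"
    hence u: "a \<in> Units R" using unit ideal.Icarr[OF I(1) a] by blast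
    have "inv a \<otimes> a \<in> I" using ideal.I_l_closed[OF I(1) a] u by blast
    thus False using I(2) u by simp
  qed
qed

lemma mlen_mm: "mlen R (self_module R) \<mm> (carrier R) = 1"
proof -
  interpret S: module R "self_module R" by (rule module_self)
  have sm: "submodule \<mm> R (self_module R)" using ideal_mm by (simp add: submodule_self_iff)
  have mc: "\<mm> \<subseteq> carrier R" using mm_carr by blast
  have max: "J = \<mm> \<or> J = carrier R" if J: "submodule J R (self_module R)" "\<mm> \<subseteq> J" for J
  proof (cases "\<one> \<in> J")
    case True
    hence "J = carrier R" using ideal.one_imp_carrier J(1) submodule_self_iff by blast
    thus ?thesis ..
  next
    case False
    thus ?thesis using proper_ideal_le_mm J submodule_self_iff by blast
  qed
  have "submodule_chain R (self_module R) \<mm> (carrier R) n \<longleftrightarrow> n \<le> 1" for n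
  proof
    assume "submodule_chain R (self_module R) \<mm> (carrier R) n"
    then obtain J where J: "\<forall>i\<le>n. submodule (J i) R (self_module R) \<and> \<mm> \<subseteq> J i \<and> J i \<subseteq> carrier R"
      "\<forall>i<n. J i \<subset> J (Suc i)"
      unfolding submodule_chain_def by (elim exE conjE) rule
    show "n \<le> 1"
    proof (rule ccontr)
      assume n: "\<not> n \<le> 1"
      hence "J 0 \<subset> J 1" "J 1 \<subset> J 2" using J(2)[rule_format, of 0] J(2)[rule_format, of 1] by (auto simp: numeral_2_eq_2)
      moreover have "J 0 = \<mm> \<or> J 0 = carrier R" "J 1 = \<mm> \<or> J 1 = carrier R" "J 2 = \<mm> \<or> J 2 = carrier R"
        using J(1)[rule_format, of 0] J(1)[rule_format, of 1] J(1)[rule_format, of 2] n max by simp_all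
      ultimately show False using mc by blast
    qed
  next
    assume n: "n \<le> 1"
    have "\<mm> \<subset> carrier R" using mc one_notin by blast
    hence "submodule_chain R (self_module R) \<mm> (carrier R) (Suc 0)"
      using submodule_chain_step[OF submodule_chain_0[OF sm order_refl] _ sm] S.carrier_is_submodule by simp
    thus "submodule_chain R (self_module R) \<mm> (carrier R) n" using n submodule_chain_le by fastforce
  qed
  thus ?thesis
    by (intro enat_eqI) (simp add: enat_le_mlen[OF sm mc] one_enat_def)
qed

end

text \<open>For a submodule \<open>K\<close> this is the product of the ideal \<open>(x, y)\<close>
  with \<open>K\<close>.\<close>

definition two_gen_mult :: "('a, 'm, 'c) module_scheme \<Rightarrow> 'a \<Rightarrow> 'a \<Rightarrow> 'm set \<Rightarrow> 'm set" where
  "two_gen_mult M x y K = (\<lambda>v. x \<odot>\<^bsub>M\<^esub> v) ` K <+>\<^bsub>M\<^esub> (\<lambda>v. y \<odot>\<^bsub>M\<^esub> v) ` K"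

locale noeth_module = module R M + two_gen_local R x y
  for R (structure) and M (structure) and x y +
  assumes acc: "acc_module R M"
begin

abbreviation "xy_mult \<equiv> two_gen_mult M x y"

lemma submodule_xy_mult: "submodule K R M \<Longrightarrow> submodule (xy_mult K) R M"
  unfolding two_gen_mult_def by (intro submodule_set_add submodule_smult x_carr y_carr)

lemma xy_mult_subset: "submodule K R M \<Longrightarrow> xy_mult K \<subseteq> K"
  unfolding two_gen_mult_def by (intro set_add_subset smult_subset x_carr y_carr)

lemma x_in_xy_mult: "submodule K R M \<Longrightarrow> v \<in> K \<Longrightarrow> x \<odot>\<^bsub>M\<^esub> v \<in> xy_mult K"
  unfolding two_gen_mult_def
  using subset_set_add1[OF submodule_smult[OF x_carr] submodule_smult[OF y_carr], of K K] by blast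

lemma y_in_xy_mult: "submodule K R M \<Longrightarrow> v \<in> K \<Longrightarrow> y \<odot>\<^bsub>M\<^esub> v \<in> xy_mult K"
  unfolding two_gen_mult_def
  using subset_set_add2[OF submodule_smult[OF x_carr] submodule_smult[OF y_carr], of K K] by blast

lemma xy_mult_least:
  "submodule L R M \<Longrightarrow> (\<And>v. v \<in> K \<Longrightarrow> x \<odot>\<^bsub>M\<^esub> v \<in> L) \<Longrightarrow> (\<And>v. v \<in> K \<Longrightarrow> y \<odot>\<^bsub>M\<^esub> v \<in> L) \<Longrightarrow> xy_mult K \<subseteq> L"
  unfolding two_gen_mult_def by (intro set_add_subset) auto

lemma mm_smult_in:
  assumes L: "submodule L R M" and v: "v \<in> carrier M"
    and xy: "x \<odot>\<^bsub>M\<^esub> v \<in> L" "y \<odot>\<^bsub>M\<^esub> v \<in> L" and a: "a \<in> \<mm>"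
  shows "a \<odot>\<^bsub>M\<^esub> v \<in> L"
proof -
  obtain b c where bc: "b \<in> carrier R" "c \<in> carrier R" "a = x \<otimes> b \<oplus> y \<otimes> c"
    using a by (auto simp: two_gen_def)
  have "a \<odot>\<^bsub>M\<^esub> v = b \<odot>\<^bsub>M\<^esub> (x \<odot>\<^bsub>M\<^esub> v) \<oplus>\<^bsub>M\<^esub> c \<odot>\<^bsub>M\<^esub> (y \<odot>\<^bsub>M\<^esub> v)"
    using bc v by (simp add: smult_l_distr smult_assoc1[symmetric] R.m_comm)
  thus ?thesis using L xy bc by (simp add: submoduleE(4,5))
qed

lemma unit_smult_cancel:
  assumes L: "submodule L R M" and v: "v \<in> carrier M" and u: "u \<in> Units R" "u \<odot>\<^bsub>M\<^esub> v \<in> L"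
  shows "v \<in> L"
proof -
  have "inv u \<odot>\<^bsub>M\<^esub> (u \<odot>\<^bsub>M\<^esub> v) = v"
    using u v by (simp add: smult_assoc1[symmetric] R.Units_closed)
  thus ?thesis using submoduleE(4)[OF L, of "inv u" "u \<odot>\<^bsub>M\<^esub> v"] u by simp
qed

text \<open>The map sending \<open>a\<close> to \<open>a v\<close> identifies R/m with (K + Rv)/K:
  the maximal ideal goes into \<open>K\<close>, and a unit cannot, since \<open>v\<close> is
  outside.\<close>

lemma mlen_add_cyclic:
  assumes K: "submodule K R M" and v: "v \<in> carrier M" "v \<notin> K"
    and xy: "x \<odot>\<^bsub>M\<^esub> v \<in> K" "y \<odot>\<^bsub>M\<^esub> v \<in> K"
  shows "mlen R M K (K <+>\<^bsub>M\<^esub> cyclic v) = 1"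
proof -
  interpret S: module R "self_module R" by (rule module_self)
  interpret C: module_map R "self_module R" M "\<lambda>a. a \<odot>\<^bsub>M\<^esub> v" by (rule cyclic_map[OF v(1)])
  have sm: "submodule \<mm> R (self_module R)" "submodule (carrier R) R (self_module R)"
    using ideal_mm S.carrier_is_submodule by (simp_all add: submodule_self_iff)
  have ker: "a \<in> \<mm>" if "a \<in> carrier R" "a \<odot>\<^bsub>M\<^esub> v \<in> K" for a
    using unit_smult_cancel[OF K v(1) unit that(2)] that(1) v(2) by blast
  have "(\<lambda>a. a \<odot>\<^bsub>M\<^esub> v) ` \<mm> \<subseteq> K" using mm_smult_in[OF K v(1) xy] by blast
  hence e: "K <+>\<^bsub>M\<^esub> (\<lambda>a. a \<odot>\<^bsub>M\<^esub> v) ` \<mm> = K"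
    using set_add_subset[OF K order_refl] subset_set_add1[OF K C.submodule_image[OF sm(1)]] by blast
  show ?thesis
    using C.mlen_image[OF K sm _ ker] mlen_mm mm_carr unfolding e cyclic_def by auto
qed

text \<open>No determinants: choose \<open>H\<close> maximal among the proper submodules of
  \<open>L\<close> containing \<open>K\<close>, so that \<open>L = H + Rv\<close>. The generation
  hypothesis gives \<open>v = h + a v\<close> with \<open>h\<close> in \<open>H\<close> and
  \<open>a\<close> in m, and \<open>1 - a\<close> is a unit.\<close>

lemma nakayama:
  assumes K: "submodule K R M" and L: "submodule L R M" and KL: "K \<subseteq> L"
    and gen: "L \<subseteq> K <+>\<^bsub>M\<^esub> xy_mult L"
  shows "K = L"
proof (rule ccontr)
  assume "K \<noteq> L"
  let ?S = "{H. submodule H R M \<and> K \<subseteq> H \<and> H \<subset> L}"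
  have "K \<in> ?S" using K KL \<open>K \<noteq> L\<close> by blast
  moreover have "submodule H R M" if "H \<in> ?S" for H using that by simp
  ultimately have "\<exists>H\<in>?S. \<forall>L'\<in>?S. H \<subseteq> L' \<longrightarrow> L' = H"
    by (rule acc_module_maximal[OF acc])
  then obtain H where H: "H \<in> ?S" "\<forall>L'\<in>?S. H \<subseteq> L' \<longrightarrow> L' = H" ..
  have sH: "submodule H R M" using H(1) by blast
  obtain v where v: "v \<in> L" "v \<notin> H" using H(1) by blast
  have vc: "v \<in> carrier M" using v L submodule_carr by blast
  have sC: "submodule (H <+>\<^bsub>M\<^esub> cyclic v) R M" using submodule_set_add[OF sH submodule_cyclic[OF vc]] .
  have HC: "H \<subseteq> H <+>\<^bsub>M\<^esub> cyclic v" "v \<in> H <+>\<^bsub>M\<^esub> cyclic v"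
    using subset_set_add1[OF sH submodule_cyclic[OF vc]] subset_set_add2[OF sH submodule_cyclic[OF vc]]
      cyclic_self[OF vc] by auto
  have "H <+>\<^bsub>M\<^esub> cyclic v \<subseteq> L" using set_add_subset[OF L] H(1) cyclic_subset[OF L v(1)] by blast
  hence LC: "L = H <+>\<^bsub>M\<^esub> cyclic v" using H(2)[rule_format, of "H <+>\<^bsub>M\<^esub> cyclic v"] H(1) HC v(2) sC by blast
  have dec: "\<exists>h\<in>H. \<exists>r\<in>carrier R. w = h \<oplus>\<^bsub>M\<^esub> r \<odot>\<^bsub>M\<^esub> v" if "w \<in> L" for w
    using that unfolding LC by (auto simp: set_add_iff cyclic_def)
  obtain k w1 w2 where w: "k \<in> K" "w1 \<in> L" "w2 \<in> L" "v = k \<oplus>\<^bsub>M\<^esub> (x \<odot>\<^bsub>M\<^esub> w1 \<oplus>\<^bsub>M\<^esub> y \<odot>\<^bsub>M\<^esub> w2)"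
  proof -
    have "v \<in> K <+>\<^bsub>M\<^esub> xy_mult L" using gen v(1) by blast
    then obtain k q where kq: "k \<in> K" "q \<in> xy_mult L" "v = k \<oplus>\<^bsub>M\<^esub> q" by (auto simp: set_add_iff)
    from kq(2) obtain w1 w2 where "w1 \<in> L" "w2 \<in> L" "q = x \<odot>\<^bsub>M\<^esub> w1 \<oplus>\<^bsub>M\<^esub> y \<odot>\<^bsub>M\<^esub> w2"
      unfolding two_gen_mult_def set_add_iff by blast
    thus ?thesis using that kq by blast
  qed
  obtain h1 r1 where h1: "h1 \<in> H" "r1 \<in> carrier R" "w1 = h1 \<oplus>\<^bsub>M\<^esub> r1 \<odot>\<^bsub>M\<^esub> v" using dec[OF w(2)] by blast
  obtain h2 r2 where h2: "h2 \<in> H" "r2 \<in> carrier R" "w2 = h2 \<oplus>\<^bsub>M\<^esub> r2 \<odot>\<^bsub>M\<^esub> v" using dec[OF w(3)] by blast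
  let ?a = "x \<otimes> r1 \<oplus> y \<otimes> r2"
  have a: "?a \<in> \<mm>" using h1 h2 by (auto simp: two_gen_def)
  let ?h = "k \<oplus>\<^bsub>M\<^esub> (x \<odot>\<^bsub>M\<^esub> h1 \<oplus>\<^bsub>M\<^esub> y \<odot>\<^bsub>M\<^esub> h2)"
  have hH: "?h \<in> H" using w(1) h1 h2 H(1) by (intro submoduleE(5)[OF sH] submoduleE(4)[OF sH]) auto
  have c: "k \<in> carrier M" "h1 \<in> carrier M" "h2 \<in> carrier M" "?h \<in> carrier M"
    using hH w(1) h1 h2 sH K submodule_carr by blast+
  have "v = ?h \<oplus>\<^bsub>M\<^esub> ?a \<odot>\<^bsub>M\<^esub> v"
    using w(4) h1(2) h2(2) c vc unfolding h1(3) h2(3)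
    by (simp add: smult_r_distr smult_l_distr smult_assoc1 M.a_ac)
  moreover have "(\<one> \<ominus> b) \<odot>\<^bsub>M\<^esub> v \<oplus>\<^bsub>M\<^esub> b \<odot>\<^bsub>M\<^esub> v = v" if "b \<in> carrier R" for b
    using smult_l_distr[of "\<one> \<ominus> b" b v, symmetric] that vc
    by (simp add: R.minus_eq R.a_assoc R.l_neg)
  note this[OF mm_carr[OF a]]
  ultimately have "(\<one> \<ominus> ?a) \<odot>\<^bsub>M\<^esub> v = ?h"
    using M.add.r_cancel[of "(\<one> \<ominus> ?a) \<odot>\<^bsub>M\<^esub> v" "?a \<odot>\<^bsub>M\<^esub> v" ?h] mm_carr[OF a] vc c(4) by simp
  hence "v \<in> H" using unit_smult_cancel[OF sH vc one_minus_unit[OF a]] hH by simp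
  thus False using v(2) by blast
qed

text \<open>Because m \<open>L\<close> lies in \<open>K\<close>, adjoining one element of
  \<open>L\<close> outside \<open>K\<close> lowers the length of L/K by exactly one; hence this
  length counts generators.\<close>

lemma lin_span_generators:
  assumes L: "submodule L R M"
  shows "submodule K R M \<Longrightarrow> K \<subseteq> L \<Longrightarrow> xy_mult L \<subseteq> K \<Longrightarrow> mlen R M K L = enat s \<Longrightarrow>
    \<exists>u. (\<forall>i<s. u i \<in> L) \<and> L = K <+>\<^bsub>M\<^esub> lin_span R M u s"
proof (induction s arbitrary: K)
  case 0
  hence "K = L" using mlen_zero_iff[OF _ L] by (simp add: zero_enat_def)
  moreover have "K <+>\<^bsub>M\<^esub> {\<zero>\<^bsub>M\<^esub>} = K"
    using submodule_carr[OF 0(1)] by (auto simp: set_add_iff intro!: bexI)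
  ultimately show ?case by (auto simp: lin_span_0)
next
  case (Suc s)
  note K = Suc.prems(1)
  have "mlen R M K L \<noteq> 0" using Suc.prems(4) by (simp add: zero_enat_def)
  hence "K \<noteq> L" using mlen_self[OF K] by auto
  then obtain v where v: "v \<in> L" "v \<notin> K" using Suc.prems(2) by blast
  have vc: "v \<in> carrier M" using v L submodule_carr by blast
  let ?K = "K <+>\<^bsub>M\<^esub> cyclic v"
  have sK: "submodule ?K R M" using submodule_set_add[OF K submodule_cyclic[OF vc]] .
  have KL: "?K \<subseteq> L" using set_add_subset[OF L Suc.prems(2) cyclic_subset[OF L v(1)]] .
  have KK: "K \<subseteq> ?K" using subset_set_add1[OF K submodule_cyclic[OF vc]] .
  have "mlen R M K ?K = 1"
    by (rule mlen_add_cyclic[OF K vc v(2)])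
      (use Suc.prems(3) x_in_xy_mult[OF L v(1)] y_in_xy_mult[OF L v(1)] in blast)+
  hence "mlen R M ?K L = enat s"
    using mlen_add[OF K sK L KK KL] Suc.prems(4)
    by (cases "mlen R M ?K L") (auto simp: one_enat_def)
  from Suc.IH[OF sK KL _ this] KK Suc.prems(3)
  obtain u where u: "\<forall>i<s. u i \<in> L" "L = ?K <+>\<^bsub>M\<^esub> lin_span R M u s" by blast
  let ?u = "u(s := v)"
  have e: "lin_span R M ?u s = lin_span R M u s"
    unfolding lin_span_def by (intro image_cong refl lincomb_cong) auto
  have uc: "\<And>i. i < s \<Longrightarrow> u i \<in> carrier M" using u(1) L submodule_carr by blast
  have sub: "lin_span R M u s \<subseteq> carrier M" "cyclic v \<subseteq> carrier M" "K \<subseteq> carrier M"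
    using submoduleE(1)[OF submodule_lin_span[of s u]] uc submoduleE(1)[OF submodule_cyclic[OF vc]] submoduleE(1)[OF K]
    by auto
  have "L = K <+>\<^bsub>M\<^esub> (lin_span R M u s <+>\<^bsub>M\<^esub> cyclic v)"
    unfolding u(2) set_add_assoc[OF sub(3,2,1)] set_add_comm[OF sub(1,2)] ..
  hence "L = K <+>\<^bsub>M\<^esub> lin_span R M ?u (Suc s)" by (simp add: lin_span_Suc e)
  moreover have "\<forall>i<Suc s. ?u i \<in> L" using u(1) v(1) by auto
  ultimately show ?case by blast
qed

text \<open>Take \<open>K\<close> maximal among the submodules between m \<open>L\<close> and
  \<open>L\<close> with L/K of infinite length. Adjoining one more element costs length one, so the
  larger submodule would still have infinite colength.\<close>

lemma mlen_xy_mult_finite: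
  assumes L: "submodule L R M"
  shows "mlen R M (xy_mult L) L \<noteq> \<infinity>"
proof
  assume inf: "mlen R M (xy_mult L) L = \<infinity>"
  let ?S = "{K. submodule K R M \<and> xy_mult L \<subseteq> K \<and> K \<subseteq> L \<and> mlen R M K L = \<infinity>}"
  have "xy_mult L \<in> ?S" using inf submodule_xy_mult[OF L] xy_mult_subset[OF L] by blast
  moreover have "submodule K R M" if "K \<in> ?S" for K using that by simp
  ultimately have "\<exists>K\<in>?S. \<forall>L'\<in>?S. K \<subseteq> L' \<longrightarrow> L' = K"
    by (rule acc_module_maximal[OF acc])
  then obtain K where K: "K \<in> ?S" "\<forall>L'\<in>?S. K \<subseteq> L' \<longrightarrow> L' = K" ..
  have sK: "submodule K R M" using K by blast
  have "K \<noteq> L" using K(1) mlen_self[OF sK] by auto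
  then obtain v where v: "v \<in> L" "v \<notin> K" using K(1) by blast
  have vc: "v \<in> carrier M" using v L submodule_carr by blast
  let ?K = "K <+>\<^bsub>M\<^esub> cyclic v"
  have sK': "submodule ?K R M" using submodule_set_add[OF sK submodule_cyclic[OF vc]] .
  have KL: "?K \<subseteq> L" using set_add_subset[OF L _ cyclic_subset[OF L v(1)]] K(1) by blast
  have KK: "K \<subseteq> ?K" "v \<in> ?K"
    using subset_set_add1[OF sK submodule_cyclic[OF vc]] subset_set_add2[OF sK submodule_cyclic[OF vc]]
      cyclic_self[OF vc] by auto
  have "mlen R M K ?K = 1"
    by (rule mlen_add_cyclic[OF sK vc v(2)])
      (use K(1) x_in_xy_mult[OF L v(1)] y_in_xy_mult[OF L v(1)] in blast)+
  hence "mlen R M ?K L = \<infinity>"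
    using mlen_add[OF sK sK' L KK(1) KL] K(1) by (cases "mlen R M ?K L") (auto simp: one_enat_def)
  hence "?K = K" using K(2)[rule_format, of ?K] K(1) sK' KL KK by blast
  thus False using KK v by blast
qed

end

section \<open>Lengths modulo multiplication by an element\<close>

lemma set_addI: "a \<in> A \<Longrightarrow> b \<in> B \<Longrightarrow> a \<oplus>\<^bsub>M\<^esub> b \<in> A <+>\<^bsub>M\<^esub> B"
  unfolding set_add_iff by blast

lemma enat_add_cancel_comm: "a + c = c + b \<Longrightarrow> c \<noteq> \<infinity> \<Longrightarrow> a = (b::enat)"
  by (simp add: add.commute[of a])

context module
begin

lemma mlen_smult_image:
  assumes z: "z \<in> carrier R" and E: "submodule E R M" and A: "submodule A R M" and B: "submodule B R M"
    and AB: "A \<subseteq> B" and ker: "\<And>v. v \<in> B \<Longrightarrow> z \<odot>\<^bsub>M\<^esub> v \<in> E \<Longrightarrow> v \<in> A"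
  shows "mlen R M (E <+>\<^bsub>M\<^esub> (\<lambda>v. z \<odot>\<^bsub>M\<^esub> v) ` A) (E <+>\<^bsub>M\<^esub> (\<lambda>v. z \<odot>\<^bsub>M\<^esub> v) ` B) = mlen R M A B"
  by (rule module_map.mlen_image[OF smult_map[OF z] E A B AB ker])

text \<open>Regularity of \<open>z\<close> on F/E makes (E + zF)/(E + zK) a copy of F/K. Both ways
  from \<open>E + zK\<close> up to \<open>F\<close>, through \<open>K\<close> and through
  \<open>E + zF\<close>, contain this length, which is finite and cancels.\<close>

lemma mlen_mod_smult_finite:
  assumes z: "z \<in> carrier R" and E: "submodule E R M" and K: "submodule K R M" and F: "submodule F R M"
    and EK: "E \<subseteq> K" and KF: "K \<subseteq> F" and reg: "\<And>v. v \<in> F \<Longrightarrow> z \<odot>\<^bsub>M\<^esub> v \<in> E \<Longrightarrow> v \<in> E"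
    and fin: "mlen R M K F \<noteq> \<infinity>"
  shows "mlen R M (E <+>\<^bsub>M\<^esub> (\<lambda>v. z \<odot>\<^bsub>M\<^esub> v) ` K) K = mlen R M (E <+>\<^bsub>M\<^esub> (\<lambda>v. z \<odot>\<^bsub>M\<^esub> v) ` F) F"
proof -
  let ?z = "\<lambda>A. E <+>\<^bsub>M\<^esub> (\<lambda>v. z \<odot>\<^bsub>M\<^esub> v) ` A"
  have sub: "submodule (?z A) R M" if "submodule A R M" for A
    using submodule_set_add[OF E submodule_smult[OF z that]] .
  have KK: "?z K \<subseteq> K" using set_add_subset[OF K EK smult_subset[OF z K]] .
  have FF: "?z F \<subseteq> F" using set_add_subset[OF F _ smult_subset[OF z F]] EK KF by blast
  have KF': "?z K \<subseteq> ?z F" using KF by (intro set_add_mono) auto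
  have h1: "mlen R M (?z K) K + mlen R M K F = mlen R M (?z K) (?z F) + mlen R M (?z F) F"
    using mlen_add[OF sub[OF K] K F KK KF] mlen_add[OF sub[OF K] sub[OF F] F KF' FF] by simp
  have h2: "mlen R M (?z K) (?z F) = mlen R M K F"
    by (rule mlen_smult_image[OF z E K F KF]) (use reg EK in blast)
  show ?thesis by (rule enat_add_cancel_comm[OF h1[unfolded h2] fin])
qed

text \<open>As F/W has no \<open>z\<close>-torsion, the exact sequence of W/E, F/E and F/W stays
  exact modulo \<open>z\<close>; in terms of submodules, \<open>W\<close> meets
  \<open>E + zF\<close> only in \<open>E + zW\<close>.\<close>

lemma mlen_mod_smult_saturated:
  assumes z: "z \<in> carrier R" and E: "submodule E R M" and W: "submodule W R M" and F: "submodule F R M"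
    and EW: "E \<subseteq> W" and WF: "W \<subseteq> F" and Wsat: "\<And>v. v \<in> F \<Longrightarrow> z \<odot>\<^bsub>M\<^esub> v \<in> W \<Longrightarrow> v \<in> W"
  shows "mlen R M (E <+>\<^bsub>M\<^esub> (\<lambda>v. z \<odot>\<^bsub>M\<^esub> v) ` W) W + mlen R M (W <+>\<^bsub>M\<^esub> (\<lambda>v. z \<odot>\<^bsub>M\<^esub> v) ` F) F
    = mlen R M (E <+>\<^bsub>M\<^esub> (\<lambda>v. z \<odot>\<^bsub>M\<^esub> v) ` F) F"
proof -
  let ?z = "\<lambda>A. E <+>\<^bsub>M\<^esub> (\<lambda>v. z \<odot>\<^bsub>M\<^esub> v) ` A"
  have sub: "submodule (?z A) R M" if "submodule A R M" for A
    using submodule_set_add[OF E submodule_smult[OF z that]] .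
  have WzF: "submodule (W <+>\<^bsub>M\<^esub> (\<lambda>v. z \<odot>\<^bsub>M\<^esub> v) ` F) R M"
    using submodule_set_add[OF W submodule_smult[OF z F]] .
  have FF: "?z F \<subseteq> F" using set_add_subset[OF F _ smult_subset[OF z F]] EW WF by blast
  have WF': "W <+>\<^bsub>M\<^esub> (\<lambda>v. z \<odot>\<^bsub>M\<^esub> v) ` F \<subseteq> F" using set_add_subset[OF F WF smult_subset[OF z F]] .
  have zWW: "?z W \<subseteq> W" using set_add_subset[OF W EW smult_subset[OF z W]] .
  have "?z W \<subseteq> ?z F" by (intro set_add_mono order_refl image_mono WF)
  hence eq1: "?z F <+>\<^bsub>M\<^esub> ?z W = ?z F"
    using set_add_subset[OF sub[OF F] order_refl, of "?z W"] subset_set_add1[OF sub[OF F] sub[OF W]]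
    by blast
  have eq2: "?z F <+>\<^bsub>M\<^esub> W = W <+>\<^bsub>M\<^esub> (\<lambda>v. z \<odot>\<^bsub>M\<^esub> v) ` F"
  proof (rule equalityI)
    have "?z F \<subseteq> W <+>\<^bsub>M\<^esub> (\<lambda>v. z \<odot>\<^bsub>M\<^esub> v) ` F" by (rule set_add_mono[OF EW order_refl])
    thus "?z F <+>\<^bsub>M\<^esub> W \<subseteq> W <+>\<^bsub>M\<^esub> (\<lambda>v. z \<odot>\<^bsub>M\<^esub> v) ` F"
      using set_add_subset[OF WzF] subset_set_add1[OF W submodule_smult[OF z F]] by blast
    have "(\<lambda>v. z \<odot>\<^bsub>M\<^esub> v) ` F \<subseteq> ?z F <+>\<^bsub>M\<^esub> W" "W \<subseteq> ?z F <+>\<^bsub>M\<^esub> W"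
      using subset_set_add1[OF sub[OF F] W] subset_set_add2[OF sub[OF F] W]
        subset_set_add2[OF E submodule_smult[OF z F]] by blast+
    thus "W <+>\<^bsub>M\<^esub> (\<lambda>v. z \<odot>\<^bsub>M\<^esub> v) ` F \<subseteq> ?z F <+>\<^bsub>M\<^esub> W"
      by (intro set_add_subset[OF submodule_set_add[OF sub[OF F] W]])
  qed
  have int: "W \<inter> ?z F \<subseteq> ?z W"
  proof
    fix w assume w: "w \<in> W \<inter> ?z F"
    then obtain e v where ev: "e \<in> E" "v \<in> F" "w = e \<oplus>\<^bsub>M\<^esub> z \<odot>\<^bsub>M\<^esub> v" by (auto simp: set_add_iff)
    have "z \<odot>\<^bsub>M\<^esub> v \<in> W"
      by (rule submodule_add_cancel[OF W, of e]) (use ev w EW z submodule_carr[OF F] in auto)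
    hence "v \<in> W" using Wsat ev by blast
    thus "w \<in> ?z W" using ev by (auto simp: set_add_iff)
  qed
  have "mlen R M (?z F) F = mlen R M (?z F) (W <+>\<^bsub>M\<^esub> (\<lambda>v. z \<odot>\<^bsub>M\<^esub> v) ` F)
      + mlen R M (W <+>\<^bsub>M\<^esub> (\<lambda>v. z \<odot>\<^bsub>M\<^esub> v) ` F) F"
    using mlen_add[OF sub[OF F] WzF F _ WF'] eq2 subset_set_add1[OF sub[OF F] W] by simp
  moreover have "mlen R M (?z F) (W <+>\<^bsub>M\<^esub> (\<lambda>v. z \<odot>\<^bsub>M\<^esub> v) ` F) = mlen R M (?z W) W"
    using mlen_second_iso[OF sub[OF F] sub[OF W] W zWW int] unfolding eq1 eq2 .
  ultimately show ?thesis by simp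
qed

text \<open>The submodule \<open>W\<close> is the saturation of \<open>K\<close> with respect to the powers of \<open>z\<close>. As \<open>W/K\<close> has
  finite length, \<open>K\<close> may be replaced by \<open>W\<close>, and \<open>F/W\<close> has no \<open>z\<close>-torsion.\<close>

lemma mlen_mod_smult_saturation:
  assumes acc: "acc_module R M"
    and z: "z \<in> carrier R" and E: "submodule E R M" and K: "submodule K R M" and F: "submodule F R M"
    and EK: "E \<subseteq> K" and KF: "K \<subseteq> F" and reg: "\<And>v. v \<in> F \<Longrightarrow> z \<odot>\<^bsub>M\<^esub> v \<in> E \<Longrightarrow> v \<in> E"
    and fin: "mlen R M (E <+>\<^bsub>M\<^esub> (\<lambda>v. z \<odot>\<^bsub>M\<^esub> v) ` F) F = enat l"
  obtains W and c :: nat where "submodule W R M" "K \<subseteq> W" "W \<subseteq> F"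
    "\<And>v. v \<in> W \<Longrightarrow> (z [^]\<^bsub>R\<^esub> c) \<odot>\<^bsub>M\<^esub> v \<in> K"
    "mlen R M (E <+>\<^bsub>M\<^esub> (\<lambda>v. z \<odot>\<^bsub>M\<^esub> v) ` K) K + mlen R M (W <+>\<^bsub>M\<^esub> (\<lambda>v. z \<odot>\<^bsub>M\<^esub> v) ` F) F = enat l"
proof -
  \<comment> \<open>The elements of \<open>F\<close> carried into \<open>K\<close> by
    \<open>z^i\<close>. This ascending chain stops at some \<open>c\<close>, and \<open>T c\<close>
    is the saturation.\<close>
  define T where "T i = {v \<in> F. (z [^]\<^bsub>R\<^esub> (i::nat)) \<odot>\<^bsub>M\<^esub> v \<in> K}" for i
  have zp: "z [^]\<^bsub>R\<^esub> (i::nat) \<in> carrier R" for i using z by simp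
  have T: "submodule (T i) R M" for i
    unfolding T_def by (rule module_map.submodule_vimage[OF smult_map[OF zp] F K])
  have pow_Suc: "(z [^]\<^bsub>R\<^esub> (Suc i)) \<odot>\<^bsub>M\<^esub> v = (z [^]\<^bsub>R\<^esub> i) \<odot>\<^bsub>M\<^esub> (z \<odot>\<^bsub>M\<^esub> v)"
    "(z [^]\<^bsub>R\<^esub> (Suc i)) \<odot>\<^bsub>M\<^esub> v = z \<odot>\<^bsub>M\<^esub> ((z [^]\<^bsub>R\<^esub> i) \<odot>\<^bsub>M\<^esub> v)" if "v \<in> carrier M" for i v
  proof -
    show "(z [^]\<^bsub>R\<^esub> (Suc i)) \<odot>\<^bsub>M\<^esub> v = (z [^]\<^bsub>R\<^esub> i) \<odot>\<^bsub>M\<^esub> (z \<odot>\<^bsub>M\<^esub> v)"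
      using z that smult_assoc1[OF zp z that] by simp
    show "(z [^]\<^bsub>R\<^esub> (Suc i)) \<odot>\<^bsub>M\<^esub> v = z \<odot>\<^bsub>M\<^esub> ((z [^]\<^bsub>R\<^esub> i) \<odot>\<^bsub>M\<^esub> v)"
      using z that smult_assoc1[OF z zp that] by (simp add: R.m_comm)
  qed
  have Tinc: "T i \<subseteq> T (Suc i)" for i
    using submodule_carr[OF F] submoduleE(4)[OF K z] by (auto simp only: T_def pow_Suc(2))
  obtain c where c: "\<forall>i\<ge>c. T i = T c"
    using acc_moduleD[of R M T, OF acc T Tinc] by blast
  define W where "W = T c"
  have W: "submodule W R M" and WF: "W \<subseteq> F" using T by (auto simp: W_def T_def)
  have "T 0 = K" using KF submodule_carr[OF F] by (auto simp: T_def)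
  moreover have "T 0 \<subseteq> T i" for i by (rule lift_Suc_mono_le[of T, OF Tinc]) simp
  ultimately have KW: "K \<subseteq> W" by (auto simp: W_def)
  have Wsat: "v \<in> W" if v: "v \<in> F" "z \<odot>\<^bsub>M\<^esub> v \<in> W" for v
  proof -
    have vc: "v \<in> carrier M" using v submodule_carr[OF F] by blast
    have "(z [^]\<^bsub>R\<^esub> (Suc c)) \<odot>\<^bsub>M\<^esub> v \<in> K" unfolding pow_Suc(1)[OF vc] using v by (simp add: W_def T_def)
    hence "v \<in> T (Suc c)" using v unfolding T_def by blast
    thus ?thesis using c[rule_format, of "Suc c"] by (simp add: W_def)
  qed
  let ?z = "\<lambda>A. E <+>\<^bsub>M\<^esub> (\<lambda>v. z \<odot>\<^bsub>M\<^esub> v) ` A"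
  have sub: "submodule (?z A) R M" if "submodule A R M" for A
    using submodule_set_add[OF E submodule_smult[OF z that]] .
  have EW: "E \<subseteq> W" using EK KW by blast
  have zWW: "?z W \<subseteq> W" using set_add_subset[OF W EW smult_subset[OF z W]] .
  have total: "mlen R M (?z W) W + mlen R M (W <+>\<^bsub>M\<^esub> (\<lambda>v. z \<odot>\<^bsub>M\<^esub> v) ` F) F = enat l"
    using mlen_mod_smult_saturated[OF z E W F EW WF Wsat] unfolding fin .
  hence fin1: "mlen R M (?z W) W \<noteq> \<infinity>" by (metis enat.distinct(1) plus_eq_infty_iff_enat)
  let ?zi = "\<lambda>i. E <+>\<^bsub>M\<^esub> (\<lambda>v. (z [^]\<^bsub>R\<^esub> (i::nat)) \<odot>\<^bsub>M\<^esub> v) ` W"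
  have subi: "submodule (?zi i) R M" for i using submodule_set_add[OF E submodule_smult[OF zp W]] .
  have powreg: "v \<in> E" if "v \<in> F" "(z [^]\<^bsub>R\<^esub> (i::nat)) \<odot>\<^bsub>M\<^esub> v \<in> E" for i v
    using that(2)
  proof (induction i)
    case 0 thus ?case using that submodule_carr[OF F] by simp
  next
    case (Suc i)
    have vc: "v \<in> carrier M" using that submodule_carr[OF F] by blast
    have "(z [^]\<^bsub>R\<^esub> i) \<odot>\<^bsub>M\<^esub> v \<in> F" using submoduleE(4)[OF F zp that(1)] .
    moreover have "z \<odot>\<^bsub>M\<^esub> ((z [^]\<^bsub>R\<^esub> i) \<odot>\<^bsub>M\<^esub> v) \<in> E" using Suc.prems unfolding pow_Suc(2)[OF vc] .
    ultimately show ?case using reg Suc.IH by blast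
  qed
  \<comment> \<open>Each step from \<open>E + z^(i+1) W\<close> to \<open>E + z^i W\<close> is a
    copy of W/(E + zW), so these quotients of \<open>W\<close> all have finite length. Since
    \<open>z^c W\<close> lies in \<open>K\<close>, so has W/K.\<close>
  have finW: "mlen R M (?zi i) W \<noteq> \<infinity>" for i
  proof (induction i)
    case 0
    have "(\<lambda>v. (z [^]\<^bsub>R\<^esub> (0::nat)) \<odot>\<^bsub>M\<^esub> v) ` W = W" using submodule_carr[OF W] by force
    hence "?zi 0 = W" using set_add_subset[OF W EW, of W] subset_set_add2[OF E W] by auto
    thus ?case using mlen_self[OF W] by simp
  next
    case (Suc i)
    have e: "E <+>\<^bsub>M\<^esub> (\<lambda>v. (z [^]\<^bsub>R\<^esub> i) \<odot>\<^bsub>M\<^esub> v) ` (?z W) = ?zi (Suc i)"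
    proof (intro equalityI subsetI)
      fix w assume "w \<in> E <+>\<^bsub>M\<^esub> (\<lambda>v. (z [^]\<^bsub>R\<^esub> i) \<odot>\<^bsub>M\<^esub> v) ` (?z W)"
      then obtain e e' v where ev: "e \<in> E" "e' \<in> E" "v \<in> W"
        "w = e \<oplus>\<^bsub>M\<^esub> (z [^]\<^bsub>R\<^esub> i) \<odot>\<^bsub>M\<^esub> (e' \<oplus>\<^bsub>M\<^esub> z \<odot>\<^bsub>M\<^esub> v)" by (auto simp: set_add_iff)
      have cc: "e \<in> carrier M" "e' \<in> carrier M" "v \<in> carrier M"
        using ev submodule_carr[OF E] submodule_carr[OF W] by auto
      have "w = (e \<oplus>\<^bsub>M\<^esub> (z [^]\<^bsub>R\<^esub> i) \<odot>\<^bsub>M\<^esub> e') \<oplus>\<^bsub>M\<^esub> (z [^]\<^bsub>R\<^esub> Suc i) \<odot>\<^bsub>M\<^esub> v"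
        unfolding pow_Suc(1)[OF cc(3)] using ev(4) cc z zp by (simp add: smult_r_distr M.a_assoc)
      moreover have "e \<oplus>\<^bsub>M\<^esub> (z [^]\<^bsub>R\<^esub> i) \<odot>\<^bsub>M\<^esub> e' \<in> E" using ev zp submoduleE(4,5)[OF E] by blast
      ultimately show "w \<in> ?zi (Suc i)" unfolding set_add_iff using ev(3) by blast
    next
      fix w assume "w \<in> ?zi (Suc i)"
      then obtain e v where ev: "e \<in> E" "v \<in> W" "w = e \<oplus>\<^bsub>M\<^esub> (z [^]\<^bsub>R\<^esub> Suc i) \<odot>\<^bsub>M\<^esub> v"
        unfolding set_add_iff by blast
      have vc: "v \<in> carrier M" using ev submodule_carr[OF W] by auto
      have "z \<odot>\<^bsub>M\<^esub> v \<in> ?z W" using ev subset_set_add2[OF E submodule_smult[OF z W]] by blast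
      hence "(z [^]\<^bsub>R\<^esub> i) \<odot>\<^bsub>M\<^esub> (z \<odot>\<^bsub>M\<^esub> v) \<in> (\<lambda>v. (z [^]\<^bsub>R\<^esub> i) \<odot>\<^bsub>M\<^esub> v) ` (?z W)" by (rule imageI)
      thus "w \<in> E <+>\<^bsub>M\<^esub> (\<lambda>v. (z [^]\<^bsub>R\<^esub> i) \<odot>\<^bsub>M\<^esub> v) ` (?z W)"
        unfolding ev(3) pow_Suc(1)[OF vc] by (rule set_addI[OF ev(1)])
    qed
    have h1: "mlen R M (?zi (Suc i)) (?zi i) = mlen R M (?z W) W"
      unfolding e[symmetric]
    proof (rule mlen_smult_image[OF zp E sub[OF W] W zWW])
      fix v assume "v \<in> W" "(z [^]\<^bsub>R\<^esub> i) \<odot>\<^bsub>M\<^esub> v \<in> E"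
      hence "v \<in> E" using powreg WF by blast
      thus "v \<in> ?z W" using subset_set_add1[OF E submodule_smult[OF z W]] by blast
    qed
    have h2: "?zi (Suc i) \<subseteq> ?zi i"
      unfolding e[symmetric] by (intro set_add_mono order_refl image_mono zWW)
    have h3: "?zi i \<subseteq> W" using set_add_subset[OF W EW smult_subset[OF zp W]] .
    show ?case
      using mlen_add[OF subi[of "Suc i"] subi[of i] W h2 h3, unfolded h1] fin1 Suc
      by (metis plus_eq_infty_iff_enat)
  qed
  have cK: "(z [^]\<^bsub>R\<^esub> c) \<odot>\<^bsub>M\<^esub> v \<in> K" if "v \<in> W" for v using that by (auto simp: W_def T_def)
  have "?zi c \<subseteq> K" using set_add_subset[OF K EK] cK by blast
  hence "mlen R M K W \<le> mlen R M (?zi c) W" by (intro mlen_mono) auto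
  hence "mlen R M K W \<noteq> \<infinity>" using finW[of c] by (metis enat_ord_simps(5))
  hence "mlen R M (?z K) K = mlen R M (?z W) W"
    by (intro mlen_mod_smult_finite[OF z E K W EK KW]) (use reg WF in blast)+
  thus thesis using that[OF W KW WF cK] total by simp
qed

end

context two_gen_local
begin

lemma noeth_self: "noeth_module R (self_module R) x y"
  by (intro noeth_module.intro module_self two_gen_local_axioms noeth_module_axioms.intro
      acc_module_self noetherian)

lemma noeth_free: "noeth_module R (free_module R n) x y"
  by (intro noeth_module.intro module_free two_gen_local_axioms noeth_module_axioms.intro
      acc_module_free noetherian)

lemma two_gen_mult_free: "two_gen_mult (free_module R n) x y (comp_set (carrier R) n) = comp_set \<mm> n"
proof (intro equalityI subsetI)
  fix v assume "v \<in> two_gen_mult (free_module R n) x y (comp_set (carrier R) n)"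
  then obtain a b where ab: "a \<in> comp_set (carrier R) n" "b \<in> comp_set (carrier R) n"
    "v = (x \<odot>\<^bsub>free_module R n\<^esub> a) \<oplus>\<^bsub>free_module R n\<^esub> (y \<odot>\<^bsub>free_module R n\<^esub> b)"
    unfolding two_gen_mult_def set_add_iff by blast
  have "v i \<in> \<mm>" if "i < n" for i
  proof -
    have "v i = x \<otimes> a i \<oplus> y \<otimes> b i" "a i \<in> carrier R" "b i \<in> carrier R" using ab that by auto
    thus ?thesis unfolding two_gen_def by blast
  qed
  moreover have "v \<in> extensional {..<n}" using ab(3) by simp
  ultimately show "v \<in> comp_set \<mm> n" by (simp add: PiE_iff)
next
  fix v assume v: "v \<in> comp_set \<mm> n"
  hence "\<forall>i<n. \<exists>a b. a \<in> carrier R \<and> b \<in> carrier R \<and> v i = x \<otimes> a \<oplus> y \<otimes> b"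
    by (auto simp: two_gen_def PiE_iff)
  then obtain a b where ab: "\<And>i. i < n \<Longrightarrow> a i \<in> carrier R \<and> b i \<in> carrier R \<and> v i = x \<otimes> a i \<oplus> y \<otimes> b i"
    by metis
  let ?F = "free_module R n"
  have "v = (x \<odot>\<^bsub>?F\<^esub> restrict a {..<n}) \<oplus>\<^bsub>?F\<^esub> (y \<odot>\<^bsub>?F\<^esub> restrict b {..<n})"
    using v ab by (auto simp: fun_eq_iff PiE_iff extensional_def)
  moreover have "restrict a {..<n} \<in> comp_set (carrier R) n" "restrict b {..<n} \<in> comp_set (carrier R) n"
    using ab by auto
  ultimately show "v \<in> two_gen_mult ?F x y (comp_set (carrier R) n)"
    unfolding two_gen_mult_def set_add_iff by blast
qed

lemma mlen_comp_mm:
  "mlen R (free_module R n) (comp_set \<mm> n) (comp_set (carrier R) n) = enat n"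
  using mlen_comp_set[OF ideal_mm, of 1 n] mlen_mm by (simp add: one_enat_def)

end

context noeth_module
begin

text \<open>The coefficient vectors whose combination falls into m \<open>K\<close> contain m R^s
  and have the same colength \<open>s\<close>, so they are exactly m R^s. A relation among the
  generators is one of them.\<close>

lemma minimal_generators:
  assumes K: "submodule K R M" and s: "mlen R M (xy_mult K) K = enat s"
  obtains u where "\<And>i. i < s \<Longrightarrow> u i \<in> K" "K = lin_span R M u s"
    "\<And>v. v \<in> carrier (free_module R s) \<Longrightarrow> lincomb M u v s = \<zero>\<^bsub>M\<^esub> \<Longrightarrow> v \<in> comp_set \<mm> s"
proof -
  interpret F: noeth_module R "free_module R s" x y by (rule noeth_free)
  note sX = submodule_xy_mult[OF K] and XK = xy_mult_subset[OF K]
  from lin_span_generators[OF K sX XK order_refl s]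
  obtain u where u: "\<forall>i<s. u i \<in> K" "K = xy_mult K <+>\<^bsub>M\<^esub> lin_span R M u s" by blast
  have uc: "u i \<in> carrier M" if "i < s" for i using u(1) K submodule_carr that by blast
  interpret L: module_map R "free_module R s" M "\<lambda>v. lincomb M u v s" by (rule lincomb_map[OF uc])
  have sL: "submodule (lin_span R M u s) R M" by (rule submodule_lin_span[OF uc])
  have LK: "lin_span R M u s \<subseteq> K"
  proof
    fix w assume "w \<in> lin_span R M u s"
    then obtain v where v: "v \<in> comp_set (carrier R) s" "w = lincomb M u v s" by (auto simp: lin_span_def)
    have "v i \<odot>\<^bsub>M\<^esub> u i \<in> K" if "i < s" for i
      using submoduleE(4)[OF K, of "v i" "u i"] v(1) u(1) that by auto
    thus "w \<in> K" unfolding v(2) by (rule lincomb_in_submodule[OF K])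
  qed
  have Keq: "lin_span R M u s = K"
    by (rule nakayama[OF sL K LK])
      (use u(2) set_add_comm[OF submoduleE(1)[OF sX] submoduleE(1)[OF sL]] in simp)
  let ?B = "carrier (free_module R s)"
  let ?A = "{v \<in> ?B. lincomb M u v s \<in> xy_mult K}"
  have sA: "submodule ?A R (free_module R s)"
    by (rule L.submodule_vimage[OF F.carrier_is_submodule sX])
  have "(\<lambda>v. lincomb M u v s) ` ?A \<subseteq> xy_mult K" by auto
  hence e1: "xy_mult K <+>\<^bsub>M\<^esub> (\<lambda>v. lincomb M u v s) ` ?A = xy_mult K"
    by (intro equalityI set_add_subset[OF sX order_refl] subset_set_add1[OF sX L.submodule_image[OF sA]])
  have e2: "xy_mult K <+>\<^bsub>M\<^esub> (\<lambda>v. lincomb M u v s) ` ?B = K"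
    using u(2) unfolding lin_span_def by simp
  have "mlen R M (xy_mult K <+>\<^bsub>M\<^esub> (\<lambda>v. lincomb M u v s) ` ?A) (xy_mult K <+>\<^bsub>M\<^esub> (\<lambda>v. lincomb M u v s) ` ?B)
      = mlen R (free_module R s) ?A ?B"
    by (rule L.mlen_image[OF sX sA F.carrier_is_submodule]) auto
  hence A: "mlen R (free_module R s) ?A ?B = enat s" using s unfolding e1 e2 by simp
  have sm: "submodule (comp_set \<mm> s) R (free_module R s)" by (rule submodule_comp_set[OF ideal_mm])
  have mA: "comp_set \<mm> s \<subseteq> ?A"
    unfolding two_gen_mult_free[symmetric]
  proof (rule F.xy_mult_least[OF sA])
    fix v assume v: "v \<in> comp_set (carrier R) s"
    hence "lincomb M u v s \<in> K" using Keq by (auto simp: lin_span_def)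
    thus "x \<odot>\<^bsub>free_module R s\<^esub> v \<in> ?A" "y \<odot>\<^bsub>free_module R s\<^esub> v \<in> ?A"
      using v x_in_xy_mult[OF K] y_in_xy_mult[OF K] L.map_smult[of x v] L.map_smult[of y v]
        F.smult_closed[of x v] F.smult_closed[of y v]
      by (simp_all del: free_module_simps(2-4))
  qed
  have AB: "?A \<subseteq> ?B" by blast
  have "mlen R (free_module R s) (comp_set \<mm> s) ?B = enat s"
    using mlen_comp_mm[of s] by (simp only: free_module_simps)
  with F.mlen_add[OF sm sA F.carrier_is_submodule mA AB]
  have "mlen R (free_module R s) (comp_set \<mm> s) ?A + enat s = enat s + 0"
    unfolding A by simp
  hence "mlen R (free_module R s) (comp_set \<mm> s) ?A = 0"
    by (rule enat_add_cancel_comm) simp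
  hence "?A = comp_set \<mm> s" using F.mlen_zero_iff[OF sm sA mA] by simp
  moreover have "v \<in> ?A" if "v \<in> ?B" "lincomb M u v s = \<zero>\<^bsub>M\<^esub>" for v
    using that submodule_zero[OF sX] by simp
  ultimately show thesis using that[of u] u(1) Keq by blast
qed

end

section \<open>Powers of the maximal ideal\<close>

text \<open>The recursion \<open>m^(n+1) = x m^n + y m^n\<close> hands every induction on the degree
  its two summands; \<open>ideal_power_eq\<close> connects it with
  \<open>ideal_power\<close>.\<close>

primrec two_gen_pow :: "('a, 'b) ring_scheme \<Rightarrow> 'a \<Rightarrow> 'a \<Rightarrow> nat \<Rightarrow> 'a set" where
  "two_gen_pow R x y 0 = carrier R"
| "two_gen_pow R x y (Suc n) =
    {x \<otimes>\<^bsub>R\<^esub> a \<oplus>\<^bsub>R\<^esub> y \<otimes>\<^bsub>R\<^esub> b | a b. a \<in> two_gen_pow R x y n \<and> b \<in> two_gen_pow R x y n}"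

declare two_gen_pow.simps(2) [simp del]

context two_gen_local
begin

abbreviation "mpow \<equiv> two_gen_pow R x y"

lemma mpow_SucI: "a \<in> mpow n \<Longrightarrow> b \<in> mpow n \<Longrightarrow> x \<otimes> a \<oplus> y \<otimes> b \<in> mpow (Suc n)"
  by (auto simp: two_gen_pow.simps(2))

lemma mpow_SucE:
  assumes "v \<in> mpow (Suc n)"
  obtains a b where "a \<in> mpow n" "b \<in> mpow n" "v = x \<otimes> a \<oplus> y \<otimes> b"
  using assms by (auto simp: two_gen_pow.simps(2))

lemma mpow_1: "mpow (Suc 0) = \<mm>"
  by (auto simp: two_gen_def two_gen_pow.simps(2))

lemma two_gen_mult_mpow: "two_gen_mult (self_module R) x y (mpow n) = mpow (Suc n)"
  unfolding two_gen_mult_def set_add_def' by (auto simp: two_gen_pow.simps(2))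

lemma submodule_mpow: "submodule (mpow n) R (self_module R)"
proof (induction n)
  case 0
  interpret S: module R "self_module R" by (rule module_self)
  show ?case using S.carrier_is_submodule by simp
next
  case (Suc n)
  interpret S: noeth_module R "self_module R" x y by (rule noeth_self)
  show ?case using S.submodule_xy_mult[OF Suc] unfolding two_gen_mult_mpow .
qed

lemma ideal_mpow: "ideal (mpow n) R"
  using submodule_mpow by (simp add: submodule_self_iff)

lemma mpow_carr: "a \<in> mpow n \<Longrightarrow> a \<in> carrier R"
  using ideal.Icarr[OF ideal_mpow] by blast

lemma mpow_zero [simp]: "\<zero> \<in> mpow n"
  and mpow_add: "a \<in> mpow n \<Longrightarrow> b \<in> mpow n \<Longrightarrow> a \<oplus> b \<in> mpow n"
  and mpow_l_mult: "r \<in> carrier R \<Longrightarrow> a \<in> mpow n \<Longrightarrow> r \<otimes> a \<in> mpow n"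
  and mpow_r_mult: "r \<in> carrier R \<Longrightarrow> a \<in> mpow n \<Longrightarrow> a \<otimes> r \<in> mpow n"
  and mpow_neg: "a \<in> mpow n \<Longrightarrow> \<ominus> a \<in> mpow n"
  using additive_subgroup.zero_closed[OF ideal.axioms(1)[OF ideal_mpow]]
    additive_subgroup.a_closed[OF ideal.axioms(1)[OF ideal_mpow]]
    ideal.I_l_closed[OF ideal_mpow] ideal.I_r_closed[OF ideal_mpow]
    additive_subgroup.a_inv_closed[OF ideal.axioms(1)[OF ideal_mpow]] by auto

lemma mpow_minus: "a \<in> mpow n \<Longrightarrow> b \<in> mpow n \<Longrightarrow> a \<ominus> b \<in> mpow n"
  by (simp add: a_minus_def mpow_add mpow_neg)

lemma mpow_Suc_subset: "mpow (Suc n) \<subseteq> mpow n"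
  by (auto simp: two_gen_pow.simps(2) intro!: mpow_add mpow_l_mult)

lemma mpow_antimono: "i \<le> j \<Longrightarrow> mpow j \<subseteq> mpow i"
  by (rule lift_Suc_antimono_le[of mpow, OF mpow_Suc_subset])

lemma mpow_le: "a \<in> mpow j \<Longrightarrow> i \<le> j \<Longrightarrow> a \<in> mpow i"
  using mpow_antimono by blast

lemma x_mult_mpow: "a \<in> mpow n \<Longrightarrow> x \<otimes> a \<in> mpow (Suc n)"
  using mpow_SucI[of a n \<zero>] mpow_carr[of a n] by simp

lemma y_mult_mpow: "a \<in> mpow n \<Longrightarrow> y \<otimes> a \<in> mpow (Suc n)"
  using mpow_SucI[of \<zero> n a] mpow_carr[of a n] by simp

lemma mpow_mult: "a \<in> mpow i \<Longrightarrow> b \<in> mpow j \<Longrightarrow> a \<otimes> b \<in> mpow (i + j)"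
proof (induction i arbitrary: a)
  case 0
  thus ?case by (auto intro: mpow_l_mult)
next
  case (Suc i)
  obtain c d where cd: "c \<in> mpow i" "d \<in> mpow i" "a = x \<otimes> c \<oplus> y \<otimes> d"
    using Suc.prems(1) by (rule mpow_SucE)
  have "a \<otimes> b = x \<otimes> (c \<otimes> b) \<oplus> y \<otimes> (d \<otimes> b)"
    using cd mpow_carr[OF cd(1)] mpow_carr[OF cd(2)] mpow_carr[OF Suc.prems(2)] by (simp add: l_distr m_assoc)
  thus ?case using mpow_SucI[OF Suc.IH[OF cd(1) Suc.prems(2)] Suc.IH[OF cd(2) Suc.prems(2)]] by simp
qed

lemma mm_mult_mpow: "a \<in> \<mm> \<Longrightarrow> b \<in> mpow n \<Longrightarrow> a \<otimes> b \<in> mpow (Suc n)"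
  using mpow_mult[of a "Suc 0" b n] unfolding mpow_1 by simp

lemma pow_mpow: "a \<in> mpow i \<Longrightarrow> a [^] (n::nat) \<in> mpow (i * n)"
proof (induction n)
  case (Suc n)
  thus ?case using mpow_mult[OF Suc.IH[OF Suc.prems] Suc.prems] by (simp add: add.commute)
qed simp

lemma x_pow_mpow: "x [^] (n::nat) \<in> mpow n" and y_pow_mpow: "y [^] (n::nat) \<in> mpow n"
  using pow_mpow[of x "Suc 0" n] pow_mpow[of y "Suc 0" n] unfolding mpow_1 by simp_all

text \<open>The only monomial of degree \<open>n + 1\<close> not divisible by \<open>x\<close> is
  the power of \<open>y\<close>. This normal form, one factor \<open>x\<close> split off and one
  coefficient \<open>u\<close> left over, drives the inductions on initial forms.\<close>

lemma mpow_Suc_cases: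
  assumes "v \<in> mpow (Suc n)"
  obtains p u where "p \<in> mpow n" "u \<in> carrier R" "v = x \<otimes> p \<oplus> u \<otimes> y [^] Suc n"
  using assms
proof (induction n arbitrary: v thesis)
  case 0
  then obtain a b where "a \<in> mpow 0" "b \<in> mpow 0" "v = x \<otimes> a \<oplus> y \<otimes> b" by (elim mpow_SucE) 
  thus ?case using 0(1)[of a b] by (simp add: m_comm)
next
  case (Suc n)
  obtain p q where pq: "p \<in> mpow (Suc n)" "q \<in> mpow (Suc n)" "v = x \<otimes> p \<oplus> y \<otimes> q"
    using Suc.prems(2) by (rule mpow_SucE)
  obtain p' u where u: "p' \<in> mpow n" "u \<in> carrier R" "q = x \<otimes> p' \<oplus> u \<otimes> y [^] Suc n"
    using Suc.IH[OF _ pq(2)] by blast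
  have c: "p \<in> carrier R" "p' \<in> carrier R" using mpow_carr pq u by blast+
  have "v = x \<otimes> (p \<oplus> y \<otimes> p') \<oplus> u \<otimes> y [^] Suc (Suc n)"
    unfolding pq(3) u(3) using c u(2) by (simp add: r_distr a_ac m_ac)
  moreover have "p \<oplus> y \<otimes> p' \<in> mpow (Suc n)" using pq(1) y_mult_mpow[OF u(1)] by (rule mpow_add)
  ultimately show ?case using Suc.prems(1) u(2) by blast
qed

text \<open>A monomial of degree \<open>i + j\<close> is divisible by \<open>x^i\<close> or by
  \<open>y^j\<close>.\<close>

lemma mpow_split:
  assumes "v \<in> mpow (i + j)"
  obtains a b where "a \<in> mpow j" "b \<in> mpow i" "v = x [^] i \<otimes> a \<oplus> y [^] j \<otimes> b"
  using assms
proof (induction i arbitrary: v thesis)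
  case 0
  thus ?case using 0(1)[of v \<zero>] mpow_carr[of v j] by simp
next
  case (Suc i)
  obtain p q where pq: "p \<in> mpow (i + j)" "q \<in> mpow (i + j)" "v = x \<otimes> p \<oplus> y \<otimes> q"
    using Suc.prems(2)[unfolded add_Suc] by (rule mpow_SucE)
  obtain a b where ab: "a \<in> mpow j" "b \<in> mpow i" "p = x [^] i \<otimes> a \<oplus> y [^] j \<otimes> b"
    using Suc.IH[OF _ pq(1)] by blast
  obtain a' b' where ab': "a' \<in> mpow j" "b' \<in> mpow i" "q = x [^] i \<otimes> a' \<oplus> y [^] j \<otimes> b'"
    using Suc.IH[OF _ pq(2)] by blast
  obtain c u where cu: "c \<in> mpow j" "u \<in> carrier R" "y \<otimes> a' = x \<otimes> c \<oplus> u \<otimes> y [^] Suc j"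
    using mpow_Suc_cases[OF y_mult_mpow[OF ab'(1)]] .
  have cc: "a \<in> carrier R" "b \<in> carrier R" "a' \<in> carrier R" "b' \<in> carrier R" "c \<in> carrier R"
    using ab ab' cu mpow_carr by blast+
  have "v = x \<otimes> p \<oplus> (x [^] i \<otimes> (y \<otimes> a') \<oplus> y [^] j \<otimes> (y \<otimes> b'))"
    unfolding pq(3) ab'(3) using cc by (simp add: ab(3) r_distr m_ac)
  also have "\<dots> = x [^] Suc i \<otimes> (a \<oplus> c) \<oplus> y [^] j \<otimes> ((x \<otimes> b \<oplus> y \<otimes> b') \<oplus> (x [^] i \<otimes> (u \<otimes> y)))"
    unfolding cu(3) ab(3) using cc cu(2) by (simp add: r_distr m_ac a_ac)
  finally have "v = x [^] Suc i \<otimes> (a \<oplus> c) \<oplus> y [^] j \<otimes> ((x \<otimes> b \<oplus> y \<otimes> b') \<oplus> (x [^] i \<otimes> (u \<otimes> y)))" .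
  moreover have "x [^] i \<otimes> (u \<otimes> y) \<in> mpow (Suc i)"
    using mpow_mult[OF x_pow_mpow[of i], of "u \<otimes> y" "Suc 0"] mpow_l_mult[of u y "Suc 0"] cu(2)
    unfolding mpow_1 by simp
  ultimately show ?case
    using Suc.prems(1)[of "a \<oplus> c" "(x \<otimes> b \<oplus> y \<otimes> b') \<oplus> (x [^] i \<otimes> (u \<otimes> y))"]
      mpow_add ab cu(1) mpow_SucI[OF ab(2) ab'(2)] by blast
qed

lemma mpow_order:
  assumes "a \<in> carrier R" "a \<notin> mpow n"
  obtains j where "j < n" "a \<in> mpow j" "a \<notin> mpow (Suc j)"
  using assms(2)
proof (induction n)
  case 0 thus ?case using assms(1) by simp
next
  case (Suc n)
  show ?case
  proof (cases "a \<in> mpow n")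
    case True thus ?thesis using Suc.prems(1)[of n] Suc.prems(2) by blast
  next
    case False thus ?thesis using Suc.IH Suc.prems(1) less_SucI by blast
  qed
qed

text \<open>Finiteness is available before any assumption on the dimension; the exact value comes
  with \<open>mlen_mpow\<close>.\<close>

lemma mlen_mpow_finite: "mlen R (self_module R) (mpow n) (carrier R) \<noteq> \<infinity>"
proof (induction n)
  interpret S: noeth_module R "self_module R" x y by (rule noeth_self)
  case 0
  show ?case using S.mlen_self[OF submodule_mpow[of 0]] by simp
next
  interpret S: noeth_module R "self_module R" x y by (rule noeth_self)
  case (Suc n)
  have "mlen R (self_module R) (mpow (Suc n)) (mpow n) \<noteq> \<infinity>"
    using S.mlen_xy_mult_finite[OF submodule_mpow[of n]] unfolding two_gen_mult_mpow .
  moreover have "mpow n \<subseteq> carrier R" using mpow_carr by blast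
  note S.mlen_add[OF submodule_mpow submodule_mpow submodule_mpow[of 0] mpow_Suc_subset, unfolded two_gen_pow.simps(1), OF this]
  ultimately show ?case using Suc by (metis plus_eq_infty_iff_enat)
qed

text \<open>With \<open>J\<close> the intersection of the ideals \<open>I + m^n\<close>, an ideal \<open>L\<close> that is maximal with
  \<open>L \<inter> J = I + m J\<close> contains a power of \<open>m\<close>; hence \<open>J = I + m J\<close>, and Nakayama applies.\<close>

lemma krull_intersection:
  assumes I: "ideal I R" and a: "\<And>n. a \<in> I <+>\<^bsub>R\<^esub> mpow n"
  shows "a \<in> I"
proof -
  interpret S: noeth_module R "self_module R" x y by (rule noeth_self)
  have sI: "submodule I R (self_module R)" using I by (simp add: submodule_self_iff)
  have sIn: "submodule (I <+>\<^bsub>R\<^esub> mpow n) R (self_module R)" for n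
    using S.submodule_set_add[OF sI submodule_mpow] by simp
  define J where "J = (\<Inter>n. I <+>\<^bsub>R\<^esub> mpow n)"
  have sJ: "submodule J R (self_module R)"
  proof (rule S.submoduleI')
    show "J \<subseteq> carrier (self_module R)" using S.submoduleE(1)[OF sIn[of 0]] unfolding J_def by blast
    show "\<zero>\<^bsub>self_module R\<^esub> \<in> J" using S.submodule_zero[OF sIn] unfolding J_def by blast
    fix p q assume "p \<in> J" "q \<in> J"
    thus "p \<oplus>\<^bsub>self_module R\<^esub> q \<in> J" using S.submoduleE(5)[OF sIn] unfolding J_def by blast
  next
    fix r p assume "r \<in> carrier R" "p \<in> J"
    thus "r \<odot>\<^bsub>self_module R\<^esub> p \<in> J" using S.submoduleE(4)[OF sIn] unfolding J_def by blast
  qed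
  have IJ: "I \<subseteq> J" using S.subset_set_add1[OF sI submodule_mpow] by (auto simp: J_def)
  let ?X = "I <+>\<^bsub>R\<^esub> S.xy_mult J"
  have sX: "submodule ?X R (self_module R)" using S.submodule_set_add[OF sI S.submodule_xy_mult[OF sJ]] by simp
  have mX: "S.xy_mult J \<subseteq> ?X" using S.subset_set_add2[OF sI S.submodule_xy_mult[OF sJ]] by simp
  let ?S = "{L. submodule L R (self_module R) \<and> ?X \<subseteq> L \<and> L \<inter> J \<subseteq> ?X}"
  have "?X \<in> ?S" using sX by blast
  moreover have "submodule K R (self_module R)" if "K \<in> ?S" for K using that by simp
  ultimately have "\<exists>L\<in>?S. \<forall>L'\<in>?S. L \<subseteq> L' \<longrightarrow> L' = L"
    by (rule acc_module_maximal[OF S.acc, of ?X ?S])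
  then obtain L where L: "L \<in> ?S" "\<forall>L'\<in>?S. L \<subseteq> L' \<longrightarrow> L' = L" ..
  have sL: "submodule L R (self_module R)" and XL: "?X \<subseteq> L" and LJ: "L \<inter> J \<subseteq> ?X" using L(1) by blast+
  \<comment> \<open>The ideals \<open>T i\<close> of multipliers of \<open>z^i\<close> into
    \<open>L\<close> become stationary at some \<open>c\<close>. Then adjoining \<open>z^c\<close>
    to \<open>L\<close> does not enlarge the intersection with \<open>J\<close>, so by maximality
    \<open>z^c\<close> was in \<open>L\<close> already.\<close>
  have pw: "\<exists>c. z [^] (c::nat) \<in> L" if z: "z \<in> carrier R" and zJ: "\<And>w. w \<in> J \<Longrightarrow> z \<otimes> w \<in> L" for z
  proof -
    define T where "T i = {r \<in> carrier R. z [^] (i::nat) \<otimes> r \<in> L}" for i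
    have zp: "z [^] i \<in> carrier R" for i :: nat using z by simp
    have T: "submodule (T i) R (self_module R)" for i
      using module_map.submodule_vimage[OF S.smult_map[OF zp] S.carrier_is_submodule sL, of i]
      by (simp add: T_def)
    have Tinc: "T i \<subseteq> T (Suc i)" for i
    proof
      fix r assume r: "r \<in> T i"
      have "z [^] Suc i \<otimes> r = z \<otimes> (z [^] i \<otimes> r)" using r z by (simp add: T_def m_ac)
      moreover have "z \<otimes> (z [^] i \<otimes> r) \<in> L" using S.submoduleE(4)[OF sL z, of "z [^] i \<otimes> r"] r by (simp add: T_def)
      ultimately show "r \<in> T (Suc i)" using r unfolding T_def by simp
    qed
    obtain c where c: "\<forall>i\<ge>c. T i = T c"
      using acc_moduleD[of R "self_module R" T, OF S.acc T Tinc] by blast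
    let ?v = "z [^] c"
    have vc: "?v \<in> carrier (self_module R)" using zp by simp
    let ?L = "L <+>\<^bsub>self_module R\<^esub> S.cyclic ?v"
    have sL': "submodule ?L R (self_module R)" by (rule S.submodule_set_add[OF sL S.submodule_cyclic[OF vc]])
    have LL: "L \<subseteq> ?L" "?v \<in> ?L"
      using S.subset_set_add1[OF sL S.submodule_cyclic[OF vc]] S.subset_set_add2[OF sL S.submodule_cyclic[OF vc]]
        S.cyclic_self[OF vc] by auto
    have "?L \<inter> J \<subseteq> ?X"
    proof
      fix w assume w: "w \<in> ?L \<inter> J"
      hence "w \<in> ?L" by blast
      then obtain l r where lr: "l \<in> L" "r \<in> carrier R" "w = l \<oplus> r \<otimes> ?v"
        unfolding S.cyclic_def set_add_iff by auto
      have lc: "l \<in> carrier R" using lr(1) S.submodule_carr[OF sL] by simp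
      have "z \<otimes> w = z \<otimes> l \<oplus> z [^] Suc c \<otimes> r"
        using lr z lc by (simp add: r_distr m_ac)
      moreover have "z \<otimes> w \<in> L" using zJ w by blast
      moreover have "z \<otimes> l \<in> L" using S.submoduleE(4)[OF sL z lr(1)] by simp
      ultimately have "z [^] Suc c \<otimes> r \<in> L"
        using S.submodule_add_cancel[OF sL, of "z \<otimes> l" "z [^] Suc c \<otimes> r"] z lr(2) by simp
      hence "r \<in> T (Suc c)" using lr(2) unfolding T_def by blast
      hence "r \<in> T c" using c[rule_format, of "Suc c"] by simp
      hence "r \<otimes> ?v \<in> L" using zp lr(2) by (simp add: T_def m_comm)
      hence "w \<in> L" using S.submoduleE(5)[OF sL lr(1)] lr(3) by simp
      thus "w \<in> ?X" using w LJ by blast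
    qed
    hence "?L = L" using L(2)[rule_format, of ?L] sL' XL LL by blast
    thus ?thesis using LL by blast
  qed
  obtain c1 where c1: "x [^] (c1::nat) \<in> L"
    using pw[OF x_carr] S.x_in_xy_mult[OF sJ] mX XL by auto
  obtain c2 where c2: "y [^] (c2::nat) \<in> L"
    using pw[OF y_carr] S.y_in_xy_mult[OF sJ] mX XL by auto
  have "mpow (c1 + c2) \<subseteq> L"
  proof
    fix v assume "v \<in> mpow (c1 + c2)"
    then obtain p q where pq: "p \<in> mpow c2" "q \<in> mpow c1" "v = x [^] c1 \<otimes> p \<oplus> y [^] c2 \<otimes> q"
      by (rule mpow_split)
    have "p \<otimes> x [^] c1 \<in> L" "q \<otimes> y [^] c2 \<in> L"
      using S.submoduleE(4)[OF sL _ c1, of p] S.submoduleE(4)[OF sL _ c2, of q] mpow_carr pq by simp_all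
    hence "p \<otimes> x [^] c1 \<oplus> q \<otimes> y [^] c2 \<in> L" using S.submoduleE(5)[OF sL] by simp
    thus "v \<in> L" unfolding pq(3) using mpow_carr[OF pq(1)] mpow_carr[OF pq(2)] by (simp add: m_comm)
  qed
  moreover have "I \<subseteq> L" using S.subset_set_add1[OF sI S.submodule_xy_mult[OF sJ]] XL by simp
  ultimately have "I <+>\<^bsub>R\<^esub> mpow (c1 + c2) \<subseteq> L" using S.set_add_subset[OF sL, of I "mpow (c1 + c2)"] by simp
  hence "J \<subseteq> L" by (auto simp: J_def)
  hence "J \<subseteq> ?X" using LJ by blast
  hence "I = J" using S.nakayama[OF sI sJ IJ] by simp
  moreover have "a \<in> J" using a by (auto simp: J_def)
  ultimately show ?thesis by simp
qed

lemma mpow_Inter_zero: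
  assumes "\<And>n. a \<in> mpow n"
  shows "a = \<zero>"
proof -
  have "a \<in> {\<zero>} <+>\<^bsub>R\<^esub> mpow n" for n
    using set_addI[of \<zero> "{\<zero>}" a "mpow n" R] assms[of n] mpow_carr[of a n] by simp
  thus ?thesis using krull_intersection[OF zeroideal, of a] by simp
qed

text \<open>The initial form of \<open>f\<close> is \<open>x^b F\<close>, where \<open>F\<close> has degree \<open>a\<close> and \<open>y^a\<close> occurs in \<open>F\<close>. Over any
  residue field the form \<open>x^(a+1) + y F\<close> is coprime to it.\<close>

lemma mpow_le_parameter_ideal:
  assumes F: "F \<in> mpow a" and u: "u \<in> carrier R" "u \<notin> \<mm>" and h: "h \<in> mpow a"
    and yF: "y \<otimes> F = u \<otimes> y [^] Suc a \<oplus> x \<otimes> h"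
    and f: "f \<in> mpow (a + b)" and init: "f \<ominus> x [^] b \<otimes> F \<in> mpow (Suc (a + b))"
  defines "z \<equiv> x [^] Suc a \<oplus> y \<otimes> F" and "k \<equiv> Suc a" and "d \<equiv> a + b"
  shows "z \<in> mpow k" and "v \<in> mpow (k * d + d + 1 + k) \<Longrightarrow>
    \<exists>p\<in>mpow (k * d + d + 1). \<exists>q\<in>mpow (k * d + 1 + k). v = z \<otimes> p \<oplus> f \<otimes> q"
proof -
  interpret S: noeth_module R "self_module R" x y by (rule noeth_self)
  have uU: "u \<in> Units R" using unit u by blast
  have c: "F \<in> carrier R" "h \<in> carrier R" "f \<in> carrier R" using F h f mpow_carr by blast+
  show zk: "z \<in> mpow k" unfolding z_def k_def by (rule mpow_add[OF x_pow_mpow y_mult_mpow[OF F]])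
  have zc: "z \<in> carrier R" using zk mpow_carr by blast
  \<comment> \<open>Membership in \<open>W N\<close> says that, up to terms of order
    \<open>N + 1\<close>, an element is a combination of \<open>z\<close> and \<open>f\<close> with
    coefficients of the complementary orders. Working modulo higher order lets \<open>f\<close> be
    replaced by \<open>x^b F\<close>.\<close>
  define W where "W N = {z \<otimes> p \<oplus> f \<otimes> q \<oplus> c | p q c. p \<in> mpow (N - k) \<and> q \<in> mpow (N - d) \<and> c \<in> mpow (Suc N)}" for N
  have W_I: "z \<otimes> p \<oplus> f \<otimes> q \<oplus> c \<in> W N" if "p \<in> mpow (N - k)" "q \<in> mpow (N - d)" "c \<in> mpow (Suc N)" for p q c N
    unfolding W_def using that by blast
  have W_E: "\<exists>p q c. p \<in> mpow (N - k) \<and> q \<in> mpow (N - d) \<and> c \<in> mpow (Suc N) \<and> v = z \<otimes> p \<oplus> f \<otimes> q \<oplus> c"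
    if "v \<in> W N" for v N
    using that unfolding W_def by blast
  have W_add: "v \<oplus> w \<in> W N" if "v \<in> W N" "w \<in> W N" for v w N
  proof -
    obtain p q c where 1: "p \<in> mpow (N - k)" "q \<in> mpow (N - d)" "c \<in> mpow (Suc N)" "v = z \<otimes> p \<oplus> f \<otimes> q \<oplus> c"
      using W_E[OF \<open>v \<in> W N\<close>] by blast
    obtain p' q' c' where 2: "p' \<in> mpow (N - k)" "q' \<in> mpow (N - d)" "c' \<in> mpow (Suc N)" "w = z \<otimes> p' \<oplus> f \<otimes> q' \<oplus> c'"
      using W_E[OF \<open>w \<in> W N\<close>] by blast
    note cc = mpow_carr[OF 1(1)] mpow_carr[OF 1(2)] mpow_carr[OF 1(3)] mpow_carr[OF 2(1)] mpow_carr[OF 2(2)] mpow_carr[OF 2(3)]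
    have "v \<oplus> w = z \<otimes> (p \<oplus> p') \<oplus> f \<otimes> (q \<oplus> q') \<oplus> (c \<oplus> c')"
      unfolding 1(4) 2(4) using cc zc c by (simp add: r_distr a_ac)
    thus ?thesis using W_I[of "p \<oplus> p'" N "q \<oplus> q'" "c \<oplus> c'"] mpow_add 1 2 by simp
  qed
  have W_mult: "v \<otimes> r \<in> W (N + j)" if v: "v \<in> W N" and r: "r \<in> mpow j" and N: "k \<le> N" "d \<le> N" for v r N j
  proof -
    obtain p q c where 1: "p \<in> mpow (N - k)" "q \<in> mpow (N - d)" "c \<in> mpow (Suc N)" "v = z \<otimes> p \<oplus> f \<otimes> q \<oplus> c"
      using W_E[OF v] by blast
    note cc = mpow_carr[OF 1(1)] mpow_carr[OF 1(2)] mpow_carr[OF 1(3)] mpow_carr[OF r]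
    have e: "v \<otimes> r = z \<otimes> (p \<otimes> r) \<oplus> f \<otimes> (q \<otimes> r) \<oplus> c \<otimes> r"
      unfolding 1(4) using cc zc c by (simp add: l_distr m_assoc)
    have "p \<otimes> r \<in> mpow (N + j - k)" "q \<otimes> r \<in> mpow (N + j - d)" "c \<otimes> r \<in> mpow (Suc (N + j))"
      using mpow_mult[OF 1(1) r] mpow_mult[OF 1(2) r] mpow_mult[OF 1(3) r] N by (simp_all add: Nat.add_diff_assoc2)
    thus ?thesis unfolding e by (rule W_I)
  qed
  have kd: "k \<le> Suc d" by (simp add: k_def d_def)
  \<comment> \<open>From \<open>x^(a+1) = z - y F\<close> one gets
    \<open>x^(d+1) = x^b z - y x^b F\<close>, and \<open>x^b F\<close> agrees with \<open>f\<close>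
    up to higher order.\<close>
  have xW: "x [^] Suc d \<in> W (Suc d)"
  proof -
    have xb: "x [^] b \<in> carrier R" by simp
    have "x [^] b \<otimes> F = f \<ominus> (f \<ominus> x [^] b \<otimes> F)" using c xb by (simp add: a_minus_def minus_add r_neg2)
    then obtain e where e: "e \<in> mpow (Suc (a + b))" "x [^] b \<otimes> F = f \<ominus> e" using init by blast
    have ec: "e \<in> carrier R" using e(1) mpow_carr by blast
    have x0: "x [^] Suc d = x [^] b \<otimes> x [^] Suc a"
      by (simp only: nat_pow_mult[OF x_carr] d_def) (simp add: add.commute)
    have "x [^] Suc a = z \<ominus> y \<otimes> F" using c by (simp add: z_def a_minus_def a_assoc r_neg)
    hence "x [^] Suc d = x [^] b \<otimes> (z \<ominus> y \<otimes> F)" using x0 by simp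
    also have "\<dots> = z \<otimes> x [^] b \<ominus> y \<otimes> (x [^] b \<otimes> F)"
      using c zc by (simp add: a_minus_def r_distr r_minus m_ac)
    also have "\<dots> = z \<otimes> x [^] b \<oplus> f \<otimes> (\<ominus> y) \<oplus> y \<otimes> e"
      unfolding e(2) using c zc ec xb by (simp add: a_minus_def r_distr r_minus l_minus minus_add m_ac a_ac)
    finally have "x [^] Suc d = z \<otimes> x [^] b \<oplus> f \<otimes> (\<ominus> y) \<oplus> y \<otimes> e" .
    moreover have "x [^] b \<in> mpow (Suc d - k)" using x_pow_mpow[of b] by (simp add: d_def k_def)
    moreover have "\<ominus> y \<in> mpow (Suc d - d)" using mpow_neg[of y "Suc 0"] unfolding mpow_1 by (simp add: Suc_diff_le mpow_1)
    moreover have "y \<otimes> e \<in> mpow (Suc (Suc d))" using y_mult_mpow[OF e(1)] by (simp add: d_def)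
    ultimately show ?thesis using W_I by simp
  qed
  have iu: "inv u \<in> carrier R" using uU by simp
  \<comment> \<open>Since \<open>z = x (x^a + h) + u y^k\<close> with \<open>u\<close> a unit,
    \<open>y^k\<close> is a multiple of \<open>z\<close> plus \<open>x ?q\<close>, and
    \<open>?q\<close> has order at least \<open>a\<close>.\<close>
  let ?q = "\<ominus> (inv u \<otimes> (x [^] a \<oplus> h))"
  have q: "?q \<in> mpow a" using mpow_neg mpow_l_mult[OF iu] mpow_add[OF x_pow_mpow h] by blast
  have qc: "?q \<in> carrier R" using q mpow_carr by blast
  have yk: "y [^] k = z \<otimes> inv u \<oplus> x \<otimes> ?q"
  proof -
    have "inv u \<otimes> (u \<otimes> y [^] Suc a) = y [^] Suc a"
      using m_assoc[OF iu u(1), of "y [^] Suc a"] Units_l_inv[OF uU] by (simp del: nat_pow_Suc)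
    moreover have "u \<otimes> y [^] Suc a = z \<ominus> x \<otimes> (x [^] a \<oplus> h)"
    proof -
      have "z = x \<otimes> (x [^] a \<oplus> h) \<oplus> u \<otimes> y [^] Suc a"
        unfolding z_def yF using c u by (simp add: r_distr m_ac a_ac)
      thus ?thesis using c u by (simp add: a_minus_def r_neg1 a_ac r_neg)
    qed
    ultimately have "y [^] Suc a = inv u \<otimes> (z \<ominus> x \<otimes> (x [^] a \<oplus> h))" by simp
    also have "\<dots> = z \<otimes> inv u \<oplus> x \<otimes> ?q"
      using c zc iu by (simp add: a_minus_def r_distr r_minus m_ac minus_add)
    finally show ?thesis by (simp only: k_def)
  qed
  \<comment> \<open>Modulo \<open>z\<close>, each factor \<open>y^k\<close> is traded for one factor
    \<open>x\<close>. After \<open>d + 1\<close> trades the power \<open>x^(d+1)\<close> appears,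
    which \<open>xW\<close> handles.\<close>
  have ykj: "\<exists>r s. r \<in> mpow (k * j) \<and> s \<in> mpow (a * Suc j) \<and> y [^] (k * Suc j) = z \<otimes> r \<oplus> x [^] Suc j \<otimes> s" for j
  proof (induction j)
    case 0
    show ?case using yk q iu by (intro exI[of _ "inv u"] exI[of _ ?q]) (simp del: nat_pow_Suc add: nat_pow_Suc[of x 0])
  next
    case (Suc j)
    then obtain r s where rs: "r \<in> mpow (k * j)" "s \<in> mpow (a * Suc j)" "y [^] (k * Suc j) = z \<otimes> r \<oplus> x [^] Suc j \<otimes> s"
      by blast
    note cc = mpow_carr[OF rs(1)] mpow_carr[OF rs(2)]
    have "y [^] (k * Suc (Suc j)) = y [^] k \<otimes> y [^] (k * Suc j)" by (simp add: nat_pow_mult)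
    also have "\<dots> = z \<otimes> (y [^] k \<otimes> r) \<oplus> x [^] Suc j \<otimes> s \<otimes> y [^] k"
      unfolding rs(3) using cc zc by (simp add: r_distr m_ac del: nat_pow_Suc)
    also have "x [^] Suc j \<otimes> s \<otimes> y [^] k = z \<otimes> (inv u \<otimes> (x [^] Suc j \<otimes> s)) \<oplus> x [^] Suc (Suc j) \<otimes> (s \<otimes> ?q)"
      unfolding yk nat_pow_Suc[of x "Suc j"] using cc zc iu qc by (simp add: r_distr m_ac del: nat_pow_Suc)
    finally have "y [^] (k * Suc (Suc j)) = z \<otimes> (y [^] k \<otimes> r) \<oplus> (z \<otimes> (inv u \<otimes> (x [^] Suc j \<otimes> s)) \<oplus> x [^] Suc (Suc j) \<otimes> (s \<otimes> ?q))" .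
    also have "\<dots> = z \<otimes> (y [^] k \<otimes> r \<oplus> inv u \<otimes> (x [^] Suc j \<otimes> s)) \<oplus> x [^] Suc (Suc j) \<otimes> (s \<otimes> ?q)"
      using cc zc iu qc by (simp add: r_distr a_assoc del: nat_pow_Suc)
    finally have e: "y [^] (k * Suc (Suc j)) = z \<otimes> (y [^] k \<otimes> r \<oplus> inv u \<otimes> (x [^] Suc j \<otimes> s)) \<oplus> x [^] Suc (Suc j) \<otimes> (s \<otimes> ?q)" .
    have m1: "y [^] k \<otimes> r \<in> mpow (k * Suc j)" using mpow_mult[OF y_pow_mpow[of k] rs(1)] by simp
    have "x [^] Suc j \<otimes> s \<in> mpow (Suc j + a * Suc j)" by (rule mpow_mult[OF x_pow_mpow rs(2)])
    moreover have "Suc j + a * Suc j = k * Suc j" by (simp add: k_def)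
    ultimately have "inv u \<otimes> (x [^] Suc j \<otimes> s) \<in> mpow (k * Suc j)" using mpow_l_mult[OF iu] by metis
    hence m2: "y [^] k \<otimes> r \<oplus> inv u \<otimes> (x [^] Suc j \<otimes> s) \<in> mpow (k * Suc j)" using m1 mpow_add by blast
    have m3: "s \<otimes> ?q \<in> mpow (a * Suc (Suc j))" using mpow_mult[OF rs(2) q] by (simp add: add.commute)
    show ?case using m2 m3 e by blast
  qed
  have yW: "y [^] (k * Suc d) \<in> W (k * Suc d)"
  proof -
    obtain r s where rs: "r \<in> mpow (k * d)" "s \<in> mpow (a * Suc d)" "y [^] (k * Suc d) = z \<otimes> r \<oplus> x [^] Suc d \<otimes> s"
      using ykj[of d] by blast
    have "x [^] Suc d \<otimes> s \<in> W (Suc d + a * Suc d)" using W_mult[OF xW rs(2) kd] by simp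
    moreover have "Suc d + a * Suc d = k * Suc d" by (simp add: k_def)
    ultimately have "x [^] Suc d \<otimes> s \<in> W (k * Suc d)" by (simp only:)
    moreover have "z \<otimes> r \<in> W (k * Suc d)"
      using W_I[of r "k * Suc d" \<zero> \<zero>] rs(1) mpow_carr[OF rs(1)] zc c by simp
    ultimately show ?thesis unfolding rs(3) by (rule W_add[rotated])
  qed
  \<comment> \<open>This is \<open>(d + 1) + k (d + 1)\<close>, the degree in which
    \<open>mpow_split\<close> produces a factor \<open>x^(d+1)\<close> or
    \<open>y^(k (d+1))\<close>.\<close>
  let ?N = "k * d + d + 1 + k"
  have N: "?N = Suc d + k * Suc d" by simp
  have mW: "mpow ?N \<subseteq> W ?N"
  proof
    fix v assume "v \<in> mpow ?N"
    hence "v \<in> mpow (Suc d + k * Suc d)" unfolding N .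
    then obtain p q where pq: "p \<in> mpow (k * Suc d)" "q \<in> mpow (Suc d)"
      "v = x [^] Suc d \<otimes> p \<oplus> y [^] (k * Suc d) \<otimes> q" by (rule mpow_split)
    have "d \<le> k * Suc d" "k \<le> k * Suc d" by (simp_all add: k_def)
    hence "y [^] (k * Suc d) \<otimes> q \<in> W (k * Suc d + Suc d)" using W_mult[OF yW pq(2)] by blast
    moreover have "x [^] Suc d \<otimes> p \<in> W (Suc d + k * Suc d)" using W_mult[OF xW pq(1) kd] by simp
    ultimately show "v \<in> W ?N" unfolding pq(3) N by (simp only: add.commute[of "k * Suc d"] W_add)
  qed
  let ?V = "(\<lambda>v. z \<odot>\<^bsub>self_module R\<^esub> v) ` mpow (k * d + d + 1) <+>\<^bsub>self_module R\<^esub> (\<lambda>v. f \<odot>\<^bsub>self_module R\<^esub> v) ` mpow (k * d + 1 + k)"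
  have sV: "submodule ?V R (self_module R)"
    by (intro S.submodule_set_add S.submodule_smult submodule_mpow zc c)
  have V_iff: "w \<in> ?V \<longleftrightarrow> (\<exists>p\<in>mpow (k * d + d + 1). \<exists>q\<in>mpow (k * d + 1 + k). w = z \<otimes> p \<oplus> f \<otimes> q)" for w
    unfolding set_add_iff by auto
  have VN: "?V \<subseteq> mpow ?N"
  proof
    fix w assume "w \<in> ?V"
    then obtain p q where pq: "p \<in> mpow (k * d + d + 1)" "q \<in> mpow (k * d + 1 + k)" "w = z \<otimes> p \<oplus> f \<otimes> q"
      unfolding V_iff by blast
    have "z \<otimes> p \<in> mpow ?N" "f \<otimes> q \<in> mpow ?N"
      using mpow_mult[OF zk pq(1)] mpow_mult[OF f pq(2)] unfolding d_def[symmetric] by (simp_all add: ac_simps)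
    thus "w \<in> mpow ?N" unfolding pq(3) by (rule mpow_add)
  qed
  \<comment> \<open>Nakayama absorbs the error terms of order \<open>?N + 1\<close>.\<close>
  have "?V = mpow ?N"
  proof (rule S.nakayama[OF sV submodule_mpow VN])
    show "mpow ?N \<subseteq> ?V <+>\<^bsub>self_module R\<^esub> S.xy_mult (mpow ?N)"
    proof
      fix v assume "v \<in> mpow ?N"
      hence "v \<in> W ?N" using mW by blast
      then obtain p q e where e: "p \<in> mpow (?N - k)" "q \<in> mpow (?N - d)" "e \<in> mpow (Suc ?N)" "v = z \<otimes> p \<oplus> f \<otimes> q \<oplus> e"
        using W_E by blast
      have N': "?N - k = k * d + d + 1" "?N - d = k * d + 1 + k" by simp_all
      have "z \<otimes> p \<oplus> f \<otimes> q \<in> ?V" unfolding V_iff using e(1,2)[unfolded N'] by blast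
      thus "v \<in> ?V <+>\<^bsub>self_module R\<^esub> S.xy_mult (mpow ?N)"
        using set_addI[of "z \<otimes> p \<oplus> f \<otimes> q" ?V e "S.xy_mult (mpow ?N)" "self_module R"] e(3,4)
        unfolding two_gen_mult_mpow by simp
    qed
  qed
  thus "v \<in> mpow ?N \<Longrightarrow> \<exists>p\<in>mpow (k * d + d + 1). \<exists>q\<in>mpow (k * d + 1 + k). v = z \<otimes> p \<oplus> f \<otimes> q"
    using V_iff[of v] by blast
qed

text \<open>In the normal form \<open>p = x q + u y^(n+1)\<close>, a unit \<open>u\<close> lets
  \<open>p\<close> itself serve as \<open>F\<close>. Otherwise \<open>u y^(n+1)\<close> has higher
  order, and the induction continues with \<open>q\<close>, recording one more factor
  \<open>x\<close> in \<open>b\<close>.\<close>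

lemma initial_form_decomposition:
  assumes "p \<in> mpow n" "p \<notin> mpow (Suc n)"
  obtains a b F u h where "a + b = n" "F \<in> mpow a" "u \<in> carrier R" "u \<notin> \<mm>" "h \<in> mpow a"
    "y \<otimes> F = u \<otimes> y [^] Suc a \<oplus> x \<otimes> h" "p \<ominus> x [^] b \<otimes> F \<in> mpow (Suc n)"
  using assms
proof (induction n arbitrary: p thesis)
  case 0
  have pc: "p \<in> carrier R" using 0(2) by simp
  have "p \<notin> \<mm>" using 0(3) unfolding mpow_1 .
  thus ?case using 0(1)[of 0 0 p p \<zero>] pc by (simp add: m_comm a_minus_def r_neg)
next
  case (Suc n)
  obtain q u where qu: "q \<in> mpow n" "u \<in> carrier R" "p = x \<otimes> q \<oplus> u \<otimes> y [^] Suc n"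
    using mpow_Suc_cases[OF Suc.prems(2)] .
  note qc = mpow_carr[OF qu(1)] and pc = mpow_carr[OF Suc.prems(2)]
  show ?case
  proof (cases "u \<in> \<mm>")
    case False
    have "y \<otimes> p = u \<otimes> y [^] Suc (Suc n) \<oplus> x \<otimes> (y \<otimes> q)"
      unfolding qu(3) using qc qu(2) by (simp add: r_distr m_ac a_ac)
    moreover have "p \<ominus> x [^] (0::nat) \<otimes> p = \<zero>" using pc by (simp add: a_minus_def r_neg)
    ultimately show ?thesis
      using Suc.prems(1)[of "Suc n" 0 p u "y \<otimes> q"] Suc.prems(2) qu(2) False y_mult_mpow[OF qu(1)] by simp
  next
    case True
    have uy: "u \<otimes> y [^] Suc n \<in> mpow (Suc (Suc n))" by (rule mm_mult_mpow[OF True y_pow_mpow])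
    have "q \<notin> mpow (Suc n)"
    proof
      assume "q \<in> mpow (Suc n)"
      hence "p \<in> mpow (Suc (Suc n))" unfolding qu(3) using x_mult_mpow uy mpow_add by blast
      thus False using Suc.prems(3) by blast
    qed
    then obtain a b F w h where h: "a + b = n" "F \<in> mpow a" "w \<in> carrier R" "w \<notin> \<mm>" "h \<in> mpow a"
      "y \<otimes> F = w \<otimes> y [^] Suc a \<oplus> x \<otimes> h" "q \<ominus> x [^] b \<otimes> F \<in> mpow (Suc n)"
      using Suc.IH[OF _ qu(1)] by blast
    note Fc = mpow_carr[OF h(2)]
    have "p \<ominus> x [^] Suc b \<otimes> F = x \<otimes> (q \<ominus> x [^] b \<otimes> F) \<oplus> u \<otimes> y [^] Suc n"
      unfolding qu(3) using qc Fc qu(2) by (simp add: a_minus_def r_distr r_minus m_ac a_ac)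
    moreover have "x \<otimes> (q \<ominus> x [^] b \<otimes> F) \<oplus> u \<otimes> y [^] Suc n \<in> mpow (Suc (Suc n))"
      using x_mult_mpow[OF h(7)] uy mpow_add by blast
    ultimately have e: "p \<ominus> x [^] Suc b \<otimes> F \<in> mpow (Suc (Suc n))" by simp
    have s: "a + Suc b = Suc n" using h(1) by simp
    show ?thesis by (rule Suc.prems(1)[OF s h(2-6) e])
  qed
qed

end

section \<open>Two-dimensional regular local rings\<close>

lemma enat_add_eq_self: "enat l + b = enat l \<Longrightarrow> b = 0"
  by (cases b) (auto simp: zero_enat_def)

lemma (in cring) primeideal_pow:
  assumes P: "primeideal P R" and a: "a \<in> carrier R" "a [^] (n::nat) \<in> P"
  shows "a \<in> P"
  using a(2)
proof (induction n)
  case 0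
  have "P = carrier R" using 0 ideal.one_imp_carrier[OF primeideal.axioms(1)[OF P]] by simp
  thus ?case using primeideal.I_notcarr[OF P] by simp
next
  case (Suc n)
  thus ?case using primeideal.I_prime[OF P, of "a [^] n" a] a(1) by auto
qed

lemma (in cring) cgenideal_iff: "a \<in> carrier R \<Longrightarrow> v \<in> PIdl a \<longleftrightarrow> (\<exists>r\<in>carrier R. v = a \<otimes> r)"
  unfolding cgenideal_def using m_comm by auto

lemma (in cring) submodule_cgenideal: "a \<in> carrier R \<Longrightarrow> submodule (PIdl a) R (self_module R)"
  by (simp add: submodule_self_iff cgenideal_ideal)

lemma (in cring) cgenideal_image: "a \<in> carrier R \<Longrightarrow> (\<lambda>v. a \<otimes> v) ` carrier R = PIdl a"
  by (auto simp: cgenideal_iff)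

text \<open>The chain of primes is the form in which dimension at least two enters; together with
  two generators of the maximal ideal it makes \<open>R\<close> regular.\<close>

locale two_dim_local = two_gen_local +
  assumes prime_chain:
    "\<exists>P0 P1 P2. primeideal P0 R \<and> primeideal P1 R \<and> primeideal P2 R \<and> P0 \<subset> P1 \<and> P1 \<subset> P2"
begin

text \<open>A case of Krull's principal ideal theorem. For \<open>a \<in> P1 - P0\<close>, saturating
  \<open>P0 + (a)\<close> with respect to \<open>z\<close> and comparing lengths modulo \<open>z\<close> shows that a power of
  \<open>z\<close> lies in \<open>P0 + (a) \<subseteq> P1\<close>.\<close>

lemma mpow_not_le_principal:
  assumes z: "z \<in> \<mm>" and N: "\<And>v. v \<in> mpow N \<Longrightarrow> v \<in> PIdl z"
  shows False
proof -
  interpret S: noeth_module R "self_module R" x y by (rule noeth_self)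
  obtain P0 P1 P2 where P: "primeideal P0 R" "primeideal P1 R" "primeideal P2 R" "P0 \<subset> P1" "P1 \<subset> P2"
    using prime_chain by blast
  note I0 = primeideal.axioms(1)[OF P(1)] and I1 = primeideal.axioms(1)[OF P(2)] and I2 = primeideal.axioms(1)[OF P(3)]
  have zc: "z \<in> carrier R" using z mm_carr by blast
  have "\<one> \<notin> P2" using primeideal.I_notcarr[OF P(3)] ideal.one_imp_carrier[OF I2] by blast
  hence P2m: "P2 \<subseteq> \<mm>" using proper_ideal_le_mm[OF I2] by blast
  \<comment> \<open>Otherwise \<open>P1\<close> contains a power of m, hence m itself, and no room
    is left for \<open>P2\<close>.\<close>
  have zP1: "z \<notin> P1"
  proof
    assume zP: "z \<in> P1"
    hence "PIdl z \<subseteq> P1" using cgenideal_minimal[OF I1] by blast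
    hence "x [^] N \<in> P1" "y [^] N \<in> P1" using N x_pow_mpow y_pow_mpow by blast+
    hence xy: "x \<in> P1" "y \<in> P1" using primeideal_pow[OF P(2)] by auto
    have "\<mm> \<subseteq> P1"
      using ideal.I_r_closed[OF I1 xy(1)] ideal.I_r_closed[OF I1 xy(2)]
        additive_subgroup.a_closed[OF ideal.axioms(1)[OF I1]] by (auto simp: two_gen_def)
    thus False using P2m P(5) by blast
  qed
  have s0: "submodule P0 R (self_module R)" and s1: "submodule P1 R (self_module R)"
    using I0 I1 by (simp_all add: submodule_self_iff)
  note sR = S.carrier_is_submodule
  obtain a where a: "a \<in> P1" "a \<notin> P0" using P(4) by blast
  have ac: "a \<in> carrier R" using a ideal.Icarr[OF I1] by blast
  let ?M = "self_module R"
  let ?z = "\<lambda>A. P0 <+>\<^bsub>?M\<^esub> (\<lambda>v. z \<odot>\<^bsub>?M\<^esub> v) ` A"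
  let ?a = "\<lambda>A. P0 <+>\<^bsub>?M\<^esub> (\<lambda>v. a \<odot>\<^bsub>?M\<^esub> v) ` A"
  let ?K = "?a (carrier ?M)"
  have acM: "a \<in> carrier R" "z \<in> carrier R" using ac zc by auto
  have sK: "submodule ?K R ?M" using S.submodule_set_add[OF s0 S.submodule_smult[OF ac sR]] .
  have szR: "submodule (?z (carrier ?M)) R ?M" using S.submodule_set_add[OF s0 S.submodule_smult[OF zc sR]] .
  have reg: "v \<in> P0" if "v \<in> carrier ?M" "z \<odot>\<^bsub>?M\<^esub> v \<in> P0" for v
    using primeideal.I_prime[OF P(1) zc, of v] that zP1 P(4) by auto
  have rega: "v \<in> P0" if "v \<in> carrier ?M" "a \<odot>\<^bsub>?M\<^esub> v \<in> P0" for v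
    using primeideal.I_prime[OF P(1) ac, of v] that a by auto
  have EK: "P0 \<subseteq> ?K" using S.subset_set_add1[OF s0 S.submodule_smult[OF ac sR]] .
  have Ez: "P0 \<subseteq> ?z (carrier ?M)" using S.subset_set_add1[OF s0 S.submodule_smult[OF zc sR]] .
  have KR: "?K \<subseteq> carrier ?M" using S.submoduleE(1)[OF sK] .
  have zR: "?z (carrier ?M) \<subseteq> carrier ?M" using S.submoduleE(1)[OF szR] .
  have "mpow N \<subseteq> PIdl z" using N by blast
  also have "PIdl z \<subseteq> ?z (carrier ?M)"
    using S.subset_set_add2[OF s0 S.submodule_smult[OF zc sR]] cgenideal_image[OF zc] by simp
  finally have "mlen R ?M (?z (carrier ?M)) (carrier R) \<le> mlen R ?M (mpow N) (carrier R)"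
    by (intro mlen_mono) auto
  hence "mlen R ?M (?z (carrier ?M)) (carrier ?M) \<noteq> \<infinity>"
    using mlen_mpow_finite[of N] by (simp only: self_module_simps) (metis enat_ord_simps(5))
  then obtain l where l: "mlen R ?M (?z (carrier ?M)) (carrier ?M) = enat l" by blast
  obtain W c where W: "submodule W R ?M" "?K \<subseteq> W" "W \<subseteq> carrier ?M"
    "\<And>v. v \<in> W \<Longrightarrow> (z [^] (c::nat)) \<odot>\<^bsub>?M\<^esub> v \<in> ?K"
    "mlen R ?M (?z ?K) ?K + mlen R ?M (W <+>\<^bsub>?M\<^esub> (\<lambda>v. z \<odot>\<^bsub>?M\<^esub> v) ` carrier ?M) (carrier ?M) = enat l"
    using S.mlen_mod_smult_saturation[OF S.acc zc s0 sK sR EK KR reg l] by blast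
  \<comment> \<open>Both sides equal \<open>P0 + z a R\<close>.\<close>
  have e: "?z ?K = ?a (?z (carrier ?M))"
  proof -
    have c0: "p \<in> carrier R" if "p \<in> P0" for p using that ideal.Icarr[OF I0] by blast
    have "?z ?K = P0 <+>\<^bsub>?M\<^esub> (\<lambda>v. (z \<otimes> a) \<otimes> v) ` carrier R"
    proof (intro equalityI subsetI)
      fix w assume "w \<in> ?z ?K"
      then obtain p q r where h: "p \<in> P0" "q \<in> P0" "r \<in> carrier R" "w = p \<oplus> z \<otimes> (q \<oplus> a \<otimes> r)"
        by (auto simp: set_add_iff)
      have "w = (p \<oplus> z \<otimes> q) \<oplus> (z \<otimes> a) \<otimes> r"
        using h(4) c0[OF h(1)] c0[OF h(2)] h(3) ac zc by (simp add: r_distr a_assoc m_assoc)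
      moreover have "p \<oplus> z \<otimes> q \<in> P0" using S.submoduleE(4,5)[OF s0] h zc by simp
      ultimately show "w \<in> P0 <+>\<^bsub>?M\<^esub> (\<lambda>v. (z \<otimes> a) \<otimes> v) ` carrier R"
        using h(3) by (auto simp: set_add_iff)
    next
      fix w assume "w \<in> P0 <+>\<^bsub>?M\<^esub> (\<lambda>v. (z \<otimes> a) \<otimes> v) ` carrier R"
      then obtain p r where h: "p \<in> P0" "r \<in> carrier R" "w = p \<oplus> (z \<otimes> a) \<otimes> r" by (auto simp: set_add_iff)
      have "a \<otimes> r \<in> ?K" using S.subset_set_add2[OF s0 S.submodule_smult[OF ac sR]] h(2) by auto
      moreover have "w = p \<oplus> z \<otimes> (a \<otimes> r)" using h ac zc by (simp add: m_assoc)
      ultimately show "w \<in> ?z ?K" unfolding set_add_iff[of w] using h(1) by auto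
    qed
    moreover have "?a (?z (carrier ?M)) = P0 <+>\<^bsub>?M\<^esub> (\<lambda>v. (z \<otimes> a) \<otimes> v) ` carrier R"
    proof (intro equalityI subsetI)
      fix w assume "w \<in> ?a (?z (carrier ?M))"
      then obtain p q r where h: "p \<in> P0" "q \<in> P0" "r \<in> carrier R" "w = p \<oplus> a \<otimes> (q \<oplus> z \<otimes> r)"
        by (auto simp: set_add_iff)
      have "w = (p \<oplus> a \<otimes> q) \<oplus> (z \<otimes> a) \<otimes> r"
        using h(4) c0[OF h(1)] c0[OF h(2)] h(3) ac zc by (simp add: r_distr a_assoc m_ac)
      moreover have "p \<oplus> a \<otimes> q \<in> P0" using S.submoduleE(4,5)[OF s0] h ac by simp
      ultimately show "w \<in> P0 <+>\<^bsub>?M\<^esub> (\<lambda>v. (z \<otimes> a) \<otimes> v) ` carrier R"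
        using h(3) by (auto simp: set_add_iff)
    next
      fix w assume "w \<in> P0 <+>\<^bsub>?M\<^esub> (\<lambda>v. (z \<otimes> a) \<otimes> v) ` carrier R"
      then obtain p r where h: "p \<in> P0" "r \<in> carrier R" "w = p \<oplus> (z \<otimes> a) \<otimes> r" by (auto simp: set_add_iff)
      have "z \<otimes> r \<in> ?z (carrier ?M)" using S.subset_set_add2[OF s0 S.submodule_smult[OF zc sR]] h(2) by auto
      moreover have "w = p \<oplus> a \<otimes> (z \<otimes> r)" using h ac zc by (simp add: m_ac)
      ultimately show "w \<in> ?a (?z (carrier ?M))" unfolding set_add_iff[of w] using h(1) by auto
    qed
    ultimately show ?thesis by simp
  qed
  \<comment> \<open>Multiplication by \<open>a\<close>, injective modulo \<open>P0\<close>,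
    identifies R/(P0 + zR) with \<open>?K\<close> modulo \<open>P0 + z ?K\<close>. So this summand
    alone exhausts \<open>l\<close>, which leaves \<open>R = W + zR\<close> for the saturation
    \<open>W\<close>.\<close>
  have lK: "mlen R ?M (?z ?K) ?K = enat l"
    unfolding e l[symmetric]
    by (rule S.mlen_smult_image[OF ac s0 szR sR zR]) (use rega Ez in blast)
  have zero: "mlen R ?M (W <+>\<^bsub>?M\<^esub> (\<lambda>v. z \<odot>\<^bsub>?M\<^esub> v) ` carrier ?M) (carrier ?M) = 0"
    by (rule enat_add_eq_self[OF W(5)[unfolded lK]])
  have sW: "submodule (W <+>\<^bsub>?M\<^esub> (\<lambda>v. z \<odot>\<^bsub>?M\<^esub> v) ` carrier ?M) R ?M"
    using S.submodule_set_add[OF W(1) S.submodule_smult[OF zc sR]] .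
  have "W <+>\<^bsub>?M\<^esub> (\<lambda>v. z \<odot>\<^bsub>?M\<^esub> v) ` carrier ?M = carrier ?M"
    using S.mlen_zero_iff[OF sW sR S.submoduleE(1)[OF sW]] zero by blast
  hence "\<one> \<in> W <+>\<^bsub>?M\<^esub> (\<lambda>v. z \<odot>\<^bsub>?M\<^esub> v) ` carrier ?M" by simp
  then obtain w r where w: "w \<in> W" "r \<in> carrier R" "\<one> = w \<oplus> z \<otimes> r" by (auto simp: set_add_iff)
  have "\<one> \<in> W"
  proof (rule ccontr)
    assume "\<one> \<notin> W"
    hence "w \<in> \<mm>" using proper_ideal_le_mm[of W] W(1) w(1) by (auto simp: submodule_self_iff)
    hence "\<one> \<in> \<mm>" using mm_add mm_mult'[OF z w(2)] w(3) by simp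
    thus False using one_notin by simp
  qed
  hence "z [^] c \<in> ?K" using W(4)[of \<one>] zc by simp
  moreover have "(\<lambda>v. a \<odot>\<^bsub>?M\<^esub> v) ` carrier ?M \<subseteq> P1"
    using ideal.I_r_closed[OF I1 a(1)] by auto
  hence "?K \<subseteq> P1" using S.set_add_subset[OF s1, of P0] P(4) by blast
  ultimately have "z \<in> P1" using primeideal_pow[OF P(2) zc] by blast
  thus False using zP1 by simp
qed

text \<open>If the product had higher order, \<open>mpow_le_parameter_ideal\<close> would apply with
  \<open>f = 0\<close> and put a power of m into the principal ideal of \<open>z\<close>, against
  dimension two.\<close>

lemma initial_form_nonzero:
  assumes F: "F \<in> mpow a" and u: "u \<in> carrier R" "u \<notin> \<mm>" and h: "h \<in> mpow a"
    and yF: "y \<otimes> F = u \<otimes> y [^] Suc a \<oplus> x \<otimes> h"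
  shows "x [^] b \<otimes> F \<notin> mpow (Suc (a + b))"
proof
  assume "x [^] b \<otimes> F \<in> mpow (Suc (a + b))"
  moreover have Fc: "F \<in> carrier R" using F mpow_carr by blast
  hence e: "\<zero> \<ominus> x [^] b \<otimes> F = \<ominus> (x [^] b \<otimes> F)" by (simp add: a_minus_def)
  ultimately have init: "\<zero> \<ominus> x [^] b \<otimes> F \<in> mpow (Suc (a + b))" using mpow_neg by simp
  note Z = mpow_le_parameter_ideal[OF F u h yF mpow_zero init]
  let ?z = "x [^] Suc a \<oplus> y \<otimes> F"
  have zc: "?z \<in> carrier R" using Z(1) mpow_carr by blast
  have "?z \<in> \<mm>" using mpow_le[OF Z(1), of "Suc 0"] by (simp add: mpow_1)
  moreover have "v \<in> PIdl ?z" if v: "v \<in> mpow (Suc a * (a + b) + (a + b) + 1 + Suc a)" for v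
  proof -
    obtain p q where pq: "p \<in> mpow (Suc a * (a + b) + (a + b) + 1)" "q \<in> mpow (Suc a * (a + b) + 1 + Suc a)"
      "v = ?z \<otimes> p \<oplus> \<zero> \<otimes> q"
      using Z(2)[OF v] by blast
    have "v = ?z \<otimes> p" using pq(3) mpow_carr[OF pq(1)] mpow_carr[OF pq(2)] zc by simp
    thus ?thesis using cgenideal_iff[OF zc] mpow_carr[OF pq(1)] by blast
  qed
  ultimately show False by (rule mpow_not_le_principal)
qed

text \<open>The monomials of degree \<open>n + 1\<close> are independent modulo m. A unit
  \<open>u\<close> would give a vanishing form in which the power of \<open>y\<close> has a unit
  coefficient; with \<open>u\<close> in m, \<open>x\<close> times the initial form of
  \<open>p\<close> would vanish.\<close>

lemma quasi_regular:
  assumes p: "p \<in> mpow n" and u: "u \<in> carrier R" and v: "x \<otimes> p \<oplus> u \<otimes> y [^] Suc n \<in> mpow (Suc (Suc n))"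
  shows "p \<in> mpow (Suc n)" "u \<in> \<mm>"
proof -
  have pc: "p \<in> carrier R" using p mpow_carr by blast
  let ?F = "x \<otimes> p \<oplus> u \<otimes> y [^] Suc n"
  show um: "u \<in> \<mm>"
  proof (rule ccontr)
    assume nu: "u \<notin> \<mm>"
    have F: "?F \<in> mpow (Suc n)" using v mpow_Suc_subset by blast
    have "y \<otimes> ?F = u \<otimes> y [^] Suc (Suc n) \<oplus> x \<otimes> (y \<otimes> p)"
      using pc u by (simp add: r_distr m_ac a_ac)
    from initial_form_nonzero[OF F u nu y_mult_mpow[OF p] this, of 0] v pc u show False by simp
  qed
  have "u \<otimes> y [^] Suc n \<in> mpow (Suc (Suc n))" by (rule mm_mult_mpow[OF um y_pow_mpow])
  from mpow_minus[OF v this] have xp: "x \<otimes> p \<in> mpow (Suc (Suc n))"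
    using pc u by (simp add: a_minus_def a_assoc r_neg)
  show "p \<in> mpow (Suc n)"
  proof (rule ccontr)
    assume np: "p \<notin> mpow (Suc n)"
    obtain a b F w h where h: "a + b = n" "F \<in> mpow a" "w \<in> carrier R" "w \<notin> \<mm>" "h \<in> mpow a"
      "y \<otimes> F = w \<otimes> y [^] Suc a \<oplus> x \<otimes> h" "p \<ominus> x [^] b \<otimes> F \<in> mpow (Suc n)"
      using initial_form_decomposition[OF p np] .
    have Fc: "F \<in> carrier R" using h(2) mpow_carr by blast
    have "x [^] Suc b \<otimes> F = x \<otimes> p \<ominus> x \<otimes> (p \<ominus> x [^] b \<otimes> F)"
      using pc Fc by (simp add: a_minus_def r_distr r_minus minus_add r_neg2 m_ac)
    hence "x [^] Suc b \<otimes> F \<in> mpow (Suc (Suc n))" using mpow_minus[OF xp x_mult_mpow[OF h(7)]] by simp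
    thus False using initial_form_nonzero[OF h(2-6), of "Suc b"] h(1) by simp
  qed
qed

lemma x_mult_mpow_cancel: "p \<in> mpow n \<Longrightarrow> x \<otimes> p \<in> mpow (Suc (Suc n)) \<Longrightarrow> p \<in> mpow (Suc n)"
  using quasi_regular(1)[of p n \<zero>] mpow_carr[of p n] by simp

lemma unit_notin_mm: "a \<in> Units R \<Longrightarrow> a \<notin> \<mm>"
  using mm_mult[of "inv a" a] one_notin by auto

lemma unit_mult_mpow_cancel:
  assumes "a \<in> carrier R" "a \<notin> \<mm>" "b \<in> carrier R" "a \<otimes> b \<in> mpow n"
  shows "b \<in> mpow n"
proof -
  have a: "a \<in> Units R" using unit assms by blast
  have "inv a \<otimes> (a \<otimes> b) = b" using a assms by (simp add: m_assoc[symmetric])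
  thus ?thesis using mpow_l_mult[OF Units_inv_closed[OF a] assms(4)] by simp
qed

text \<open>If the coefficient \<open>u\<close> of the power of \<open>y\<close> is in m, only
  \<open>x p\<close> contributes to the initial form, and the factor \<open>x\<close>
  cancels.\<close>

lemma mult_notin_mpow_step:
  assumes IH: "\<And>p. p \<in> mpow i \<Longrightarrow> p \<notin> mpow (Suc i) \<Longrightarrow> p \<otimes> b \<notin> mpow (Suc (i + j))"
    and b: "b \<in> mpow j" and p: "p \<in> mpow i" and u: "u \<in> \<mm>"
    and a: "x \<otimes> p \<oplus> u \<otimes> y [^] Suc i \<notin> mpow (Suc (Suc i))"
  shows "(x \<otimes> p \<oplus> u \<otimes> y [^] Suc i) \<otimes> b \<notin> mpow (Suc (Suc i + j))"
proof
  note c = mpow_carr[OF b] mpow_carr[OF p] mm_carr[OF u]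
  have uy: "u \<otimes> y [^] Suc i \<in> mpow (Suc (Suc i))" by (rule mm_mult_mpow[OF u y_pow_mpow])
  have "p \<notin> mpow (Suc i)" using a x_mult_mpow[of p "Suc i"] uy mpow_add by blast
  hence pb: "p \<otimes> b \<notin> mpow (Suc (i + j))" using IH p by blast
  assume "(x \<otimes> p \<oplus> u \<otimes> y [^] Suc i) \<otimes> b \<in> mpow (Suc (Suc i + j))"
  moreover have "(u \<otimes> y [^] Suc i) \<otimes> b \<in> mpow (Suc (Suc i + j))" using mpow_mult[OF uy b] by simp
  ultimately have "(x \<otimes> p \<oplus> u \<otimes> y [^] Suc i) \<otimes> b \<ominus> (u \<otimes> y [^] Suc i) \<otimes> b \<in> mpow (Suc (Suc i + j))"
    by (rule mpow_minus)
  moreover have "(x \<otimes> p \<oplus> u \<otimes> y [^] Suc i) \<otimes> b \<ominus> (u \<otimes> y [^] Suc i) \<otimes> b = x \<otimes> (p \<otimes> b)"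
    using c by (simp add: a_minus_def l_distr a_assoc r_neg m_assoc)
  ultimately have "x \<otimes> (p \<otimes> b) \<in> mpow (Suc (Suc (i + j)))" by simp
  thus False using pb x_mult_mpow_cancel[OF mpow_mult[OF p b]] by blast
qed

text \<open>The associated graded ring is a domain. If one of the two coefficients of powers of
  \<open>y\<close> lies in m, a factor \<open>x\<close> splits off and the degree drops. If both are
  units, the product again has a unit coefficient at its power of \<open>y\<close>, so by
  \<open>quasi_regular\<close> it cannot have higher order.\<close>

lemma mult_notin_mpow:
  assumes "a \<in> mpow i" "a \<notin> mpow (Suc i)" "b \<in> mpow j" "b \<notin> mpow (Suc j)"
  shows "a \<otimes> b \<notin> mpow (Suc (i + j))"
  using assms
proof (induction "i + j" arbitrary: a b i j rule: less_induct)
  case less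
  note ac = mpow_carr[OF less.prems(1)] and bc = mpow_carr[OF less.prems(3)]
  show ?case
  proof (cases i)
    case 0
    thus ?thesis using unit_mult_mpow_cancel[OF ac _ bc, of "Suc j"] less.prems by (auto simp: mpow_1)
  next
    case i: (Suc i')
    show ?thesis
    proof (cases j)
      case 0
      thus ?thesis using unit_mult_mpow_cancel[OF bc _ ac, of "Suc i"] less.prems m_comm[OF ac bc] by (auto simp: mpow_1)
    next
      case j: (Suc j')
      obtain p u where p: "p \<in> mpow i'" "u \<in> carrier R" "a = x \<otimes> p \<oplus> u \<otimes> y [^] Suc i'"
        using mpow_Suc_cases[OF less.prems(1)[unfolded i]] .
      obtain q w where q: "q \<in> mpow j'" "w \<in> carrier R" "b = x \<otimes> q \<oplus> w \<otimes> y [^] Suc j'"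
        using mpow_Suc_cases[OF less.prems(3)[unfolded j]] .
      note pc = mpow_carr[OF p(1)] and qc = mpow_carr[OF q(1)]
      consider "u \<in> \<mm>" | "w \<in> \<mm>" | "u \<notin> \<mm>" "w \<notin> \<mm>" by blast
      thus ?thesis
      proof cases
        case 1
        have "p' \<otimes> b \<notin> mpow (Suc (i' + j))" if "p' \<in> mpow i'" "p' \<notin> mpow (Suc i')" for p'
          using less.hyps[OF _ that less.prems(3,4)] i by simp
        from mult_notin_mpow_step[OF this less.prems(3) p(1) 1] less.prems(2)
        show ?thesis unfolding i p(3) by simp
      next
        case 2
        have "q' \<otimes> a \<notin> mpow (Suc (j' + i))" if "q' \<in> mpow j'" "q' \<notin> mpow (Suc j')" for q'
          using less.hyps[OF _ that less.prems(1,2)] j by simp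
        from mult_notin_mpow_step[OF this less.prems(1) q(1) 2] less.prems(4)
        have "b \<otimes> a \<notin> mpow (Suc (Suc j' + i))" unfolding j q(3) by simp
        thus ?thesis using m_comm[OF ac bc] j by (simp add: add.commute)
      next
        case 3
        have "u \<otimes> w \<notin> \<mm>" using unit_notin_mm Units_m_closed unit p(2) q(2) 3 by blast
        have yy: "y [^] Suc (i' + Suc j') = y [^] Suc i' \<otimes> y [^] Suc j'" by (simp only: nat_pow_mult[OF y_carr]) simp
        let ?p = "p \<otimes> b \<oplus> (u \<otimes> y [^] Suc i') \<otimes> q"
        have yc: "y [^] Suc i' \<in> carrier R" "y [^] Suc j' \<in> carrier R" by auto
        have "a \<otimes> b = x \<otimes> (p \<otimes> b) \<oplus> (u \<otimes> y [^] Suc i') \<otimes> b"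
          unfolding p(3) using pc bc p(2) yc by (simp add: l_distr m_assoc del: nat_pow_Suc)
        also have "(u \<otimes> y [^] Suc i') \<otimes> b = x \<otimes> ((u \<otimes> y [^] Suc i') \<otimes> q) \<oplus> (u \<otimes> w) \<otimes> y [^] Suc (i' + Suc j')"
          unfolding q(3) yy using qc p(2) q(2) yc by (simp add: r_distr m_ac del: nat_pow_Suc)
        finally have ab: "a \<otimes> b = x \<otimes> ?p \<oplus> (u \<otimes> w) \<otimes> y [^] Suc (i' + Suc j')"
          using pc bc p(2) q(2) qc yc by (simp add: r_distr a_assoc del: nat_pow_Suc)
        have "p \<otimes> b \<in> mpow (i' + Suc j')" using mpow_mult[OF p(1) less.prems(3)] j by simp
        moreover have "(u \<otimes> y [^] Suc i') \<otimes> q \<in> mpow (Suc i' + j')"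
          by (rule mpow_mult[OF mpow_l_mult[OF p(2) y_pow_mpow] q(1)])
        ultimately have "?p \<in> mpow (i' + Suc j')" using mpow_add by simp
        from quasi_regular(2)[OF this, of "u \<otimes> w"] \<open>u \<otimes> w \<notin> \<mm>\<close> p(2) q(2)
        show ?thesis unfolding ab i j by auto
      qed
    qed
  qed
qed

text \<open>Orders of products add, so an element of exact order \<open>d\<close> cancels with a
  loss of exactly \<open>d\<close>.\<close>

lemma mpow_mult_cancel:
  assumes f: "f \<in> mpow d" "f \<notin> mpow (Suc d)" and g: "g \<in> carrier R" "f \<otimes> g \<in> mpow (d + n)"
  shows "g \<in> mpow n"
proof (rule ccontr)
  assume "g \<notin> mpow n"
  then obtain j where j: "j < n" "g \<in> mpow j" "g \<notin> mpow (Suc j)" using mpow_order[OF g(1)] by blast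
  hence "f \<otimes> g \<notin> mpow (Suc (d + j))" using mult_notin_mpow[OF f] by blast
  thus False using mpow_le[OF g(2)] j(1) by simp
qed

lemma nonzero_order:
  assumes "a \<in> carrier R" "a \<noteq> \<zero>"
  obtains i where "a \<in> mpow i" "a \<notin> mpow (Suc i)"
  using mpow_Inter_zero[of a] mpow_order[OF assms(1)] assms(2) by metis

lemma domain: "domain R"
proof (rule domainI[OF is_cring])
  show "\<one> \<noteq> \<zero>" using one_notin mm_zero by auto
  fix a b assume ab: "a \<otimes> b = \<zero>" "a \<in> carrier R" "b \<in> carrier R"
  show "a = \<zero> \<or> b = \<zero>"
  proof (rule ccontr)
    assume "\<not> (a = \<zero> \<or> b = \<zero>)"
    then obtain i j where "a \<in> mpow i" "a \<notin> mpow (Suc i)" "b \<in> mpow j" "b \<notin> mpow (Suc j)"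
      using nonzero_order ab by metis
    hence "a \<otimes> b \<notin> mpow (Suc (i + j))" by (rule mult_notin_mpow)
    thus False using ab by simp
  qed
qed

lemma m_left_cancel: "a \<in> carrier R \<Longrightarrow> a \<noteq> \<zero> \<Longrightarrow> b \<in> carrier R \<Longrightarrow> c \<in> carrier R \<Longrightarrow> a \<otimes> b = a \<otimes> c \<Longrightarrow> b = c"
  using domain.m_lcancel[OF domain] by blast

lemma x_order: "x \<in> mpow (Suc 0)" "x \<notin> mpow (Suc (Suc 0))"
proof -
  show "x \<in> mpow (Suc 0)" by (simp add: mpow_1)
  show "x \<notin> mpow (Suc (Suc 0))"
  proof
    assume "x \<in> mpow (Suc (Suc 0))"
    hence "\<one> \<in> mpow (Suc 0)" using x_mult_mpow_cancel[of \<one> 0] by simp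
    thus False using one_notin by (simp add: mpow_1)
  qed
qed

lemma x_nonzero: "x \<noteq> \<zero>"
  using x_order(2) mpow_zero by metis

text \<open>By Krull's intersection theorem it suffices to approximate \<open>a\<close> by multiples
  of \<open>x\<close> to every order. The remainder \<open>a'\<close> has its
  \<open>y\<close>-coefficient in m, so moving its \<open>x\<close>-part into \<open>x c\<close>
  raises the order by one.\<close>

lemma y_regular_mod_x:
  assumes a: "a \<in> carrier R" and b: "b \<in> carrier R" and eq: "y \<otimes> a = x \<otimes> b"
  shows "a \<in> PIdl x"
proof (rule krull_intersection[OF cgenideal_ideal[OF x_carr]])
  fix n
  have "\<exists>c\<in>carrier R. \<exists>a'\<in>mpow n. a = x \<otimes> c \<oplus> a'"
  proof (induction n)
    case 0
    show ?case using a by (intro bexI[of _ \<zero>] bexI[of _ a]) auto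
  next
    case (Suc n)
    then obtain c a' where c: "c \<in> carrier R" "a' \<in> mpow n" "a = x \<otimes> c \<oplus> a'" by blast
    have ac: "a' \<in> carrier R" using c mpow_carr by blast
    let ?b = "b \<ominus> y \<otimes> c"
    have bc: "?b \<in> carrier R" using b c by simp
    have "y \<otimes> a' = y \<otimes> a \<ominus> x \<otimes> (y \<otimes> c)"
      unfolding c(3) using c(1) ac by (simp add: r_distr a_minus_def m_ac a_ac r_neg2 r_neg)
    hence ya: "y \<otimes> a' = x \<otimes> ?b" unfolding eq using b c(1) by (simp add: a_minus_def r_distr r_minus)
    show ?case
    proof (cases n)
      case 0
      \<comment> \<open>In order zero there is no normal form to split; here
        \<open>y a' = x ?b\<close> itself shows that \<open>a'\<close> is not a unit.\<close>
      have "a' \<in> \<mm>"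
      proof -
        have "x \<otimes> (\<ominus> ?b) \<oplus> a' \<otimes> y [^] Suc 0 = \<zero>"
          using ya bc ac by (simp add: r_minus m_comm l_neg)
        thus ?thesis using quasi_regular(2)[of "\<ominus> ?b" 0 a'] bc ac by simp
      qed
      thus ?thesis using c(1,3) 0 by (auto simp: mpow_1)
    next
      case n: (Suc m)
      obtain p u where p: "p \<in> mpow m" "u \<in> carrier R" "a' = x \<otimes> p \<oplus> u \<otimes> y [^] Suc m"
        using mpow_Suc_cases[OF c(2)[unfolded n]] .
      have pc: "p \<in> carrier R" using p mpow_carr by blast
      have "x \<otimes> ?b \<in> mpow (Suc 0 + n)" using y_mult_mpow[OF c(2)] ya by simp
      hence bn: "?b \<in> mpow n" using mpow_mult_cancel[OF x_order bc] by blast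
      have yp: "y \<otimes> p \<in> mpow n" using y_mult_mpow[OF p(1)] n by simp
      have "x \<otimes> (y \<otimes> p \<ominus> ?b) \<oplus> u \<otimes> y [^] Suc n = y \<otimes> a' \<ominus> x \<otimes> ?b"
        unfolding p(3) n using pc p(2) bc by (simp add: a_minus_def r_distr r_minus m_ac a_ac)
      also have "\<dots> = \<zero>" unfolding ya using bc by (simp add: a_minus_def r_neg)
      finally have "x \<otimes> (y \<otimes> p \<ominus> ?b) \<oplus> u \<otimes> y [^] Suc n \<in> mpow (Suc (Suc n))" by simp
      hence "u \<in> \<mm>" using quasi_regular(2)[OF mpow_minus[OF yp bn] p(2)] by blast
      hence "u \<otimes> y [^] Suc m \<in> mpow (Suc n)" using mm_mult_mpow y_pow_mpow n by blast
      moreover have "a = x \<otimes> (c \<oplus> p) \<oplus> u \<otimes> y [^] Suc m"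
        unfolding c(3) p(3) using c(1) pc p(2) by (simp add: r_distr a_assoc)
      ultimately show ?thesis using c(1) pc by blast
    qed
  qed
  then obtain c a' where c: "c \<in> carrier R" "a' \<in> mpow n" "a = x \<otimes> c \<oplus> a'" by blast
  have "x \<otimes> c \<in> PIdl x" using c(1) by (auto simp: cgenideal_iff)
  thus "a \<in> PIdl x <+>\<^bsub>R\<^esub> mpow n" unfolding c(3) using c(2) by (rule set_addI)
qed

text \<open>The quotient by \<open>f\<close> has positive depth: if \<open>x\<close> and \<open>y\<close> multiply \<open>w\<close> into \<open>(f)\<close>, then so does \<open>1\<close>.\<close>

lemma regular_mod:
  assumes f: "f \<in> carrier R" "f \<noteq> \<zero>" and z: "z \<in> carrier R"
    and N: "\<And>v. v \<in> mpow N \<Longrightarrow> \<exists>p\<in>carrier R. \<exists>q\<in>carrier R. v = z \<otimes> p \<oplus> f \<otimes> q"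
    and g: "g \<in> carrier R" "z \<otimes> g \<in> PIdl f"
  shows "g \<in> PIdl f"
proof -
  obtain h where h: "h \<in> carrier R" "z \<otimes> g = f \<otimes> h" using g(2) cgenideal_iff[OF f(1)] by blast
  \<comment> \<open>Exactness of the Koszul complex: \<open>x w = f a\<close> and
    \<open>y w = f b\<close> give \<open>y a = x b\<close>, so \<open>a\<close> is a multiple of
    \<open>x\<close>, and \<open>w\<close> one of \<open>f\<close>.\<close>
  have step: "w \<in> PIdl f" if w: "w \<in> carrier R" "x \<otimes> w \<in> PIdl f" "y \<otimes> w \<in> PIdl f" for w
  proof -
    obtain a where a: "a \<in> carrier R" "x \<otimes> w = f \<otimes> a" using w(2) unfolding cgenideal_iff[OF f(1)] by blast
    obtain b where b: "b \<in> carrier R" "y \<otimes> w = f \<otimes> b" using w(3) unfolding cgenideal_iff[OF f(1)] by blast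
    note ab = a(1) b(1) a(2) b(2)
    have "f \<otimes> (y \<otimes> a) = y \<otimes> (x \<otimes> w)" unfolding ab(3) using ab f by (simp add: m_ac)
    also have "\<dots> = x \<otimes> (y \<otimes> w)" using w by (simp add: m_ac)
    also have "\<dots> = f \<otimes> (x \<otimes> b)" unfolding ab(4) using ab f by (simp add: m_ac)
    finally have "y \<otimes> a = x \<otimes> b" using m_left_cancel[OF f] ab by simp
    hence "a \<in> PIdl x" using y_regular_mod_x ab by blast
    then obtain c where c: "c \<in> carrier R" "a = x \<otimes> c" unfolding cgenideal_iff[OF x_carr] by blast
    have "x \<otimes> w = x \<otimes> (f \<otimes> c)" unfolding ab(3) c(2) using f c by (simp add: m_ac)
    hence "w = f \<otimes> c" using m_left_cancel[OF x_carr x_nonzero w(1)] f c by simp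
    thus ?thesis unfolding cgenideal_iff[OF f(1)] using c by blast
  qed
  \<comment> \<open>Descending induction on the order: \<open>m^N g\<close> lies in
    \<open>(f)\<close> because \<open>m^N\<close> lies in \<open>(z, f)\<close>, and
    \<open>step\<close> lowers the exponent down to 0.\<close>
  have "\<forall>v\<in>mpow (N - n). v \<otimes> g \<in> PIdl f" for n
  proof (induction n)
    case 0
    show ?case
    proof
      fix v assume "v \<in> mpow (N - 0)"
      hence "v \<in> mpow N" by simp
      from N[OF this] obtain p q where pq: "p \<in> carrier R" "q \<in> carrier R" "v = z \<otimes> p \<oplus> f \<otimes> q" by blast
      have "v \<otimes> g = (z \<otimes> g) \<otimes> p \<oplus> f \<otimes> (q \<otimes> g)" unfolding pq(3) using pq z f g by (simp add: l_distr r_distr m_ac)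
      also have "\<dots> = f \<otimes> (h \<otimes> p \<oplus> q \<otimes> g)" unfolding h(2) using pq h f g by (simp add: r_distr m_ac)
      finally have "v \<otimes> g = f \<otimes> (h \<otimes> p \<oplus> q \<otimes> g)" .
      moreover have "h \<otimes> p \<oplus> q \<otimes> g \<in> carrier R" using pq h g by simp
      ultimately show "v \<otimes> g \<in> PIdl f" unfolding cgenideal_iff[OF f(1)] by blast
    qed
  next
    case (Suc n)
    show ?case
    proof (cases "n < N")
      case True
      show ?thesis
      proof
        fix v assume v: "v \<in> mpow (N - Suc n)"
        have e: "Suc (N - Suc n) = N - n" using True by simp
        have vc: "v \<in> carrier R" using v mpow_carr by blast
        have "(x \<otimes> v) \<otimes> g \<in> PIdl f" "(y \<otimes> v) \<otimes> g \<in> PIdl f"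
          using Suc.IH x_mult_mpow[OF v] y_mult_mpow[OF v] unfolding e by blast+
        thus "v \<otimes> g \<in> PIdl f" using step[of "v \<otimes> g"] vc g(1) by (simp add: m_assoc)
      qed
    next
      case False
      thus ?thesis using Suc.IH by simp
    qed
  qed
  from this[of N] have "\<one> \<otimes> g \<in> PIdl f" by simp
  thus ?thesis using g by simp
qed

end

section \<open>Hilbert functions of the regular ring and of the hypersurface\<close>

lemma triangle_add: "(d + j) * (d + j + 1) div 2 = (d * j + d * (d + 1) div 2) + j * (j + 1) div (2::nat)"
proof -
  have "even (d * (d + 1))" "even (j * (j + 1))" by auto
  then obtain a b where ab: "d * (d + 1) = 2 * a" "j * (j + 1) = 2 * b" by (elim evenE)
  have "(d + j) * (d + j + 1) = 2 * (d * j) + (d * (d + 1) + j * (j + 1))" by (simp add: algebra_simps)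
  also have "\<dots> = 2 * (d * j + a + b)" unfolding ab by simp
  finally have "(d + j) * (d + j + 1) div 2 = d * j + a + b" by simp
  thus ?thesis unfolding ab by simp
qed

context two_dim_local
begin

text \<open>In degree \<open>n + 1\<close> the part divisible by \<open>x\<close> is a copy of
  degree \<open>n\<close>, and the power of \<open>y\<close> adds one copy of the residue
  field.\<close>

lemma mlen_mpow_Suc: "mlen R (self_module R) (mpow (Suc n)) (mpow n) = enat (Suc n)"
proof (induction n)
  case 0
  show ?case using mlen_mm by (simp add: mpow_1 one_enat_def)
next
  case (Suc n)
  interpret S: noeth_module R "self_module R" x y by (rule noeth_self)
  let ?M = "self_module R"
  note sp = submodule_mpow
  have sR: "submodule (carrier R) R ?M" using sp[of 0] by simp
  have smm: "submodule \<mm> R ?M" using sp[of "Suc 0"] by (simp add: mpow_1)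
  let ?T = "mpow (Suc (Suc n)) <+>\<^bsub>?M\<^esub> (\<lambda>v. x \<odot>\<^bsub>?M\<^esub> v) ` mpow n"
  have sT: "submodule ?T R ?M" by (rule S.submodule_set_add[OF sp S.submodule_smult[OF x_carr sp]])
  have sub1: "mpow (Suc (Suc n)) \<subseteq> ?T" by (rule S.subset_set_add1[OF sp S.submodule_smult[OF x_carr sp]])
  have sub2: "?T \<subseteq> mpow (Suc n)"
    by (rule S.set_add_subset[OF sp mpow_Suc_subset]) (auto simp: x_mult_mpow)
  have "(\<lambda>v. x \<odot>\<^bsub>?M\<^esub> v) ` mpow (Suc n) \<subseteq> mpow (Suc (Suc n))" by (auto simp: x_mult_mpow)
  hence e1: "mpow (Suc (Suc n)) <+>\<^bsub>?M\<^esub> (\<lambda>v. x \<odot>\<^bsub>?M\<^esub> v) ` mpow (Suc n) = mpow (Suc (Suc n))"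
    by (intro equalityI S.set_add_subset[OF sp order_refl] S.subset_set_add1[OF sp S.submodule_smult[OF x_carr sp]])
  have "mlen R ?M (mpow (Suc (Suc n)) <+>\<^bsub>?M\<^esub> (\<lambda>v. x \<odot>\<^bsub>?M\<^esub> v) ` mpow (Suc n)) ?T = mlen R ?M (mpow (Suc n)) (mpow n)"
    by (rule S.mlen_smult_image[OF x_carr sp sp sp mpow_Suc_subset]) (simp add: x_mult_mpow_cancel)
  hence l1: "mlen R ?M (mpow (Suc (Suc n))) ?T = enat (Suc n)" unfolding e1 Suc .
  let ?y = "y [^] Suc n"
  have yc: "?y \<in> carrier R" by simp
  have T_E: "\<exists>c p. c \<in> mpow (Suc (Suc n)) \<and> p \<in> mpow n \<and> v = c \<oplus> x \<otimes> p" if "v \<in> ?T" for v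
    using that unfolding set_add_iff by auto
  have ker: "v \<in> \<mm>" if v: "v \<in> carrier R" "?y \<odot>\<^bsub>?M\<^esub> v \<in> ?T" for v
  proof -
    obtain c p where cp: "c \<in> mpow (Suc (Suc n))" "p \<in> mpow n" "?y \<otimes> v = c \<oplus> x \<otimes> p"
      using T_E[OF v(2)] by auto
    note cc = mpow_carr[OF cp(1)] mpow_carr[OF cp(2)]
    have "x \<otimes> (\<ominus> p) \<oplus> v \<otimes> ?y = c"
      using cp(3) cc v(1) yc by (simp add: m_comm[of v] r_minus r_neg1 a_ac del: nat_pow_Suc) (simp add: a_assoc[symmetric] l_neg r_neg)
    thus ?thesis using quasi_regular(2)[OF mpow_neg[OF cp(2)] v(1)] cp(1) by simp
  qed
  have yT: "?y \<otimes> v \<in> ?T" if "v \<in> \<mm>" for v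
  proof -
    have "v \<otimes> ?y \<in> mpow (Suc (Suc n))" using mm_mult_mpow[OF that y_pow_mpow] .
    thus ?thesis using sub1 mm_carr[OF that] yc m_comm by auto
  qed
  have e2: "?T <+>\<^bsub>?M\<^esub> (\<lambda>v. ?y \<odot>\<^bsub>?M\<^esub> v) ` \<mm> = ?T"
    by (intro equalityI S.set_add_subset[OF sT order_refl] S.subset_set_add1[OF sT S.submodule_smult[OF yc smm]])
      (use yT in auto)
  have e3: "?T <+>\<^bsub>?M\<^esub> (\<lambda>v. ?y \<odot>\<^bsub>?M\<^esub> v) ` carrier R = mpow (Suc n)"
  proof (intro equalityI S.set_add_subset[OF sp sub2])
    show "(\<lambda>v. ?y \<odot>\<^bsub>?M\<^esub> v) ` carrier R \<subseteq> mpow (Suc n)"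
      using mpow_r_mult[OF _ y_pow_mpow[of "Suc n"]] by (auto simp del: nat_pow_Suc)
    show "mpow (Suc n) \<subseteq> ?T <+>\<^bsub>?M\<^esub> (\<lambda>v. ?y \<odot>\<^bsub>?M\<^esub> v) ` carrier R"
    proof
      fix v assume "v \<in> mpow (Suc n)"
      then obtain p u where p: "p \<in> mpow n" "u \<in> carrier R" "v = x \<otimes> p \<oplus> u \<otimes> ?y" by (rule mpow_Suc_cases)
      have "x \<otimes> p \<in> ?T" using S.subset_set_add2[OF sp S.submodule_smult[OF x_carr sp]] p(1) by auto
      moreover have "u \<otimes> ?y \<in> (\<lambda>v. ?y \<odot>\<^bsub>?M\<^esub> v) ` carrier R"
        using p(2) m_comm[OF p(2) yc] by auto
      ultimately have "x \<otimes> p \<oplus>\<^bsub>?M\<^esub> u \<otimes> ?y \<in> ?T <+>\<^bsub>?M\<^esub> (\<lambda>v. ?y \<odot>\<^bsub>?M\<^esub> v) ` carrier R" by (rule set_addI)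
      thus "v \<in> ?T <+>\<^bsub>?M\<^esub> (\<lambda>v. ?y \<odot>\<^bsub>?M\<^esub> v) ` carrier R" unfolding p(3) by simp
    qed
  qed
  have mmR: "\<mm> \<subseteq> carrier R" using mm_carr by blast
  have "mlen R ?M (?T <+>\<^bsub>?M\<^esub> (\<lambda>v. ?y \<odot>\<^bsub>?M\<^esub> v) ` \<mm>) (?T <+>\<^bsub>?M\<^esub> (\<lambda>v. ?y \<odot>\<^bsub>?M\<^esub> v) ` carrier R)
      = mlen R ?M \<mm> (carrier R)"
    by (rule S.mlen_smult_image[OF yc sT smm sR mmR ker])
  hence l2: "mlen R ?M ?T (mpow (Suc n)) = 1" unfolding e2 e3 mlen_mm .
  show ?case
    using S.mlen_add[OF sp sT sp sub1 sub2] unfolding l1 l2 by (simp add: one_enat_def)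
qed

lemma mlen_mpow: "mlen R (self_module R) (mpow n) (carrier R) = enat (n * (n + 1) div 2)"
proof (induction n)
  interpret S: noeth_module R "self_module R" x y by (rule noeth_self)
  case 0
  show ?case using S.mlen_self[OF submodule_mpow[of 0]] by (simp add: zero_enat_def)
next
  interpret S: noeth_module R "self_module R" x y by (rule noeth_self)
  case (Suc n)
  have "mpow n \<subseteq> mpow 0" by (rule mpow_antimono) simp
  from S.mlen_add[OF submodule_mpow submodule_mpow submodule_mpow mpow_Suc_subset this]
  show ?case using Suc mlen_mpow_Suc[of n] by (simp add: algebra_simps)
qed

lemma set_add_image_absorb:
  assumes "submodule E R (self_module R)" "submodule A R (self_module R)" "A \<subseteq> E"
  shows "E <+>\<^bsub>self_module R\<^esub> A = E"
proof -
  interpret S: module R "self_module R" by (rule module_self)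
  show ?thesis by (intro equalityI S.set_add_subset[OF assms(1) order_refl assms(3)] S.subset_set_add1 assms)
qed

text \<open>Since orders add, multiplication by \<open>f\<close> identifies R/m^j with (m^(d+j) +
  (f))/m^(d+j); what remains is a difference of triangular numbers.\<close>

lemma mlen_hypersurface:
  assumes f: "f \<in> mpow d" "f \<notin> mpow (Suc d)"
  shows "mlen R (self_module R) (PIdl f <+>\<^bsub>R\<^esub> mpow (d + j)) (carrier R) = enat (d * j + d * (d + 1) div 2)"
proof -
  interpret S: noeth_module R "self_module R" x y by (rule noeth_self)
  let ?M = "self_module R"
  have fc: "f \<in> carrier R" using f mpow_carr by blast
  note sp = submodule_mpow
  have sR: "submodule (carrier R) R ?M" using sp[of 0] by simp
  have sf: "submodule (PIdl f) R ?M" by (rule submodule_cgenideal[OF fc])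
  let ?H = "mpow (d + j) <+>\<^bsub>?M\<^esub> PIdl f"
  have sH: "submodule ?H R ?M" by (rule S.submodule_set_add[OF sp sf])
  have jR: "mpow j \<subseteq> carrier R" using mpow_carr by blast
  have "mlen R ?M (mpow (d + j) <+>\<^bsub>?M\<^esub> (\<lambda>v. f \<odot>\<^bsub>?M\<^esub> v) ` mpow j) (mpow (d + j) <+>\<^bsub>?M\<^esub> (\<lambda>v. f \<odot>\<^bsub>?M\<^esub> v) ` carrier R)
     = mlen R ?M (mpow j) (carrier R)"
    by (rule S.mlen_smult_image[OF fc sp sp sR jR]) (use mpow_mult_cancel[OF f] in simp)
  moreover have "(\<lambda>v. f \<odot>\<^bsub>?M\<^esub> v) ` carrier R = PIdl f" using cgenideal_image[OF fc] by simp
  moreover have "mpow (d + j) <+>\<^bsub>?M\<^esub> (\<lambda>v. f \<odot>\<^bsub>?M\<^esub> v) ` mpow j = mpow (d + j)"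
    by (rule set_add_image_absorb[OF sp S.submodule_smult[OF fc sp]]) (use mpow_mult[OF f(1)] in auto)
  ultimately have l: "mlen R ?M (mpow (d + j)) ?H = enat (j * (j + 1) div 2)" by (simp add: mlen_mpow)
  have sub: "mpow (d + j) \<subseteq> ?H" "?H \<subseteq> carrier R"
    using S.subset_set_add1[OF sp sf] S.submoduleE(1)[OF sH] by simp_all
  have "enat ((d + j) * (d + j + 1) div 2) = enat (j * (j + 1) div 2) + mlen R ?M ?H (carrier R)"
    using S.mlen_add[OF sp sH sR sub] unfolding l mlen_mpow .
  hence "mlen R ?M ?H (carrier R) = enat (d * j + d * (d + 1) div 2)"
    unfolding triangle_add by (cases "mlen R ?M ?H (carrier R)") auto
  moreover have "?H = PIdl f <+>\<^bsub>R\<^esub> mpow (d + j)"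
    using S.set_add_comm[OF S.submoduleE(1)[OF sp] S.submoduleE(1)[OF sf]] by simp
  ultimately show ?thesis by simp
qed

text \<open>As \<open>z\<close> is regular modulo \<open>f\<close> and \<open>z m^n + (f)\<close>
  equals \<open>m^(n+k) + (f)\<close>, multiplication by \<open>z\<close> maps R/(f, m^n)
  isomorphically onto (f, z)/(f, m^(n+k)). The length of R/(f, z) is therefore the growth over
  \<open>k\<close> steps of a linear function of slope \<open>d\<close>.\<close>

lemma homogeneous_parameter:
  assumes f: "f \<in> mpow d" "f \<notin> mpow (Suc d)"
  obtains k z N where "k \<ge> 1" "z \<in> mpow k"
    "\<And>v. v \<in> mpow N \<Longrightarrow> \<exists>p\<in>carrier R. \<exists>q\<in>carrier R. v = z \<otimes> p \<oplus> f \<otimes> q"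
    "mlen R (self_module R) (PIdl f <+>\<^bsub>R\<^esub> PIdl z) (carrier R) = enat (k * d)"
proof -
  interpret S: noeth_module R "self_module R" x y by (rule noeth_self)
  let ?M = "self_module R"
  have fc: "f \<in> carrier R" and f0: "f \<noteq> \<zero>" using f mpow_carr by auto
  obtain a b F u h where h: "a + b = d" "F \<in> mpow a" "u \<in> carrier R" "u \<notin> \<mm>" "h \<in> mpow a"
    "y \<otimes> F = u \<otimes> y [^] Suc a \<oplus> x \<otimes> h" "f \<ominus> x [^] b \<otimes> F \<in> mpow (Suc d)"
    using initial_form_decomposition[OF f] .
  define z where "z = x [^] Suc a \<oplus> y \<otimes> F"
  define k where "k = Suc a"
  \<comment> \<open>Large enough for \<open>m^(n+k)\<close> to lie in
    \<open>z m^n + (f)\<close>.\<close>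
  define n where "n = k * d + d + 1"
  note Z = mpow_le_parameter_ideal[OF h(2-6) f(1)[folded h(1)] h(7)[folded h(1)], folded z_def k_def, unfolded h(1), folded n_def]
  have zc: "z \<in> carrier R" using Z(1) mpow_carr by blast
  have N: "\<exists>p\<in>carrier R. \<exists>q\<in>carrier R. v = z \<otimes> p \<oplus> f \<otimes> q" if "v \<in> mpow (n + k)" for v
    using Z(2)[OF that] mpow_carr by blast
  note sp = submodule_mpow
  have sR: "submodule (carrier R) R ?M" using sp[of 0] by simp
  have sf: "submodule (PIdl f) R ?M" by (rule submodule_cgenideal[OF fc])
  have sz: "submodule (PIdl z) R ?M" by (rule submodule_cgenideal[OF zc])
  let ?A = "PIdl f <+>\<^bsub>?M\<^esub> mpow n" and ?B = "PIdl f <+>\<^bsub>?M\<^esub> mpow (n + k)" and ?C = "PIdl f <+>\<^bsub>?M\<^esub> PIdl z"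
  have sA: "submodule ?A R ?M" and sB: "submodule ?B R ?M" and sC: "submodule ?C R ?M"
    by (intro S.submodule_set_add sf sp sz)+
  have AR: "?A \<subseteq> carrier R" and CR: "?C \<subseteq> carrier R" using S.submoduleE(1)[OF sA] S.submoduleE(1)[OF sC] by simp_all
  have inf: "p \<in> ?A" "p \<in> ?B" if "p \<in> PIdl f" for p
    using that S.subset_set_add1[OF sf sp] by auto
  have "mlen R ?M (PIdl f <+>\<^bsub>?M\<^esub> (\<lambda>v. z \<odot>\<^bsub>?M\<^esub> v) ` ?A) (PIdl f <+>\<^bsub>?M\<^esub> (\<lambda>v. z \<odot>\<^bsub>?M\<^esub> v) ` carrier R)
      = mlen R ?M ?A (carrier R)"
    by (rule S.mlen_smult_image[OF zc sf sA sR AR]) (use regular_mod[OF fc f0 zc N] inf in simp)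
  moreover have "(\<lambda>v. z \<odot>\<^bsub>?M\<^esub> v) ` carrier R = PIdl z" using cgenideal_image[OF zc] by simp
  moreover have "PIdl f <+>\<^bsub>?M\<^esub> (\<lambda>v. z \<odot>\<^bsub>?M\<^esub> v) ` ?A = ?B"
  proof (rule equalityI)
    show "PIdl f <+>\<^bsub>?M\<^esub> (\<lambda>v. z \<odot>\<^bsub>?M\<^esub> v) ` ?A \<subseteq> ?B"
    proof (rule S.set_add_subset[OF sB])
      show "PIdl f \<subseteq> ?B" using inf by blast
      show "(\<lambda>v. z \<odot>\<^bsub>?M\<^esub> v) ` ?A \<subseteq> ?B"
      proof
        fix w assume "w \<in> (\<lambda>v. z \<odot>\<^bsub>?M\<^esub> v) ` ?A"
        then obtain p c where pc: "p \<in> PIdl f" "c \<in> mpow n" "w = z \<otimes> (p \<oplus> c)" by (auto simp: set_add_iff)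
        have "z \<otimes> c \<in> mpow (n + k)" using mpow_mult[OF Z(1) pc(2)] by (simp add: add.commute)
        moreover have "z \<otimes> p \<in> PIdl f" using S.submoduleE(4)[OF sf zc pc(1)] by simp
        ultimately have "z \<otimes> p \<oplus>\<^bsub>?M\<^esub> z \<otimes> c \<in> ?B" by (intro set_addI)
        moreover have "w = z \<otimes> p \<oplus> z \<otimes> c"
          unfolding pc(3) using zc mpow_carr[OF pc(2)] S.submodule_carr[OF sf pc(1)] by (simp add: r_distr)
        ultimately show "w \<in> ?B" by simp
      qed
    qed
    show "?B \<subseteq> PIdl f <+>\<^bsub>?M\<^esub> (\<lambda>v. z \<odot>\<^bsub>?M\<^esub> v) ` ?A"
    proof (rule S.set_add_subset[OF S.submodule_set_add[OF sf S.submodule_smult[OF zc sA]]])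
      show "PIdl f \<subseteq> PIdl f <+>\<^bsub>?M\<^esub> (\<lambda>v. z \<odot>\<^bsub>?M\<^esub> v) ` ?A"
        by (rule S.subset_set_add1[OF sf S.submodule_smult[OF zc sA]])
      show "mpow (n + k) \<subseteq> PIdl f <+>\<^bsub>?M\<^esub> (\<lambda>v. z \<odot>\<^bsub>?M\<^esub> v) ` ?A"
      proof
        fix v assume "v \<in> mpow (n + k)"
        from Z(2)[OF this] obtain p q where pq: "p \<in> mpow n" "q \<in> mpow (k * d + 1 + k)" "v = z \<otimes> p \<oplus> f \<otimes> q" by blast
        note cc = mpow_carr[OF pq(1)] mpow_carr[OF pq(2)]
        have "f \<otimes> q \<in> PIdl f" using cc cgenideal_iff[OF fc] by blast
        moreover have "p \<in> ?A" using pq(1) S.subset_set_add2[OF sf sp] by blast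
        hence "z \<otimes> p \<in> (\<lambda>v. z \<odot>\<^bsub>?M\<^esub> v) ` ?A" by simp
        ultimately have "f \<otimes> q \<oplus>\<^bsub>?M\<^esub> z \<otimes> p \<in> PIdl f <+>\<^bsub>?M\<^esub> (\<lambda>v. z \<odot>\<^bsub>?M\<^esub> v) ` ?A" by (rule set_addI)
        moreover have "v = f \<otimes> q \<oplus> z \<otimes> p" unfolding pq(3) using cc zc fc by (simp add: a_comm)
        ultimately show "v \<in> PIdl f <+>\<^bsub>?M\<^esub> (\<lambda>v. z \<odot>\<^bsub>?M\<^esub> v) ` ?A" by simp
      qed
    qed
  qed
  ultimately have BC: "mlen R ?M ?B ?C = mlen R ?M ?A (carrier R)" by simp
  have n1: "n = d + (k * d + 1)" and n2: "n + k = d + (k * d + 1 + k)" by (simp_all add: n_def)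
  have lA: "mlen R ?M ?A (carrier R) = enat (d * (k * d + 1) + d * (d + 1) div 2)"
    using mlen_hypersurface[OF f, of "k * d + 1"] unfolding n1 by simp
  have lB: "mlen R ?M ?B (carrier R) = enat (d * (k * d + 1 + k) + d * (d + 1) div 2)"
    using mlen_hypersurface[OF f, of "k * d + 1 + k"] unfolding n2 by simp
  have "mpow (n + k) \<subseteq> ?C"
  proof
    fix v assume "v \<in> mpow (n + k)"
    from N[OF this] obtain p q where pq: "p \<in> carrier R" "q \<in> carrier R" "v = z \<otimes> p \<oplus> f \<otimes> q" by blast
    have "f \<otimes> q \<oplus>\<^bsub>?M\<^esub> z \<otimes> p \<in> ?C"
      by (rule set_addI) (use pq cgenideal_iff[OF fc] cgenideal_iff[OF zc] in auto)
    thus "v \<in> ?C" unfolding pq(3) using a_comm zc fc pq by simp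
  qed
  hence "?B \<subseteq> ?C" using S.set_add_subset[OF sC S.subset_set_add1[OF sf sz]] by blast
  from S.mlen_add[OF sB sC sR this CR]
  have "enat (d * (k * d + 1 + k) + d * (d + 1) div 2) = enat (d * (k * d + 1) + d * (d + 1) div 2) + mlen R ?M ?C (carrier R)"
    unfolding BC lA lB .
  hence "mlen R ?M ?C (carrier R) = enat (k * d)"
    by (cases "mlen R ?M ?C (carrier R)") (auto simp: algebra_simps)
  hence "mlen R ?M (PIdl f <+>\<^bsub>R\<^esub> PIdl z) (carrier R) = enat (k * d)" by simp
  moreover have "k \<ge> 1" by (simp add: k_def)
  ultimately show thesis using that[of k z "n + k"] Z(1) N by blast
qed

text \<open>The sign is hidden in a factor, so the parity of \<open>n\<close> need not be
  tracked.\<close>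

lemma neg_pow: 
  assumes a: "a \<in> carrier R"
  shows "\<exists>e\<in>carrier R. (\<ominus> a) [^] (n::nat) = e \<otimes> a [^] n"
proof (induction n)
  case 0 show ?case by (intro bexI[of _ \<one>]) auto
next
  case (Suc n)
  then obtain e where e: "e \<in> carrier R" "(\<ominus> a) [^] n = e \<otimes> a [^] n" by blast
  have "(\<ominus> a) [^] Suc n = (\<ominus> e) \<otimes> a [^] Suc n"
    using e a by (simp add: l_minus r_minus m_assoc)
  thus ?case using e(1) by blast
qed

text \<open>If \<open>f = x^c (u y^e + x w)\<close> with \<open>u\<close> a unit, then \<open>f\<close> is congruent to a unit times
  \<open>y^(c (e + 1) + e)\<close> modulo \<open>x + y^(e+1)\<close>.\<close>

lemma linear_parameter:
  assumes f: "f \<in> carrier R" "f \<noteq> \<zero>"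
  obtains x' E where "two_dim_local R x' y"
    "\<exists>p\<in>carrier R. \<exists>q\<in>carrier R. y [^] (E::nat) = x' \<otimes> p \<oplus> f \<otimes> q"
    "\<exists>p\<in>carrier R. \<exists>q\<in>carrier R. f = x' \<otimes> p \<oplus> y [^] E \<otimes> q"
proof -
  interpret S: module R "self_module R" by (rule module_self)
  \<comment> \<open>Split off the highest power of \<open>x\<close>; it exists because a nonzero
    \<open>f\<close> does not lie in every power of m.\<close>
  have "\<exists>c g. g \<in> carrier R \<and> f = x [^] (c::nat) \<otimes> g \<and> g \<notin> PIdl x"
  proof (rule ccontr)
    assume no: "\<not> ?thesis"
    have "\<exists>g\<in>carrier R. f = x [^] c \<otimes> g" for c :: nat
    proof (induction c)
      case 0 show ?case using f by (intro bexI[of _ f]) auto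
    next
      case (Suc c)
      then obtain g where g: "g \<in> carrier R" "f = x [^] c \<otimes> g" by blast
      hence "g \<in> PIdl x" using no by blast
      then obtain g' where g': "g' \<in> carrier R" "g = x \<otimes> g'" unfolding cgenideal_iff[OF x_carr] by blast
      have "f = x [^] Suc c \<otimes> g'" unfolding g(2) g'(2) using g'(1) by (simp add: m_ac)
      thus ?case using g'(1) by blast
    qed
    hence "f \<in> mpow c" for c using mpow_r_mult[OF _ x_pow_mpow] by metis
    thus False using mpow_Inter_zero f by blast
  qed
  then obtain c g where g: "g \<in> carrier R" "f = x [^] (c::nat) \<otimes> g" "g \<notin> PIdl x" by blast
  have sx: "submodule (PIdl x) R (self_module R)" by (rule submodule_cgenideal[OF x_carr])
  have "\<exists>n. g \<notin> PIdl x <+>\<^bsub>R\<^esub> mpow n" using krull_intersection[OF cgenideal_ideal[OF x_carr]] g(3) by blast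
  moreover have "g \<in> PIdl x <+>\<^bsub>R\<^esub> mpow 0"
    using S.subset_set_add2[OF sx submodule_mpow[of 0]] g(1) by auto
  \<comment> \<open>The exponent \<open>e\<close> is the order of \<open>g\<close> modulo
    \<open>x\<close>, finite because \<open>g\<close> is not a multiple of \<open>x\<close>.\<close>
  ultimately have "\<not> (\<forall>e. g \<in> PIdl x <+>\<^bsub>R\<^esub> mpow e \<longrightarrow> g \<in> PIdl x <+>\<^bsub>R\<^esub> mpow (Suc e))"
    using nat_induct[of "\<lambda>n. g \<in> PIdl x <+>\<^bsub>R\<^esub> mpow n"] by blast
  then obtain e where e: "g \<in> PIdl x <+>\<^bsub>R\<^esub> mpow e" "g \<notin> PIdl x <+>\<^bsub>R\<^esub> mpow (Suc e)"
    by blast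
  have "\<exists>w u. w \<in> carrier R \<and> u \<in> carrier R \<and> g = x \<otimes> w \<oplus> u \<otimes> y [^] e"
  proof -
    obtain w v where w: "w \<in> carrier R" "v \<in> mpow e" "g = x \<otimes> w \<oplus> v"
      using e(1) unfolding set_add_iff by (auto simp: cgenideal_iff)
    show ?thesis
    proof (cases e)
      case 0
      thus ?thesis using w mpow_carr[OF w(2)] by (intro exI[of _ w] exI[of _ v]) simp
    next
      case e': (Suc e0)
      obtain p u where p: "p \<in> mpow e0" "u \<in> carrier R" "v = x \<otimes> p \<oplus> u \<otimes> y [^] Suc e0"
        using mpow_Suc_cases[OF w(2)[unfolded e']] .
      have g: "g = x \<otimes> (w \<oplus> p) \<oplus> u \<otimes> y [^] e"
        unfolding w(3) p(3) e' using w(1) mpow_carr[OF p(1)] p(2) by (simp add: r_distr a_assoc)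
      show ?thesis
        by (intro exI[of _ "w \<oplus> p"] exI[of _ u] conjI g p(2) a_closed w(1) mpow_carr[OF p(1)])
    qed
  qed
  then obtain w u where w: "w \<in> carrier R" "u \<in> carrier R" "g = x \<otimes> w \<oplus> u \<otimes> y [^] e" by blast
  have u: "u \<notin> \<mm>"
  proof
    assume "u \<in> \<mm>"
    hence "u \<otimes> y [^] e \<in> mpow (Suc e)" using mm_mult_mpow y_pow_mpow by blast
    moreover have "x \<otimes> w \<in> PIdl x" using w(1) by (auto simp: cgenideal_iff)
    ultimately have "x \<otimes> w \<oplus> u \<otimes> y [^] e \<in> PIdl x <+>\<^bsub>R\<^esub> mpow (Suc e)" by (intro set_addI)
    thus False using e(2) w(3) by simp
  qed
  define Y where "Y = \<ominus> (y [^] Suc e)"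
  \<comment> \<open>Modulo \<open>x'\<close> the element \<open>x\<close> becomes
    \<open>-y^(e+1)\<close>. As this exponent exceeds \<open>e\<close>, \<open>g\<close> turns into
    \<open>y^e\<close> times \<open>u - y w\<close>, which is still a unit.\<close>
  define x' where "x' = x \<oplus> y [^] Suc e"
  have Yc: "Y \<in> carrier R" and x'c: "x' \<in> carrier R" by (simp_all add: Y_def x'_def)
  have xx: "x = x' \<oplus> Y" by (simp add: x'_def Y_def a_assoc r_neg del: nat_pow_Suc)
  have "\<exists>s\<in>carrier R. x [^] c = x' \<otimes> s \<oplus> Y [^] c"
  proof (induction c)
    case 0 show ?case using x'c by (intro bexI[of _ \<zero>]) auto
  next
    case (Suc c)
    then obtain s where s: "s \<in> carrier R" "x [^] c = x' \<otimes> s \<oplus> Y [^] c" by blast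
    have "x [^] Suc c = (x' \<otimes> s \<oplus> Y [^] c) \<otimes> (x' \<oplus> Y)" using s(2) xx by simp
    also have "\<dots> = x' \<otimes> (s \<otimes> (x' \<oplus> Y) \<oplus> Y [^] c) \<oplus> Y [^] Suc c"
      using s(1) x'c Yc by (simp add: l_distr r_distr m_ac a_ac)
    finally have "x [^] Suc c = x' \<otimes> (s \<otimes> (x' \<oplus> Y) \<oplus> Y [^] c) \<oplus> Y [^] Suc c" .
    thus ?case by (rule bexI) (use s(1) x'c Yc in simp)
  qed
  then obtain s where s: "s \<in> carrier R" "x [^] c = x' \<otimes> s \<oplus> Y [^] c" by blast
  let ?t = "u \<ominus> y \<otimes> w"
  have tc: "?t \<in> carrier R" using w by simp
  have tU: "?t \<in> Units R"
  proof (rule unit[OF tc], rule)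
    assume "?t \<in> \<mm>"
    hence "?t \<oplus> y \<otimes> w \<in> \<mm>" using mm_add mm_mult'[OF y_mm w(1)] by blast
    thus False using u w by (simp add: a_minus_def a_assoc l_neg)
  qed
  obtain \<epsilon> where \<epsilon>: "\<epsilon> \<in> carrier R" "(\<ominus> Y) [^] c = \<epsilon> \<otimes> Y [^] c" using neg_pow[OF Yc] by blast
  define E where "E = Suc e * c + e"
  have g': "g = x' \<otimes> w \<oplus> y [^] e \<otimes> ?t"
  proof -
    have "g = (x' \<oplus> Y) \<otimes> w \<oplus> u \<otimes> y [^] e" using w(3) xx by simp
    also have "\<dots> = x' \<otimes> w \<oplus> y [^] e \<otimes> ?t"
      unfolding Y_def using w(1,2) x'c by (simp add: a_minus_def l_distr r_distr l_minus r_minus m_ac a_ac)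
    finally show ?thesis .
  qed
  let ?q = "x' \<otimes> (s \<otimes> g \<oplus> Y [^] c \<otimes> w)"
  have f': "f = ?q \<oplus> Y [^] c \<otimes> (y [^] e \<otimes> ?t)"
  proof -
    have "f = x' \<otimes> (s \<otimes> g) \<oplus> Y [^] c \<otimes> g" unfolding g(2) s(2) using s(1) x'c Yc g(1) by (simp add: l_distr m_assoc)
    also have "Y [^] c \<otimes> g = x' \<otimes> (Y [^] c \<otimes> w) \<oplus> Y [^] c \<otimes> (y [^] e \<otimes> ?t)"
      unfolding g' using x'c w(1) Yc tc by (simp add: r_distr m_ac del: r_minus)
    finally show ?thesis using x'c s(1) g(1) Yc w(1) tc by (simp add: r_distr a_assoc)
  qed
  have fy: "\<exists>p\<in>carrier R. \<exists>q\<in>carrier R. f = x' \<otimes> p \<oplus> y [^] E \<otimes> q"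
  proof -
    have "y [^] Suc e \<in> carrier R" by simp
    from neg_pow[OF this] obtain \<delta> where \<delta>: "\<delta> \<in> carrier R" "Y [^] c = \<delta> \<otimes> (y [^] Suc e) [^] c"
      unfolding Y_def by blast
    have "Y [^] c \<otimes> (y [^] e \<otimes> ?t) = ((y [^] Suc e) [^] c \<otimes> y [^] e) \<otimes> (\<delta> \<otimes> ?t)"
      unfolding \<delta>(2) using \<delta>(1) tc by (simp only: m_ac m_closed nat_pow_closed y_carr)
    also have "(y [^] Suc e) [^] c \<otimes> y [^] e = y [^] E"
      by (simp only: E_def nat_pow_pow[OF y_carr] nat_pow_mult[OF y_carr])
    finally have "f = ?q \<oplus> y [^] E \<otimes> (\<delta> \<otimes> ?t)" using f' by simp
    moreover have "s \<otimes> g \<oplus> Y [^] c \<otimes> w \<in> carrier R" "\<delta> \<otimes> ?t \<in> carrier R"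
      using s(1) g(1) Yc w(1) \<delta>(1) tc by simp_all
    ultimately show ?thesis
      by (intro bexI[of _ "s \<otimes> g \<oplus> Y [^] c \<otimes> w"] bexI[of _ "\<delta> \<otimes> ?t"])
  qed
  let ?i = "\<epsilon> \<otimes> inv ?t"
  have ic: "inv ?t \<in> carrier R" "?i \<in> carrier R" using tU \<epsilon>(1) by auto
  have qc: "s \<otimes> g \<oplus> Y [^] c \<otimes> w \<in> carrier R" using s(1) g(1) Yc w(1) by simp
  have "y [^] E = (y [^] Suc e) [^] c \<otimes> y [^] e" 
    by (simp only: E_def nat_pow_pow[OF y_carr] nat_pow_mult[OF y_carr])
  also have "y [^] Suc e = \<ominus> Y" by (simp add: Y_def del: nat_pow_Suc)
  also have "(\<ominus> Y) [^] c \<otimes> y [^] e = ?i \<otimes> (Y [^] c \<otimes> (y [^] e \<otimes> ?t))"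
  proof -
    have "?i \<otimes> (Y [^] c \<otimes> (y [^] e \<otimes> ?t)) = (\<epsilon> \<otimes> Y [^] c) \<otimes> y [^] e \<otimes> (inv ?t \<otimes> ?t)"
      using \<epsilon>(1) ic(1) Yc tc by (simp only: m_ac m_closed nat_pow_closed y_carr)
    thus ?thesis using \<epsilon> tU Yc by simp
  qed
  also have "Y [^] c \<otimes> (y [^] e \<otimes> ?t) = f \<ominus> ?q"
  proof -
    have aux: "p \<oplus> q \<ominus> p = q" if "p \<in> carrier R" "q \<in> carrier R" for p q
      using that by (simp add: a_minus_def a_comm[of p q] a_assoc r_neg)
    have "Y [^] c \<otimes> (y [^] e \<otimes> ?t) \<in> carrier R" "?q \<in> carrier R" using Yc tc qc x'c by simp_all
    from aux[OF this(2,1)] show ?thesis unfolding f'[symmetric] by (rule sym)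
  qed
  also have "?i \<otimes> (f \<ominus> ?q) = x' \<otimes> (\<ominus> (?i \<otimes> (s \<otimes> g \<oplus> Y [^] c \<otimes> w))) \<oplus> f \<otimes> ?i"
  proof -
    have "?i \<otimes> (f \<ominus> x' \<otimes> r) = x' \<otimes> (\<ominus> (?i \<otimes> r)) \<oplus> f \<otimes> ?i" if "r \<in> carrier R" for r
    proof -
      have "j \<otimes> (f \<ominus> x' \<otimes> r) = x' \<otimes> (\<ominus> (j \<otimes> r)) \<oplus> f \<otimes> j" if "j \<in> carrier R" for j
        using that \<open>r \<in> carrier R\<close> f(1) x'c by (simp add: a_minus_def r_distr r_minus m_ac a_ac)
      thus ?thesis using ic(2) by blast
    qed
    thus ?thesis using qc by blast
  qed
  finally have "y [^] E = x' \<otimes> (\<ominus> (?i \<otimes> (s \<otimes> g \<oplus> Y [^] c \<otimes> w))) \<oplus> f \<otimes> ?i" .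
  moreover have "\<ominus> (?i \<otimes> (s \<otimes> g \<oplus> Y [^] c \<otimes> w)) \<in> carrier R" using ic(2) qc by blast
  ultimately have y': "\<exists>p\<in>carrier R. \<exists>q\<in>carrier R. y [^] E = x' \<otimes> p \<oplus> f \<otimes> q"
    by (intro bexI[of _ "\<ominus> (?i \<otimes> (s \<otimes> g \<oplus> Y [^] c \<otimes> w))"] bexI[of _ ?i] ic(2))
  \<comment> \<open>\<open>x'\<close> differs from \<open>x\<close> by a multiple of
    \<open>y\<close>, so the new pair generates the same maximal ideal.\<close>
  have mm: "two_gen R x' y = \<mm>"
  proof (intro equalityI subsetI)
    fix v assume "v \<in> two_gen R x' y"
    then obtain a b where ab: "a \<in> carrier R" "b \<in> carrier R" "v = x' \<otimes> a \<oplus> y \<otimes> b" by (auto simp: two_gen_def)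
    have v: "v = x \<otimes> a \<oplus> y \<otimes> (y [^] e \<otimes> a \<oplus> b)"
      unfolding ab(3) x'_def using ab by (simp add: l_distr r_distr m_ac a_ac)
    show "v \<in> \<mm>"
      unfolding v by (intro mm_add mm_mult'[OF x_mm ab(1)] mm_mult'[OF y_mm]) (use ab in simp)
  next
    fix v assume "v \<in> \<mm>"
    then obtain a b where ab: "a \<in> carrier R" "b \<in> carrier R" "v = x \<otimes> a \<oplus> y \<otimes> b" by (auto simp: two_gen_def)
    have v: "v = x' \<otimes> a \<oplus> y \<otimes> (b \<ominus> y [^] e \<otimes> a)"
      unfolding ab(3) using ab x'c by (subst xx) (simp add: Y_def l_distr r_distr l_minus r_minus a_minus_def m_ac a_ac)
    have "b \<ominus> y [^] e \<otimes> a \<in> carrier R" using ab by simp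
    thus "v \<in> two_gen R x' y" unfolding two_gen_def mem_Collect_eq
      by (intro exI[of _ a] exI[of _ "b \<ominus> y [^] e \<otimes> a"] conjI v ab(1))
  qed
  have "two_dim_local R x' y"
  proof (intro two_dim_local.intro two_gen_local.intro two_gen_local_axioms.intro two_dim_local_axioms.intro)
    show "cring R" by (rule is_cring)
    show "noetherian_ring R" by (rule noetherian)
    show "\<one> \<notin> two_gen R x' y" unfolding mm by (rule one_notin)
    show "a \<in> Units R" if "a \<in> carrier R" "a \<notin> two_gen R x' y" for a using that unit unfolding mm by blast
    show "\<exists>P0 P1 P2. primeideal P0 R \<and> primeideal P1 R \<and> primeideal P2 R \<and> P0 \<subset> P1 \<and> P1 \<subset> P2"
      by (rule prime_chain)
  qed (use x'c in auto)
  thus thesis using that y' fy by blast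
qed

end

section \<open>Quotients of local rings\<close>

context two_gen_local
begin

lemma maximalideal_mm: "maximalideal \<mm> R"
proof (rule maximalidealI[OF ideal_mm])
  show "carrier R \<noteq> \<mm>" using one_notin one_closed by blast
  fix J assume J: "ideal J R" "\<mm> \<subseteq> J" "J \<subseteq> carrier R"
  show "J = \<mm> \<or> J = carrier R"
    using proper_ideal_le_mm[OF J(1)] ideal.one_imp_carrier[OF J(1)] J(2) by blast
qed

lemma max_ideal_eq: "max_ideal R = \<mm>"
  unfolding max_ideal_def
proof (rule the_equality)
  show "maximalideal \<mm> R" by (rule maximalideal_mm)
  fix I assume I: "maximalideal I R"
  have II: "ideal I R" using I by (rule maximalideal.axioms(1))
  have "\<one> \<notin> I" using maximalideal.I_notcarr[OF I] ideal.one_imp_carrier[OF II] by blast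
  hence "I \<subseteq> \<mm>" by (rule proper_ideal_le_mm[OF II])
  moreover have "\<mm> \<subseteq> carrier R" using mm_carr by blast
  ultimately have "\<mm> = I \<or> \<mm> = carrier R" using maximalideal.I_maximal[OF I ideal_mm] by blast
  thus "I = \<mm>" using one_notin one_closed by blast
qed

lemma ideal_power_eq: "ideal_power R \<mm> n = mpow n"
proof (induction n)
  case (Suc n)
  have "ideal_prod R \<mm> (mpow n) = mpow (Suc n)"
  proof (intro equalityI subsetI)
    fix v assume "v \<in> ideal_prod R \<mm> (mpow n)"
    thus "v \<in> mpow (Suc n)"
      by (induction rule: ideal_prod.induct) (auto intro: mm_mult_mpow mpow_add)
  next
    fix v assume "v \<in> mpow (Suc n)"
    then obtain a b where ab: "a \<in> mpow n" "b \<in> mpow n" "v = x \<otimes> a \<oplus> y \<otimes> b" by (rule mpow_SucE)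
    show "v \<in> ideal_prod R \<mm> (mpow n)"
      unfolding ab(3) by (intro ideal_prod.sum ideal_prod.prod x_mm y_mm ab(1,2))
  qed
  thus ?case using Suc by simp
qed simp

end

text \<open>Abstracting from \<open>Quot\<close> lets one correspondence of ideals serve a single
  quotient map as well as the composite of two.\<close>

locale surj_ring_hom = ring_hom_cring R S h for R (structure) and S (structure) and h +
  assumes surj: "h ` carrier R = carrier S"
begin

lemma closed_S [simp]: "a \<in> carrier R \<Longrightarrow> h a \<in> carrier S"
  using surj by blast

lemma surjE:
  assumes "s \<in> carrier S"
  obtains a where "a \<in> carrier R" "s = h a"
  using assms surj by blast

lemma map_add: "a \<in> carrier R \<Longrightarrow> b \<in> carrier R \<Longrightarrow> h (a \<oplus> b) = h a \<oplus>\<^bsub>S\<^esub> h b"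
  by simp

lemma map_eq_iff:
  assumes "a \<in> carrier R" "b \<in> carrier R"
  shows "h a = h b \<longleftrightarrow> a \<ominus> b \<in> a_kernel R S h"
proof -
  have "h (a \<ominus> b) = h a \<ominus>\<^bsub>S\<^esub> h b" using assms by (simp add: R.minus_eq S.minus_eq)
  moreover have "h a \<ominus>\<^bsub>S\<^esub> h b = \<zero>\<^bsub>S\<^esub> \<longleftrightarrow> h a = h b"
    by (rule S.r_right_minus_eq) (use assms in simp_all)
  moreover have "a \<ominus> b \<in> carrier R" using assms by simp
  ultimately show ?thesis by (simp only: a_kernel_def' mem_Collect_eq simp_thms)
qed

lemma ideal_image:
  assumes J: "ideal J R"
  shows "ideal (h ` J) S"
proof (rule idealI[OF S.ring_axioms])
  note c = ideal.Icarr[OF J] and a = additive_subgroup.a_closed[OF ideal.axioms(1)[OF J]]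
    and z = additive_subgroup.zero_closed[OF ideal.axioms(1)[OF J]]
    and n = additive_subgroup.a_inv_closed[OF ideal.axioms(1)[OF J]]
  show "subgroup (h ` J) (add_monoid S)"
  proof (rule S.add.subgroupI)
    show "h ` J \<subseteq> carrier S" using c by auto
    show "h ` J \<noteq> {}" using z by blast
    fix u v assume u: "u \<in> h ` J" 
    then obtain p where p: "p \<in> J" "u = h p" by blast
    have "\<ominus>\<^bsub>S\<^esub> u = h (\<ominus> p)" using p c by simp
    thus "\<ominus>\<^bsub>S\<^esub> u \<in> h ` J" using n[OF p(1)] by blast
    assume "v \<in> h ` J"
    then obtain q where q: "q \<in> J" "v = h q" by blast
    have "u \<oplus>\<^bsub>S\<^esub> v = h (p \<oplus> q)" using p q c by simp
    thus "u \<oplus>\<^bsub>S\<^esub> v \<in> h ` J" using a[OF p(1) q(1)] by blast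
  qed
  fix u s assume us: "u \<in> h ` J" "s \<in> carrier S"
  then obtain p where p: "p \<in> J" "u = h p" by blast
  obtain r where r: "r \<in> carrier R" "s = h r" using us(2) by (rule surjE)
  have "s \<otimes>\<^bsub>S\<^esub> u = h (r \<otimes> p)" "u \<otimes>\<^bsub>S\<^esub> s = h (p \<otimes> r)" using p r c by simp_all
  thus "s \<otimes>\<^bsub>S\<^esub> u \<in> h ` J" "u \<otimes>\<^bsub>S\<^esub> s \<in> h ` J"
    using ideal.I_l_closed[OF J p(1) r(1)] ideal.I_r_closed[OF J p(1) r(1)] by auto
qed

lemma image_vimage: "J \<subseteq> carrier S \<Longrightarrow> h ` {r \<in> carrier R. h r \<in> J} = J"
proof (intro equalityI subsetI)
  fix s assume J: "J \<subseteq> carrier S" and s: "s \<in> J"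
  obtain a where "a \<in> carrier R" "s = h a" using J s by (elim surjE[OF subsetD])
  thus "s \<in> h ` {r \<in> carrier R. h r \<in> J}" using s by blast
qed auto

lemma vimage_image:
  assumes J: "ideal J R" "a_kernel R S h \<subseteq> J"
  shows "{r \<in> carrier R. h r \<in> h ` J} = J"
proof (intro equalityI subsetI)
  fix r assume "r \<in> {r \<in> carrier R. h r \<in> h ` J}"
  then obtain j where j: "r \<in> carrier R" "j \<in> J" "h r = h j" by auto
  have jc: "j \<in> carrier R" using j ideal.Icarr[OF J(1)] by blast
  have "r \<ominus> j \<in> J" using map_eq_iff[OF j(1) jc] j(3) J(2) by blast
  hence "(r \<ominus> j) \<oplus> j \<in> J" using j(2) additive_subgroup.a_closed[OF ideal.axioms(1)[OF J(1)]] by blast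
  thus "r \<in> J" using j(1) jc by (simp add: R.minus_eq R.a_assoc R.l_neg)
next
  fix r assume "r \<in> J"
  thus "r \<in> {r \<in> carrier R. h r \<in> h ` J}" by (simp add: ideal.Icarr[OF J(1)])
qed

lemma ideal_kernel: "ideal (a_kernel R S h) R"
proof -
  have "ring_hom_ring R S h" by (rule ring_hom_ringI2[OF R.ring_axioms S.ring_axioms homh])
  thus ?thesis by (rule ring_hom_ring.kernel_is_ideal)
qed

lemma ideal_vimage: "ideal J S \<Longrightarrow> ideal {r \<in> carrier R. h r \<in> J} R"
proof -
  assume J: "ideal J S"
  have "ring_hom_ring R S h" by (rule ring_hom_ringI2[OF R.ring_axioms S.ring_axioms homh])
  thus ?thesis using J by (rule ring_hom_ring.ideal_vimage)
qed

lemma primeideal_vimage: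
  assumes P: "primeideal P S"
  shows "primeideal {r \<in> carrier R. h r \<in> P} R"
proof (rule primeidealI[OF ideal_vimage[OF primeideal.axioms(1)[OF P]] R.is_cring])
  have "\<one>\<^bsub>S\<^esub> \<notin> P"
    using primeideal.I_notcarr[OF P] ideal.one_imp_carrier[OF primeideal.axioms(1)[OF P]] by blast
  hence "\<one> \<notin> {r \<in> carrier R. h r \<in> P}" by simp
  thus "carrier R \<noteq> {r \<in> carrier R. h r \<in> P}" using R.one_closed by blast
  fix a b assume "a \<in> carrier R" "b \<in> carrier R" "a \<otimes> b \<in> {r \<in> carrier R. h r \<in> P}"
  thus "a \<in> {r \<in> carrier R. h r \<in> P} \<or> b \<in> {r \<in> carrier R. h r \<in> P}"
    using primeideal.I_prime[OF P, of "h a" "h b"] by auto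
qed

lemma primeideal_image:
  assumes P: "primeideal P R" and k: "a_kernel R S h \<subseteq> P"
  shows "primeideal (h ` P) S"
proof (rule primeidealI[OF ideal_image[OF primeideal.axioms(1)[OF P]] S.is_cring])
  note v = vimage_image[OF primeideal.axioms(1)[OF P] k]
  show "carrier S \<noteq> h ` P"
  proof
    assume "carrier S = h ` P"
    hence "\<one> \<in> {r \<in> carrier R. h r \<in> h ` P}" by (metis (mono_tags) R.one_closed closed_S mem_Collect_eq)
    thus False unfolding v
      using primeideal.I_notcarr[OF P] ideal.one_imp_carrier[OF primeideal.axioms(1)[OF P]] by blast
  qed
  fix a b assume ab: "a \<in> carrier S" "b \<in> carrier S" "a \<otimes>\<^bsub>S\<^esub> b \<in> h ` P"
  obtain r where r: "r \<in> carrier R" "a = h r" using ab(1) by (rule surjE)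
  obtain s where s: "s \<in> carrier R" "b = h s" using ab(2) by (rule surjE)
  have "r \<otimes> s \<in> {r \<in> carrier R. h r \<in> h ` P}" using ab(3) r s by simp
  hence "r \<in> P \<or> s \<in> P" unfolding v using primeideal.I_prime[OF P r(1) s(1)] by blast
  thus "a \<in> h ` P \<or> b \<in> h ` P" using r s by blast
qed

text \<open>Ideals of \<open>S\<close> correspond to ideals of \<open>R\<close> containing the
  kernel, so lengths of quotient rings become interval lengths in \<open>R\<close>.\<close>

lemma ring_length_eq: "ring_length S = mlen R (self_module R) (a_kernel R S h) (carrier R)"
proof -
  have "(\<exists>J. (\<forall>i\<le>n. ideal (J i) S) \<and> (\<forall>i<n. J i \<subset> J (Suc i)))
     \<longleftrightarrow> submodule_chain R (self_module R) (a_kernel R S h) (carrier R) n" for n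
  proof
    assume "\<exists>J. (\<forall>i\<le>n. ideal (J i) S) \<and> (\<forall>i<n. J i \<subset> J (Suc i))"
    then obtain J where J: "\<forall>i\<le>n. ideal (J i) S" "\<forall>i<n. J i \<subset> J (Suc i)" by blast
    let ?V = "\<lambda>i. {r \<in> carrier R. h r \<in> J i}"
    have "submodule (?V i) R (self_module R) \<and> a_kernel R S h \<subseteq> ?V i \<and> ?V i \<subseteq> carrier R" if "i \<le> n" for i
    proof -
      have Ji: "ideal (J i) S" using J(1) that by blast
      have "\<zero>\<^bsub>S\<^esub> \<in> J i" using additive_subgroup.zero_closed[OF ideal.axioms(1)[OF Ji]] .
      moreover have "h r = \<zero>\<^bsub>S\<^esub>" "r \<in> carrier R" if "r \<in> a_kernel R S h" for r
        using that unfolding a_kernel_def' by blast+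
      ultimately have "a_kernel R S h \<subseteq> ?V i" by auto
      moreover have "submodule (?V i) R (self_module R)"
        unfolding R.submodule_self_iff by (rule ideal_vimage[OF Ji])
      ultimately show ?thesis by blast
    qed
    moreover have "?V i \<subset> ?V (Suc i)" if i: "i < n" for i
    proof -
      have "J i \<subset> J (Suc i)" using J(2) i by blast
      moreover have "J (Suc i) \<subseteq> carrier S" using J(1)[rule_format, of "Suc i"] i ideal.Icarr by fastforce
      ultimately have "h ` ?V i \<subset> h ` ?V (Suc i)" using image_vimage[of "J i"] image_vimage[of "J (Suc i)"] by simp
      moreover have "?V i \<subseteq> ?V (Suc i)" using \<open>J i \<subset> J (Suc i)\<close> by blast
      ultimately show ?thesis by blast
    qed
    ultimately show "submodule_chain R (self_module R) (a_kernel R S h) (carrier R) n"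
      unfolding submodule_chain_def by (intro exI[of _ ?V]) simp
  next
    assume "submodule_chain R (self_module R) (a_kernel R S h) (carrier R) n"
    then obtain J where J: "\<forall>i\<le>n. submodule (J i) R (self_module R) \<and> a_kernel R S h \<subseteq> J i \<and> J i \<subseteq> carrier R"
      "\<forall>i<n. J i \<subset> J (Suc i)" unfolding submodule_chain_def by (elim exE conjE) rule
    have Ji: "ideal (J i) R" "a_kernel R S h \<subseteq> J i" if "i \<le> n" for i
      using J(1)[rule_format, OF that] by (simp_all add: R.submodule_self_iff)
    have "h ` J i \<subset> h ` J (Suc i)" if i: "i < n" for i
    proof -
      have "J i \<subset> J (Suc i)" using J(2) i by blast
      have "i \<le> n" "Suc i \<le> n" using i by simp_all
      hence e: "{r \<in> carrier R. h r \<in> h ` J i} = J i" "{r \<in> carrier R. h r \<in> h ` J (Suc i)} = J (Suc i)"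
        by (intro vimage_image Ji; simp)+
      have "h ` J i \<noteq> h ` J (Suc i)"
      proof
        assume eq: "h ` J i = h ` J (Suc i)"
        have "J i = J (Suc i)" by (rule trans[OF sym[OF e(1)] e(2)[folded eq]])
        thus False using \<open>J i \<subset> J (Suc i)\<close> by simp
      qed
      moreover have "h ` J i \<subseteq> h ` J (Suc i)" using \<open>J i \<subset> J (Suc i)\<close> by (intro image_mono) blast
      ultimately show ?thesis by (rule psubsetI[rotated])
    qed
    moreover have "ideal (h ` J i) S" if "i \<le> n" for i using ideal_image[OF Ji(1)[OF that]] .
    ultimately show "\<exists>J. (\<forall>i\<le>n. ideal (J i) S) \<and> (\<forall>i<n. J i \<subset> J (Suc i))"
      by (intro exI[of _ "\<lambda>i. h ` J i"]) simp
  qed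
  moreover have "{enat n |n. Q n} = enat ` {n. Q n}" for Q by blast
  ultimately show ?thesis unfolding ring_length_def mlen_def by simp
qed

lemma noetherian_image:
  assumes "noetherian_ring R"
  shows "noetherian_ring S"
proof (rule S.trivial_ideal_chain_imp_noetherian)
  interpret N: noetherian_ring R by fact
  fix C assume C: "C \<noteq> {}" "subset.chain {I. ideal I S} C"
  let ?V = "\<lambda>J. {r \<in> carrier R. h r \<in> J}"
  have CI: "ideal J S" if "J \<in> C" for J using C(2) that unfolding subset_chain_def by blast
  have "subset.chain {I. ideal I R} (?V ` C)"
    unfolding subset_chain_def
  proof (intro conjI ballI)
    show "?V ` C \<subseteq> {I. ideal I R}" using ideal_vimage[OF CI] by blast
    fix A B assume "A \<in> ?V ` C" "B \<in> ?V ` C"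
    then obtain J K where JK: "J \<in> C" "K \<in> C" "A = ?V J" "B = ?V K" by blast
    have "J \<subseteq> K \<or> K \<subseteq> J" using C(2) JK(1,2) unfolding subset_chain_def by blast
    thus "A \<subseteq> B \<or> B \<subseteq> A" unfolding JK(3,4) by blast
  qed
  hence "\<Union>(?V ` C) \<in> ?V ` C" using C(1) by (intro N.ideal_chain_is_trivial) auto
  then obtain K where K: "K \<in> C" "\<Union>(?V ` C) = ?V K" by blast
  have "J \<subseteq> K" if J: "J \<in> C" for J
  proof -
    have "J \<subseteq> carrier S" "K \<subseteq> carrier S" using ideal.Icarr[OF CI[OF J]] ideal.Icarr[OF CI[OF K(1)]] by auto
    moreover have "?V J \<subseteq> ?V K" using J K(2) by blast
    hence "h ` ?V J \<subseteq> h ` ?V K" by (rule image_mono)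
    ultimately show ?thesis using image_vimage[of J] image_vimage[of K] by simp
  qed
  hence "\<Union>C = K" using K(1) by blast
  thus "\<Union>C \<in> C" using K(1) by simp
qed

end

lemma (in cring) quotient_surj:
  assumes I: "ideal I R"
  shows "surj_ring_hom R (R Quot I) (\<lambda>a. I +> a)" "a_kernel R (R Quot I) (\<lambda>a. I +> a) = I"
proof -
  have h: "ring_hom_cring R (R Quot I) ((+>) I)" by (rule ideal.rcos_ring_hom_cring[OF I is_cring])
  have AS: "abelian_subgroup I R" by (rule abelian_subgroupI3[OF ideal.axioms(1)[OF I] is_abelian_group])
  have "(\<lambda>a. I +> a) ` carrier R = carrier (R Quot I)"
    unfolding FactRing_def A_RCOSETS_def' by auto
  thus "surj_ring_hom R (R Quot I) (\<lambda>a. I +> a)"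
    by (intro surj_ring_hom.intro h surj_ring_hom_axioms.intro)
  have z: "\<zero>\<^bsub>R Quot I\<^esub> = I" unfolding FactRing_def by simp
  have "I +> a = I \<longleftrightarrow> a \<in> I" if "a \<in> carrier R" for a
  proof
    assume "I +> a = I"
    thus "a \<in> I" using abelian_subgroup.a_rcos_self[OF AS that] by (simp only:)
  qed (rule abelian_subgroup.a_rcos_const[OF AS])
  thus "a_kernel R (R Quot I) (\<lambda>a. I +> a) = I"
    unfolding a_kernel_def' z using ideal.Icarr[OF I] by blast
qed

lemma surj_ring_hom_comp:
  assumes g: "surj_ring_hom R S g" and h: "surj_ring_hom S T h"
  shows "surj_ring_hom R T (\<lambda>a. h (g a))"
proof -
  interpret g: surj_ring_hom R S g by (rule g)
  interpret h: surj_ring_hom S T h by (rule h)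
  have "(\<lambda>a. h (g a)) \<in> ring_hom R T" by (auto simp: ring_hom_def)
  moreover have "(\<lambda>a. h (g a)) ` carrier R = carrier T"
    using g.surj h.surj by (metis image_image)
  ultimately show ?thesis
    by (intro surj_ring_hom.intro ring_hom_cring.intro ring_hom_cring_axioms.intro surj_ring_hom_axioms.intro
        g.R.is_cring h.S.is_cring)
qed

locale local_surj = two_gen_local R x y + surj_ring_hom R S h
  for R (structure) and S (structure) and x y h +
  assumes one_nonzero: "\<one>\<^bsub>S\<^esub> \<noteq> \<zero>\<^bsub>S\<^esub>"
begin

lemma kernel_le_mm: "a_kernel R S h \<subseteq> \<mm>"
proof (rule proper_ideal_le_mm[OF ideal_kernel])
  show "\<one> \<notin> a_kernel R S h" unfolding a_kernel_def' mem_Collect_eq hom_one using one_nonzero by blast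
qed

lemma two_gen_image: "two_gen S (h x) (h y) = h ` \<mm>"
proof (intro equalityI subsetI)
  fix v assume "v \<in> two_gen S (h x) (h y)"
  then obtain s t where st: "s \<in> carrier S" "t \<in> carrier S" "v = h x \<otimes>\<^bsub>S\<^esub> s \<oplus>\<^bsub>S\<^esub> h y \<otimes>\<^bsub>S\<^esub> t"
    by (auto simp: two_gen_def)
  obtain a where a: "a \<in> carrier R" "s = h a" using st(1) by (rule surjE)
  obtain b where b: "b \<in> carrier R" "t = h b" using st(2) by (rule surjE)
  have "v = h (x \<otimes> a \<oplus> y \<otimes> b)" using st a b by simp
  moreover have "x \<otimes> a \<oplus> y \<otimes> b \<in> \<mm>" using a b by (auto simp: two_gen_def)
  ultimately show "v \<in> h ` \<mm>" by blast
next
  fix v assume "v \<in> h ` \<mm>"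
  then obtain a b where ab: "a \<in> carrier R" "b \<in> carrier R" "v = h (x \<otimes> a \<oplus> y \<otimes> b)" by (auto simp: two_gen_def)
  have "v = h x \<otimes>\<^bsub>S\<^esub> h a \<oplus>\<^bsub>S\<^esub> h y \<otimes>\<^bsub>S\<^esub> h b" using ab by simp
  thus "v \<in> two_gen S (h x) (h y)" using ab(1,2) unfolding two_gen_def by blast
qed

lemma h_mm_iff: "a \<in> carrier R \<Longrightarrow> h a \<in> h ` \<mm> \<longleftrightarrow> a \<in> \<mm>"
  using vimage_image[OF ideal_mm kernel_le_mm] by blast

lemma two_gen_local_image: "two_gen_local S (h x) (h y)"
proof (intro two_gen_local.intro two_gen_local_axioms.intro)
  show "cring S" by (rule S.is_cring)
  show "noetherian_ring S" by (rule noetherian_image[OF noetherian])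
  show "h x \<in> carrier S" "h y \<in> carrier S" by simp_all
  have "h \<one> \<notin> h ` \<mm>" using h_mm_iff[OF R.one_closed] one_notin by blast
  thus "\<one>\<^bsub>S\<^esub> \<notin> two_gen S (h x) (h y)" unfolding two_gen_image by simp
  fix s assume s: "s \<in> carrier S" "s \<notin> two_gen S (h x) (h y)"
  obtain a where a: "a \<in> carrier R" "s = h a" using s(1) by (rule surjE)
  have "a \<notin> \<mm>" using s(2) a(2) unfolding two_gen_image by blast
  hence u: "a \<in> Units R" using unit a(1) by blast
  have "h (inv a) \<otimes>\<^bsub>S\<^esub> h a = \<one>\<^bsub>S\<^esub>" "h a \<otimes>\<^bsub>S\<^esub> h (inv a) = \<one>\<^bsub>S\<^esub>"
    using u a(1) by (simp_all flip: hom_mult)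
  thus "s \<in> Units S" unfolding Units_def a(2) using u a(1) by auto
qed

lemma two_gen_pow_image: "two_gen_pow S (h x) (h y) n = h ` mpow n"
proof (induction n)
  case 0
  show ?case using surj by simp
next
  case (Suc n)
  have e: "h x \<otimes>\<^bsub>S\<^esub> h a \<oplus>\<^bsub>S\<^esub> h y \<otimes>\<^bsub>S\<^esub> h b = h (x \<otimes> a \<oplus> y \<otimes> b)" if "a \<in> mpow n" "b \<in> mpow n" for a b
    using mpow_carr[OF that(1)] mpow_carr[OF that(2)] by simp
  show ?case
  proof (intro equalityI subsetI)
    fix v assume "v \<in> two_gen_pow S (h x) (h y) (Suc n)"
    then obtain s t where st: "s \<in> h ` mpow n" "t \<in> h ` mpow n" "v = h x \<otimes>\<^bsub>S\<^esub> s \<oplus>\<^bsub>S\<^esub> h y \<otimes>\<^bsub>S\<^esub> t"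
      unfolding two_gen_pow.simps(2) Suc by blast
    obtain a where a: "a \<in> mpow n" "s = h a" using st(1) by (rule imageE)
    obtain b where b: "b \<in> mpow n" "t = h b" using st(2) by (rule imageE)
    show "v \<in> h ` mpow (Suc n)" unfolding st(3) a(2) b(2) e[OF a(1) b(1)]
      by (rule imageI[OF mpow_SucI[OF a(1) b(1)]])
  next
    fix v assume "v \<in> h ` mpow (Suc n)"
    then obtain w where w: "w \<in> mpow (Suc n)" "v = h w" by (rule imageE)
    obtain a b where ab: "a \<in> mpow n" "b \<in> mpow n" "w = x \<otimes> a \<oplus> y \<otimes> b" using w(1) by (rule mpow_SucE)
    have "h a \<in> two_gen_pow S (h x) (h y) n" "h b \<in> two_gen_pow S (h x) (h y) n"
      unfolding Suc using ab(1,2) by (simp_all only: imageI)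
    thus "v \<in> two_gen_pow S (h x) (h y) (Suc n)"
      unfolding w(2) ab(3) e[OF ab(1,2), symmetric] two_gen_pow.simps(2) by blast
  qed
qed

lemma max_ideal_image: "max_ideal S = h ` \<mm>"
  using two_gen_local.max_ideal_eq[OF two_gen_local_image] two_gen_image by simp

text \<open>The ring is reached from \<open>R\<close> by two surjections, whose composite has the
  sum of the kernel and \<open>m^n\<close> as its kernel.\<close>

lemma ring_length_Quot_power:
  "ring_length (S Quot ideal_power S (max_ideal S) n)
     = mlen R (self_module R) (a_kernel R S h <+>\<^bsub>R\<^esub> mpow n) (carrier R)"
proof -
  interpret L: two_gen_local S "h x" "h y" by (rule two_gen_local_image)
  interpret M: module R "self_module R" by (rule R.module_self)
  let ?I = "h ` mpow n"
  have e: "ideal_power S (max_ideal S) n = ?I"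
    using L.ideal_power_eq[of n] L.max_ideal_eq two_gen_pow_image by simp
  have I: "ideal ?I S" by (rule ideal_image[OF ideal_mpow])
  note q = S.quotient_surj[OF I]
  let ?g = "\<lambda>a. ?I +>\<^bsub>S\<^esub> h a"
  interpret T: surj_ring_hom R "S Quot ?I" ?g
    by (rule surj_ring_hom_comp[OF surj_ring_hom_axioms q(1)])
  have sk: "submodule (a_kernel R S h) R (self_module R)" using ideal_kernel by (simp add: R.submodule_self_iff)
  have sum: "submodule (a_kernel R S h <+>\<^bsub>R\<^esub> mpow n) R (self_module R)"
    using M.submodule_set_add[OF sk submodule_mpow] by simp
  have "a_kernel R (S Quot ?I) ?g = {a \<in> carrier R. h a \<in> ?I}"
  proof -
    have "h a \<in> ?I \<longleftrightarrow> ?g a = \<zero>\<^bsub>S Quot ?I\<^esub>" if "a \<in> carrier R" for a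
    proof -
      have "h a \<in> a_kernel S (S Quot ?I) (\<lambda>a. ?I +>\<^bsub>S\<^esub> a) \<longleftrightarrow> ?g a = \<zero>\<^bsub>S Quot ?I\<^esub>"
        unfolding a_kernel_def' using closed_S[OF that] by blast
      thus ?thesis unfolding q(2) .
    qed
    thus ?thesis unfolding a_kernel_def' by blast
  qed
  also have "\<dots> = a_kernel R S h <+>\<^bsub>R\<^esub> mpow n"
  proof (intro equalityI subsetI)
    fix a assume "a \<in> {a \<in> carrier R. h a \<in> ?I}"
    then obtain m where m: "a \<in> carrier R" "m \<in> mpow n" "h a = h m" by auto
    have mc: "m \<in> carrier R" using m(2) mpow_carr by blast
    have "(a \<ominus> m) \<oplus> m \<in> a_kernel R S h <+>\<^bsub>R\<^esub> mpow n"
      using map_eq_iff[OF m(1) mc] m by (intro set_addI) auto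
    thus "a \<in> a_kernel R S h <+>\<^bsub>R\<^esub> mpow n" using m(1) mc by (simp add: R.minus_eq R.a_assoc R.l_neg)
  next
    fix a assume a: "a \<in> a_kernel R S h <+>\<^bsub>R\<^esub> mpow n"
    hence ac: "a \<in> carrier R" using M.submodule_carr[OF sum] by simp
    from a obtain k m where km: "k \<in> a_kernel R S h" "m \<in> mpow n" "a = k \<oplus> m" unfolding set_add_iff by blast
    have "k \<in> carrier R" "h k = \<zero>\<^bsub>S\<^esub>" using km(1) unfolding a_kernel_def' by blast+
    hence "h a = h m" unfolding km(3) using mpow_carr[OF km(2)] by simp
    thus "a \<in> {a \<in> carrier R. h a \<in> ?I}" using ac km(2) by blast
  qed
  finally show ?thesis using T.ring_length_eq unfolding e by simp
qed

end

section \<open>Dimension and multiplicity of a hypersurface\<close>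

lemma (in two_gen_local) local_surj_quotient:
  assumes I: "ideal I R" "I \<subseteq> \<mm>"
  shows "local_surj R (R Quot I) x y (\<lambda>a. I +> a)"
proof (intro local_surj.intro two_gen_local_axioms local_surj_axioms.intro)
  show "surj_ring_hom R (R Quot I) (\<lambda>a. I +> a)" by (rule quotient_surj(1)[OF I(1)])
  then interpret H: surj_ring_hom R "R Quot I" "\<lambda>a. I +> a" .
  show "\<one>\<^bsub>R Quot I\<^esub> \<noteq> \<zero>\<^bsub>R Quot I\<^esub>"
  proof
    assume "\<one>\<^bsub>R Quot I\<^esub> = \<zero>\<^bsub>R Quot I\<^esub>"
    hence "\<one> \<in> a_kernel R (R Quot I) (\<lambda>a. I +> a)"
      unfolding a_kernel_def' mem_Collect_eq H.hom_one using one_closed by blast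
    hence "\<one> \<in> \<mm>" unfolding quotient_surj(2)[OF I(1)] using I(2) by blast
    thus False using one_notin by blast
  qed
qed

lemma krull_dim_ge:
  assumes "\<And>i. i \<le> n \<Longrightarrow> primeideal (P i) R" "\<And>i. i < n \<Longrightarrow> P i \<subset> P (Suc i)"
  shows "enat n \<le> krull_dim R"
  unfolding krull_dim_def using assms by (intro Sup_upper) auto

context two_dim_local
begin

text \<open>An ideal \<open>P\<close> maximal among those that contain \<open>I\<close> and no power
  of \<open>z\<close> is prime: for \<open>a\<close> and \<open>b\<close> outside \<open>P\<close>,
  powers of \<open>z\<close> lie in \<open>P + (a)\<close> and in \<open>P + (b)\<close>, and their
  product lies in \<open>P + (a b)\<close>.\<close>

lemma exists_prime_avoiding:
  assumes I: "ideal I R" and z: "z \<in> carrier R" and zI: "\<And>n::nat. z [^] n \<notin> I"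
  obtains P where "primeideal P R" "I \<subseteq> P" "z \<notin> P"
proof -
  interpret S: noeth_module R "self_module R" x y by (rule noeth_self)
  let ?S = "{P. submodule P R (self_module R) \<and> I \<subseteq> P \<and> (\<forall>n::nat. z [^] n \<notin> P)}"
  have "I \<in> ?S" using I zI by (simp add: submodule_self_iff)
  moreover have "submodule P R (self_module R)" if "P \<in> ?S" for P using that by simp
  ultimately have "\<exists>P\<in>?S. \<forall>L\<in>?S. P \<subseteq> L \<longrightarrow> L = P" by (rule acc_module_maximal[OF S.acc])
  then obtain P where P: "P \<in> ?S" "\<forall>L\<in>?S. P \<subseteq> L \<longrightarrow> L = P" ..
  have sP: "submodule P R (self_module R)" and IP: "I \<subseteq> P" and zP: "\<And>n::nat. z [^] n \<notin> P" using P(1) by auto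
  have iP: "ideal P R" using sP by (simp add: submodule_self_iff)
  have pow: "\<exists>n::nat. \<exists>p\<in>P. \<exists>r\<in>carrier R. z [^] n = p \<oplus> r \<otimes> a" if a: "a \<in> carrier R" "a \<notin> P" for a
  proof (rule ccontr)
    assume no: "\<not> ?thesis"
    have ac: "a \<in> carrier (self_module R)" using a by simp
    let ?L = "P <+>\<^bsub>self_module R\<^esub> S.cyclic a"
    have sL: "submodule ?L R (self_module R)" by (rule S.submodule_set_add[OF sP S.submodule_cyclic[OF ac]])
    have PL: "P \<subseteq> ?L" "a \<in> ?L"
      using S.subset_set_add1[OF sP S.submodule_cyclic[OF ac]] S.subset_set_add2[OF sP S.submodule_cyclic[OF ac]]
        S.cyclic_self[OF ac] by auto
    have "z [^] n \<notin> ?L" for n :: nat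
      using no unfolding set_add_iff S.cyclic_def by auto
    hence "?L = P" using P(2)[rule_format, of ?L] sL PL(1) IP by blast
    thus False using PL(2) a(2) by blast
  qed
  have "primeideal P R"
  proof (rule primeidealI[OF iP is_cring])
    show "carrier R \<noteq> P" using zP[of 0] one_closed by auto
    fix a b assume ab: "a \<in> carrier R" "b \<in> carrier R" "a \<otimes> b \<in> P"
    show "a \<in> P \<or> b \<in> P"
    proof (rule ccontr)
      assume no: "\<not> (a \<in> P \<or> b \<in> P)"
      obtain n :: nat and p r where n: "p \<in> P" "r \<in> carrier R" "z [^] n = p \<oplus> r \<otimes> a"
        using pow[OF ab(1)] no by blast
      obtain m :: nat and q s where m: "q \<in> P" "s \<in> carrier R" "z [^] m = q \<oplus> s \<otimes> b"
        using pow[OF ab(2)] no by blast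
      have c: "p \<in> carrier R" "q \<in> carrier R" using n m ideal.Icarr[OF iP] by auto
      have "z [^] (n + m) = (p \<oplus> r \<otimes> a) \<otimes> (q \<oplus> s \<otimes> b)" using n(3) m(3) nat_pow_mult[OF z, of n m] by simp
      also have "\<dots> = (q \<oplus> s \<otimes> b) \<otimes> p \<oplus> ((r \<otimes> a) \<otimes> q \<oplus> (r \<otimes> s) \<otimes> (a \<otimes> b))"
        using c n(2) m(2) ab by (simp add: l_distr r_distr m_ac a_ac)
      also have "\<dots> \<in> P"
        using ideal.I_l_closed[OF iP n(1), of "q \<oplus> s \<otimes> b"] ideal.I_l_closed[OF iP m(1), of "r \<otimes> a"]
          ideal.I_l_closed[OF iP ab(3), of "r \<otimes> s"] c n(2) m(2) ab(1,2)
          additive_subgroup.a_closed[OF ideal.axioms(1)[OF iP]] by simp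
      finally show False using zP by blast
    qed
  qed
  thus thesis using that IP zP[of 1] z by auto
qed

text \<open>Upper bound: a chain of primes pulled back to \<open>R\<close> can be extended below by
  zero, as all its members contain \<open>f\<close>. Lower bound: \<open>z\<close> is regular modulo
  \<open>f\<close>, hence not nilpotent there, so some prime over \<open>f\<close> avoids
  \<open>z\<close> and lies strictly below m.\<close>

lemma krull_dim_hypersurface:
  assumes dim: "krull_dim R = 2" and f: "f \<in> mpow d" "f \<notin> mpow (Suc d)" and d: "1 \<le> d"
  shows "krull_dim (R Quot PIdl f) = 1"
proof -
  have fc: "f \<in> carrier R" and f0: "f \<noteq> \<zero>" using f mpow_carr by auto
  have I: "ideal (PIdl f) R" by (rule cgenideal_ideal[OF fc])
  have fm: "f \<in> \<mm>" using mpow_le[OF f(1) d] by (simp add: mpow_1)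
  have Im: "PIdl f \<subseteq> \<mm>" using cgenideal_minimal[OF ideal_mm fm] .
  interpret L: local_surj R "R Quot PIdl f" x y "\<lambda>a. PIdl f +> a" by (rule local_surj_quotient[OF I Im])
  note ker = quotient_surj(2)[OF I]
  show ?thesis
  proof (rule antisym)
    show "krull_dim (R Quot PIdl f) \<le> 1"
      unfolding krull_dim_def
    proof (rule Sup_least)
      fix e assume "e \<in> {enat n | n. \<exists>P. (\<forall>i\<le>n. primeideal (P i) (R Quot PIdl f)) \<and> (\<forall>i<n. P i \<subset> P (Suc i))}"
      then obtain n P where n: "e = enat n" "\<forall>i\<le>n. primeideal (P i) (R Quot PIdl f)" "\<forall>i<n. P i \<subset> P (Suc i)" by blast
      let ?V = "\<lambda>i. {r \<in> carrier R. (PIdl f +> r) \<in> P i}"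
      \<comment> \<open>The zero ideal, prime because \<open>R\<close> is a domain, takes index 0,
        and the given chain is shifted by one.\<close>
      define T where "T i = (case i of 0 \<Rightarrow> {\<zero>} | Suc j \<Rightarrow> ?V j)" for i
      have "enat (Suc n) \<le> krull_dim R"
      proof (rule krull_dim_ge[of _ T])
        fix i assume i: "i \<le> Suc n"
        show "primeideal (T i) R"
        proof (cases i)
          case 0
          thus ?thesis using domain.zeroprimeideal[OF domain] by (simp add: T_def)
        next
          case (Suc j)
          thus ?thesis using L.primeideal_vimage n(2) i by (simp add: T_def)
        qed
      next
        fix i assume i: "i < Suc n"
        show "T i \<subset> T (Suc i)"
        proof (cases i)
          case 0
          have P0: "primeideal (P 0) (R Quot PIdl f)" using n(2) by blast
          have z0: "\<zero>\<^bsub>R Quot PIdl f\<^esub> \<in> P 0"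
            using additive_subgroup.zero_closed[OF ideal.axioms(1)[OF primeideal.axioms(1)[OF P0]]] .
          have "f \<in> PIdl f" by (rule cgenideal_self[OF fc])
          hence "f \<in> a_kernel R (R Quot PIdl f) (\<lambda>a. PIdl f +> a)" unfolding ker .
          hence "PIdl f +> f = \<zero>\<^bsub>R Quot PIdl f\<^esub>" unfolding a_kernel_def' by blast
          hence "f \<in> ?V 0" using z0 fc by (simp only: mem_Collect_eq simp_thms)
          moreover have "\<zero> \<in> ?V 0"
            using additive_subgroup.zero_closed[OF ideal.axioms(1)[OF L.ideal_vimage[OF primeideal.axioms(1)[OF P0]]]] .
          ultimately have "{\<zero>} \<subset> ?V 0" using f0 by blast
          thus ?thesis using 0 by (simp add: T_def)
        next
          case (Suc j)
          have j: "j < n" using i Suc by simp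
          have P: "primeideal (P j) (R Quot PIdl f)" "primeideal (P (Suc j)) (R Quot PIdl f)" "P j \<subset> P (Suc j)"
            using n(2,3) j by auto
          have c: "P j \<subseteq> carrier (R Quot PIdl f)" "P (Suc j) \<subseteq> carrier (R Quot PIdl f)"
            using ideal.Icarr[OF primeideal.axioms(1)[OF P(1)]] ideal.Icarr[OF primeideal.axioms(1)[OF P(2)]] by blast+
          have "?V j \<noteq> ?V (Suc j)"
          proof
            assume "?V j = ?V (Suc j)"
            hence "(\<lambda>a. PIdl f +> a) ` ?V j = (\<lambda>a. PIdl f +> a) ` ?V (Suc j)" by (rule arg_cong)
            hence "P j = P (Suc j)" unfolding L.image_vimage[OF c(1)] L.image_vimage[OF c(2)] .
            thus False using P(3) by blast
          qed
          moreover have "?V j \<subseteq> ?V (Suc j)" using P(3) by blast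
          ultimately have "?V j \<subset> ?V (Suc j)" by blast
          thus ?thesis using Suc by (simp add: T_def)
        qed
      qed
      hence "enat (Suc n) \<le> enat 2" unfolding dim by (simp add: numeral_eq_enat)
      thus "e \<le> 1" unfolding n(1) by (simp add: one_enat_def)
    qed
    obtain k z N where z: "k \<ge> 1" "z \<in> mpow k"
      "\<And>v. v \<in> mpow N \<Longrightarrow> \<exists>p\<in>carrier R. \<exists>q\<in>carrier R. v = z \<otimes> p \<oplus> f \<otimes> q"
      "mlen R (self_module R) (PIdl f <+>\<^bsub>R\<^esub> PIdl z) (carrier R) = enat (k * d)"
      using homogeneous_parameter[OF f] by blast
    have zc: "z \<in> carrier R" using z(2) mpow_carr by blast
    have zm: "z \<in> \<mm>" using mpow_le[OF z(2,1)] by (simp add: mpow_1)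
    have "z [^] n \<notin> PIdl f" for n :: nat
    proof (induction n)
      case 0
      show ?case using Im one_notin by auto
    next
      case (Suc n)
      have "z \<otimes> z [^] n \<in> PIdl f \<Longrightarrow> z [^] n \<in> PIdl f"
        by (rule regular_mod[OF fc f0 zc z(3)]) (use zc in auto)
      thus ?case using Suc zc by (auto simp: m_comm)
    qed
    then obtain P where P: "primeideal P R" "PIdl f \<subseteq> P" "z \<notin> P" using exists_prime_avoiding[OF I zc] by blast
    note IP = primeideal.axioms(1)[OF P(1)]
    have Pm: "P \<subseteq> \<mm>"
      using proper_ideal_le_mm[OF IP] primeideal.I_notcarr[OF P(1)] ideal.one_imp_carrier[OF IP] by blast
    let ?h = "\<lambda>a. PIdl f +> a"
    have kP: "a_kernel R (R Quot PIdl f) ?h \<subseteq> P" "a_kernel R (R Quot PIdl f) ?h \<subseteq> \<mm>" unfolding ker using P(2) Im by auto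
    have "?h ` P \<noteq> ?h ` \<mm>"
    proof
      assume e: "?h ` P = ?h ` \<mm>"
      have "?h z \<in> ?h ` \<mm>" using zm by (rule imageI)
      hence "z \<in> {r \<in> carrier R. ?h r \<in> ?h ` P}" unfolding e using zc by blast
      thus False unfolding L.vimage_image[OF IP kP(1)] using P(3) by blast
    qed
    moreover have "?h ` P \<subseteq> ?h ` \<mm>" using Pm by (rule image_mono)
    ultimately have lt: "?h ` P \<subset> ?h ` \<mm>" by blast
    have pr: "primeideal (?h ` P) (R Quot PIdl f)" "primeideal (?h ` \<mm>) (R Quot PIdl f)"
      using L.primeideal_image[OF P(1) kP(1)] L.primeideal_image[OF maximalideal_prime[OF maximalideal_mm] kP(2)] by blast+
    have "enat 1 \<le> krull_dim (R Quot PIdl f)"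
      by (rule krull_dim_ge[of _ "\<lambda>i. if i = 0 then ?h ` P else ?h ` \<mm>"]) (use pr lt in auto)
    thus "1 \<le> krull_dim (R Quot PIdl f)" by (simp add: one_enat_def)
  qed
qed

text \<open>From degree \<open>d\<close> on the length is a linear function of slope
  \<open>d\<close>, and the dimension by which it is normalised is 1.\<close>

lemma hs_multiplicity_hypersurface:
  assumes dim: "krull_dim R = 2" and f: "f \<in> mpow d" "f \<notin> mpow (Suc d)" and d: "1 \<le> d"
  shows "hs_multiplicity (R Quot PIdl f) = d"
proof -
  let ?Q = "R Quot PIdl f"
  have fc: "f \<in> carrier R" using f mpow_carr by blast
  have I: "ideal (PIdl f) R" by (rule cgenideal_ideal[OF fc])
  have fm: "f \<in> \<mm>" using mpow_le[OF f(1) d] by (simp add: mpow_1)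
  have Im: "PIdl f \<subseteq> \<mm>" using cgenideal_minimal[OF ideal_mm fm] .
  interpret L: local_surj R ?Q x y "\<lambda>a. PIdl f +> a" by (rule local_surj_quotient[OF I Im])
  let ?l = "\<lambda>n. real (the_enat (ring_length (?Q Quot ideal_power ?Q (max_ideal ?Q) n)))"
  define c where "c = real (d * (d + 1) div 2)"
  have l: "?l (d + j) = real d * real j + c" for j
    unfolding L.ring_length_Quot_power quotient_surj(2)[OF I] mlen_hypersurface[OF f] c_def by simp
  have "(\<lambda>n. real d + (c - real d * real d) / real n) \<longlonglongrightarrow> real d + 0"
    by (intro tendsto_add tendsto_const lim_const_over_n)
  \<comment> \<open>The bound \<open>d + 1\<close> makes \<open>n\<close> at least \<open>d\<close>
    for the length formula and positive for the division.\<close>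
  moreover have "eventually (\<lambda>n. real d + (c - real d * real d) / real n = fact 1 * ?l n / real n ^ 1) sequentially"
    using eventually_ge_at_top[of "d + 1"]
  proof eventually_elim
    case (elim n)
    then obtain j where j: "n = d + j" "n > 0" using le_Suc_ex[of d n] by auto
    have "?l n = real d * real n + (c - real d * real d)" unfolding j(1) l by (simp add: algebra_simps)
    thus ?case using j(2) by (simp add: field_simps)
  qed
  ultimately have lim: "(\<lambda>n. fact 1 * ?l n / real n ^ 1) \<longlonglongrightarrow> real d"
    using Lim_transform_eventually by fastforce
  have "(THE e. (\<lambda>n. fact 1 * ?l n / real n ^ 1) \<longlonglongrightarrow> real e) = d"
  proof (rule the_equality)
    show "(\<lambda>n. fact 1 * ?l n / real n ^ 1) \<longlonglongrightarrow> real d" by (rule lim)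
    fix e assume "(\<lambda>n. fact 1 * ?l n / real n ^ 1) \<longlonglongrightarrow> real e"
    from LIMSEQ_unique[OF this lim] show "e = d" by simp
  qed
  moreover have "the_enat 1 = 1" by (simp add: one_enat_def)
  ultimately show ?thesis
    unfolding hs_multiplicity_def Let_def krull_dim_hypersurface[OF dim f d] by simp
qed

end

section \<open>Betti numbers over a hypersurface\<close>

lemma (in module) set_add_absorb:
  "submodule E R M \<Longrightarrow> submodule A R M \<Longrightarrow> A \<subseteq> E \<Longrightarrow> E <+>\<^bsub>M\<^esub> A = E"
  by (intro equalityI set_add_subset order_refl subset_set_add1)

lemma (in module) mlen_mod_smult_le:
  assumes acc: "acc_module R M"
    and z: "z \<in> carrier R" and E: "submodule E R M" and K: "submodule K R M" and F: "submodule F R M"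
    and EK: "E \<subseteq> K" and KF: "K \<subseteq> F" and reg: "\<And>v. v \<in> F \<Longrightarrow> z \<odot>\<^bsub>M\<^esub> v \<in> E \<Longrightarrow> v \<in> E"
    and fin: "mlen R M (E <+>\<^bsub>M\<^esub> (\<lambda>v. z \<odot>\<^bsub>M\<^esub> v) ` F) F = enat l"
  shows "mlen R M (E <+>\<^bsub>M\<^esub> (\<lambda>v. z \<odot>\<^bsub>M\<^esub> v) ` K) K \<le> enat l"
proof -
  have le: "p \<le> r" if "p + q = r" for p q r :: enat using that by auto
  show ?thesis
    by (rule mlen_mod_smult_saturation[OF acc z E K F EK KF reg fin], assumption, assumption, erule le)
qed

lemma (in cring) comp_set_sum:
  assumes I: "ideal I R" and z: "z \<in> carrier R"
  shows "comp_set I n <+>\<^bsub>free_module R n\<^esub> (\<lambda>v. z \<odot>\<^bsub>free_module R n\<^esub> v) ` comp_set (carrier R) n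
    = comp_set (I <+>\<^bsub>R\<^esub> PIdl z) n"
proof (intro equalityI subsetI)
  let ?F = "free_module R n"
  fix v assume "v \<in> comp_set I n <+>\<^bsub>?F\<^esub> (\<lambda>v. z \<odot>\<^bsub>?F\<^esub> v) ` comp_set (carrier R) n"
  then obtain p c where pc: "p \<in> comp_set I n" "c \<in> comp_set (carrier R) n" "v = p \<oplus>\<^bsub>?F\<^esub> (z \<odot>\<^bsub>?F\<^esub> c)"
    unfolding set_add_iff by blast
  have "v i \<in> I <+>\<^bsub>R\<^esub> PIdl z" if i: "i < n" for i
  proof -
    have "v i = p i \<oplus> z \<otimes> c i" unfolding pc(3) using i by simp
    moreover have "p i \<in> I" "z \<otimes> c i \<in> PIdl z" using pc i cgenideal_iff[OF z] by (auto simp: PiE_iff)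
    ultimately show ?thesis using set_addI by metis
  qed
  moreover have "v \<in> extensional {..<n}" unfolding pc(3) by simp
  ultimately show "v \<in> comp_set (I <+>\<^bsub>R\<^esub> PIdl z) n" by (simp add: PiE_iff)
next
  let ?F = "free_module R n"
  fix v assume v: "v \<in> comp_set (I <+>\<^bsub>R\<^esub> PIdl z) n"
  have "\<exists>p c. p \<in> I \<and> c \<in> carrier R \<and> v i = p \<oplus> z \<otimes> c" if "i < n" for i
  proof -
    have "v i \<in> I <+>\<^bsub>R\<^esub> PIdl z" using v that by (auto simp: PiE_iff)
    then obtain p q where pq: "p \<in> I" "q \<in> PIdl z" "v i = p \<oplus> q" unfolding set_add_iff by blast
    obtain c where "c \<in> carrier R" "q = z \<otimes> c" using pq(2) unfolding cgenideal_iff[OF z] by blast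
    thus ?thesis using pq by blast
  qed
  then obtain p c where pc: "\<And>i. i < n \<Longrightarrow> p i \<in> I" "\<And>i. i < n \<Longrightarrow> c i \<in> carrier R"
    "\<And>i. i < n \<Longrightarrow> v i = p i \<oplus> z \<otimes> c i" by metis
  have "v = restrict p {..<n} \<oplus>\<^bsub>?F\<^esub> (z \<odot>\<^bsub>?F\<^esub> restrict c {..<n})"
    using v pc(3) by (auto simp: fun_eq_iff PiE_iff extensional_def)
  moreover have "restrict p {..<n} \<in> comp_set I n" "restrict c {..<n} \<in> comp_set (carrier R) n"
    using pc by auto
  ultimately show "v \<in> comp_set I n <+>\<^bsub>?F\<^esub> (\<lambda>v. z \<odot>\<^bsub>?F\<^esub> v) ` comp_set (carrier R) n"
    unfolding set_add_iff by blast
qed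

text \<open>The data of a minimal free resolution over \<open>R/(f)\<close>, lifted to \<open>R\<close>: \<open>K i\<close> is the preimage in
  \<open>R^(b i)\<close> of the \<open>(i+1)\<close>-st syzygy module, and \<open>D i\<close> lifts the \<open>i\<close>-th differential.\<close>

locale hypersurface_resolution = two_dim_local R x y for R (structure) and x y +
  fixes f :: 'a and d k N E :: nat and z :: 'a
    and b :: "nat \<Rightarrow> nat" and K :: "nat \<Rightarrow> (nat \<Rightarrow> 'a) set" and D :: "nat \<Rightarrow> (nat \<Rightarrow> 'a) \<Rightarrow> (nat \<Rightarrow> 'a)"
  assumes f: "f \<in> mpow d" "f \<notin> mpow (Suc d)" "1 \<le> d"
    and k: "1 \<le> k" and z: "z \<in> mpow k"
    and zN: "\<And>v. v \<in> mpow N \<Longrightarrow> \<exists>p\<in>carrier R. \<exists>q\<in>carrier R. v = z \<otimes> p \<oplus> f \<otimes> q"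
    and lz: "mlen R (self_module R) (PIdl f <+>\<^bsub>R\<^esub> PIdl z) (carrier R) = enat (k * d)"
    and yE: "\<exists>p\<in>carrier R. \<exists>q\<in>carrier R. y [^] E = x \<otimes> p \<oplus> f \<otimes> q"
    and fE: "\<exists>p\<in>carrier R. \<exists>q\<in>carrier R. f = x \<otimes> p \<oplus> y [^] E \<otimes> q"
    and K: "\<And>i. submodule (K i) R (free_module R (b i))"
      "\<And>i. comp_set (PIdl f) (b i) \<subseteq> K i" "\<And>i. K i \<subseteq> comp_set (two_gen R x y) (b i)"
    and D: "\<And>i. module_map R (free_module R (b (Suc i))) (free_module R (b i)) (D i)"
    and D_im: "\<And>i. K i = comp_set (PIdl f) (b i) <+>\<^bsub>free_module R (b i)\<^esub> D i ` comp_set (carrier R) (b (Suc i))"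
    and K_Suc: "\<And>i. K (Suc i) = {v \<in> comp_set (carrier R) (b (Suc i)). D i v \<in> comp_set (PIdl f) (b i)}"
begin

abbreviation "F i \<equiv> free_module R (b i)"
abbreviation "C i \<equiv> comp_set (carrier R) (b i)"
abbreviation "G i \<equiv> comp_set (PIdl f) (b i)"

lemma f_carr: "f \<in> carrier R" and f_nonzero: "f \<noteq> \<zero>" and z_carr: "z \<in> carrier R"
  using f z mpow_carr by auto

lemma f_mm: "f \<in> \<mm>"
  using mpow_le[OF f(1,3)] by (simp add: mpow_1)

lemma ideal_f: "ideal (PIdl f) R"
  by (rule cgenideal_ideal[OF f_carr])

lemma E_pos: "E > 0"
proof (rule ccontr)
  assume "\<not> E > 0"
  then obtain p q where pq: "p \<in> carrier R" "q \<in> carrier R" "\<one> = x \<otimes> p \<oplus> f \<otimes> q" using yE by auto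
  hence "\<one> \<in> \<mm>" using mm_add[OF mm_mult'[OF x_mm pq(1)] mm_mult'[OF f_mm pq(2)]] by simp
  thus False using one_notin by simp
qed

text \<open>Modulo \<open>x\<close> every element of \<open>m^E\<close> is a multiple of
  \<open>y^E\<close>.\<close>

lemma mpow_E: "v \<in> mpow E \<Longrightarrow> \<exists>p\<in>carrier R. \<exists>q\<in>carrier R. v = x \<otimes> p \<oplus> f \<otimes> q"
proof -
  assume v: "v \<in> mpow E"
  obtain e where e: "E = Suc e" using E_pos gr0_conv_Suc by blast
  obtain p u where pu: "p \<in> mpow e" "u \<in> carrier R" "v = x \<otimes> p \<oplus> u \<otimes> y [^] Suc e"
    using mpow_Suc_cases[OF v[unfolded e]] .
  obtain r s where rs: "r \<in> carrier R" "s \<in> carrier R" "y [^] E = x \<otimes> r \<oplus> f \<otimes> s" using yE by blast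
  have pc: "p \<in> carrier R" using pu mpow_carr by blast
  have "v = x \<otimes> (p \<oplus> u \<otimes> r) \<oplus> f \<otimes> (u \<otimes> s)"
    unfolding pu(3) e[symmetric] rs(3) using pc pu(2) rs(1,2) f_carr by (simp add: r_distr m_ac a_ac)
  thus ?thesis
    by (intro bexI[of _ "p \<oplus> u \<otimes> r"] bexI[of _ "u \<otimes> s"]) (use pc pu(2) rs in simp_all)
qed

lemma F_mod: "noeth_module R (F i) x y"
  by (rule noeth_free)

lemma sub_G: "submodule (G i) R (F i)"
  by (rule submodule_comp_set[OF ideal_f])

lemma sub_C: "submodule (C i) R (F i)"
  by (rule submodule_comp_set[OF oneideal])

lemma K_le_C: "K i \<subseteq> C i"
proof -
  interpret F: noeth_module R "F i" x y by (rule F_mod)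
  show ?thesis using F.submoduleE(1)[OF K(1)[of i]] by simp
qed

text \<open>Nonzerodivisors on the quotient by \<open>f\<close>; both \<open>z\<close> and the
  linear parameter \<open>x\<close> are of this kind.\<close>

definition regular_elem :: "'a \<Rightarrow> bool" where
  "regular_elem w \<longleftrightarrow> w \<in> carrier R \<and> (\<forall>g\<in>carrier R. w \<otimes> g \<in> PIdl f \<longrightarrow> g \<in> PIdl f)"

lemma regular_z: "regular_elem z"
  unfolding regular_elem_def using regular_mod[OF f_carr f_nonzero z_carr zN] z_carr by blast

lemma regular_x: "regular_elem x"
  unfolding regular_elem_def using regular_mod[OF f_carr f_nonzero x_carr mpow_E] by blast

lemma reg_G:
  assumes w: "regular_elem w" and v: "v \<in> C i" "w \<odot>\<^bsub>F i\<^esub> v \<in> G i"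
  shows "v \<in> G i"
proof -
  have "v j \<in> PIdl f" if j: "j < b i" for j
  proof -
    have "v j \<in> carrier R" using v(1) j by (auto simp: PiE_iff)
    moreover have "w \<otimes> v j \<in> PIdl f" using v(2) j by (auto simp: PiE_iff)
    ultimately show ?thesis using w unfolding regular_elem_def by blast
  qed
  thus ?thesis using v(1) by (simp add: PiE_iff)
qed

text \<open>From index 1 on the syzygy \<open>C i\<close> modulo \<open>K i\<close> embeds through
  \<open>D\<close> into a free module over the quotient by \<open>f\<close>, so elements regular
  there stay regular on it. At index 0 the module may have torsion.\<close>

lemma reg_K:
  assumes w: "regular_elem w" and v: "v \<in> C (Suc i)" "w \<odot>\<^bsub>F (Suc i)\<^esub> v \<in> K (Suc i)"
  shows "v \<in> K (Suc i)"
proof -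
  interpret D: module_map R "F (Suc i)" "F i" "D i" by (rule D)
  have wc: "w \<in> carrier R" using w by (simp add: regular_elem_def)
  have "D i (w \<odot>\<^bsub>F (Suc i)\<^esub> v) \<in> G i" using v(2) unfolding K_Suc by blast
  moreover have "D i (w \<odot>\<^bsub>F (Suc i)\<^esub> v) = w \<odot>\<^bsub>F i\<^esub> D i v"
    by (rule D.map_smult[OF wc]) (use v(1) in simp)
  moreover have "D i v \<in> C i" using D.closed[of v] v(1) by simp
  ultimately have "D i v \<in> G i" using reg_G[OF w] by metis
  thus ?thesis unfolding K_Suc using v(1) by blast
qed

lemma D_in_K: "v \<in> C (Suc i) \<Longrightarrow> D i v \<in> K i"
proof -
  assume v: "v \<in> C (Suc i)"
  interpret D: module_map R "F (Suc i)" "F i" "D i" by (rule D)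
  show ?thesis unfolding D_im
    by (rule subsetD[OF D.N.subset_set_add2[OF sub_G D.submodule_image[OF sub_C]] imageI[OF v]])
qed

text \<open>\<open>D i\<close> induces an isomorphism from \<open>C (Suc i)\<close> modulo
  \<open>K (Suc i)\<close> onto \<open>K i\<close> modulo \<open>G i\<close>: the same syzygy, once
  as a quotient of a free module and once inside one.\<close>

lemma mlen_transfer:
  assumes A: "submodule A R (F (Suc i))" "K (Suc i) \<subseteq> A"
  shows "mlen R (F i) (G i <+>\<^bsub>F i\<^esub> D i ` A) (K i) = mlen R (F (Suc i)) A (C (Suc i))"
proof -
  interpret D: module_map R "F (Suc i)" "F i" "D i" by (rule D)
  have AC: "A \<subseteq> C (Suc i)" using D.M.submoduleE(1)[OF A(1)] by simp
  have ker: "v \<in> A" if "v \<in> C (Suc i)" "D i v \<in> G i" for v using that A(2) unfolding K_Suc by blast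
  from D.mlen_image[OF sub_G A(1) sub_C AC ker] show ?thesis unfolding D_im[of i, symmetric] .
qed

lemma smult_K_in:
  assumes A: "submodule A R (F (Suc i))" and w: "w \<in> carrier R"
    and wC: "\<And>c. c \<in> C (Suc i) \<Longrightarrow> w \<odot>\<^bsub>F (Suc i)\<^esub> c \<in> A" and v: "v \<in> K i"
  shows "w \<odot>\<^bsub>F i\<^esub> v \<in> G i <+>\<^bsub>F i\<^esub> D i ` A"
proof -
  interpret D: module_map R "F (Suc i)" "F i" "D i" by (rule D)
  obtain g c where gc: "g \<in> G i" "c \<in> C (Suc i)" "v = g \<oplus>\<^bsub>F i\<^esub> D i c"
    using v unfolding D_im set_add_iff by blast
  have cM: "c \<in> carrier (F (Suc i))" using gc(2) by simp
  have "w \<odot>\<^bsub>F i\<^esub> v = w \<odot>\<^bsub>F i\<^esub> g \<oplus>\<^bsub>F i\<^esub> w \<odot>\<^bsub>F i\<^esub> D i c"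
    unfolding gc(3) by (rule D.N.smult_r_distr[OF w D.N.submodule_carr[OF sub_G gc(1)] D.closed[OF cM]])
  also have "w \<odot>\<^bsub>F i\<^esub> D i c = D i (w \<odot>\<^bsub>F (Suc i)\<^esub> c)" by (rule D.map_smult[OF w cM, symmetric])
  finally have "w \<odot>\<^bsub>F i\<^esub> v = w \<odot>\<^bsub>F i\<^esub> g \<oplus>\<^bsub>F i\<^esub> D i (w \<odot>\<^bsub>F (Suc i)\<^esub> c)" .
  moreover have "w \<odot>\<^bsub>F i\<^esub> g \<in> G i" by (rule D.N.submoduleE(4)[OF sub_G w gc(1)])
  moreover have "D i (w \<odot>\<^bsub>F (Suc i)\<^esub> c) \<in> D i ` A" by (rule imageI[OF wC[OF gc(2)]])
  ultimately show ?thesis using set_addI by metis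
qed

text \<open>For the \<open>i\<close>-th syzygy M, presented as \<open>C i\<close> modulo
  \<open>K i\<close>, this is the length of M/zM.\<close>

definition a where
  "a i = mlen R (F i) (K i <+>\<^bsub>F i\<^esub> (\<lambda>v. z \<odot>\<^bsub>F i\<^esub> v) ` C i) (C i)"

text \<open>Under the two presentations of the syzygy, \<open>K (Suc i) + z C (Suc i)\<close>
  corresponds to \<open>G i + z K i\<close>.\<close>

lemma a_Suc: "a (Suc i) = mlen R (F i) (G i <+>\<^bsub>F i\<^esub> (\<lambda>v. z \<odot>\<^bsub>F i\<^esub> v) ` K i) (K i)"
proof -
  interpret D: module_map R "F (Suc i)" "F i" "D i" by (rule D)
  let ?A = "K (Suc i) <+>\<^bsub>F (Suc i)\<^esub> (\<lambda>v. z \<odot>\<^bsub>F (Suc i)\<^esub> v) ` C (Suc i)"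
  let ?B = "G i <+>\<^bsub>F i\<^esub> (\<lambda>v. z \<odot>\<^bsub>F i\<^esub> v) ` K i"
  have szC: "submodule ((\<lambda>v. z \<odot>\<^bsub>F (Suc i)\<^esub> v) ` C (Suc i)) R (F (Suc i))" by (rule D.M.submodule_smult[OF z_carr sub_C])
  have sA: "submodule ?A R (F (Suc i))" by (rule D.M.submodule_set_add[OF K(1) szC])
  have KA: "K (Suc i) \<subseteq> ?A" by (rule D.M.subset_set_add1[OF K(1) szC])
  have szK: "submodule ((\<lambda>v. z \<odot>\<^bsub>F i\<^esub> v) ` K i) R (F i)" by (rule D.N.submodule_smult[OF z_carr K(1)])
  have sB: "submodule ?B R (F i)" by (rule D.N.submodule_set_add[OF sub_G szK])
  have sDA: "submodule (D i ` ?A) R (F i)" by (rule D.submodule_image[OF sA])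
  have "G i <+>\<^bsub>F i\<^esub> D i ` ?A = ?B"
  proof (rule equalityI)
    show "G i <+>\<^bsub>F i\<^esub> D i ` ?A \<subseteq> ?B"
    proof (rule D.N.set_add_subset[OF sB D.N.subset_set_add1[OF sub_G szK]])
      show "D i ` ?A \<subseteq> ?B"
      proof
        fix w assume "w \<in> D i ` ?A"
        then obtain a where a: "a \<in> ?A" "w = D i a" by (rule imageE)
        obtain p c where pc: "p \<in> K (Suc i)" "c \<in> C (Suc i)" "a = p \<oplus>\<^bsub>F (Suc i)\<^esub> (z \<odot>\<^bsub>F (Suc i)\<^esub> c)"
          using a(1) unfolding set_add_iff by blast
        have cM: "c \<in> carrier (F (Suc i))" using pc(2) by simp
        have pM: "p \<in> carrier (F (Suc i))" by (rule D.M.submodule_carr[OF K(1) pc(1)])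
        have "w = D i p \<oplus>\<^bsub>F i\<^esub> (z \<odot>\<^bsub>F i\<^esub> D i c)"
          unfolding a(2) pc(3) D.map_add[OF pM D.M.smult_closed[OF z_carr cM]] D.map_smult[OF z_carr cM] ..
        moreover have "D i p \<in> G i" using pc(1) unfolding K_Suc by blast
        moreover have "z \<odot>\<^bsub>F i\<^esub> D i c \<in> (\<lambda>v. z \<odot>\<^bsub>F i\<^esub> v) ` K i" by (rule imageI[OF D_in_K[OF pc(2)]])
        ultimately show "w \<in> ?B" using set_addI by metis
      qed
    qed
    show "?B \<subseteq> G i <+>\<^bsub>F i\<^esub> D i ` ?A"
    proof (rule D.N.set_add_subset[OF D.N.submodule_set_add[OF sub_G sDA] D.N.subset_set_add1[OF sub_G sDA]])
      show "(\<lambda>v. z \<odot>\<^bsub>F i\<^esub> v) ` K i \<subseteq> G i <+>\<^bsub>F i\<^esub> D i ` ?A"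
      proof (rule image_subsetI, rule smult_K_in[OF sA z_carr])
        fix c assume c: "c \<in> C (Suc i)"
        show "z \<odot>\<^bsub>F (Suc i)\<^esub> c \<in> ?A" by (rule subsetD[OF D.M.subset_set_add2[OF K(1) szC] imageI[OF c]])
      qed
    qed
  qed
  thus ?thesis unfolding a_def using mlen_transfer[OF sA KA] by simp
qed

text \<open>Here m \<open>C (Suc i)\<close> corresponds to \<open>G i\<close> plus m
  \<open>K i\<close>: the Betti number counts the generators of \<open>K i\<close> modulo
  \<open>f\<close>.\<close>

lemma b_Suc: "mlen R (F i) (G i <+>\<^bsub>F i\<^esub> two_gen_mult (F i) x y (K i)) (K i) = enat (b (Suc i))"
proof -
  interpret D: module_map R "F (Suc i)" "F i" "D i" by (rule D)
  interpret M: noeth_module R "F (Suc i)" x y by (rule F_mod)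
  interpret N: noeth_module R "F i" x y by (rule F_mod)
  let ?A = "comp_set \<mm> (b (Suc i))"
  let ?B = "G i <+>\<^bsub>F i\<^esub> two_gen_mult (F i) x y (K i)"
  have A: "?A = two_gen_mult (F (Suc i)) x y (C (Suc i))" by (rule two_gen_mult_free[symmetric])
  have sA: "submodule ?A R (F (Suc i))" by (rule submodule_comp_set[OF ideal_mm])
  have sm: "submodule (two_gen_mult (F i) x y (K i)) R (F i)" by (rule N.submodule_xy_mult[OF K(1)])
  have sB: "submodule ?B R (F i)" by (rule D.N.submodule_set_add[OF sub_G sm])
  have sDA: "submodule (D i ` ?A) R (F i)" by (rule D.submodule_image[OF sA])
  have "G i <+>\<^bsub>F i\<^esub> D i ` ?A = ?B"
  proof (rule equalityI)
    show "G i <+>\<^bsub>F i\<^esub> D i ` ?A \<subseteq> ?B"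
    proof (rule D.N.set_add_subset[OF sB D.N.subset_set_add1[OF sub_G sm]])
      show "D i ` ?A \<subseteq> ?B"
      proof
        fix w assume "w \<in> D i ` ?A"
        then obtain a where a: "a \<in> ?A" "w = D i a" by (rule imageE)
        obtain c c' where c: "c \<in> C (Suc i)" "c' \<in> C (Suc i)"
          "a = (x \<odot>\<^bsub>F (Suc i)\<^esub> c) \<oplus>\<^bsub>F (Suc i)\<^esub> (y \<odot>\<^bsub>F (Suc i)\<^esub> c')"
          using a(1) unfolding A two_gen_mult_def set_add_iff by blast
        have cM: "c \<in> carrier (F (Suc i))" "c' \<in> carrier (F (Suc i))" using c by simp_all
        have w: "w = (x \<odot>\<^bsub>F i\<^esub> D i c) \<oplus>\<^bsub>F i\<^esub> (y \<odot>\<^bsub>F i\<^esub> D i c')"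
          unfolding a(2) c(3) D.map_add[OF D.M.smult_closed[OF x_carr cM(1)] D.M.smult_closed[OF y_carr cM(2)]]
            D.map_smult[OF x_carr cM(1)] D.map_smult[OF y_carr cM(2)] ..
        have "w \<in> two_gen_mult (F i) x y (K i)"
          unfolding w by (rule D.N.submoduleE(5)[OF sm N.x_in_xy_mult[OF K(1) D_in_K[OF c(1)]] N.y_in_xy_mult[OF K(1) D_in_K[OF c(2)]]])
        thus "w \<in> ?B" using D.N.subset_set_add2[OF sub_G sm] by blast
      qed
    qed
    show "?B \<subseteq> G i <+>\<^bsub>F i\<^esub> D i ` ?A"
    proof (rule D.N.set_add_subset[OF D.N.submodule_set_add[OF sub_G sDA] D.N.subset_set_add1[OF sub_G sDA]])
      show "two_gen_mult (F i) x y (K i) \<subseteq> G i <+>\<^bsub>F i\<^esub> D i ` ?A"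
      proof (rule N.xy_mult_least[OF D.N.submodule_set_add[OF sub_G sDA]])
        fix v assume v: "v \<in> K i"
        show "x \<odot>\<^bsub>F i\<^esub> v \<in> G i <+>\<^bsub>F i\<^esub> D i ` ?A"
          by (rule smult_K_in[OF sA x_carr _ v]) (unfold A, rule M.x_in_xy_mult[OF sub_C])
        show "y \<odot>\<^bsub>F i\<^esub> v \<in> G i <+>\<^bsub>F i\<^esub> D i ` ?A"
          by (rule smult_K_in[OF sA y_carr _ v]) (unfold A, rule M.y_in_xy_mult[OF sub_C])
      qed
    qed
  qed
  thus ?thesis using mlen_transfer[OF sA K(3)] mlen_comp_mm by simp
qed

lemma mlen_G_z: "mlen R (F i) (G i <+>\<^bsub>F i\<^esub> (\<lambda>v. z \<odot>\<^bsub>F i\<^esub> v) ` C i) (C i) = enat (b i * (k * d))"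
proof -
  interpret S: module R "self_module R" by (rule module_self)
  have "submodule (PIdl f <+>\<^bsub>self_module R\<^esub> PIdl z) R (self_module R)"
    by (rule S.submodule_set_add[OF submodule_cgenideal[OF f_carr] submodule_cgenideal[OF z_carr]])
  hence "ideal (PIdl f <+>\<^bsub>R\<^esub> PIdl z) R" by (simp add: submodule_self_iff)
  thus ?thesis unfolding comp_set_sum[OF ideal_f z_carr] by (rule mlen_comp_set[OF _ lz])
qed

text \<open>The saturation that additivity requires is \<open>reg_K\<close>, so the sums start at
  index 1.\<close>

lemma a_add: "a (Suc (Suc i)) + a (Suc i) = enat (b (Suc i) * (k * d))"
proof -
  interpret M: noeth_module R "F (Suc i)" x y by (rule F_mod)
  have "mlen R (F (Suc i)) (G (Suc i) <+>\<^bsub>F (Suc i)\<^esub> (\<lambda>v. z \<odot>\<^bsub>F (Suc i)\<^esub> v) ` K (Suc i)) (K (Suc i))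
      + mlen R (F (Suc i)) (K (Suc i) <+>\<^bsub>F (Suc i)\<^esub> (\<lambda>v. z \<odot>\<^bsub>F (Suc i)\<^esub> v) ` C (Suc i)) (C (Suc i))
      = mlen R (F (Suc i)) (G (Suc i) <+>\<^bsub>F (Suc i)\<^esub> (\<lambda>v. z \<odot>\<^bsub>F (Suc i)\<^esub> v) ` C (Suc i)) (C (Suc i))"
    by (rule M.mlen_mod_smult_saturated[OF z_carr sub_G K(1) sub_C K(2) K_le_C reg_K[OF regular_z]])
  thus ?thesis unfolding a_Suc[of "Suc i", symmetric] a_def[of "Suc i", symmetric] mlen_G_z .
qed

text \<open>\<open>K 0\<close> need not be saturated, so only one of the two summands in the
  saturation formula is kept.\<close>

lemma a_1_le: "a (Suc 0) \<le> enat (b 0 * (k * d))"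
proof -
  interpret M: noeth_module R "F 0" x y by (rule F_mod)
  have "mlen R (F 0) (G 0 <+>\<^bsub>F 0\<^esub> (\<lambda>v. z \<odot>\<^bsub>F 0\<^esub> v) ` K 0) (K 0) \<le> enat (b 0 * (k * d))"
    by (rule M.mlen_mod_smult_le[OF M.acc z_carr sub_G[of 0] K(1)[of 0] sub_C[of 0] K(2)[of 0] K_le_C[of 0]
      reg_G[OF regular_z, of _ 0] mlen_G_z[of 0]])
  thus ?thesis unfolding a_Suc .
qed

text \<open>The reason is Auslander--Buchsbaum: over \<open>R\<close> the syzygy is torsion of
  projective dimension at most one, so its presentation matrix is square. In lengths:
  \<open>x\<close> is regular modulo \<open>K\<close>, so K/mK is isomorphic to L/(xC + yL) for
  \<open>L = xC + K\<close>. As C/L has finite length, this is as long as C/(xC + yC).\<close>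

lemma mlen_two_gen_mult_K:
  "mlen R (F (Suc i)) (two_gen_mult (F (Suc i)) x y (K (Suc i))) (K (Suc i)) = enat (b (Suc i))"
proof -
  interpret M: noeth_module R "F (Suc i)" x y by (rule F_mod)
  let ?F = "F (Suc i)" and ?K = "K (Suc i)" and ?C = "C (Suc i)"
  let ?xC = "(\<lambda>v. x \<odot>\<^bsub>?F\<^esub> v) ` ?C"
  let ?L = "?xC <+>\<^bsub>?F\<^esub> ?K"
  have sx: "submodule ?xC R ?F" by (rule M.submodule_smult[OF x_carr sub_C])
  have sL: "submodule ?L R ?F" by (rule M.submodule_set_add[OF sx K(1)])
  have xL: "?xC \<subseteq> ?L" and KL: "?K \<subseteq> ?L" using M.subset_set_add1[OF sx K(1)] M.subset_set_add2[OF sx K(1)] by auto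
  have LC: "?L \<subseteq> ?C" using M.submoduleE(1)[OF sL] by simp
  have regy: "v \<in> ?xC" if v: "v \<in> ?C" "y \<odot>\<^bsub>?F\<^esub> v \<in> ?xC" for v
  proof -
    obtain c where c: "c \<in> ?C" "y \<odot>\<^bsub>?F\<^esub> v = x \<odot>\<^bsub>?F\<^esub> c" using v(2) by (auto simp del: free_module_simps)
    have "\<exists>e\<in>carrier R. v j = x \<otimes> e" if j: "j < b (Suc i)" for j
    proof -
      have "y \<otimes> v j = x \<otimes> c j" using fun_cong[OF c(2), of j] j by simp
      hence "v j \<in> PIdl x" using y_regular_mod_x[of "v j" "c j"] v(1) c(1) j by (auto simp: PiE_iff)
      thus ?thesis unfolding cgenideal_iff[OF x_carr] .
    qed
    then obtain e where e: "\<And>j. j < b (Suc i) \<Longrightarrow> e j \<in> carrier R \<and> v j = x \<otimes> e j" by metis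
    have "v = x \<odot>\<^bsub>?F\<^esub> restrict e {..<b (Suc i)}"
      using v(1) e by (auto simp: fun_eq_iff PiE_iff extensional_def)
    moreover have "restrict e {..<b (Suc i)} \<in> ?C" using e by auto
    ultimately show ?thesis by blast
  qed
  \<comment> \<open>\<open>mpow_E\<close> puts \<open>m^E\<close> into \<open>(x, f)\<close>, so
    \<open>L\<close> contains \<open>m^E C\<close>, which has finite colength.\<close>
  have fin: "mlen R ?F ?L ?C \<noteq> \<infinity>"
  proof -
    have "comp_set (mpow E) (b (Suc i)) \<subseteq> ?L"
    proof
      fix v assume v: "v \<in> comp_set (mpow E) (b (Suc i))"
      have "v \<in> comp_set (PIdl f <+>\<^bsub>R\<^esub> PIdl x) (b (Suc i))"
      proof -
        have "v j \<in> PIdl f <+>\<^bsub>R\<^esub> PIdl x" if j: "j < b (Suc i)" for j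
        proof -
          have "v j \<in> mpow E" using v j by (auto simp: PiE_iff)
          from mpow_E[OF this] obtain p q where pq: "p \<in> carrier R" "q \<in> carrier R" "v j = x \<otimes> p \<oplus> f \<otimes> q" by blast
          have "f \<otimes> q \<oplus> x \<otimes> p \<in> PIdl f <+>\<^bsub>R\<^esub> PIdl x"
            by (rule set_addI) (use pq cgenideal_iff[OF f_carr] cgenideal_iff[OF x_carr] in auto)
          thus ?thesis unfolding pq(3) using a_comm[of "f \<otimes> q" "x \<otimes> p"] pq(1,2) f_carr by simp
        qed
        thus ?thesis using v by (simp add: PiE_iff)
      qed
      hence "v \<in> G (Suc i) <+>\<^bsub>?F\<^esub> ?xC" unfolding comp_set_sum[OF ideal_f x_carr] .
      moreover have "G (Suc i) <+>\<^bsub>?F\<^esub> ?xC \<subseteq> ?L" using M.set_add_subset[OF sL _ xL] K(2) KL by blast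
      ultimately show "v \<in> ?L" by blast
    qed
    hence "mlen R ?F ?L ?C \<le> mlen R ?F (comp_set (mpow E) (b (Suc i))) ?C" by (intro mlen_mono) auto
    also have "\<dots> = enat (b (Suc i) * (E * (E + 1) div 2))" by (rule mlen_comp_set[OF ideal_mpow mlen_mpow])
    finally show ?thesis by (metis enat_ord_simps(5) infinity_ileE)
  qed
  have "mlen R ?F (?xC <+>\<^bsub>?F\<^esub> (\<lambda>v. y \<odot>\<^bsub>?F\<^esub> v) ` ?L) ?L = mlen R ?F (?xC <+>\<^bsub>?F\<^esub> (\<lambda>v. y \<odot>\<^bsub>?F\<^esub> v) ` ?C) ?C"
    by (rule M.mlen_mod_smult_finite[OF y_carr sx sL sub_C xL LC regy fin])
  also have "?xC <+>\<^bsub>?F\<^esub> (\<lambda>v. y \<odot>\<^bsub>?F\<^esub> v) ` ?C = comp_set \<mm> (b (Suc i))"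
    using two_gen_mult_free unfolding two_gen_mult_def .
  also have "mlen R ?F (comp_set \<mm> (b (Suc i))) ?C = enat (b (Suc i))" by (rule mlen_comp_mm)
  finally have l: "mlen R ?F (?xC <+>\<^bsub>?F\<^esub> (\<lambda>v. y \<odot>\<^bsub>?F\<^esub> v) ` ?L) ?L = enat (b (Suc i))" .
  let ?m = "two_gen_mult ?F x y ?K"
  have sm: "submodule ?m R ?F" by (rule M.submodule_xy_mult[OF K(1)])
  have syL: "submodule ((\<lambda>v. y \<odot>\<^bsub>?F\<^esub> v) ` ?L) R ?F" by (rule M.submodule_smult[OF y_carr sL])
  have e: "?xC <+>\<^bsub>?F\<^esub> ?m = ?xC <+>\<^bsub>?F\<^esub> (\<lambda>v. y \<odot>\<^bsub>?F\<^esub> v) ` ?L"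
  proof (rule equalityI)
    have sR: "submodule (?xC <+>\<^bsub>?F\<^esub> (\<lambda>v. y \<odot>\<^bsub>?F\<^esub> v) ` ?L) R ?F" by (rule M.submodule_set_add[OF sx syL])
    have sR': "submodule (?xC <+>\<^bsub>?F\<^esub> ?m) R ?F" by (rule M.submodule_set_add[OF sx sm])
    show "?xC <+>\<^bsub>?F\<^esub> ?m \<subseteq> ?xC <+>\<^bsub>?F\<^esub> (\<lambda>v. y \<odot>\<^bsub>?F\<^esub> v) ` ?L"
    proof (rule M.set_add_subset[OF sR M.subset_set_add1[OF sx syL]])
      show "?m \<subseteq> ?xC <+>\<^bsub>?F\<^esub> (\<lambda>v. y \<odot>\<^bsub>?F\<^esub> v) ` ?L"
      proof (rule M.xy_mult_least[OF sR])
        fix v assume v: "v \<in> ?K"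
        show "x \<odot>\<^bsub>?F\<^esub> v \<in> ?xC <+>\<^bsub>?F\<^esub> (\<lambda>v. y \<odot>\<^bsub>?F\<^esub> v) ` ?L"
          by (rule subsetD[OF M.subset_set_add1[OF sx syL] imageI[OF subsetD[OF K_le_C v]]])
        show "y \<odot>\<^bsub>?F\<^esub> v \<in> ?xC <+>\<^bsub>?F\<^esub> (\<lambda>v. y \<odot>\<^bsub>?F\<^esub> v) ` ?L"
          by (rule subsetD[OF M.subset_set_add2[OF sx syL] imageI[OF subsetD[OF KL v]]])
      qed
    qed
    show "?xC <+>\<^bsub>?F\<^esub> (\<lambda>v. y \<odot>\<^bsub>?F\<^esub> v) ` ?L \<subseteq> ?xC <+>\<^bsub>?F\<^esub> ?m"
    proof (rule M.set_add_subset[OF sR' M.subset_set_add1[OF sx sm]])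
      show "(\<lambda>v. y \<odot>\<^bsub>?F\<^esub> v) ` ?L \<subseteq> ?xC <+>\<^bsub>?F\<^esub> ?m"
      proof (rule image_subsetI)
        fix v assume "v \<in> ?L"
        then obtain p q where pq: "p \<in> ?xC" "q \<in> ?K" "v = p \<oplus>\<^bsub>?F\<^esub> q" unfolding set_add_iff by blast
        have "y \<odot>\<^bsub>?F\<^esub> v = y \<odot>\<^bsub>?F\<^esub> p \<oplus>\<^bsub>?F\<^esub> y \<odot>\<^bsub>?F\<^esub> q"
          unfolding pq(3) by (rule M.smult_r_distr[OF y_carr M.submodule_carr[OF sx pq(1)] M.submodule_carr[OF K(1) pq(2)]])
        moreover have "y \<odot>\<^bsub>?F\<^esub> p \<in> ?xC" by (rule M.submoduleE(4)[OF sx y_carr pq(1)])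
        moreover have "y \<odot>\<^bsub>?F\<^esub> q \<in> ?m" by (rule M.y_in_xy_mult[OF K(1) pq(2)])
        ultimately show "y \<odot>\<^bsub>?F\<^esub> v \<in> ?xC <+>\<^bsub>?F\<^esub> ?m" using set_addI by metis
      qed
    qed
  qed
  have "?K \<inter> ?xC \<subseteq> ?m"
  proof
    fix v assume v: "v \<in> ?K \<inter> ?xC"
    then obtain c where c: "c \<in> ?C" "v = x \<odot>\<^bsub>?F\<^esub> c" by blast
    have "x \<odot>\<^bsub>?F\<^esub> c \<in> ?K" using v unfolding c(2) by (rule IntD1)
    hence "c \<in> ?K" by (rule reg_K[OF regular_x c(1)])
    thus "v \<in> ?m" unfolding c(2) by (rule M.x_in_xy_mult[OF K(1)])
  qed
  from M.mlen_second_iso[OF sx sm K(1) M.xy_mult_subset[OF K(1)] this] show ?thesis unfolding e l by simp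
qed

text \<open>The next Betti number counts the generators of \<open>K (Suc i)\<close> modulo
  \<open>f\<close>, the present one all of them.\<close>

lemma b_antimono: "b (Suc (Suc i)) \<le> b (Suc i)"
proof -
  interpret M: noeth_module R "F (Suc i)" x y by (rule F_mod)
  have "enat (b (Suc (Suc i))) \<le> enat (b (Suc i))"
    unfolding b_Suc[of "Suc i", symmetric] mlen_two_gen_mult_K[of i, symmetric]
    by (rule mlen_mono[OF M.subset_set_add2[OF sub_G M.submodule_xy_mult[OF K(1)]] order_refl])
  thus ?thesis by simp
qed

end

lemma (in cring) comp_set_cgenideal:
  assumes f: "f \<in> carrier R" and v: "v \<in> comp_set (PIdl f) n"
  obtains w where "w \<in> comp_set (carrier R) n" "v = f \<odot>\<^bsub>free_module R n\<^esub> w"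
proof -
  have "\<exists>e\<in>carrier R. v j = f \<otimes> e" if "j < n" for j
  proof -
    have "v j \<in> PIdl f" using v that by (auto simp: PiE_iff)
    thus ?thesis unfolding cgenideal_iff[OF f] .
  qed
  then obtain e where e: "\<And>j. j < n \<Longrightarrow> e j \<in> carrier R \<and> v j = f \<otimes> e j" by metis
  have "v = f \<odot>\<^bsub>free_module R n\<^esub> restrict e {..<n}"
    using v e by (auto simp: fun_eq_iff PiE_iff extensional_def)
  moreover have "restrict e {..<n} \<in> comp_set (carrier R) n" using e by auto
  ultimately show thesis using that by blast
qed

context hypersurface_resolution
begin

lemma smult_f_G: "w \<in> C i \<Longrightarrow> f \<odot>\<^bsub>F i\<^esub> w \<in> G i"
  using cgenideal_iff[OF f_carr] by (auto simp: PiE_iff)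

text \<open>Write \<open>f = x p + y^E s\<close>. If \<open>D (s w) = x \<alpha> + y \<beta>\<close>, then \<open>y^E \<in> (x, f)\<close> turns \<open>y^(E-1) D (s w)\<close> into
  \<open>x g\<close> plus a multiple of \<open>f\<close>, and \<open>g\<close> lies in \<open>K\<close> because \<open>x\<close> is regular. Lifting \<open>g\<close> along \<open>D\<close> shows that
  \<open>y^(E-1) s w\<close> is an element of the next \<open>K\<close> up to a multiple of \<open>x\<close>.\<close>

lemma G_le_two_gen_mult_K: "G (Suc (Suc i)) \<subseteq> two_gen_mult (F (Suc (Suc i))) x y (K (Suc (Suc i)))"
proof
  let ?I = "Suc (Suc i)" and ?J = "Suc i"
  interpret I: noeth_module R "F ?I" x y by (rule F_mod)
  interpret J: noeth_module R "F ?J" x y by (rule F_mod)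
  interpret D: module_map R "F ?I" "F ?J" "D ?J" by (rule D)
  obtain e where e: "E = Suc e" using E_pos gr0_conv_Suc by blast
  obtain p s where ps: "p \<in> carrier R" "s \<in> carrier R" "f = x \<otimes> p \<oplus> y [^] E \<otimes> s" using fE by blast
  obtain r t where rt: "r \<in> carrier R" "t \<in> carrier R" "y [^] E = x \<otimes> r \<oplus> f \<otimes> t" using yE by blast
  have yE_carr: "y [^] E \<in> carrier R" and ye: "y [^] e \<in> carrier R" by simp_all
  have yEe: "y [^] E = y [^] e \<otimes> y" unfolding e by simp
  fix v assume v: "v \<in> G ?I"
  obtain w where w: "w \<in> C ?I" "v = f \<odot>\<^bsub>F ?I\<^esub> w" using comp_set_cgenideal[OF f_carr v] by blast
  have wM: "w \<in> carrier (F ?I)" using w(1) by simp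
  let ?w = "s \<odot>\<^bsub>F ?I\<^esub> w"
  have swM: "?w \<in> carrier (F ?I)" by (rule I.smult_closed[OF ps(2) wM])
  hence swC: "?w \<in> C ?I" by (simp only: free_module_simps)
  have DwK: "D ?J ?w \<in> K ?J" by (rule D_in_K[OF swC])
  hence "D ?J ?w \<in> two_gen_mult (F ?J) x y (C ?J)" using K(3) two_gen_mult_free by blast
  then obtain \<alpha> \<beta> where ab: "\<alpha> \<in> C ?J" "\<beta> \<in> C ?J" "D ?J ?w = x \<odot>\<^bsub>F ?J\<^esub> \<alpha> \<oplus>\<^bsub>F ?J\<^esub> y \<odot>\<^bsub>F ?J\<^esub> \<beta>"
    unfolding two_gen_mult_def set_add_iff by blast
  have abM: "\<alpha> \<in> carrier (F ?J)" "\<beta> \<in> carrier (F ?J)" using ab by simp_all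
  let ?g = "y [^] e \<odot>\<^bsub>F ?J\<^esub> \<alpha> \<oplus>\<^bsub>F ?J\<^esub> r \<odot>\<^bsub>F ?J\<^esub> \<beta>"
  let ?d = "f \<odot>\<^bsub>F ?J\<^esub> (t \<odot>\<^bsub>F ?J\<^esub> \<beta>)"
  have gM: "?g \<in> carrier (F ?J)" using abM ye rt(1) by (simp only: J.M.add.m_closed J.smult_closed)
  have tM: "t \<odot>\<^bsub>F ?J\<^esub> \<beta> \<in> carrier (F ?J)" by (rule J.smult_closed[OF rt(2) abM(2)])
  hence dG: "?d \<in> G ?J" by (intro smult_f_G) (simp only: free_module_simps)
  have dM: "?d \<in> carrier (F ?J)" by (rule J.smult_closed[OF f_carr tM])
  have eq1: "y [^] e \<odot>\<^bsub>F ?J\<^esub> D ?J ?w = ?d \<oplus>\<^bsub>F ?J\<^esub> x \<odot>\<^bsub>F ?J\<^esub> ?g"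
  proof -
    have "y [^] e \<odot>\<^bsub>F ?J\<^esub> D ?J ?w
        = x \<odot>\<^bsub>F ?J\<^esub> (y [^] e \<odot>\<^bsub>F ?J\<^esub> \<alpha>) \<oplus>\<^bsub>F ?J\<^esub> (y [^] E) \<odot>\<^bsub>F ?J\<^esub> \<beta>"
      unfolding ab(3) yEe using abM ye
      by (simp add: J.smult_r_distr J.smult_assoc1[symmetric] m_comm del: free_module_simps)
    also have "(y [^] E) \<odot>\<^bsub>F ?J\<^esub> \<beta> = x \<odot>\<^bsub>F ?J\<^esub> (r \<odot>\<^bsub>F ?J\<^esub> \<beta>) \<oplus>\<^bsub>F ?J\<^esub> ?d"
      unfolding rt(3) using abM rt(1,2) f_carr
      by (simp add: J.smult_l_distr J.smult_assoc1 del: free_module_simps)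
    finally show ?thesis
      using abM ye rt(1,2) f_carr by (simp add: J.smult_r_distr J.M.a_ac del: free_module_simps)
  qed
  have "?d \<oplus>\<^bsub>F ?J\<^esub> x \<odot>\<^bsub>F ?J\<^esub> ?g \<in> K ?J"
    unfolding eq1[symmetric] by (rule J.submoduleE(4)[OF K(1) ye DwK])
  hence "x \<odot>\<^bsub>F ?J\<^esub> ?g \<in> K ?J"
    by (rule J.submodule_add_cancel[OF K(1) subsetD[OF K(2) dG] J.smult_closed[OF x_carr gM]])
  hence "?g \<in> K ?J" using reg_K[OF regular_x, of ?g i] gM by (simp only: free_module_simps)
  then obtain g c where gc: "g \<in> G ?J" "c \<in> C ?I" "?g = g \<oplus>\<^bsub>F ?J\<^esub> D ?J c" unfolding D_im set_add_iff by blast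
  have cM: "c \<in> carrier (F ?I)" using gc(2) by simp
  have gM': "g \<in> carrier (F ?J)" by (rule J.submodule_carr[OF sub_G gc(1)])
  have DcM: "D ?J c \<in> carrier (F ?J)" by (rule D.closed[OF cM])
  let ?k = "y [^] e \<odot>\<^bsub>F ?I\<^esub> ?w \<ominus>\<^bsub>F ?I\<^esub> x \<odot>\<^bsub>F ?I\<^esub> c"
  have m1: "y [^] e \<odot>\<^bsub>F ?I\<^esub> ?w \<in> carrier (F ?I)" by (rule I.smult_closed[OF ye swM])
  have m2: "x \<odot>\<^bsub>F ?I\<^esub> c \<in> carrier (F ?I)" by (rule I.smult_closed[OF x_carr cM])
  have kM: "?k \<in> carrier (F ?I)" by (rule I.M.minus_closed[OF m1 m2])
  have "D ?J ?k = y [^] e \<odot>\<^bsub>F ?J\<^esub> D ?J ?w \<ominus>\<^bsub>F ?J\<^esub> x \<odot>\<^bsub>F ?J\<^esub> D ?J c"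
    unfolding D.map_minus[OF m1 m2] D.map_smult[OF ye swM] D.map_smult[OF x_carr cM] ..
  also have "\<dots> = ?d \<oplus>\<^bsub>F ?J\<^esub> x \<odot>\<^bsub>F ?J\<^esub> g"
    unfolding eq1 gc(3) using dM gM' DcM
    by (simp add: J.smult_r_distr a_minus_def J.M.a_assoc J.M.r_neg del: free_module_simps)
  also have "\<dots> \<in> G ?J" by (rule J.submoduleE(5)[OF sub_G dG J.submoduleE(4)[OF sub_G x_carr gc(1)]])
  finally have kK: "?k \<in> K ?I" unfolding K_Suc using kM by (simp only: free_module_simps mem_Collect_eq simp_thms)
  have yw: "y [^] e \<odot>\<^bsub>F ?I\<^esub> ?w = ?k \<oplus>\<^bsub>F ?I\<^esub> x \<odot>\<^bsub>F ?I\<^esub> c"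
    using m1 m2 by (simp add: a_minus_def I.M.a_assoc I.M.l_neg del: free_module_simps)
  let ?t = "p \<odot>\<^bsub>F ?I\<^esub> w \<oplus>\<^bsub>F ?I\<^esub> y \<odot>\<^bsub>F ?I\<^esub> c"
  have tM': "?t \<in> carrier (F ?I)" using wM cM ps(1) by (simp only: I.M.add.m_closed I.smult_closed y_carr)
  have veq: "v = y \<odot>\<^bsub>F ?I\<^esub> ?k \<oplus>\<^bsub>F ?I\<^esub> x \<odot>\<^bsub>F ?I\<^esub> ?t"
  proof -
    have "v = x \<odot>\<^bsub>F ?I\<^esub> (p \<odot>\<^bsub>F ?I\<^esub> w) \<oplus>\<^bsub>F ?I\<^esub> (y [^] E) \<odot>\<^bsub>F ?I\<^esub> ?w"
      unfolding w(2) using wM ps(1,2) yE_carr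
      by (subst ps(3)) (simp add: I.smult_l_distr I.smult_assoc1 del: free_module_simps)
    also have "(y [^] E) \<odot>\<^bsub>F ?I\<^esub> ?w = y \<odot>\<^bsub>F ?I\<^esub> (y [^] e \<odot>\<^bsub>F ?I\<^esub> ?w)"
      unfolding yEe m_comm[OF ye y_carr] by (rule I.smult_assoc1[OF y_carr ye swM])
    also have "\<dots> = y \<odot>\<^bsub>F ?I\<^esub> ?k \<oplus>\<^bsub>F ?I\<^esub> y \<odot>\<^bsub>F ?I\<^esub> (x \<odot>\<^bsub>F ?I\<^esub> c)"
      by (subst yw, rule I.smult_r_distr[OF y_carr kM m2])
    also have "y \<odot>\<^bsub>F ?I\<^esub> (x \<odot>\<^bsub>F ?I\<^esub> c) = x \<odot>\<^bsub>F ?I\<^esub> (y \<odot>\<^bsub>F ?I\<^esub> c)"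
      using I.smult_assoc1[OF y_carr x_carr cM] I.smult_assoc1[OF x_carr y_carr cM] m_comm[OF x_carr y_carr] by metis
    finally have v1: "v = x \<odot>\<^bsub>F ?I\<^esub> (p \<odot>\<^bsub>F ?I\<^esub> w) \<oplus>\<^bsub>F ?I\<^esub> (y \<odot>\<^bsub>F ?I\<^esub> ?k \<oplus>\<^bsub>F ?I\<^esub> x \<odot>\<^bsub>F ?I\<^esub> (y \<odot>\<^bsub>F ?I\<^esub> c))" .
    have "q \<oplus>\<^bsub>F ?I\<^esub> (k' \<oplus>\<^bsub>F ?I\<^esub> q') = k' \<oplus>\<^bsub>F ?I\<^esub> (q \<oplus>\<^bsub>F ?I\<^esub> q')"
      if "q \<in> carrier (F ?I)" "k' \<in> carrier (F ?I)" "q' \<in> carrier (F ?I)" for q k' q'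
      by (rule I.M.a_lcomm[OF that])
    thus ?thesis unfolding v1
      using wM cM ps(1) kM I.smult_r_distr[OF x_carr I.smult_closed[OF ps(1) wM] I.smult_closed[OF y_carr cM]]
      by (simp only: I.smult_closed x_carr y_carr)
  qed
  have yk: "y \<odot>\<^bsub>F ?I\<^esub> ?k \<in> K ?I" by (rule I.submoduleE(4)[OF K(1) y_carr kK])
  \<comment> \<open>As \<open>v\<close> and \<open>y ?k\<close> lie in \<open>K ?I\<close>, so does
    \<open>x ?t\<close>, and regularity of \<open>x\<close> yields \<open>?t\<close>. Both summands
    of \<open>v\<close> are then in m \<open>K ?I\<close>.\<close>
  have "x \<odot>\<^bsub>F ?I\<^esub> ?t \<in> K ?I"
    by (rule I.submodule_add_cancel[OF K(1) yk I.smult_closed[OF x_carr tM'] subsetD[OF K(2) v, unfolded veq]])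
  hence "?t \<in> K ?I" using reg_K[OF regular_x, of ?t ?J] tM' by (simp only: free_module_simps)
  thus "v \<in> two_gen_mult (F ?I) x y (K ?I)" unfolding veq
    by (intro I.submoduleE(5)[OF I.submodule_xy_mult[OF K(1)]] I.x_in_xy_mult[OF K(1)] I.y_in_xy_mult[OF K(1)] kK)
qed

text \<open>Since \<open>G\<close> lies in m \<open>K\<close>, passing to generators modulo
  \<open>f\<close> loses none of the minimal generators.\<close>

lemma b_eventually_constant: "b (Suc (Suc (Suc i))) = b (Suc (Suc i))"
proof -
  let ?I = "Suc (Suc i)"
  interpret I: noeth_module R "F ?I" x y by (rule F_mod)
  have sm: "submodule (two_gen_mult (F ?I) x y (K ?I)) R (F ?I)" by (rule I.submodule_xy_mult[OF K(1)])
  have "G ?I <+>\<^bsub>F ?I\<^esub> two_gen_mult (F ?I) x y (K ?I) = two_gen_mult (F ?I) x y (K ?I)"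
    by (intro equalityI I.set_add_subset[OF sm G_le_two_gen_mult_K order_refl] I.subset_set_add2[OF sub_G sm])
  hence "enat (b (Suc ?I)) = enat (b ?I)"
    using b_Suc[of ?I] mlen_two_gen_mult_K[of "Suc i"] by simp
  thus ?thesis by simp
qed

lemma b_const: "2 \<le> i \<Longrightarrow> b i = b 2"
proof (induction i rule: dec_induct)
  case (step n)
  then obtain m where "n = Suc (Suc m)" by (metis Suc_le_D Suc_le_mono numeral_2_eq_2)
  thus ?case using b_eventually_constant[of m] step by simp
qed simp

text \<open>\<open>K\<close> is generated by \<open>b\<close> elements of \<open>m F\<close>, so its image modulo \<open>m^k F\<close> has length at most
  \<open>b\<close> times that of \<open>R/m^(k-1)\<close>.\<close>

lemma a_ge: "enat (k * b (Suc i)) \<le> a (Suc i)"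
proof -
  let ?I = "Suc i" and ?n = "b (Suc i)"
  interpret I: noeth_module R "F ?I" x y by (rule F_mod)
  obtain k' where k': "k = Suc k'" using k by (cases k) auto
  have "\<exists>u. (\<forall>j<?n. u j \<in> K ?I) \<and> K ?I = lin_span R (F ?I) u ?n"
    by (rule I.minimal_generators[OF K(1) mlen_two_gen_mult_K]) (rule_tac x=u in exI, simp)
  then obtain u where u: "\<forall>j<?n. u j \<in> K ?I" "K ?I = lin_span R (F ?I) u ?n" by blast
  have uM: "u j \<in> carrier (F ?I)" if "j < ?n" for j using I.submodule_carr[OF K(1)] u(1) that by blast
  interpret L: module_map R "F ?I" "F ?I" "\<lambda>v. lincomb (F ?I) u v ?n" by (rule I.lincomb_map[OF uM])
  let ?E = "comp_set (mpow k) ?n" and ?E' = "comp_set (mpow k') ?n"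
  have sE: "submodule ?E R (F ?I)" and sE': "submodule ?E' R (F ?I)" by (intro submodule_comp_set ideal_mpow)+
  \<comment> \<open>The coefficient vectors whose combination falls into \<open>m^k\<close>. The
    generators lie in m, so coefficients in \<open>m^(k-1)\<close> qualify.\<close>
  let ?A = "{v \<in> C ?I. lincomb (F ?I) u v ?n \<in> ?E}"
  have sA: "submodule ?A R (F ?I)" by (rule L.submodule_vimage[OF sub_C sE])
  have AC: "?A \<subseteq> C ?I" by blast
  have E'A: "?E' \<subseteq> ?A"
  proof
    fix v assume v: "v \<in> ?E'"
    have "v j \<odot>\<^bsub>F ?I\<^esub> u j \<in> ?E" if j: "j < ?n" for j
    proof -
      have "u j \<in> comp_set \<mm> ?n" using u(1) j K(3) by blast
      moreover have "v j \<in> mpow k'" using v j by (auto simp: PiE_iff)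
      ultimately have "v j \<otimes> u j l \<in> mpow k" if "l < ?n" for l
        using mm_mult_mpow[of "u j l" "v j" k'] mm_carr[of "u j l"] mpow_carr[of "v j" k'] m_comm[of "v j" "u j l"] that
        unfolding k' by (auto simp: PiE_iff)
      thus ?thesis by auto
    qed
    hence "lincomb (F ?I) u v ?n \<in> ?E" by (rule I.lincomb_in_submodule[OF sE])
    moreover have "v \<in> C ?I" using I.submodule_carr[OF sE' v] by (simp only: free_module_simps)
    ultimately show "v \<in> ?A" by blast
  qed
  have sLA: "submodule ((\<lambda>v. lincomb (F ?I) u v ?n) ` ?A) R (F ?I)" by (rule L.submodule_image[OF sA])
  have "(\<lambda>v. lincomb (F ?I) u v ?n) ` ?A \<subseteq> ?E" by blast
  hence e1: "?E <+>\<^bsub>F ?I\<^esub> (\<lambda>v. lincomb (F ?I) u v ?n) ` ?A = ?E" by (rule I.set_add_absorb[OF sE sLA])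
  have e2: "(\<lambda>v. lincomb (F ?I) u v ?n) ` C ?I = K ?I" using u(2) unfolding lin_span_def by simp
  let ?EK = "?E <+>\<^bsub>F ?I\<^esub> K ?I"
  have sEK: "submodule ?EK R (F ?I)" by (rule I.submodule_set_add[OF sE K(1)])
  have EKC: "?EK \<subseteq> C ?I" using I.submoduleE(1)[OF sEK] by (simp only: free_module_simps)
  have EEK: "?E \<subseteq> ?EK" by (rule I.subset_set_add1[OF sE K(1)])
  have "mlen R (F ?I) (?E <+>\<^bsub>F ?I\<^esub> (\<lambda>v. lincomb (F ?I) u v ?n) ` ?A) (?E <+>\<^bsub>F ?I\<^esub> (\<lambda>v. lincomb (F ?I) u v ?n) ` C ?I)
      = mlen R (F ?I) ?A (C ?I)"
    by (rule L.mlen_image[OF sE sA sub_C AC]) blast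
  hence l1: "mlen R (F ?I) ?E ?EK = mlen R (F ?I) ?A (C ?I)" unfolding e1 e2 .
  have "mlen R (F ?I) ?A (C ?I) \<le> mlen R (F ?I) ?E' (C ?I)" by (rule mlen_mono[OF E'A order_refl])
  also have "\<dots> = enat (?n * (k' * (k' + 1) div 2))" by (rule mlen_comp_set[OF ideal_mpow mlen_mpow])
  finally have l2: "mlen R (F ?I) ?E ?EK \<le> enat (?n * (k' * (k' + 1) div 2))" unfolding l1 .
  have l3: "enat (?n * (k * (k + 1) div 2)) = mlen R (F ?I) ?E ?EK + mlen R (F ?I) ?EK (C ?I)"
    unfolding I.mlen_add[OF sE sEK sub_C EEK EKC, symmetric]
    by (rule mlen_comp_set[OF ideal_mpow mlen_mpow, symmetric])
  have "k * (k + 1) div 2 = k' * (k' + 1) div 2 + k"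
    unfolding k' using triangle_add[of 1 k'] by simp
  hence nk: "?n * (k * (k + 1) div 2) = ?n * (k' * (k' + 1) div 2) + k * ?n" by (simp add: algebra_simps)
  have l4: "enat (k * ?n) \<le> mlen R (F ?I) ?EK (C ?I)"
  proof (cases "mlen R (F ?I) ?EK (C ?I)")
    case (enat q)
    obtain p where p: "mlen R (F ?I) ?E ?EK = enat p" using l2 enat_ile by blast
    show ?thesis using l2 l3 unfolding p enat nk by simp
  qed simp
  have zE: "(\<lambda>v. z \<odot>\<^bsub>F ?I\<^esub> v) ` C ?I \<subseteq> ?E"
  proof (rule image_subsetI)
    fix v assume v: "v \<in> C ?I"
    have "z \<otimes> v j \<in> mpow k" if "j < ?n" for j
      by (rule mpow_r_mult[OF _ z]) (use v that in \<open>auto simp: PiE_iff\<close>)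
    thus "z \<odot>\<^bsub>F ?I\<^esub> v \<in> ?E" by auto
  qed
  have "K ?I <+>\<^bsub>F ?I\<^esub> (\<lambda>v. z \<odot>\<^bsub>F ?I\<^esub> v) ` C ?I \<subseteq> ?EK"
    by (rule I.set_add_subset[OF sEK I.subset_set_add2[OF sE K(1)] subset_trans[OF zE EEK]])
  hence "mlen R (F ?I) ?EK (C ?I) \<le> a ?I" unfolding a_def by (rule mlen_mono[OF _ order_refl])
  with l4 show ?thesis by (rule order_trans)
qed

lemma betti_inequality: "d * b 1 + b 2 \<le> d * b 0 + d * b 2"
proof -
  have s1: "a 2 + a 1 = enat (b 1 * (k * d))" using a_add[of 0] by (simp add: numeral_2_eq_2)
  have s2: "a 3 + a 2 = enat (b 2 * (k * d))" using a_add[of 1] by (simp add: numeral_2_eq_2 numeral_3_eq_3)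
  obtain a1 where a1: "a 1 = enat a1" using s1 by (cases "a 1") auto
  obtain a2 where a2: "a 2 = enat a2" using s1 by (cases "a 2") auto
  obtain a3 where a3: "a 3 = enat a3" using s2 by (cases "a 3") auto
  have "a1 \<le> b 0 * (k * d)" using a_1_le a1 by simp
  moreover have "k * b 2 \<le> a3" using a_ge[of 2] a3 b_const[of 3] by (simp add: numeral_3_eq_3 numeral_2_eq_2)
  moreover have "a2 + a1 = b 1 * (k * d)" "a3 + a2 = b 2 * (k * d)" using s1 s2 a1 a2 a3 by simp_all
  \<comment> \<open>Eliminating \<open>a2\<close> leaves \<open>a3 + b 1 k d = b 2 k d + a1\<close>;
    the upper bound for \<open>a1\<close> and the lower bound for \<open>a3\<close> then
    combine.\<close>
  ultimately have "b 1 * (k * d) + k * b 2 \<le> b 0 * (k * d) + b 2 * (k * d)" by linarith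
  hence "k * (d * b 1 + b 2) \<le> k * (d * b 0 + d * b 2)" by (simp add: algebra_simps)
  thus ?thesis using k by simp
qed

end

section \<open>Reducing vectors and lifting maps along a surjection of rings\<close>

context surj_ring_hom
begin

definition reduce :: "nat \<Rightarrow> (nat \<Rightarrow> 'a) \<Rightarrow> nat \<Rightarrow> 'c" where
  "reduce n v = (\<lambda>i\<in>{..<n}. h (v i))"

definition lifts :: "(nat \<Rightarrow> 'c) set \<Rightarrow> nat \<Rightarrow> (nat \<Rightarrow> 'a) set" where
  "lifts Z n = {v \<in> comp_set (carrier R) n. reduce n v \<in> Z}"

lemma reduce_nth: "i < n \<Longrightarrow> reduce n v i = h (v i)"
  by (simp add: reduce_def)

lemma reduce_closed: "v \<in> comp_set (carrier R) n \<Longrightarrow> reduce n v \<in> comp_set (carrier S) n"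
  unfolding reduce_def by (auto simp: PiE_iff)

lemma reduce_surj:
  assumes w: "w \<in> comp_set (carrier S) n"
  obtains v where "v \<in> comp_set (carrier R) n" "w = reduce n v"
proof -
  have "\<exists>a\<in>carrier R. w i = h a" if "i < n" for i
    using surjE[of "w i"] w that by (metis PiE_mem lessThan_iff)
  then obtain a where a: "\<And>i. i < n \<Longrightarrow> a i \<in> carrier R \<and> w i = h (a i)" by metis
  have "restrict a {..<n} \<in> comp_set (carrier R) n" using a by auto
  moreover have "w = reduce n (restrict a {..<n})"
    using w a by (auto simp: fun_eq_iff reduce_def PiE_iff extensional_def)
  ultimately show thesis by (rule that)
qed

lemma reduce_add:
  assumes "v \<in> comp_set (carrier R) n" "w \<in> comp_set (carrier R) n"
  shows "reduce n (v \<oplus>\<^bsub>free_module R n\<^esub> w) = reduce n v \<oplus>\<^bsub>free_module S n\<^esub> reduce n w"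
  using assms by (auto simp: fun_eq_iff reduce_def PiE_iff)

lemma reduce_smult:
  assumes "a \<in> carrier R" "v \<in> comp_set (carrier R) n"
  shows "reduce n (a \<odot>\<^bsub>free_module R n\<^esub> v) = h a \<odot>\<^bsub>free_module S n\<^esub> reduce n v"
  using assms by (auto simp: fun_eq_iff reduce_def PiE_iff)

lemma reduce_zero: "reduce n \<zero>\<^bsub>free_module R n\<^esub> = \<zero>\<^bsub>free_module S n\<^esub>"
  by (auto simp: fun_eq_iff reduce_def)

lemma reduce_eq_zero_iff:
  assumes v: "v \<in> comp_set (carrier R) n"
  shows "reduce n v = \<zero>\<^bsub>free_module S n\<^esub> \<longleftrightarrow> v \<in> comp_set (a_kernel R S h) n"
proof
  assume e: "reduce n v = \<zero>\<^bsub>free_module S n\<^esub>"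
  have "v i \<in> a_kernel R S h" if i: "i < n" for i
  proof -
    have "h (v i) = \<zero>\<^bsub>S\<^esub>" using fun_cong[OF e, of i] i by (simp add: reduce_def)
    moreover have "v i \<in> carrier R" using v i by (auto simp: PiE_iff)
    ultimately show ?thesis unfolding a_kernel_def' by blast
  qed
  thus "v \<in> comp_set (a_kernel R S h) n" using v by (simp add: PiE_iff)
next
  assume k: "v \<in> comp_set (a_kernel R S h) n"
  have "h (v i) = \<zero>\<^bsub>S\<^esub>" if "i < n" for i
  proof -
    have "v i \<in> a_kernel R S h" using k that by (auto simp: PiE_iff)
    thus ?thesis unfolding a_kernel_def' by blast
  qed
  thus "reduce n v = \<zero>\<^bsub>free_module S n\<^esub>" by (auto simp: fun_eq_iff reduce_def)
qed

lemma reduce_eqE: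
  assumes v: "v \<in> comp_set (carrier R) n" "w \<in> comp_set (carrier R) n" "reduce n v = reduce n w"
  obtains g where "g \<in> comp_set (a_kernel R S h) n" "v = g \<oplus>\<^bsub>free_module R n\<^esub> w"
proof -
  let ?g = "\<lambda>i\<in>{..<n}. v i \<ominus> w i"
  have c: "v i \<in> carrier R" "w i \<in> carrier R" if "i < n" for i using v that by (auto simp: PiE_iff)
  have "v i \<ominus> w i \<in> a_kernel R S h" if i: "i < n" for i
    using map_eq_iff[OF c[OF i]] fun_cong[OF v(3), of i] i by (simp add: reduce_def)
  hence "?g \<in> comp_set (a_kernel R S h) n" by auto
  moreover have "v = ?g \<oplus>\<^bsub>free_module R n\<^esub> w"
  proof
    fix i
    show "v i = (?g \<oplus>\<^bsub>free_module R n\<^esub> w) i"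
    proof (cases "i < n")
      case True
      thus ?thesis using c[OF True] by (simp add: a_minus_def R.a_assoc R.l_neg)
    next
      case False
      thus ?thesis using v(1) by (simp add: PiE_iff extensional_def)
    qed
  qed
  ultimately show thesis by (rule that)
qed

lemma reduce_lincomb:
  assumes "\<And>i. i < n \<Longrightarrow> u i \<in> comp_set (carrier R) m" "\<And>i. i < n \<Longrightarrow> v i \<in> carrier R"
  shows "reduce m (lincomb (free_module R m) u v n)
    = lincomb (free_module S m) (\<lambda>i. reduce m (u i)) (\<lambda>i. h (v i)) n"
  using assms
proof (induction n)
  case 0
  show ?case by (simp only: lincomb.simps reduce_zero)
next
  case (Suc n)
  interpret F: module R "free_module R m" by (rule R.module_free)
  have l: "lincomb (free_module R m) u v n \<in> comp_set (carrier R) m"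
    using F.lincomb_closed[of n u v] Suc.prems by simp
  have vn: "v n \<in> carrier R" and un: "u n \<in> comp_set (carrier R) m" using Suc.prems by simp_all
  have vu: "v n \<odot>\<^bsub>free_module R m\<^esub> u n \<in> comp_set (carrier R) m" using F.smult_closed[of "v n" "u n"] vn un by simp
  have IH: "reduce m (lincomb (free_module R m) u v n)
    = lincomb (free_module S m) (\<lambda>i. reduce m (u i)) (\<lambda>i. h (v i)) n" using Suc by simp
  show ?case unfolding lincomb.simps reduce_add[OF l vu] reduce_smult[OF vn un] IH ..
qed

text \<open>A map out of a free module is determined by the images of the unit vectors, and these
  can be lifted one by one.\<close>

lemma lift_module_map:
  assumes \<phi>: "module_map S (free_module S n) (free_module S m) \<phi>"
  obtains D where "module_map R (free_module R n) (free_module R m) D"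
    "\<And>v. v \<in> comp_set (carrier R) n \<Longrightarrow> reduce m (D v) = \<phi> (reduce n v)"
proof -
  interpret \<phi>: module_map S "free_module S n" "free_module S m" \<phi> by (rule \<phi>)
  interpret F: module R "free_module R m" by (rule R.module_free)
  let ?e = "\<lambda>j. \<lambda>i\<in>{..<n}. if i = j then \<one>\<^bsub>S\<^esub> else \<zero>\<^bsub>S\<^esub>"
  have "\<phi> (?e j) \<in> comp_set (carrier S) m" for j
  proof -
    have "?e j \<in> carrier (free_module S n)" by auto
    from \<phi>.closed[OF this] show ?thesis by simp
  qed
  hence "\<exists>u. u \<in> comp_set (carrier R) m \<and> \<phi> (?e j) = reduce m u" for j by (metis reduce_surj)
  then obtain u where u: "\<And>j. u j \<in> comp_set (carrier R) m" "\<And>j. \<phi> (?e j) = reduce m (u j)" by metis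
  have D: "module_map R (free_module R n) (free_module R m) (\<lambda>v. lincomb (free_module R m) u v n)"
    by (rule F.lincomb_map) (use u(1) in simp)
  have "reduce m (lincomb (free_module R m) u v n) = \<phi> (reduce n v)" if v: "v \<in> comp_set (carrier R) n" for v
  proof -
    have rv: "reduce n v \<in> carrier (free_module S n)" using reduce_closed[OF v] by simp
    have "\<phi> (reduce n v) = lincomb (free_module S m) (\<lambda>j. \<phi> (?e j)) (reduce n v) n"
      by (rule S.module_map_free_eq_lincomb[OF \<phi> rv])
    also have "\<dots> = lincomb (free_module S m) (\<lambda>j. reduce m (u j)) (\<lambda>i. h (v i)) n"
      by (rule lincomb_cong) (simp_all only: u(2) reduce_nth)
    also have "\<dots> = reduce m (lincomb (free_module R m) u v n)"
      by (rule reduce_lincomb[symmetric]) (use u(1) v in \<open>auto simp: PiE_iff\<close>)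
    finally show ?thesis by (rule sym)
  qed
  with D show thesis by (rule that)
qed

lemma submodule_lifts:
  assumes Z: "submodule Z S (free_module S n)"
  shows "submodule (lifts Z n) R (free_module R n)"
proof -
  interpret F: module R "free_module R n" by (rule R.module_free)
  interpret G: module S "free_module S n" by (rule S.module_free)
  show ?thesis
  proof (rule F.submoduleI')
    show "lifts Z n \<subseteq> carrier (free_module R n)" unfolding lifts_def by auto
    show "\<zero>\<^bsub>free_module R n\<^esub> \<in> lifts Z n"
      unfolding lifts_def mem_Collect_eq reduce_zero using G.submodule_zero[OF Z] F.zero_closed by simp
  next
    fix v w assume "v \<in> lifts Z n" "w \<in> lifts Z n"
    hence vw: "v \<in> comp_set (carrier R) n" "w \<in> comp_set (carrier R) n" "reduce n v \<in> Z" "reduce n w \<in> Z"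
      unfolding lifts_def by auto
    have "v \<oplus>\<^bsub>free_module R n\<^esub> w \<in> comp_set (carrier R) n" using F.M.add.m_closed[of v w] vw by simp
    thus "v \<oplus>\<^bsub>free_module R n\<^esub> w \<in> lifts Z n"
      unfolding lifts_def mem_Collect_eq reduce_add[OF vw(1,2)] using G.submoduleE(5)[OF Z vw(3,4)] by blast
  next
    fix a v assume a: "a \<in> carrier R" and "v \<in> lifts Z n"
    hence v: "v \<in> comp_set (carrier R) n" "reduce n v \<in> Z" unfolding lifts_def by auto
    have "a \<odot>\<^bsub>free_module R n\<^esub> v \<in> comp_set (carrier R) n" using F.smult_closed[of a v] a v by simp
    thus "a \<odot>\<^bsub>free_module R n\<^esub> v \<in> lifts Z n"
      unfolding lifts_def mem_Collect_eq reduce_smult[OF a v(1)]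
      using G.submoduleE(4)[OF Z closed_S[OF a] v(2)] by blast
  qed
qed

lemma kernel_le_lifts:
  assumes Z: "submodule Z S (free_module S n)"
  shows "comp_set (a_kernel R S h) n \<subseteq> lifts Z n"
proof
  interpret G: module S "free_module S n" by (rule S.module_free)
  fix v assume v: "v \<in> comp_set (a_kernel R S h) n"
  have vc: "v \<in> comp_set (carrier R) n" using v ideal.Icarr[OF ideal_kernel] by (auto simp: PiE_iff)
  have "reduce n v \<in> Z" using reduce_eq_zero_iff[OF vc] v G.submodule_zero[OF Z] by simp
  thus "v \<in> lifts Z n" unfolding lifts_def using vc by blast
qed

text \<open>Vectors with the same reduction differ by a vector over the kernel, which accounts for
  the first summand.\<close>

lemma lifts_image:
  assumes \<phi>: "module_map S (free_module S n) (free_module S m) \<phi>"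
    and D: "module_map R (free_module R n) (free_module R m) D"
    and red: "\<And>v. v \<in> comp_set (carrier R) n \<Longrightarrow> reduce m (D v) = \<phi> (reduce n v)"
  shows "lifts (\<phi> ` comp_set (carrier S) n) m
    = comp_set (a_kernel R S h) m <+>\<^bsub>free_module R m\<^esub> D ` comp_set (carrier R) n"
proof (rule equalityI)
  interpret \<phi>: module_map S "free_module S n" "free_module S m" \<phi> by (rule \<phi>)
  interpret D: module_map R "free_module R n" "free_module R m" D by (rule D)
  have Dc: "D c \<in> comp_set (carrier R) m" if "c \<in> comp_set (carrier R) n" for c
    using D.closed[of c] that by simp
  show "lifts (\<phi> ` comp_set (carrier S) n) m
      \<subseteq> comp_set (a_kernel R S h) m <+>\<^bsub>free_module R m\<^esub> D ` comp_set (carrier R) n"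
  proof
    fix v assume "v \<in> lifts (\<phi> ` comp_set (carrier S) n) m"
    hence v: "v \<in> comp_set (carrier R) m" "reduce m v \<in> \<phi> ` comp_set (carrier S) n" unfolding lifts_def by auto
    obtain w where w: "w \<in> comp_set (carrier S) n" "reduce m v = \<phi> w" using v(2) by (metis imageE)
    obtain c where c: "c \<in> comp_set (carrier R) n" "w = reduce n c" using w(1) by (rule reduce_surj)
    have "reduce m v = reduce m (D c)" unfolding w(2) c(2) red[OF c(1)] ..
    then obtain g where g: "g \<in> comp_set (a_kernel R S h) m" "v = g \<oplus>\<^bsub>free_module R m\<^esub> D c"
      by (rule reduce_eqE[OF v(1) Dc[OF c(1)]])
    show "v \<in> comp_set (a_kernel R S h) m <+>\<^bsub>free_module R m\<^esub> D ` comp_set (carrier R) n"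
      unfolding g(2) by (rule set_addI[OF g(1) imageI[OF c(1)]])
  qed
  have sub: "submodule (\<phi> ` comp_set (carrier S) n) S (free_module S m)"
    by (rule \<phi>.submodule_image[OF S.submodule_comp_set[OF S.oneideal]])
  show "comp_set (a_kernel R S h) m <+>\<^bsub>free_module R m\<^esub> D ` comp_set (carrier R) n
      \<subseteq> lifts (\<phi> ` comp_set (carrier S) n) m"
  proof (rule D.N.set_add_subset[OF submodule_lifts[OF sub] kernel_le_lifts[OF sub]])
    show "D ` comp_set (carrier R) n \<subseteq> lifts (\<phi> ` comp_set (carrier S) n) m"
    proof (rule image_subsetI)
      fix c assume c: "c \<in> comp_set (carrier R) n"
      show "D c \<in> lifts (\<phi> ` comp_set (carrier S) n) m"
        unfolding lifts_def mem_Collect_eq red[OF c] using Dc[OF c] imageI[OF reduce_closed[OF c], of \<phi>] by blast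
    qed
  qed
qed

lemma lifts_kernel:
  assumes D: "module_map R (free_module R n) (free_module R m) D"
    and red: "\<And>v. v \<in> comp_set (carrier R) n \<Longrightarrow> reduce m (D v) = \<phi> (reduce n v)"
  shows "lifts {w \<in> comp_set (carrier S) n. \<phi> w = \<zero>\<^bsub>free_module S m\<^esub>} n
    = {v \<in> comp_set (carrier R) n. D v \<in> comp_set (a_kernel R S h) m}"
proof (rule Set.set_eqI)
  interpret D: module_map R "free_module R n" "free_module R m" D by (rule D)
  fix v
  show "v \<in> lifts {w \<in> comp_set (carrier S) n. \<phi> w = \<zero>\<^bsub>free_module S m\<^esub>} n
    \<longleftrightarrow> v \<in> {v \<in> comp_set (carrier R) n. D v \<in> comp_set (a_kernel R S h) m}"
  proof (cases "v \<in> comp_set (carrier R) n")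
    case True
    have "D v \<in> comp_set (carrier R) m" using D.closed[of v] True by simp
    from reduce_eq_zero_iff[OF this]
    show ?thesis unfolding lifts_def mem_Collect_eq red[OF True] using True reduce_closed[OF True] by blast
  next
    case False
    thus ?thesis unfolding lifts_def mem_Collect_eq by blast
  qed
qed

end

lemma (in local_surj) lifts_le_mm:
  assumes "\<And>w j. w \<in> Z \<Longrightarrow> j < n \<Longrightarrow> w j \<in> max_ideal S"
  shows "lifts Z n \<subseteq> comp_set \<mm> n"
proof
  fix v assume "v \<in> lifts Z n"
  hence v: "v \<in> comp_set (carrier R) n" "reduce n v \<in> Z" unfolding lifts_def by auto
  have "v j \<in> \<mm>" if j: "j < n" for j
  proof -
    have "v j \<in> carrier R" using v(1) j by (auto simp: PiE_iff)
    moreover have "h (v j) \<in> h ` \<mm>" using assms[OF v(2) j] unfolding reduce_nth[OF j] max_ideal_image .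
    ultimately show ?thesis using h_mm_iff by blast
  qed
  thus "v \<in> comp_set \<mm> n" using v(1) by (simp add: PiE_iff)
qed

locale hypersurface = two_dim_local R x y for R (structure) and x y +
  fixes f :: 'a and d E :: nat
  assumes f: "f \<in> mpow d" "f \<notin> mpow (Suc d)" "1 \<le> d"
    and yE: "\<exists>p\<in>carrier R. \<exists>q\<in>carrier R. y [^] E = x \<otimes> p \<oplus> f \<otimes> q"
    and fE: "\<exists>p\<in>carrier R. \<exists>q\<in>carrier R. f = x \<otimes> p \<oplus> y [^] E \<otimes> q"
begin

abbreviation "Q \<equiv> R Quot PIdl f"

lemma f_carr: "f \<in> carrier R"
  using f(1) mpow_carr by blast

lemma f_mm: "f \<in> \<mm>"
  using mpow_le[OF f(1,3)] by (simp add: mpow_1)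

lemma kernel_Q: "a_kernel R Q (\<lambda>a. PIdl f +> a) = PIdl f"
  by (rule quotient_surj(2)[OF cgenideal_ideal[OF f_carr]])

sublocale Q: local_surj R Q x y "\<lambda>a. PIdl f +> a"
  by (rule local_surj_quotient[OF cgenideal_ideal[OF f_carr] cgenideal_minimal[OF ideal_mm f_mm]])

text \<open>\<open>K i\<close> is the preimage of the image of a differential. Exactness describes
  the later ones also as preimages of kernels, which is \<open>K_Suc\<close>, and minimality places
  them inside m R^(b i).\<close>

lemma resolution_lift:
  assumes M: "module Q M" and res: "minimal_free_resolution Q M b \<epsilon> \<delta>"
    and k: "1 \<le> k" "z \<in> mpow k" "\<And>v. v \<in> mpow N \<Longrightarrow> \<exists>p\<in>carrier R. \<exists>q\<in>carrier R. v = z \<otimes> p \<oplus> f \<otimes> q"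
      "mlen R (self_module R) (PIdl f <+>\<^bsub>R\<^esub> PIdl z) (carrier R) = enat (k * d)"
  obtains K D where "hypersurface_resolution R x y f d k N E z b K D"
    "K 0 = Q.lifts {w \<in> comp_set (carrier Q) (b 0). \<epsilon> w = \<zero>\<^bsub>M\<^esub>} (b 0)"
proof -
  have \<delta>: "module_map Q (free_module Q (b (Suc i))) (free_module Q (b i)) (\<delta> i)" for i
    by (intro module_map.intro module_map_axioms.intro Q.S.module_free)
      (use res in \<open>simp add: minimal_free_resolution_def Let_def del: free_module_simps\<close>)
  have "\<exists>D. module_map R (free_module R (b (Suc i))) (free_module R (b i)) D \<and>
      (\<forall>v. v \<in> comp_set (carrier R) (b (Suc i)) \<longrightarrow> Q.reduce (b i) (D v) = \<delta> i (Q.reduce (b (Suc i)) v))" for i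
    by (rule Q.lift_module_map[OF \<delta>[of i]]) blast
  then obtain D where D: "\<And>i. module_map R (free_module R (b (Suc i))) (free_module R (b i)) (D i)"
    "\<And>i v. v \<in> comp_set (carrier R) (b (Suc i)) \<Longrightarrow> Q.reduce (b i) (D i v) = \<delta> i (Q.reduce (b (Suc i)) v)"
    by metis
  note r = res[unfolded minimal_free_resolution_def Let_def free_module_simps(1) One_nat_def]
  define Z where "Z i = \<delta> i ` comp_set (carrier Q) (b (Suc i))" for i
  have sZ: "submodule (Z i) Q (free_module Q (b i))" for i unfolding Z_def
    by (rule module_map.submodule_image[OF \<delta> Q.S.submodule_comp_set[OF Q.S.oneideal]])
  have Z0: "Z 0 = {w \<in> comp_set (carrier Q) (b 0). \<epsilon> w = \<zero>\<^bsub>M\<^esub>}"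
    unfolding Z_def using r[THEN conjunct2, THEN conjunct2, THEN conjunct2, THEN conjunct1, symmetric] .
  have ZS: "Z (Suc i) = {w \<in> comp_set (carrier Q) (b (Suc i)). \<delta> i w = \<zero>\<^bsub>free_module Q (b i)\<^esub>}" for i
    unfolding Z_def using r[THEN conjunct2, THEN conjunct2, THEN conjunct2, THEN conjunct2, THEN conjunct1,
      THEN spec[of _ i], symmetric] .
  have Zm: "w j \<in> max_ideal Q" if "w \<in> Z i" "j < b i" for w i j
    using r[THEN conjunct2, THEN conjunct2, THEN conjunct2, THEN conjunct2, THEN conjunct2, THEN spec[of _ i]] that
    unfolding Z_def by fast
  note ker = kernel_Q
  let ?K = "\<lambda>i. Q.lifts (Z i) (b i)"
  have "hypersurface_resolution R x y f d k N E z b ?K D"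
  proof (intro hypersurface_resolution.intro hypersurface_resolution_axioms.intro two_dim_local_axioms)
    fix i
    show "submodule (?K i) R (free_module R (b i))" by (rule Q.submodule_lifts[OF sZ])
    show "comp_set (PIdl f) (b i) \<subseteq> ?K i" using Q.kernel_le_lifts[OF sZ[of i]] unfolding ker .
    show "?K i \<subseteq> comp_set \<mm> (b i)" by (rule Q.lifts_le_mm, rule Zm)
    show "?K i = comp_set (PIdl f) (b i) <+>\<^bsub>free_module R (b i)\<^esub> D i ` comp_set (carrier R) (b (Suc i))"
      using Q.lifts_image[OF \<delta> D(1)[of i] D(2)[of _ i]] unfolding ker Z_def .
    show "?K (Suc i) = {v \<in> comp_set (carrier R) (b (Suc i)). D i v \<in> comp_set (PIdl f) (b i)}"
      using Q.lifts_kernel[OF D(1)[of i] D(2)[of _ i]] unfolding ker ZS .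
  qed (fact f yE fE k D)+
  thus thesis by (rule that) (simp only: Z0)
qed

end

section \<open>Existence of resolutions\<close>

lemma (in noeth_module) minimal_cover:
  assumes K: "submodule K R M"
  shows "\<exists>s \<phi>. module_map R (free_module R s) M \<phi> \<and> \<phi> ` comp_set (carrier R) s = K \<and>
    {v \<in> comp_set (carrier R) s. \<phi> v = \<zero>\<^bsub>M\<^esub>} \<subseteq> comp_set \<mm> s"
proof -
  obtain s where s: "mlen R M (xy_mult K) K = enat s" using mlen_xy_mult_finite[OF K] by auto
  have "\<exists>u. (\<forall>i<s. u i \<in> K) \<and> K = lin_span R M u s \<and>
      (\<forall>v. v \<in> carrier (free_module R s) \<longrightarrow> lincomb M u v s = \<zero>\<^bsub>M\<^esub> \<longrightarrow> v \<in> comp_set \<mm> s)"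
    by (rule minimal_generators[OF K s]) (rule_tac x=u in exI, simp)
  then obtain u where u: "\<forall>i<s. u i \<in> K" "K = lin_span R M u s"
    "\<forall>v. v \<in> carrier (free_module R s) \<longrightarrow> lincomb M u v s = \<zero>\<^bsub>M\<^esub> \<longrightarrow> v \<in> comp_set \<mm> s" by blast
  have uM: "u i \<in> carrier M" if "i < s" for i using u(1) that submodule_carr[OF K] by blast
  show ?thesis
  proof (intro exI conjI)
    show "module_map R (free_module R s) M (\<lambda>v. lincomb M u v s)" by (rule lincomb_map[OF uM])
    show "(\<lambda>v. lincomb M u v s) ` comp_set (carrier R) s = K"
      unfolding u(2) lin_span_def free_module_simps ..
    show "{v \<in> comp_set (carrier R) s. lincomb M u v s = \<zero>\<^bsub>M\<^esub>} \<subseteq> comp_set \<mm> s"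
    proof (rule subsetI)
      fix v assume "v \<in> {v \<in> comp_set (carrier R) s. lincomb M u v s = \<zero>\<^bsub>M\<^esub>}"
      hence v: "v \<in> comp_set (carrier R) s" "lincomb M u v s = \<zero>\<^bsub>M\<^esub>" unfolding mem_Collect_eq by simp_all
      show "v \<in> comp_set \<mm> s" by (rule u(3)[rule_format, OF _ v(2)]) (use v(1) in simp)
    qed
  qed
qed

text \<open>Minimal covers are iterated. The state is a rank \<open>n\<close> with a submodule of
  R^n contained in m R^n, the syzygy still to be covered.\<close>

lemma (in two_gen_local) minimal_resolution_tail:
  assumes Z: "submodule Z R (free_module R n)" "Z \<subseteq> comp_set \<mm> n"
  obtains b \<delta> where "b 0 = n" "\<And>i. module_map R (free_module R (b (Suc i))) (free_module R (b i)) (\<delta> i)"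
    "\<delta> 0 ` comp_set (carrier R) (b (Suc 0)) = Z"
    "\<And>i. {v \<in> comp_set (carrier R) (b (Suc i)). \<delta> i v = \<zero>\<^bsub>free_module R (b i)\<^esub>}
      = \<delta> (Suc i) ` comp_set (carrier R) (b (Suc (Suc i)))"
    "\<And>i. \<delta> i ` comp_set (carrier R) (b (Suc i)) \<subseteq> comp_set \<mm> (b i)"
proof -
  define P where "P t \<longleftrightarrow> submodule (snd t) R (free_module R (fst t)) \<and> snd t \<subseteq> comp_set \<mm> (fst t)"
    for t :: "nat \<times> (nat \<Rightarrow> 'a) set"
  define next_syz where "next_syz t t' \<phi> \<longleftrightarrow> module_map R (free_module R (fst t')) (free_module R (fst t)) \<phi> \<and>
    \<phi> ` comp_set (carrier R) (fst t') = snd t \<and>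
    snd t' = {v \<in> comp_set (carrier R) (fst t'). \<phi> v = \<zero>\<^bsub>free_module R (fst t)\<^esub>}"
    for t t' :: "nat \<times> (nat \<Rightarrow> 'a) set" and \<phi>
  have step: "\<exists>t'. P t' \<and> (\<exists>\<phi>. next_syz t t' \<phi>)" if t: "P t" for t
  proof -
    interpret F: noeth_module R "free_module R (fst t)" x y by (rule noeth_free)
    have K: "submodule (snd t) R (free_module R (fst t))" using t unfolding P_def by blast
    obtain s \<phi> where s: "module_map R (free_module R s) (free_module R (fst t)) \<phi>"
      "\<phi> ` comp_set (carrier R) s = snd t"
      "{v \<in> comp_set (carrier R) s. \<phi> v = \<zero>\<^bsub>free_module R (fst t)\<^esub>} \<subseteq> comp_set \<mm> s"
      using F.minimal_cover[OF K] by (elim exE conjE)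
    interpret \<phi>: module_map R "free_module R s" "free_module R (fst t)" \<phi> by (rule s(1))
    let ?Z = "{v \<in> comp_set (carrier R) s. \<phi> v = \<zero>\<^bsub>free_module R (fst t)\<^esub>}"
    have z: "submodule {\<zero>\<^bsub>free_module R (fst t)\<^esub>} R (free_module R (fst t))"
      by (rule F.submoduleI') (auto simp del: free_module_simps)
    have "submodule {v \<in> comp_set (carrier R) s. \<phi> v \<in> {\<zero>\<^bsub>free_module R (fst t)\<^esub>}} R (free_module R s)"
      by (rule \<phi>.submodule_vimage[OF submodule_comp_set[OF oneideal] z])
    hence sub: "submodule ?Z R (free_module R s)" unfolding singleton_iff .
    have "P (s, ?Z)" unfolding P_def fst_conv snd_conv using sub s(3) by blast
    moreover have "next_syz t (s, ?Z) \<phi>" unfolding next_syz_def fst_conv snd_conv using s(1,2) by blast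
    ultimately show ?thesis by (intro exI[of _ "(s, ?Z)"] conjI exI[of _ \<phi>])
  qed
  \<comment> \<open>Only the states are chosen recursively. A differential relates two consecutive
    states, so the maps are selected afterwards.\<close>
  define T where "T = rec_nat (n, Z) (\<lambda>_ t. SOME t'. P t' \<and> (\<exists>\<phi>. next_syz t t' \<phi>))"
  have T0: "T 0 = (n, Z)" and TS: "T (Suc i) = (SOME t'. P t' \<and> (\<exists>\<phi>. next_syz (T i) t' \<phi>))" for i
    unfolding T_def by simp_all
  have PT: "P (T i)" for i
  proof (induction i)
    case 0
    show ?case unfolding T0 P_def fst_conv snd_conv using Z by blast
  next
    case (Suc i)
    show ?case unfolding TS using someI_ex[OF step[OF Suc]] by (rule conjunct1)
  qed
  have "\<exists>\<phi>. next_syz (T i) (T (Suc i)) \<phi>" for i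
    unfolding TS using someI_ex[OF step[OF PT]] by (rule conjunct2)
  then obtain \<delta> where \<delta>: "\<And>i. next_syz (T i) (T (Suc i)) (\<delta> i)" by metis
  note n = \<delta>[unfolded next_syz_def]
  show thesis
  proof (rule that[of "\<lambda>i. fst (T i)" \<delta>])
    show "fst (T 0) = n" unfolding T0 by simp
    show "module_map R (free_module R (fst (T (Suc i)))) (free_module R (fst (T i))) (\<delta> i)" for i
      by (rule n[THEN conjunct1])
    show "\<delta> 0 ` comp_set (carrier R) (fst (T (Suc 0))) = Z"
      using n[of 0, THEN conjunct2, THEN conjunct1] unfolding T0 snd_conv .
    show "{v \<in> comp_set (carrier R) (fst (T (Suc i))). \<delta> i v = \<zero>\<^bsub>free_module R (fst (T i))\<^esub>}
      = \<delta> (Suc i) ` comp_set (carrier R) (fst (T (Suc (Suc i))))" for i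
      unfolding n[of i, THEN conjunct2, THEN conjunct2, symmetric] n[of "Suc i", THEN conjunct2, THEN conjunct1] ..
    show "\<delta> i ` comp_set (carrier R) (fst (T (Suc i))) \<subseteq> comp_set \<mm> (fst (T i))" for i
      unfolding n[of i, THEN conjunct2, THEN conjunct1] using PT[of i] unfolding P_def by blast
  qed
qed

text \<open>Makes R/J available as an \<open>R\<close>-module generated by 1.\<close>

definition scalar_restriction :: "('b, 'd) ring_scheme \<Rightarrow> ('a \<Rightarrow> 'b) \<Rightarrow> ('a, 'b) module" where
  "scalar_restriction S h = \<lparr>carrier = carrier S, mult = undefined, one = undefined,
     ring.zero = \<zero>\<^bsub>S\<^esub>, add = add S, smult = (\<lambda>a s. h a \<otimes>\<^bsub>S\<^esub> s)\<rparr>"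

lemma scalar_restriction_simps [simp]:
  "carrier (scalar_restriction S h) = carrier S" "\<zero>\<^bsub>scalar_restriction S h\<^esub> = \<zero>\<^bsub>S\<^esub>"
  "s \<oplus>\<^bsub>scalar_restriction S h\<^esub> t = s \<oplus>\<^bsub>S\<^esub> t" "a \<odot>\<^bsub>scalar_restriction S h\<^esub> s = h a \<otimes>\<^bsub>S\<^esub> s"
  by (simp_all add: scalar_restriction_def)

lemma (in surj_ring_hom) module_scalar_restriction: "module R (scalar_restriction S h)"
proof (rule moduleI[OF R.is_cring])
  show "abelian_group (scalar_restriction S h)"
  proof (rule abelian_groupI)
    fix u assume "u \<in> carrier (scalar_restriction S h)"
    thus "\<exists>w\<in>carrier (scalar_restriction S h). w \<oplus>\<^bsub>scalar_restriction S h\<^esub> u = \<zero>\<^bsub>scalar_restriction S h\<^esub>"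
      by (intro bexI[of _ "\<ominus>\<^bsub>S\<^esub> u"]) (auto simp: S.l_neg)
  qed (auto simp: S.a_ac)
qed (auto simp: S.l_distr S.r_distr S.m_assoc)

lemma (in surj_ring_hom) fin_gen_scalar_restriction: "fin_gen_module R (scalar_restriction S h)"
proof -
  let ?M = "scalar_restriction S h"
  interpret M: module R ?M by (rule module_scalar_restriction)
  have "N = carrier ?M" if N: "submodule N R ?M" "{\<one>\<^bsub>S\<^esub>} \<subseteq> N" for N
  proof (rule equalityI[OF M.submoduleE(1)[OF N(1)]], rule subsetI)
    fix s assume "s \<in> carrier ?M"
    hence "s \<in> carrier S" by simp
    then obtain a where a: "a \<in> carrier R" "s = h a" by (rule surjE)
    have "a \<odot>\<^bsub>?M\<^esub> \<one>\<^bsub>S\<^esub> \<in> N" by (rule M.submoduleE(4)[OF N(1) a(1)]) (use N(2) in blast)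
    thus "s \<in> N" using a by simp
  qed
  thus ?thesis unfolding fin_gen_module_def
    by (intro conjI M.module_axioms exI[of _ "{\<one>\<^bsub>S\<^esub>}"]) auto
qed

text \<open>The first syzygy of R/J is \<open>J\<close> inside R^1, from which
  \<open>minimal_resolution_tail\<close> continues.\<close>

lemma (in two_gen_local) cyclic_resolution:
  assumes J: "ideal J R" "J \<subseteq> \<mm>"
  obtains M :: "('a, 'a set) module" and b \<epsilon> \<delta> where "fin_gen_module R M" "minimal_free_resolution R M b \<epsilon> \<delta>"
    "b 0 = 1" "\<And>w. w \<in> comp_set (carrier R) 1 \<Longrightarrow> \<epsilon> w = \<zero>\<^bsub>M\<^esub> \<longleftrightarrow> w 0 \<in> J"
proof -
  let ?S = "R Quot J" and ?h = "\<lambda>a. J +> a"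
  interpret H: surj_ring_hom R ?S ?h by (rule quotient_surj(1)[OF J(1)])
  let ?M = "scalar_restriction ?S ?h"
  have ker: "?h a = \<zero>\<^bsub>?S\<^esub> \<longleftrightarrow> a \<in> J" if "a \<in> carrier R" for a
    using quotient_surj(2)[OF J(1)] that unfolding a_kernel_def' by blast
  have "comp_set J 1 \<subseteq> comp_set \<mm> 1" using J(2) by (auto simp: PiE_iff)
  from minimal_resolution_tail[OF submodule_comp_set[OF J(1)] this]
  obtain b \<delta> where b: "b 0 = 1" and \<delta>: "\<And>i. module_map R (free_module R (b (Suc i))) (free_module R (b i)) (\<delta> i)"
    and im: "\<delta> 0 ` comp_set (carrier R) (b (Suc 0)) = comp_set J 1"
    and ex: "\<And>i. {v \<in> comp_set (carrier R) (b (Suc i)). \<delta> i v = \<zero>\<^bsub>free_module R (b i)\<^esub>}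
      = \<delta> (Suc i) ` comp_set (carrier R) (b (Suc (Suc i)))"
    and min: "\<And>i. \<delta> i ` comp_set (carrier R) (b (Suc i)) \<subseteq> comp_set \<mm> (b i)" by blast
  let ?\<epsilon> = "\<lambda>w. ?h (w (0::nat))"
  have w0: "w 0 \<in> carrier R" if "w \<in> comp_set (carrier R) 1" for w using that by (auto simp: PiE_iff)
  have keq: "?\<epsilon> w = \<zero>\<^bsub>?M\<^esub> \<longleftrightarrow> w 0 \<in> J" if "w \<in> comp_set (carrier R) 1" for w
    using ker[OF w0[OF that]] by simp
  have "minimal_free_resolution R ?M b ?\<epsilon> \<delta>"
    unfolding minimal_free_resolution_def Let_def free_module_simps(1) One_nat_def[symmetric]
  proof (intro conjI allI ballI impI)
    show "?\<epsilon> \<in> module_homs R (free_module R (b 0)) ?M"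
      unfolding b module_homs_def by (auto simp: PiE_iff H.map_add)
    show "\<delta> i \<in> module_homs R (free_module R (b (Suc i))) (free_module R (b i))" for i
      by (rule module_map.hom[OF \<delta>])
    show "?\<epsilon> ` comp_set (carrier R) (b 0) = carrier ?M"
    proof (rule equalityI)
      show "?\<epsilon> ` comp_set (carrier R) (b 0) \<subseteq> carrier ?M" unfolding b using H.closed_S[OF w0] by auto
      show "carrier ?M \<subseteq> ?\<epsilon> ` comp_set (carrier R) (b 0)"
      proof
        fix s assume "s \<in> carrier ?M"
        hence "s \<in> carrier ?S" by simp
        then obtain a where a: "a \<in> carrier R" "s = ?h a" by (rule H.surjE)
        have "(\<lambda>i\<in>{..<1}. a) \<in> comp_set (carrier R) (b 0)" unfolding b using a(1) by auto
        moreover have "s = ?h ((\<lambda>i\<in>{..<1::nat}. a) 0)" using a(2) by simp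
        ultimately show "s \<in> ?\<epsilon> ` comp_set (carrier R) (b 0)" by (rule_tac image_eqI)
      qed
    qed
    show "{w \<in> comp_set (carrier R) (b 0). ?\<epsilon> w = \<zero>\<^bsub>?M\<^esub>} = \<delta> 0 ` comp_set (carrier R) (b 1)"
      unfolding One_nat_def im b[unfolded One_nat_def]
    proof (rule Set.set_eqI)
      fix w
      show "w \<in> {w \<in> comp_set (carrier R) (Suc 0). ?\<epsilon> w = \<zero>\<^bsub>?M\<^esub>} \<longleftrightarrow> w \<in> comp_set J (Suc 0)"
        using keq[of w] ideal.Icarr[OF J(1)] by (auto simp: PiE_iff)
    qed
    show "{v \<in> comp_set (carrier R) (b (Suc i)). \<delta> i v = \<zero>\<^bsub>free_module R (b i)\<^esub>}
      = \<delta> (Suc i) ` comp_set (carrier R) (b (Suc (Suc i)))" for i by (rule ex)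
    show "\<delta> i v j \<in> max_ideal R" if "v \<in> comp_set (carrier R) (b (Suc i))" "j < b i" for i v j
    proof -
      have "\<delta> i v \<in> comp_set \<mm> (b i)" by (rule subsetD[OF min imageI[OF that(1)]])
      thus ?thesis unfolding max_ideal_eq using that(2) by (auto simp: PiE_iff)
    qed
  qed
  with H.fin_gen_scalar_restriction show thesis using b keq by (rule that)
qed

section \<open>Extremal Betti sequences\<close>

context hypersurface_resolution
begin

text \<open>\<open>K 0 = G 0\<close> says that the resolved module is free over the quotient by
  \<open>f\<close>.\<close>

lemma betti_free:
  assumes K0: "K 0 = G 0"
  shows "b 1 = 0" "b 2 = 0"
proof -
  interpret F: noeth_module R "F 0" x y by (rule F_mod)
  let ?m = "two_gen_mult (F 0) x y (K 0)"
  have sm: "submodule ?m R (F 0)" by (rule F.submodule_xy_mult[OF K(1)])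
  have sub: "submodule (G 0 <+>\<^bsub>F 0\<^esub> ?m) R (F 0)" by (rule F.submodule_set_add[OF sub_G sm])
  have le: "G 0 <+>\<^bsub>F 0\<^esub> ?m \<subseteq> K 0"
    by (rule F.set_add_subset[OF K(1) K(2) F.xy_mult_subset[OF K(1)]])
  have "K 0 \<subseteq> G 0 <+>\<^bsub>F 0\<^esub> ?m" by (subst K0, rule F.subset_set_add1[OF sub_G sm])
  with le have "G 0 <+>\<^bsub>F 0\<^esub> ?m = K 0" by (rule equalityI)
  hence "enat (b (Suc 0)) = 0" unfolding b_Suc[of 0, symmetric] F.mlen_zero_iff[OF sub K(1) le] .
  thus "b 1 = 0" by (simp add: enat_0_iff)
  thus "b 2 = 0" using b_antimono[of 0] by (simp add: numeral_2_eq_2)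
qed

text \<open>The module is Q/(z). Its first syzygy is the image of multiplication by
  \<open>z\<close>, so it needs at most one generator, and \<open>a 1\<close> has the full value
  \<open>k d\<close>. The sum formula then forces \<open>b 1\<close> to be nonzero and
  \<open>a 2 = 0\<close>, and \<open>a 2\<close> bounds \<open>k b 2\<close> from above.\<close>

lemma betti_parameter:
  assumes b0: "b 0 = 1" and K0: "K 0 = G 0 <+>\<^bsub>F 0\<^esub> (\<lambda>v. z \<odot>\<^bsub>F 0\<^esub> v) ` C 0"
  shows "b 1 = 1" "b 2 = 0"
proof -
  interpret F: noeth_module R "F 0" x y by (rule F_mod)
  let ?z = "\<lambda>v. z \<odot>\<^bsub>F 0\<^esub> v" and ?m = "two_gen_mult (F 0) x y (K 0)"
  let ?P = "comp_set \<mm> (b 0)"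
  have P: "?P = two_gen_mult (F 0) x y (C 0)" by (rule two_gen_mult_free[symmetric])
  have sP: "submodule ?P R (F 0)" by (rule submodule_comp_set[OF ideal_mm])
  have sm: "submodule ?m R (F 0)" by (rule F.submodule_xy_mult[OF K(1)])
  have szC: "submodule (?z ` C 0) R (F 0)" by (rule F.submodule_smult[OF z_carr sub_C])
  have sGm: "submodule (G 0 <+>\<^bsub>F 0\<^esub> ?m) R (F 0)" by (rule F.submodule_set_add[OF sub_G sm])
  have PC: "?P \<subseteq> C 0" using F.submoduleE(1)[OF sP] by simp
  have GP: "G 0 \<subseteq> ?P" by (rule subset_trans[OF K(2) K(3)])
  have reg: "v \<in> G 0" if "v \<in> C 0" "?z v \<in> G 0" for v by (rule reg_G[OF regular_z that])
  have zK: "?z v \<in> K 0" if "v \<in> C 0" for v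
    unfolding K0 by (rule subsetD[OF F.subset_set_add2[OF sub_G szC] imageI[OF that]])
  have zP: "?z ` ?P \<subseteq> ?m"
  proof (rule image_subsetI)
    fix v assume "v \<in> ?P"
    then obtain c c' where c: "c \<in> C 0" "c' \<in> C 0" "v = x \<odot>\<^bsub>F 0\<^esub> c \<oplus>\<^bsub>F 0\<^esub> y \<odot>\<^bsub>F 0\<^esub> c'"
      unfolding P two_gen_mult_def set_add_iff by blast
    have cM: "c \<in> carrier (F 0)" "c' \<in> carrier (F 0)" using c by simp_all
    interpret Z: module_map R "F 0" "F 0" ?z by (rule F.smult_map[OF z_carr])
    have "?z v = x \<odot>\<^bsub>F 0\<^esub> ?z c \<oplus>\<^bsub>F 0\<^esub> y \<odot>\<^bsub>F 0\<^esub> ?z c'"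
      unfolding c(3) Z.map_add[OF F.smult_closed[OF x_carr cM(1)] F.smult_closed[OF y_carr cM(2)]]
        Z.map_smult[OF x_carr cM(1)] Z.map_smult[OF y_carr cM(2)] ..
    thus "?z v \<in> ?m"
      using F.submoduleE(5)[OF sm F.x_in_xy_mult[OF K(1) zK[OF c(1)]] F.y_in_xy_mult[OF K(1) zK[OF c(2)]]]
      by (simp only:)
  qed
  have "mlen R (F 0) (G 0 <+>\<^bsub>F 0\<^esub> ?z ` ?P) (K 0) = mlen R (F 0) ?P (C 0)"
    unfolding K0 by (rule F.mlen_smult_image[OF z_carr sub_G sP sub_C PC subsetD[OF GP reg]])
  hence "mlen R (F 0) (G 0 <+>\<^bsub>F 0\<^esub> ?z ` ?P) (K 0) = enat 1" using mlen_comp_mm[of "b 0"] b0 by (simp only:)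
  moreover have "G 0 <+>\<^bsub>F 0\<^esub> ?z ` ?P \<subseteq> G 0 <+>\<^bsub>F 0\<^esub> ?m" by (rule set_add_mono[OF order_refl zP])
  ultimately have "enat (b (Suc 0)) \<le> enat 1" using mlen_mono b_Suc[of 0] order_refl by metis
  hence le: "b 1 \<le> 1" by simp
  have "a (Suc 0) = mlen R (F 0) (K 0) (C 0)"
  proof -
    have "mlen R (F 0) (G 0 <+>\<^bsub>F 0\<^esub> ?z ` K 0) (G 0 <+>\<^bsub>F 0\<^esub> ?z ` C 0) = mlen R (F 0) (K 0) (C 0)"
      by (rule F.mlen_smult_image[OF z_carr sub_G K(1) sub_C K_le_C subsetD[OF K(2) reg]])
    thus ?thesis unfolding a_Suc K0[symmetric] .
  qed
  also have "\<dots> = enat (b 0 * (k * d))" using mlen_G_z[of 0] unfolding K0[symmetric] .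
  also have "\<dots> = enat (k * d)" by (simp add: b0)
  finally have a1: "a (Suc 0) = enat (k * d)" .
  obtain a2 where a2: "a (Suc (Suc 0)) = enat a2" using a_add[of 0] by (cases "a (Suc (Suc 0))") auto
  have eq: "a2 + k * d = b 1 * (k * d)" using a_add[of 0] unfolding a1 a2 by simp
  moreover have "k * d > 0" using k f(3) by simp
  ultimately have "b 1 \<noteq> 0" by (cases "b 1 = 0") auto
  with le show b1: "b 1 = 1" by simp
  have "a2 = 0" using eq b1 by simp
  hence "k * b 2 = 0" using a_ge[of "Suc 0"] unfolding a2 by (simp add: numeral_2_eq_2)
  thus "b 2 = 0" using k by simp
qed

text \<open>The module is Q/m^d. Modulo \<open>m^(d+1) + (f)\<close> the ideal \<open>m^d\<close>
  has length \<open>(d + 1) - 1\<close>, so \<open>b 1\<close> is at least \<open>d\<close>. The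
  Betti inequality together with \<open>b 2 \<le> b 1\<close> gives the opposite bound and, after
  cancelling the factor \<open>d - 1\<close>, also \<open>b 2 = d\<close>.\<close>

lemma betti_mpow:
  assumes d: "2 \<le> d" and b0: "b 0 = 1" and K0: "K 0 = comp_set (mpow d) (b 0)"
  shows "b 1 = d" "b 2 = d"
proof -
  interpret F: noeth_module R "F 0" x y by (rule F_mod)
  let ?f = "\<lambda>v. f \<odot>\<^bsub>F 0\<^esub> v" and ?m = "two_gen_mult (F 0) x y (K 0)"
  let ?P = "comp_set \<mm> (b 0)" and ?E = "comp_set (mpow (Suc d)) (b 0)"
  have sP: "submodule ?P R (F 0)" by (rule submodule_comp_set[OF ideal_mm])
  have sE: "submodule ?E R (F 0)" by (rule submodule_comp_set[OF ideal_mpow])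
  have sfC: "submodule (?f ` C 0) R (F 0)" by (rule F.submodule_smult[OF f_carr sub_C])
  have sfP: "submodule (?f ` ?P) R (F 0)" by (rule F.submodule_smult[OF f_carr sP])
  have sm: "submodule ?m R (F 0)" by (rule F.submodule_xy_mult[OF K(1)])
  let ?L = "?E <+>\<^bsub>F 0\<^esub> ?f ` C 0"
  have sL: "submodule ?L R (F 0)" by (rule F.submodule_set_add[OF sE sfC])
  have PC: "?P \<subseteq> C 0" using F.submoduleE(1)[OF sP] by simp
  have GfC: "G 0 \<subseteq> ?f ` C 0"
  proof
    fix v assume "v \<in> G 0"
    then obtain w where "w \<in> C 0" "v = ?f w" using comp_set_cgenideal[OF f_carr] by blast
    thus "v \<in> ?f ` C 0" by (rule_tac image_eqI)
  qed
  have fC: "?f ` C 0 \<subseteq> K 0"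
  proof (rule image_subsetI)
    fix v assume "v \<in> C 0"
    from smult_f_G[OF this] show "?f v \<in> K 0" by (rule subsetD[OF K(2)])
  qed
  have EK: "?E \<subseteq> K 0" unfolding K0 using mpow_le[of _ "Suc d" d] by (auto simp: PiE_iff)
  have mul: "w \<odot>\<^bsub>F 0\<^esub> v \<in> ?E" if v: "v \<in> K 0" and w: "w \<in> \<mm>" for v w
  proof -
    have "w \<otimes> v j \<in> mpow (Suc d)" if "j < b 0" for j
      by (rule mm_mult_mpow[OF w]) (use v that in \<open>auto simp: K0 PiE_iff\<close>)
    thus ?thesis by auto
  qed
  have mE: "?m \<subseteq> ?E" by (rule F.xy_mult_least[OF sE mul[OF _ x_mm] mul[OF _ y_mm]])
  have LK: "?L \<subseteq> K 0" by (rule F.set_add_subset[OF K(1) EK fC])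
  have GmL: "G 0 <+>\<^bsub>F 0\<^esub> ?m \<subseteq> ?L"
    by (rule F.set_add_subset[OF sL subset_trans[OF GfC F.subset_set_add2[OF sE sfC]]
      subset_trans[OF mE F.subset_set_add1[OF sE sfC]]])
  have fP: "?f ` ?P \<subseteq> ?E"
  proof (rule image_subsetI)
    fix v assume v: "v \<in> ?P"
    have "f \<otimes> v j \<in> mpow (Suc d)" if j: "j < b 0" for j
    proof -
      have "v j \<in> \<mm>" using v j by (auto simp: PiE_iff)
      thus ?thesis using mm_mult_mpow[OF _ f(1)] m_comm[OF f_carr mm_carr] by metis
    qed
    thus "?f v \<in> ?E" by auto
  qed
  have ker: "v \<in> ?P" if v: "v \<in> C 0" "?f v \<in> ?E" for v
  proof -
    have "v j \<in> \<mm>" if j: "j < b 0" for j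
    proof (rule ccontr)
      assume n: "v j \<notin> \<mm>"
      have vj: "v j \<in> carrier R" using v(1) j by (auto simp: PiE_iff)
      have "f \<otimes> v j \<notin> mpow (Suc (d + 0))"
        by (rule mult_notin_mpow[OF f(1,2)]) (use vj n in \<open>simp_all add: mpow_1\<close>)
      moreover have "f \<otimes> v j \<in> mpow (Suc d)" using PiE_mem[OF v(2), of j] j by simp
      ultimately show False by simp
    qed
    thus ?thesis using v(1) by (simp add: PiE_iff)
  qed
  \<comment> \<open>As \<open>f\<close> has exact order \<open>d\<close>, its multiples contribute a
    single copy of the residue field modulo \<open>m^(d+1)\<close>.\<close>
  have "mlen R (F 0) (?E <+>\<^bsub>F 0\<^esub> ?f ` ?P) ?L = mlen R (F 0) ?P (C 0)"
    by (rule F.mlen_smult_image[OF f_carr sE sP sub_C PC ker])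
  hence "mlen R (F 0) ?E ?L = enat (b 0)" unfolding F.set_add_absorb[OF sE sfP fP] mlen_comp_mm .
  hence l1: "mlen R (F 0) ?E ?L = enat 1" by (simp only: b0)
  have "mlen R (F 0) ?E (K 0) + mlen R (F 0) (K 0) (C 0) = mlen R (F 0) ?E (C 0)"
    by (rule F.mlen_add[OF sE K(1) sub_C EK K_le_C, symmetric])
  hence l2: "mlen R (F 0) ?E (K 0) + enat (b 0 * (d * (d + 1) div 2)) = enat (b 0 * (Suc d * (Suc d + 1) div 2))"
    unfolding K0 mlen_comp_set[OF ideal_mpow mlen_mpow] .
  have "b 0 * (Suc d * (Suc d + 1) div 2) = b 0 * (d * (d + 1) div 2) + Suc d"
    unfolding b0 using triangle_add[of 1 d] by simp
  note l2 = l2[unfolded this]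
  have "l = enat q" if "l + enat p = enat (p + q)" for l p q using that by (cases l) auto
  from this[OF l2] have "mlen R (F 0) ?E (K 0) = enat (Suc d)" .
  hence "mlen R (F 0) ?E ?L + mlen R (F 0) ?L (K 0) = enat (Suc d)"
    using F.mlen_add[OF sE sL K(1) F.subset_set_add1[OF sE sfC] LK] by simp
  hence "mlen R (F 0) ?L (K 0) = enat d" unfolding l1 by (cases "mlen R (F 0) ?L (K 0)") auto
  moreover have "mlen R (F 0) ?L (K 0) \<le> enat (b (Suc 0))"
    unfolding b_Suc[of 0, symmetric] by (rule mlen_mono[OF GmL order_refl])
  ultimately have b1: "d \<le> b 1" by simp
  have b2: "b 2 \<le> b 1" using b_antimono[of 0] by (simp add: numeral_2_eq_2)
  have ineq: "d * b 1 + b 2 \<le> d + d * b 2" using betti_inequality unfolding b0 by simp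
  obtain e where e: "d = Suc e" using d by (cases d) auto
  have i2: "d * b 1 \<le> d + e * b 2" using ineq unfolding e by simp
  also have "\<dots> \<le> d + e * b 1" using b2 by simp
  finally have "b 1 \<le> d" unfolding e by simp
  with b1 show b1': "b 1 = d" by simp
  have "e * d \<le> e * b 2" using i2 unfolding b1' by (simp add: e)
  moreover have "0 < e" using d e by simp
  ultimately have "d \<le> b 2" using nat_mult_le_cancel1 by blast
  thus "b 2 = d" using b2 b1' by simp
qed

end

context hypersurface
begin

lemma parameter_exists:
  "\<exists>k z N. 1 \<le> k \<and> z \<in> mpow k \<and>
    (\<forall>v. v \<in> mpow N \<longrightarrow> (\<exists>p\<in>carrier R. \<exists>q\<in>carrier R. v = z \<otimes> p \<oplus> f \<otimes> q)) \<and>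
    mlen R (self_module R) (PIdl f <+>\<^bsub>R\<^esub> PIdl z) (carrier R) = enat (k * d)"
  by (rule homogeneous_parameter[OF f(1,2)]) (intro exI conjI allI impI)

text \<open>The parameter \<open>z\<close> is an auxiliary choice; its degree \<open>k\<close> has
  cancelled from the conclusion.\<close>

lemma betti_sequence_facts:
  assumes M: "module Q M" and b: "is_betti_sequence Q M b"
  shows "2 \<le> i \<Longrightarrow> b i = b 2" "b 2 \<le> b 1" "d * b 1 + b 2 \<le> d * b 0 + d * b 2"
proof -
  obtain k z N where z': "1 \<le> k" "z \<in> mpow k"
    "\<forall>v. v \<in> mpow N \<longrightarrow> (\<exists>p\<in>carrier R. \<exists>q\<in>carrier R. v = z \<otimes> p \<oplus> f \<otimes> q)"
    "mlen R (self_module R) (PIdl f <+>\<^bsub>R\<^esub> PIdl z) (carrier R) = enat (k * d)"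
    using parameter_exists by (elim exE conjE)
  note z = z'(1,2) z'(3)[rule_format] z'(4)
  obtain \<epsilon> \<delta> where res: "minimal_free_resolution Q M b \<epsilon> \<delta>" using b unfolding is_betti_sequence_def by blast
  obtain K D where "hypersurface_resolution R x y f d k N E z b K D"
    by (rule resolution_lift[OF M res z])
  then interpret H: hypersurface_resolution R x y f d k N E z b K D .
  show "2 \<le> i \<Longrightarrow> b i = b 2" by (rule H.b_const)
  show "b 2 \<le> b 1" using H.b_antimono[of 0] by (simp add: numeral_2_eq_2)
  show "d * b 1 + b 2 \<le> d * b 0 + d * b 2" by (rule H.betti_inequality)
qed

text \<open>The element type is the one in \<open>betti_cone Q\<close>, so that the cone is
  literally the hull of these sequences.\<close>

definition betti_sequence :: "(nat \<Rightarrow> nat) \<Rightarrow> bool" where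
  "betti_sequence b \<longleftrightarrow> (\<exists>M :: ('a set, (nat \<Rightarrow> 'a set) set) module. fin_gen_module Q M \<and> is_betti_sequence Q M b)"

lemma cyclic_resolution_lift:
  assumes I: "ideal I R" "PIdl f \<subseteq> I" "I \<subseteq> \<mm>"
    and z: "k \<ge> 1" "z \<in> mpow k"
    "\<And>v. v \<in> mpow N \<Longrightarrow> \<exists>p\<in>carrier R. \<exists>q\<in>carrier R. v = z \<otimes> p \<oplus> f \<otimes> q"
    "mlen R (self_module R) (PIdl f <+>\<^bsub>R\<^esub> PIdl z) (carrier R) = enat (k * d)"
  obtains b K D where "betti_sequence b" "b 0 = 1" "hypersurface_resolution R x y f d k N E z b K D"
    "K 0 = comp_set I (b 0)"
proof -
  let ?h = "\<lambda>a. PIdl f +> a"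
  interpret T: two_gen_local Q "?h x" "?h y" by (rule Q.two_gen_local_image)
  have J: "ideal (?h ` I) Q" by (rule Q.ideal_image[OF I(1)])
  have Jm: "?h ` I \<subseteq> two_gen Q (?h x) (?h y)" unfolding Q.two_gen_image using I(3) by (rule image_mono)
  have "\<exists>(M :: ('a set, 'a set set) module) b \<epsilon> \<delta>. fin_gen_module Q M \<and>
    minimal_free_resolution Q M b \<epsilon> \<delta> \<and> b 0 = 1 \<and>
    (\<forall>w. w \<in> comp_set (carrier Q) 1 \<longrightarrow> \<epsilon> w = \<zero>\<^bsub>M\<^esub> \<longleftrightarrow> w 0 \<in> ?h ` I)"
    by (rule T.cyclic_resolution[OF J Jm]) (intro exI conjI allI impI)
  then obtain M :: "('a set, 'a set set) module" and b \<epsilon> \<delta> where M': "fin_gen_module Q M"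
    "minimal_free_resolution Q M b \<epsilon> \<delta>" "b 0 = 1"
    "\<forall>w. w \<in> comp_set (carrier Q) 1 \<longrightarrow> \<epsilon> w = \<zero>\<^bsub>M\<^esub> \<longleftrightarrow> w 0 \<in> ?h ` I" by (elim exE conjE)
  note M = M'(1-3) M'(4)[rule_format]
  have "is_betti_sequence Q M b" unfolding is_betti_sequence_def using M(2) by blast
  \<comment> \<open>The cyclic module has elements of another type, so its Betti sequence is
    transported to the type fixed in \<open>betti_sequence\<close>.\<close>
  hence bs: "betti_sequence b" unfolding betti_sequence_def by (rule betti_sequence_any_type[OF M(1)])
  have mod: "module Q M" using M(1) unfolding fin_gen_module_def by blast
  obtain K D where KD: "hypersurface_resolution R x y f d k N E z b K D"
    "K 0 = Q.lifts {w \<in> comp_set (carrier Q) (b 0). \<epsilon> w = \<zero>\<^bsub>M\<^esub>} (b 0)"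
    by (rule resolution_lift[OF mod M(2) z])
  have "K 0 = comp_set I (b 0)"
  proof (rule Set.set_eqI)
    fix v
    have vi: "{r \<in> carrier R. ?h r \<in> ?h ` I} = I" by (rule Q.vimage_image[OF I(1)]) (use I(2) in \<open>simp only: kernel_Q\<close>)
    show "v \<in> K 0 \<longleftrightarrow> v \<in> comp_set I (b 0)"
    proof (cases "v \<in> comp_set (carrier R) 1")
      case True
      have rc: "Q.reduce 1 v \<in> comp_set (carrier Q) 1" by (rule Q.reduce_closed[OF True])
      have v0: "v 0 \<in> carrier R" using True by (auto simp: PiE_iff)
      have "v \<in> K 0 \<longleftrightarrow> \<epsilon> (Q.reduce 1 v) = \<zero>\<^bsub>M\<^esub>"
        unfolding KD(2) M(3) Q.lifts_def mem_Collect_eq using True rc by blast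
      also have "\<dots> \<longleftrightarrow> ?h (v 0) \<in> ?h ` I" unfolding M(4)[OF rc] Q.reduce_nth[OF zero_less_one] ..
      also have "\<dots> \<longleftrightarrow> v 0 \<in> I" using vi v0 by blast
      also have "\<dots> \<longleftrightarrow> v \<in> comp_set I (b 0)" unfolding M(3) using True by (auto simp: PiE_iff)
      finally show ?thesis .
    next
      case False
      have "v \<notin> comp_set I 1"
      proof
        assume "v \<in> comp_set I 1"
        hence "v \<in> comp_set (carrier R) 1" using ideal.Icarr[OF I(1)] by (auto simp: PiE_iff)
        thus False using False by blast
      qed
      thus ?thesis using False unfolding KD(2) M(3) Q.lifts_def mem_Collect_eq by blast
    qed
  qed
  with bs M(3) KD(1) show thesis by (rule that)
qed

lemma betti_exists_free: "\<exists>b. betti_sequence b \<and> b 0 = 1 \<and> b 1 = 0 \<and> b 2 = 0"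
proof -
  obtain k z N where z': "1 \<le> k" "z \<in> mpow k"
    "\<forall>v. v \<in> mpow N \<longrightarrow> (\<exists>p\<in>carrier R. \<exists>q\<in>carrier R. v = z \<otimes> p \<oplus> f \<otimes> q)"
    "mlen R (self_module R) (PIdl f <+>\<^bsub>R\<^esub> PIdl z) (carrier R) = enat (k * d)"
    using parameter_exists by (elim exE conjE)
  note z = z'(1,2) z'(3)[rule_format] z'(4)
  obtain b K D where b: "betti_sequence b" "b 0 = 1" "hypersurface_resolution R x y f d k N E z b K D"
    "K 0 = comp_set (PIdl f) (b 0)"
    by (rule cyclic_resolution_lift[OF cgenideal_ideal[OF f_carr] order_refl cgenideal_minimal[OF ideal_mm f_mm] z])
  show ?thesis using b(1,2) hypersurface_resolution.betti_free[OF b(3,4)] by blast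
qed

lemma betti_exists_parameter: "\<exists>b. betti_sequence b \<and> b 0 = 1 \<and> b 1 = 1 \<and> b 2 = 0"
proof -
  interpret S: module R "self_module R" by (rule module_self)
  obtain k z N where z': "1 \<le> k" "z \<in> mpow k"
    "\<forall>v. v \<in> mpow N \<longrightarrow> (\<exists>p\<in>carrier R. \<exists>q\<in>carrier R. v = z \<otimes> p \<oplus> f \<otimes> q)"
    "mlen R (self_module R) (PIdl f <+>\<^bsub>R\<^esub> PIdl z) (carrier R) = enat (k * d)"
    using parameter_exists by (elim exE conjE)
  note z = z'(1,2) z'(3)[rule_format] z'(4)
  have zm: "z \<in> \<mm>" using mpow_le[OF z(2,1)] by (simp add: mpow_1)
  have zc: "z \<in> carrier R" by (rule mm_carr[OF zm])
  note sf = submodule_cgenideal[OF f_carr] and sz = submodule_cgenideal[OF zc]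
  have sI: "submodule (PIdl f <+>\<^bsub>R\<^esub> PIdl z) R (self_module R)"
    using S.submodule_set_add[OF sf sz] by simp
  hence I: "ideal (PIdl f <+>\<^bsub>R\<^esub> PIdl z) R" by (simp add: submodule_self_iff)
  have fI: "PIdl f \<subseteq> PIdl f <+>\<^bsub>R\<^esub> PIdl z" using S.subset_set_add1[OF sf sz] by simp
  have "submodule \<mm> R (self_module R)" using ideal_mm by (simp add: submodule_self_iff)
  from S.set_add_subset[OF this cgenideal_minimal[OF ideal_mm f_mm] cgenideal_minimal[OF ideal_mm zm]]
  have Im: "PIdl f <+>\<^bsub>R\<^esub> PIdl z \<subseteq> \<mm>" by simp
  obtain b K D where b: "betti_sequence b" "b 0 = 1" "hypersurface_resolution R x y f d k N E z b K D"
    "K 0 = comp_set (PIdl f <+>\<^bsub>R\<^esub> PIdl z) (b 0)"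
    by (rule cyclic_resolution_lift[OF I fI Im z])
  note c = comp_set_sum[OF cgenideal_ideal[OF f_carr] zc, of "b 0", symmetric]
  show ?thesis using b(1,2) hypersurface_resolution.betti_parameter[OF b(3,2) b(4)[unfolded c]] by blast
qed

lemma betti_exists_mpow:
  assumes d: "2 \<le> d"
  shows "\<exists>b. betti_sequence b \<and> b 0 = 1 \<and> b 1 = d \<and> b 2 = d"
proof -
  obtain k z N where z': "1 \<le> k" "z \<in> mpow k"
    "\<forall>v. v \<in> mpow N \<longrightarrow> (\<exists>p\<in>carrier R. \<exists>q\<in>carrier R. v = z \<otimes> p \<oplus> f \<otimes> q)"
    "mlen R (self_module R) (PIdl f <+>\<^bsub>R\<^esub> PIdl z) (carrier R) = enat (k * d)"
    using parameter_exists by (elim exE conjE)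
  note z = z'(1,2) z'(3)[rule_format] z'(4)
  have m: "mpow d \<subseteq> \<mm>" using mpow_le[OF _ f(3)] by (auto simp: mpow_1)
  obtain b K D where b: "betti_sequence b" "b 0 = 1" "hypersurface_resolution R x y f d k N E z b K D"
    "K 0 = comp_set (mpow d) (b 0)"
    by (rule cyclic_resolution_lift[OF ideal_mpow cgenideal_minimal[OF ideal_mpow f(1)] m z])
  show ?thesis using b(1,2) hypersurface_resolution.betti_mpow[OF b(3) d b(2,4)] by blast
qed

end

section \<open>The cone of Betti sequences\<close>

lemma rat_cone_hull_superset:
  assumes "x \<in> S"
  shows "x \<in> rat_cone_hull S"
  unfolding rat_cone_hull_def mem_Collect_eq
  by (intro exI[of _ "{x}"] exI[of _ "\<lambda>_. 1"]) (use assms in \<open>auto simp: scaleW_def\<close>)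

lemma rat_cone_hull_scale:
  assumes "0 \<le> a" "x \<in> rat_cone_hull S"
  shows "scaleW a x \<in> rat_cone_hull S"
proof -
  obtain F c where F: "finite F" "F \<subseteq> S" "\<forall>x\<in>F. 0 \<le> c x" "x = (\<Sum>x\<in>F. scaleW (c x) x)"
    using assms(2) unfolding rat_cone_hull_def by blast
  have "scaleW a x = (\<Sum>x\<in>F. scaleW (a * c x) x)"
    unfolding F(4) W.scale_sum_right W.scale_scale ..
  moreover have "\<forall>x\<in>F. 0 \<le> a * c x" using assms(1) F(3) by simp
  ultimately show ?thesis unfolding rat_cone_hull_def mem_Collect_eq using F(1,2)
    by (intro exI[of _ F] exI[of _ "\<lambda>x. a * c x"] conjI)
qed

lemma rat_cone_hull_add:
  assumes "x \<in> rat_cone_hull S" "y \<in> rat_cone_hull S"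
  shows "x + y \<in> rat_cone_hull S"
proof -
  obtain F c where F: "finite F" "F \<subseteq> S" "\<forall>x\<in>F. 0 \<le> c x" "x = (\<Sum>x\<in>F. scaleW (c x) x)"
    using assms(1) unfolding rat_cone_hull_def by blast
  obtain G e where G: "finite G" "G \<subseteq> S" "\<forall>x\<in>G. 0 \<le> e x" "y = (\<Sum>x\<in>G. scaleW (e x) x)"
    using assms(2) unfolding rat_cone_hull_def by blast
  let ?c = "\<lambda>x. if x \<in> F then c x else 0" and ?e = "\<lambda>x. if x \<in> G then e x else 0"
  have fin: "finite (F \<union> G)" using F(1) G(1) by simp
  have "x = (\<Sum>x\<in>F \<union> G. scaleW (?c x) x)" unfolding F(4)
    by (rule sum.mono_neutral_cong_left[OF fin]) auto
  moreover have "y = (\<Sum>x\<in>F \<union> G. scaleW (?e x) x)" unfolding G(4)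
    by (rule sum.mono_neutral_cong_left[OF fin]) auto
  ultimately have "x + y = (\<Sum>x\<in>F \<union> G. scaleW (?c x + ?e x) x)"
    by (simp only: W.scale_left_distrib sum.distrib)
  moreover have "\<forall>x\<in>F \<union> G. 0 \<le> ?c x + ?e x" using F(3) G(3) by auto
  moreover have "F \<union> G \<subseteq> S" using F(2) G(2) by blast
  ultimately show ?thesis unfolding rat_cone_hull_def mem_Collect_eq using fin
    by (intro exI[of _ "F \<union> G"] exI[of _ "\<lambda>x. ?c x + ?e x"] conjI)
qed

lemma rat_cone_hull_least:
  assumes "S \<subseteq> T" "0 \<in> T" "\<And>x y. x \<in> T \<Longrightarrow> y \<in> T \<Longrightarrow> x + y \<in> T"
    and "\<And>a x. 0 \<le> a \<Longrightarrow> x \<in> T \<Longrightarrow> scaleW a x \<in> T"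
  shows "rat_cone_hull S \<subseteq> T"
proof
  fix z assume "z \<in> rat_cone_hull S"
  then obtain F c where F: "finite F" "F \<subseteq> S" "\<forall>x\<in>F. 0 \<le> c x" "z = (\<Sum>x\<in>F. scaleW (c x) x)"
    unfolding rat_cone_hull_def by blast
  have "(\<Sum>x\<in>F. scaleW (c x) x) \<in> T" using F(1-3)
  proof (induction F rule: finite_induct)
    case empty
    show ?case unfolding sum.empty by (rule assms(2))
  next
    case (insert x F)
    have "scaleW (c x) x \<in> T" using insert.prems assms(1,4) by blast
    moreover have "(\<Sum>x\<in>F. scaleW (c x) x) \<in> T" using insert by simp
    ultimately show ?case unfolding sum.insert[OF insert.hyps] by (rule assms(3))
  qed
  thus "z \<in> T" unfolding F(4) .
qed

lemma rat_cone_hull_singleton: "scaleW c v \<in> rat_cone_hull {v}" if "0 \<le> c"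
  by (rule rat_cone_hull_scale[OF that rat_cone_hull_superset]) simp

lemma rat_cone_hull_singletonE:
  assumes "x \<in> rat_cone_hull {v}"
  obtains c where "0 \<le> c" "x = scaleW c v"
proof -
  have "rat_cone_hull {v} \<subseteq> {scaleW c v | c. 0 \<le> c}"
  proof (rule rat_cone_hull_least)
    have "v = scaleW 1 v" by simp
    thus "{v} \<subseteq> {scaleW c v | c. 0 \<le> c}" using zero_le_one by blast
    have "0 = scaleW 0 v" by simp
    thus "0 \<in> {scaleW c v | c. 0 \<le> c}" by blast
  next
    fix x y assume "x \<in> {scaleW c v | c. 0 \<le> c}" "y \<in> {scaleW c v | c. 0 \<le> c}"
    then obtain a b where "x = scaleW a v" "y = scaleW b v" "0 \<le> a" "0 \<le> b" by blast
    hence "x + y = scaleW (a + b) v" "0 \<le> a + b" by (simp_all add: W.scale_left_distrib)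
    thus "x + y \<in> {scaleW c v | c. 0 \<le> c}" by blast
  next
    fix a :: rat and x assume a: "0 \<le> a" and "x \<in> {scaleW c v | c. 0 \<le> c}"
    then obtain b where "x = scaleW b v" "0 \<le> b" by blast
    hence "scaleW a x = scaleW (a * b) v" "0 \<le> a * b" using a by simp_all
    thus "scaleW a x \<in> {scaleW c v | c. 0 \<le> c}" by blast
  qed
  thus thesis using assms that by blast
qed

text \<open>Each of the three inequalities is tight on two of the rays \<open>v1\<close>,
  \<open>v2\<close>, \<open>v3\<close> below and strict on the third, so they are the facets of the
  cone spanned by these rays.\<close>

definition betti_halfspaces :: "nat \<Rightarrow> (nat \<Rightarrow> rat) set" where
  "betti_halfspaces d = {x. (\<forall>i\<ge>2. x i = x 2) \<and> 0 \<le> x 2 \<and> x 2 \<le> x 1 \<and>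
     of_nat d * x 1 + x 2 \<le> of_nat d * x 0 + of_nat d * x 2}"

lemma betti_halfspacesI:
  "(\<And>i. 2 \<le> i \<Longrightarrow> x i = x 2) \<Longrightarrow> 0 \<le> x 2 \<Longrightarrow> x 2 \<le> x 1 \<Longrightarrow>
    of_nat d * x 1 + x 2 \<le> of_nat d * x 0 + of_nat d * x 2 \<Longrightarrow> x \<in> betti_halfspaces d"
  unfolding betti_halfspaces_def by blast

lemma betti_halfspacesD:
  assumes "x \<in> betti_halfspaces d"
  shows "2 \<le> i \<Longrightarrow> x i = x 2" "0 \<le> x 2" "x 2 \<le> x 1"
    "of_nat d * x 1 + x 2 \<le> of_nat d * x 0 + of_nat d * x 2"
  using assms unfolding betti_halfspaces_def by blast+

lemma betti_halfspaces_add: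
  assumes x: "x \<in> betti_halfspaces d" and y: "y \<in> betti_halfspaces d"
  shows "x + y \<in> betti_halfspaces d"
proof (rule betti_halfspacesI)
  show "(x + y) i = (x + y) 2" if "2 \<le> i" for i
    unfolding plus_fun_apply betti_halfspacesD(1)[OF x that] betti_halfspacesD(1)[OF y that] ..
  show "of_nat d * (x + y) 1 + (x + y) 2 \<le> of_nat d * (x + y) 0 + of_nat d * (x + y) 2"
    unfolding plus_fun_apply distrib_left using betti_halfspacesD(4)[OF x] betti_halfspacesD(4)[OF y] by linarith
  show "0 \<le> (x + y) 2" "(x + y) 2 \<le> (x + y) 1"
    unfolding plus_fun_apply using betti_halfspacesD(2,3)[OF x] betti_halfspacesD(2,3)[OF y] by linarith+
qed

lemma betti_halfspaces_scale:
  assumes a: "0 \<le> a" and x: "x \<in> betti_halfspaces d"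
  shows "scaleW a x \<in> betti_halfspaces d"
proof -
  have x': "\<And>i. 2 \<le> i \<Longrightarrow> x i = x 2" "0 \<le> x 2" "x 2 \<le> x 1"
    "of_nat d * x 1 + x 2 \<le> of_nat d * x 0 + of_nat d * x 2"
    using x unfolding betti_halfspaces_def by blast+
  have "a * (of_nat d * x 1 + x 2) \<le> a * (of_nat d * x 0 + of_nat d * x 2)" by (rule mult_left_mono[OF x'(4) a])
  hence "of_nat d * (a * x 1) + a * x 2 \<le> of_nat d * (a * x 0) + of_nat d * (a * x 2)"
    by (simp add: algebra_simps)
  moreover have "a * x i = a * x 2" if "2 \<le> i" for i using x'(1)[OF that] by simp
  moreover have "0 \<le> a * x 2" "a * x 2 \<le> a * x 1" using a x'(2,3) by (simp_all add: mult_left_mono)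
  ultimately show ?thesis unfolding betti_halfspaces_def scaleW_def by blast
qed

lemma zero_betti_halfspaces: "0 \<in> betti_halfspaces d"
  by (rule betti_halfspacesI) simp_all

lemma betti_halfspaces_eqI:
  assumes "x \<in> betti_halfspaces d" "y \<in> betti_halfspaces d" "x 0 = y 0" "x 1 = y 1" "x 2 = y 2"
  shows "x = y"
proof
  fix i :: nat
  have x: "x j = x 2" and y: "y j = y 2" if "2 \<le> j" for j
    using assms(1,2) that unfolding betti_halfspaces_def by blast+
  consider "i = 0" | "i = 1" | "2 \<le> i" by linarith
  thus "x i = y i" by cases (use assms(3-5) x[of i] y[of i] in simp_all)
qed

context
  fixes d :: nat and v1 v2 v3 :: "nat \<Rightarrow> rat"
  assumes d: "2 \<le> d"
  defines "v1 \<equiv> eps 0" and "v2 \<equiv> eps 0 + eps 1" and "v3 \<equiv> scaleW (1 / of_nat d) (eps 0) + eps_tail"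
begin

lemma ray_coords:
  "v1 0 = 1" "v1 1 = 0" "v1 2 = 0" "v2 0 = 1" "v2 1 = 1" "v2 2 = 0"
  "v3 0 = 1 / of_nat d" "v3 1 = 1" "v3 2 = 1"
  unfolding v1_def v2_def v3_def by (simp_all add: eps_def eps_tail_def scaleW_def)

lemma ray_coords_ge: "2 \<le> i \<Longrightarrow> v1 i = 0" "2 \<le> i \<Longrightarrow> v2 i = 0" "2 \<le> i \<Longrightarrow> v3 i = 1"
  unfolding v1_def v2_def v3_def by (simp_all add: eps_def eps_tail_def scaleW_def)

lemma d_pos: "0 < (of_nat d :: rat)"
  using d by simp

lemma rays_in: "v1 \<in> betti_halfspaces d" "v2 \<in> betti_halfspaces d" "v3 \<in> betti_halfspaces d"
  by (rule betti_halfspacesI; use ray_coords_ge ray_coords[unfolded One_nat_def] d_pos in simp)+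

lemma betti_halfspaces_decompose:
  assumes x: "x \<in> betti_halfspaces d"
  shows "x = scaleW (x 0 - (x 1 - x 2) - x 2 / of_nat d) v1 + scaleW (x 1 - x 2) v2 + scaleW (x 2) v3"
    (is "x = ?y")
    and "0 \<le> x 0 - (x 1 - x 2) - x 2 / of_nat d" "0 \<le> x 1 - x 2" "0 \<le> x 2"
proof -
  have x': "\<And>i. 2 \<le> i \<Longrightarrow> x i = x 2" "0 \<le> x 2" "x 2 \<le> x 1"
    "of_nat d * x 1 + x 2 \<le> of_nat d * x 0 + of_nat d * x 2"
    using x unfolding betti_halfspaces_def by blast+
  \<comment> \<open>Divided by \<open>d\<close>, the last facet inequality is nonnegativity of the
    coefficient of \<open>v1\<close>.\<close>
  have "x 2 \<le> (x 0 - (x 1 - x 2)) * of_nat d" 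
    using x'(4) by (simp add: left_diff_distrib right_diff_distrib distrib_left mult.commute)
  hence "x 2 / of_nat d \<le> x 0 - (x 1 - x 2)" by (simp only: pos_divide_le_eq[OF d_pos])
  thus "0 \<le> x 0 - (x 1 - x 2) - x 2 / of_nat d" by (simp only: diff_ge_0_iff_ge)
  show "0 \<le> x 1 - x 2" "0 \<le> x 2" using x'(2,3) by simp_all
  show "x = ?y"
  proof
    fix i :: nat
    consider "i = 0" | "i = 1" | "2 \<le> i" by linarith
    thus "x i = ?y i"
    proof cases
      case 1
      show ?thesis unfolding 1 plus_fun_apply scaleW_def ray_coords by simp
    next
      case 2
      show ?thesis unfolding 2 plus_fun_apply scaleW_def ray_coords by simp
    next
      case 3
      show ?thesis using x'(1)[OF 3] ray_coords_ge[OF 3] by (simp add: scaleW_def)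
    qed
  qed
qed

lemma hull_eq_betti_halfspaces:
  assumes S: "S \<subseteq> betti_halfspaces d" and v: "v1 \<in> rat_cone_hull S" "v2 \<in> rat_cone_hull S" "v3 \<in> rat_cone_hull S"
  shows "rat_cone_hull S = betti_halfspaces d"
proof (rule equalityI)
  show "rat_cone_hull S \<subseteq> betti_halfspaces d"
    by (rule rat_cone_hull_least[OF S zero_betti_halfspaces betti_halfspaces_add betti_halfspaces_scale])
  show "betti_halfspaces d \<subseteq> rat_cone_hull S"
  proof
    fix x assume x: "x \<in> betti_halfspaces d"
    note D = betti_halfspaces_decompose[OF x]
    show "x \<in> rat_cone_hull S"
      by (subst D(1)) (intro rat_cone_hull_add rat_cone_hull_scale D v)
  qed
qed

text \<open>The third vector exceeds \<open>v3\<close> by \<open>(d - 2)/d\<close> times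
  \<open>v1\<close>, so for \<open>2 \<le> d\<close> it does not enlarge the hull.\<close>

lemma hull_rays: "rat_cone_hull {v1, v2, scaleW ((of_nat d - 1) / of_nat d) (eps 0) + eps_tail, v3} = betti_halfspaces d"
proof (rule hull_eq_betti_halfspaces)
  let ?u = "scaleW ((of_nat d - 1) / of_nat d) (eps 0) + eps_tail"
  have u: "?u 0 = (of_nat d - 1) / of_nat d" "?u 1 = 1" "?u 2 = 1" "\<And>i. 2 \<le> i \<Longrightarrow> ?u i = 1"
    by (simp_all add: eps_def eps_tail_def scaleW_def)
  have "2 \<le> (of_nat d :: rat)" using d by simp
  hence "of_nat d * ?u 1 + ?u 2 \<le> of_nat d * ?u 0 + of_nat d * ?u 2" unfolding u by (simp add: field_simps)
  hence "?u \<in> betti_halfspaces d" by (intro betti_halfspacesI) (simp_all only: u zero_le_one order_refl)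
  thus "{v1, v2, ?u, v3} \<subseteq> betti_halfspaces d" using rays_in by simp
qed (rule rat_cone_hull_superset, simp)+

lemma dim_betti_halfspaces: "W.dim (betti_halfspaces d) = 3"
proof (rule W.dim_unique[of "{v1, v2, v3}"])
  have ne: "v1 \<noteq> v2" "v1 \<noteq> v3" "v2 \<noteq> v3" using ray_coords by (metis zero_neq_one)+
  thus "card {v1, v2, v3} = 3" by simp
  show "{v1, v2, v3} \<subseteq> betti_halfspaces d" using rays_in by simp
  show "betti_halfspaces d \<subseteq> W.span {v1, v2, v3}"
  proof
    fix x assume x: "x \<in> betti_halfspaces d"
    show "x \<in> W.span {v1, v2, v3}"
      by (subst betti_halfspaces_decompose(1)[OF x]) (intro W.span_add W.span_scale W.span_base; simp)
  qed
  show "W.independent {v1, v2, v3}"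
  proof (rule W.independent_if_scalars_zero)
    fix c x assume "(\<Sum>v\<in>{v1, v2, v3}. scaleW (c v) v) = 0" and x: "x \<in> {v1, v2, v3}"
    hence e: "scaleW (c v1) v1 + (scaleW (c v2) v2 + scaleW (c v3) v3) = 0" using ne by simp
    have "c v3 = 0" using fun_cong[OF e, of 2] unfolding plus_fun_apply scaleW_def ray_coords by simp
    moreover have "c v2 = 0" using fun_cong[OF e, of 1] calculation unfolding plus_fun_apply scaleW_def ray_coords by simp
    moreover have "c v1 = 0" using fun_cong[OF e, of 0] calculation unfolding plus_fun_apply scaleW_def ray_coords by simp
    ultimately show "c x = 0" using x by blast
  qed simp
qed

lemma extremal_rayI:
  assumes v: "v \<in> betti_halfspaces d" "v \<noteq> 0"
    and "\<And>x y c. x \<in> betti_halfspaces d \<Longrightarrow> y \<in> betti_halfspaces d \<Longrightarrow> 0 \<le> c \<Longrightarrow> x + y = scaleW c v \<Longrightarrow>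
      \<exists>a. 0 \<le> a \<and> x = scaleW a v"
  shows "extremal_ray (betti_halfspaces d) v"
  unfolding extremal_ray_def
proof (intro conjI ballI impI v)
  fix x y assume xy: "x \<in> betti_halfspaces d" "y \<in> betti_halfspaces d" "x + y \<in> rat_cone_hull {v}"
  obtain c where c: "0 \<le> c" "x + y = scaleW c v" using xy(3) by (rule rat_cone_hull_singletonE)
  have c': "y + x = scaleW c v" using c(2) by (simp only: add.commute)
  show "x \<in> rat_cone_hull {v}" using assms(3)[OF xy(1,2) c] rat_cone_hull_singleton by metis
  show "y \<in> rat_cone_hull {v}" using assms(3)[OF xy(2,1) c(1) c'] rat_cone_hull_singleton by metis
qed

text \<open>A facet inequality that is tight on \<open>x + y\<close> is tight on \<open>x\<close>
  and on \<open>y\<close>; the two facets through each ray then determine \<open>x\<close> up to a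
  factor.\<close>

lemma extremal_rays:
  "extremal_ray (betti_halfspaces d) v1" "extremal_ray (betti_halfspaces d) v2" "extremal_ray (betti_halfspaces d) v3"
proof -
  have coords: "0 \<le> x 2" "x 2 \<le> x 1" "of_nat d * x 1 + x 2 \<le> of_nat d * x 0 + of_nat d * x 2"
    if "x \<in> betti_halfspaces d" for x using that unfolding betti_halfspaces_def by blast+
  show "extremal_ray (betti_halfspaces d) v1"
  proof (rule extremal_rayI[OF rays_in(1)])
    show "v1 \<noteq> 0" using ray_coords(1) by auto
    fix x y c assume xy: "x \<in> betti_halfspaces d" "y \<in> betti_halfspaces d" "x + y = scaleW c v1"
    have s: "x 1 + y 1 = 0" using fun_cong[OF xy(3), of 1] unfolding plus_fun_apply scaleW_def ray_coords by simp
    have x: "x 1 = 0" "x 2 = 0" using s coords(1,2)[OF xy(1)] coords(1,2)[OF xy(2)] by linarith+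
    hence x0: "0 \<le> x 0" using coords(3)[OF xy(1)] d_pos by (simp add: zero_le_mult_iff)
    have "x = scaleW (x 0) v1"
      by (rule betti_halfspaces_eqI[OF xy(1) betti_halfspaces_scale[OF x0 rays_in(1)]])
        (simp_all only: scaleW_def ray_coords x mult_1_right mult_zero_right)
    with x0 show "\<exists>a. 0 \<le> a \<and> x = scaleW a v1" by blast
  qed
  show "extremal_ray (betti_halfspaces d) v2"
  proof (rule extremal_rayI[OF rays_in(2)])
    show "v2 \<noteq> 0" using ray_coords(4) by auto
    fix x y c assume xy: "x \<in> betti_halfspaces d" "y \<in> betti_halfspaces d" "x + y = scaleW c v2"
    have s: "x 2 + y 2 = 0" "x 1 + y 1 = c" "x 0 + y 0 = c"
      using fun_cong[OF xy(3), of 2] fun_cong[OF xy(3), of 1] fun_cong[OF xy(3), of 0]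
      unfolding plus_fun_apply scaleW_def ray_coords by simp_all
    have x: "x 2 = 0" "y 2 = 0" using s(1) coords(1)[OF xy(1)] coords(1)[OF xy(2)] by linarith+
    have "x 1 \<le> x 0" "y 1 \<le> y 0" using coords(3)[OF xy(1)] coords(3)[OF xy(2)] x d_pos by simp_all
    hence x1: "x 1 = x 0" using s(2,3) by linarith
    have x0: "0 \<le> x 0" using coords(1,2)[OF xy(1)] x1 by linarith
    have "x = scaleW (x 0) v2"
      by (rule betti_halfspaces_eqI[OF xy(1) betti_halfspaces_scale[OF x0 rays_in(2)]])
        (simp_all only: scaleW_def ray_coords x x1 mult_1_right mult_zero_right)
    with x0 show "\<exists>a. 0 \<le> a \<and> x = scaleW a v2" by blast
  qed
  show "extremal_ray (betti_halfspaces d) v3"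
  proof (rule extremal_rayI[OF rays_in(3)])
    show "v3 \<noteq> 0" using ray_coords(8) by auto
    fix x y c assume xy: "x \<in> betti_halfspaces d" "y \<in> betti_halfspaces d" "x + y = scaleW c v3"
    have s: "x 2 + y 2 = c" "x 1 + y 1 = c" "x 0 + y 0 = c / of_nat d"
      using fun_cong[OF xy(3), of 2] fun_cong[OF xy(3), of 1] fun_cong[OF xy(3), of 0]
      unfolding plus_fun_apply scaleW_def ray_coords by simp_all
    have x1: "x 1 = x 2" "y 1 = y 2" using s(1,2) coords(2)[OF xy(1)] coords(2)[OF xy(2)] by linarith+
    have "x 2 \<le> of_nat d * x 0" "y 2 \<le> of_nat d * y 0"
      using coords(3)[OF xy(1)] coords(3)[OF xy(2)] unfolding x1 by simp_all
    moreover have "of_nat d * x 0 + of_nat d * y 0 = x 2 + y 2"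
      unfolding distrib_left[symmetric] s using d_pos by simp
    ultimately have "x 2 = of_nat d * x 0" by linarith
    hence x0: "x 0 = x 2 * (1 / of_nat d)" using d_pos by (simp add: field_simps)
    note x2 = coords(1)[OF xy(1)]
    have "x = scaleW (x 2) v3"
      by (rule betti_halfspaces_eqI[OF xy(1) betti_halfspaces_scale[OF x2 rays_in(3)]])
        (simp_all only: scaleW_def ray_coords x1 x0 mult_1_right)
    with x2 show "\<exists>a. 0 \<le> a \<and> x = scaleW a v3" by blast
  qed
qed

text \<open>Stated for an arbitrary predicate on sequences, so that the convex geometry stays apart
  from the algebra.\<close>

lemma hull_betti_sequences:
  assumes "\<And>b i. P b \<Longrightarrow> 2 \<le> i \<Longrightarrow> b i = b 2" "\<And>b. P b \<Longrightarrow> b 2 \<le> b 1"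
    and "\<And>b. P b \<Longrightarrow> d * b 1 + b 2 \<le> d * b 0 + d * b 2"
    and "\<exists>b. P b \<and> b 0 = 1 \<and> b 1 = 0 \<and> b 2 = 0" "\<exists>b. P b \<and> b 0 = 1 \<and> b 1 = 1 \<and> b 2 = 0"
    and "\<exists>b. P b \<and> b 0 = 1 \<and> b 1 = d \<and> b 2 = d"
  shows "rat_cone_hull {\<lambda>i. of_nat (b i) | b :: nat \<Rightarrow> nat. P b} = betti_halfspaces d"
proof (rule hull_eq_betti_halfspaces)
  let ?S = "{\<lambda>i. of_nat (b i) :: rat | b :: nat \<Rightarrow> nat. P b}"
  have in_half: "(\<lambda>i. of_nat (b i)) \<in> betti_halfspaces d" if b: "P b" for b
  proof -
    have "(of_nat (d * b 1 + b 2) :: rat) \<le> of_nat (d * b 0 + d * b 2)"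
      using assms(3)[OF b] by (simp only: of_nat_le_iff)
    hence "of_nat d * of_nat (b 1) + of_nat (b 2) \<le> (of_nat d * of_nat (b 0) + of_nat d * of_nat (b 2) :: rat)"
      by (simp only: of_nat_add of_nat_mult)
    moreover have "(of_nat (b i) :: rat) = of_nat (b 2)" if "2 \<le> i" for i using assms(1)[OF b that] by simp
    moreover have "0 \<le> (of_nat (b 2) :: rat)" "(of_nat (b 2) :: rat) \<le> of_nat (b 1)" using assms(2)[OF b] by simp_all
    ultimately show ?thesis unfolding betti_halfspaces_def by blast
  qed
  thus "?S \<subseteq> betti_halfspaces d" by blast
  have mem: "(\<lambda>i. of_nat (b i)) \<in> rat_cone_hull ?S" if "P b" for b
    by (rule rat_cone_hull_superset) (use that in blast)
  obtain b where b: "P b" "b 0 = 1" "b 1 = 0" "b 2 = 0" using assms(4) by blast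
  have "v1 = (\<lambda>i. of_nat (b i))"
    by (rule betti_halfspaces_eqI[OF rays_in(1) in_half[OF b(1)]]) (simp_all only: ray_coords b of_nat_1 of_nat_0)
  thus "v1 \<in> rat_cone_hull ?S" using mem[OF b(1)] by simp
  obtain b where b: "P b" "b 0 = 1" "b 1 = 1" "b 2 = 0" using assms(5) by blast
  have "v2 = (\<lambda>i. of_nat (b i))"
    by (rule betti_halfspaces_eqI[OF rays_in(2) in_half[OF b(1)]]) (simp_all only: ray_coords b of_nat_1 of_nat_0)
  thus "v2 \<in> rat_cone_hull ?S" using mem[OF b(1)] by simp
  obtain b where b: "P b" "b 0 = 1" "b 1 = d" "b 2 = d" using assms(6) by blast
  have d1: "0 \<le> 1 / (of_nat d :: rat)" by simp
  \<comment> \<open>\<open>v3\<close> is \<open>1/d\<close> times the Betti sequence (1, d, d,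
    ...).\<close>
  have "v3 = scaleW (1 / of_nat d) (\<lambda>i. of_nat (b i))"
    by (rule betti_halfspaces_eqI[OF rays_in(3) betti_halfspaces_scale[OF d1 in_half[OF b(1)]]])
      (use d_pos in \<open>simp_all add: ray_coords[unfolded One_nat_def] ray_coords b[unfolded One_nat_def] scaleW_def b\<close>)
  thus "v3 \<in> rat_cone_hull ?S" using rat_cone_hull_scale[OF d1 mem[OF b(1)]] by simp
qed

end

text \<open>Each condition is a weak inequality or an equation in finitely many coordinates, and
  coordinates are continuous as real-valued maps. The cone of Betti sequences is thus its own
  closure.\<close>

lemma closedin_betti_halfspaces: "closedin W_topology (betti_halfspaces d)"
proof -
  have top: "topspace W_topology = UNIV"
    by (simp add: W_topology_def topspace_pullback_topology)
  have c: "continuous_map W_topology euclideanreal (\<lambda>x. of_rat (x i))" for i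
  proof -
    have p: "continuous_map W_topology (pullback_topology UNIV of_rat euclideanreal) (\<lambda>x. x i)"
      unfolding W_topology_def by (rule continuous_map_product_projection) simp
    have q: "continuous_map (pullback_topology UNIV of_rat euclideanreal) euclideanreal (id \<circ> of_rat)"
      by (rule continuous_map_pullback) simp
    from continuous_map_compose[OF p q] show ?thesis by (simp add: o_def)
  qed
  have le: "closedin W_topology {x. g x \<in> {0..}}" if g: "continuous_map W_topology euclideanreal g" for g
    using closedin_continuous_map_preimage[OF g, of "{0..}"] unfolding top by simp
  have eq: "closedin W_topology {x. g x \<in> {0}}" if g: "continuous_map W_topology euclideanreal g" for g
    using closedin_continuous_map_preimage[OF g, of "{0}"] unfolding top by simp
  let ?r = "\<lambda>x i. of_rat (x i) :: real"
  have "betti_halfspaces d = {x. ?r x 2 \<in> {0..}} \<inter> {x. ?r x 1 - ?r x 2 \<in> {0..}} \<inter>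
    {x. (real d * ?r x 0 + real d * ?r x 2) - (real d * ?r x 1 + ?r x 2) \<in> {0..}} \<inter>
    (\<Inter>i\<in>{2..}. {x. ?r x i - ?r x 2 \<in> {0}})" (is "_ = ?A")
  proof (rule Set.set_eqI)
    fix x :: "nat \<Rightarrow> rat"
    have "of_nat d * x 1 + x 2 \<le> of_nat d * x 0 + of_nat d * x 2 \<longleftrightarrow>
      (of_rat (of_nat d * x 1 + x 2) :: real) \<le> of_rat (of_nat d * x 0 + of_nat d * x 2)"
      by (simp only: of_rat_less_eq)
    also have "\<dots> \<longleftrightarrow> real d * ?r x 1 + ?r x 2 \<le> real d * ?r x 0 + real d * ?r x 2"
      by (simp add: of_rat_add of_rat_mult)
    finally show "x \<in> betti_halfspaces d \<longleftrightarrow> x \<in> ?A"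
      by (simp only: betti_halfspaces_def Int_iff INT_iff Ball_def mem_Collect_eq atLeast_iff singleton_iff right_minus_eq
        of_rat_eq_iff diff_ge_0_iff_ge of_rat_less_eq zero_le_of_rat_iff) blast
  qed
  moreover have "closedin W_topology ?A"
    by (intro closedin_Int closedin_INT le eq continuous_map_diff continuous_map_add continuous_map_real_mult_left c) simp
  ultimately show ?thesis by simp
qed

lemma (in hypersurface) betti_cone_eq:
  assumes d: "2 \<le> d"
  shows "betti_cone Q = betti_halfspaces d"
  unfolding betti_cone_def betti_sequence_def[symmetric]
proof (rule hull_betti_sequences[OF d])
  fix b :: "nat \<Rightarrow> nat"
  assume "betti_sequence b"
  then obtain M :: "('a set, (nat \<Rightarrow> 'a set) set) module" where M: "module Q M" "is_betti_sequence Q M b"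
    unfolding betti_sequence_def fin_gen_module_def by blast
  show "b i = b 2" if "2 \<le> i" for i by (rule betti_sequence_facts(1)[OF M that])
  show "b 2 \<le> b 1" by (rule betti_sequence_facts(2)[OF M])
  show "d * b 1 + b 2 \<le> d * b 0 + d * b 2" by (rule betti_sequence_facts(3)[OF M])
qed (rule betti_exists_free betti_exists_parameter betti_exists_mpow[OF d])+

section \<open>Generators of the maximal ideal of a regular local ring\<close>

lemma (in cring) genideal_pair:
  assumes x: "x \<in> carrier R" and y: "y \<in> carrier R"
  shows "genideal R {x, y} = two_gen R x y"
proof (rule equalityI)
  have "x = x \<otimes> \<one> \<oplus> y \<otimes> \<zero>" "y = x \<otimes> \<zero> \<oplus> y \<otimes> \<one>" using x y by simp_all
  hence "{x, y} \<subseteq> two_gen R x y" unfolding two_gen_def by blast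
  thus "genideal R {x, y} \<subseteq> two_gen R x y" by (rule genideal_minimal[OF ideal_two_gen[OF x y]])
  have G: "ideal (genideal R {x, y}) R" by (rule genideal_ideal) (use x y in blast)
  have xy: "x \<in> genideal R {x, y}" "y \<in> genideal R {x, y}" using genideal_self[of "{x, y}"] x y by blast+
  show "two_gen R x y \<subseteq> genideal R {x, y}"
  proof
    fix v assume "v \<in> two_gen R x y"
    then obtain a b where "a \<in> carrier R" "b \<in> carrier R" "v = x \<otimes> a \<oplus> y \<otimes> b" unfolding two_gen_def by blast
    thus "v \<in> genideal R {x, y}"
      using additive_subgroup.a_closed[OF ideal.axioms(1)[OF G]] ideal.I_r_closed[OF G] xy by simp
  qed
qed

text \<open>A nonunit lies in an ideal maximal among the proper ones containing it, which the chain
  condition provides; by uniqueness that ideal is \<open>(x, y)\<close>.\<close>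

lemma (in cring) two_gen_localI:
  assumes noeth: "noetherian_ring R" and uniq: "\<exists>!I. maximalideal I R"
    and x: "x \<in> carrier R" and y: "y \<in> carrier R" and max: "max_ideal R = two_gen R x y"
  shows "two_gen_local R x y"
proof (intro two_gen_local.intro two_gen_local_axioms.intro is_cring noeth x y)
  have m: "maximalideal (two_gen R x y) R"
    unfolding max[symmetric] max_ideal_def by (rule theI'[OF uniq])
  show "\<one> \<notin> two_gen R x y"
    using maximalideal.I_notcarr[OF m] ideal.one_imp_carrier[OF maximalideal.axioms(1)[OF m]] by blast
  fix a assume a: "a \<in> carrier R" "a \<notin> two_gen R x y"
  show "a \<in> Units R"
  proof (rule ccontr)
    assume nu: "a \<notin> Units R"
    have "\<one> \<notin> PIdl a"
    proof
      assume "\<one> \<in> PIdl a"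
      then obtain c where "c \<in> carrier R" "\<one> = a \<otimes> c" unfolding cgenideal_iff[OF a(1)] by blast
      thus False using nu a(1) m_comm[of a c] unfolding Units_def by force
    qed
    hence "PIdl a \<in> {I. submodule I R (self_module R) \<and> \<one> \<notin> I \<and> PIdl a \<subseteq> I}" (is "_ \<in> ?S")
      using submodule_cgenideal[OF a(1)] by blast
    moreover have "submodule I R (self_module R)" if "I \<in> ?S" for I using that by blast
    ultimately have "\<exists>K\<in>?S. \<forall>L\<in>?S. K \<subseteq> L \<longrightarrow> L = K"
      by (rule acc_module_maximal[OF acc_module_self[OF noeth]])
    then obtain K where K: "K \<in> ?S" "\<forall>L\<in>?S. K \<subseteq> L \<longrightarrow> L = K" by (elim bexE)
    have K': "ideal K R" "\<one> \<notin> K" "PIdl a \<subseteq> K" using K(1) by (simp_all add: submodule_self_iff)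
    have "maximalideal K R"
    proof (rule maximalidealI[OF K'(1)])
      show "carrier R \<noteq> K" using K'(2) by blast
      fix J assume J: "ideal J R" "K \<subseteq> J" "J \<subseteq> carrier R"
      show "J = K \<or> J = carrier R"
      proof (cases "\<one> \<in> J")
        case True
        thus ?thesis using ideal.one_imp_carrier[OF J(1)] by blast
      next
        case False
        hence "J \<in> ?S" using J K'(3) by (auto simp: submodule_self_iff)
        thus ?thesis using K(2) J(2) by blast
      qed
    qed
    hence "K = two_gen R x y" using uniq m by blast
    moreover have "a \<in> K" using K'(3) cgenideal_self[OF a(1)] by blast
    ultimately show False using a(2) by simp
  qed
qed

lemma krull_dim_two_prime_chain:
  assumes "krull_dim R = 2"
  shows "\<exists>P0 P1 P2. primeideal P0 R \<and> primeideal P1 R \<and> primeideal P2 R \<and> P0 \<subset> P1 \<and> P1 \<subset> P2"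
proof -
  have "enat 1 < krull_dim R" using assms by (simp add: numeral_eq_enat)
  then obtain n P where n: "enat 1 < enat n" "\<forall>i\<le>n. primeideal (P i) R" "\<forall>i<n. P i \<subset> P (Suc i)"
    unfolding krull_dim_def less_Sup_iff by blast
  hence "2 \<le> n" by simp
  hence "primeideal (P 0) R" "primeideal (P (Suc 0)) R" "primeideal (P (Suc (Suc 0))) R"
    "P 0 \<subset> P (Suc 0)" "P (Suc 0) \<subset> P (Suc (Suc 0))" using n(2,3) by simp_all
  thus ?thesis by blast
qed

lemma regular_local_ring_two_dim:
  assumes reg: "regular_local_ring R" and dim: "krull_dim R = 2"
  shows "\<exists>x y. two_dim_local R x y"
proof -
  have R: "cring R" "noetherian_ring R" "\<exists>!I. maximalideal I R"
    and num: "enat (min_num_gens R (max_ideal R)) = krull_dim R"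
    using reg unfolding regular_local_ring_def noetherian_local_ring_def by blast+
  interpret cring R by (rule R(1))
  have "maximalideal (max_ideal R) R" unfolding max_ideal_def by (rule theI'[OF R(3)])
  hence "ideal (max_ideal R) R" by (rule maximalideal.axioms(1))
  then obtain A where A: "A \<subseteq> carrier R" "finite A" "max_ideal R = genideal R A"
    using noetherian_ring.finetely_gen[OF R(2)] by metis
  let ?gen = "\<lambda>n. \<exists>A\<subseteq>carrier R. finite A \<and> card A = n \<and> max_ideal R = genideal R A"
  have "?gen (card A)" using A by blast
  hence "?gen (min_num_gens R (max_ideal R))" unfolding min_num_gens_def by (rule LeastI)
  moreover have "min_num_gens R (max_ideal R) = 2" using num dim by (simp add: numeral_eq_enat)
  ultimately obtain B where B: "B \<subseteq> carrier R" "card B = 2" "max_ideal R = genideal R B" by auto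
  obtain x y where xy: "B = {x, y}" using B(2) by (auto simp: card_2_iff)
  have c: "x \<in> carrier R" "y \<in> carrier R" using B(1) xy by auto
  have "max_ideal R = two_gen R x y" using B(3) unfolding xy genideal_pair[OF c] .
  hence "two_gen_local R x y" by (rule two_gen_localI[OF R(2,3) c])
  hence "two_dim_local R x y"
    by (intro two_dim_local.intro two_dim_local_axioms.intro krull_dim_two_prime_chain[OF dim])
  thus ?thesis by blast
qed

theorem proposition5p2:
  fixes R :: "('a, 'b) ring_scheme" and f :: 'a
    and Q :: "'a set ring" and d :: nat
    and B C :: "(nat \<Rightarrow> rat) set"
  assumes "regular_local_ring R"
    and "krull_dim R = 2"
    and "f \<in> ideal_power R (max_ideal R) 2"
    and "f \<noteq> \<zero>\<^bsub>R\<^esub>"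
  defines "Q \<equiv> R Quot (cgenideal R f)"
    and "d \<equiv> hs_multiplicity Q"
    and "B \<equiv> betti_cone Q"
    and "C \<equiv> W_topology closure_of B"
  shows "W.dim B = 3
    \<and> C = rat_cone_hull
           {eps 0,
            eps 0 + eps 1,
            scaleW ((of_nat d - 1) / of_nat d) (eps 0) + eps_tail,
            scaleW (1 / of_nat d) (eps 0) + eps_tail}
    \<and> extremal_ray C (eps 0)
    \<and> extremal_ray C (eps 0 + eps 1)
    \<and> extremal_ray C (scaleW (1 / of_nat d) (eps 0) + eps_tail)"
proof -
  \<comment> \<open>The first pair of generators is arbitrary; afterwards \<open>x0\<close> gives
    way to an element \<open>x\<close> for which \<open>(x, f)\<close> contains a power of
    \<open>y\<close>. Powers of m, and with them the order of \<open>f\<close>, do not depend on the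
    pair.\<close>
  obtain x0 y where "two_dim_local R x0 y" using regular_local_ring_two_dim[OF assms(1,2)] by blast
  then interpret T: two_dim_local R x0 y .
  have "f \<in> two_gen_pow R x0 y 2" using assms(3) unfolding T.max_ideal_eq T.ideal_power_eq .
  hence fc: "f \<in> carrier R" by (rule T.mpow_carr)
  have "\<exists>x E. two_dim_local R x y \<and>
      (\<exists>p\<in>carrier R. \<exists>q\<in>carrier R. y [^]\<^bsub>R\<^esub> (E::nat) = x \<otimes>\<^bsub>R\<^esub> p \<oplus>\<^bsub>R\<^esub> f \<otimes>\<^bsub>R\<^esub> q) \<and>
      (\<exists>p\<in>carrier R. \<exists>q\<in>carrier R. f = x \<otimes>\<^bsub>R\<^esub> p \<oplus>\<^bsub>R\<^esub> y [^]\<^bsub>R\<^esub> E \<otimes>\<^bsub>R\<^esub> q)"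
    by (rule T.linear_parameter[OF fc assms(4)]) (intro exI conjI)
  then obtain x E where x: "two_dim_local R x y"
    "\<exists>p\<in>carrier R. \<exists>q\<in>carrier R. y [^]\<^bsub>R\<^esub> (E::nat) = x \<otimes>\<^bsub>R\<^esub> p \<oplus>\<^bsub>R\<^esub> f \<otimes>\<^bsub>R\<^esub> q"
    "\<exists>p\<in>carrier R. \<exists>q\<in>carrier R. f = x \<otimes>\<^bsub>R\<^esub> p \<oplus>\<^bsub>R\<^esub> y [^]\<^bsub>R\<^esub> E \<otimes>\<^bsub>R\<^esub> q" by (elim exE conjE)
  interpret U: two_dim_local R x y by (rule x(1))
  have f2: "f \<in> two_gen_pow R x y 2" using assms(3) unfolding U.max_ideal_eq U.ideal_power_eq .
  obtain e where e: "f \<in> two_gen_pow R x y e" "f \<notin> two_gen_pow R x y (Suc e)"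
    by (rule U.nonzero_order[OF fc assms(4)])
  have e2: "2 \<le> e"
  proof (rule ccontr)
    assume "\<not> 2 \<le> e"
    hence "Suc e \<le> 2" by simp
    thus False using U.mpow_le[OF f2] e(2) by blast
  qed
  hence e1: "1 \<le> e" by simp
  interpret H: hypersurface R x y f e E
    by (intro hypersurface.intro hypersurface_axioms.intro x e e1)
  have d: "d = e" unfolding d_def Q_def by (rule U.hs_multiplicity_hypersurface[OF assms(2) e e1])
  have B: "B = betti_halfspaces d" unfolding B_def Q_def d by (rule H.betti_cone_eq[OF e2])
  have C: "C = betti_halfspaces d"
    unfolding C_def B by (rule closure_of_closedin[OF closedin_betti_halfspaces])
  have d2: "2 \<le> d" unfolding d by (rule e2)
  show ?thesis
    unfolding C by (intro conjI extremal_rays[OF d2] hull_rays[OF d2, symmetric])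
      (unfold B, rule dim_betti_halfspaces[OF d2])
qed

end
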